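(* Let $T$ be a non-degenerate Calderón–Zygmund operator on $\mathbb{R}^n$ with Dini-continuous kernel, let $m\in\mathbb{N}$, $p>1$, and let $\lambda,\mu\in A_p$. Let $\eta$ be an arbitrary weight such that both of the following implications hold for locally integrable $b$: $$b\in BMO_\eta\ \Rightarrow\ \|T_b^mf\|_{L^p(\lambda)}\lesssim\|b\|_{BMO_\eta}^m\|f\|_{L^p(\mu)}$$ (with a constant independent of $b$ and $f$), and $$\|T_b^mf\|_{L^p(\lambda)}\lesssim\|f\|_{L^p(\mu)}\ \text{(with a constant independent of } f)\ \Rightarrow\ b\in BMO_\eta.$$ Then $\eta\simeq\big(\frac{\mu}{\lambda}\big)^{1/pm}$ almost everywhere, i.e. there is $C\ge 1$ with $C^{-1}(\mu/\lambda)^{1/(pm)}\le\eta\le C(\mu/\lambda)^{1/(pm)}$ a.e.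
   Context: A weight is a non-negative locally integrable function on $\mathbb{R}^n$. $L^p(w)$ has norm $(\int|f|^pw)^{1/p}$. A cube is a half-open cube $\prod_{i=1}^n[a_i,a_i+h)$, $h>0$; $f_Q=\frac1{|Q|}\int_Qf$. $w\in A_p$ means $\sup_Q\big(\frac1{|Q|}\int_Qw\big)\big(\frac1{|Q|}\int_Qw^{-\frac1{p-1}}\big)^{p-1}<\infty$. For a weight $\eta$, $b\in BMO_\eta$ means $b$ is locally integrable and $\|b\|_{BMO_\eta}=\sup_Q\frac1{\eta(Q)}\int_Q|b-b_Q|<\infty$, $\eta(Q)=\int_Q\eta$. $K$ is an $\omega$-Calderón–Zygmund kernel if $|K(x,y)|\le\frac{C_K}{|x-y|^n}$ for $x\ne y$, and $|K(x,y)-K(x',y)|+|K(y,x)-K(y,x')|\le\omega\big(\frac{|x-x'|}{|x-y|}\big)\frac1{|x-y|^n}$ whenever $|x-y|>2|x-x'|$, where $\omega:[0,1]\to[0,\infty)$ is a modulus of continuity. It is Dini-continuous if $\int_0^1\omega(t)\frac{dt}t<\infty$. A Calderón–Zygmund operator $T$ is a linear $L^2$-bounded operator with $Tf(x)=\int K(x,y)f(y)dy$ for all $x\notin\operatorname{supp}f$, with $K$ such a kernel. The kernel $K$ is non-degenerate if $\omega(t)\to0$ as $t\to0$ and there is $c_0>0$ such that for every $y\in\mathbb{R}^n$ and $r>0$ there exists $x\notin B(y,r)$ with $|K(x,y)|\ge\frac{c_0}{r^n}$. $T$ is a non-degenerate Calderón–Zygmund operator if both $K(x,y)$ and $\tilde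 K(x,y)=K(y,x)$ are non-degenerate. $[b,T]f=bT(f)-T(bf)$, $T_b^1=[b,T]$, $T_b^mf=[b,T_b^{m-1}]f$. The estimates for $T_b^mf$ are understood for bounded compactly supported $f$ (for which $T_b^mf$ is defined). *)

theory Defs
  imports "HOL-Analysis.Analysis"
begin

section \<open>Weights, Muckenhoupt classes and weighted BMO\<close>

definition locally_integrable :: "(real ^ 'n \<Rightarrow> real) \<Rightarrow> bool" where
  "locally_integrable f \<longleftrightarrow> (\<forall>S. compact S \<longrightarrow> f absolutely_integrable_on S)"

definition weight :: "(real ^ 'n \<Rightarrow> real) \<Rightarrow> bool" where
  "weight w \<longleftrightarrow> (\<forall>x. 0 \<le> w x) \<and> locally_integrable w"

definition cube :: "real ^ 'n \<Rightarrow> real \<Rightarrow> (real ^ 'n) set" where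
  "cube a h = {x. \<forall>i. a $ i \<le> x $ i \<and> x $ i < a $ i + h}"

definition cubes :: "(real ^ 'n) set set" where
  "cubes = {cube a h |a h. 0 < h}"

definition average :: "(real ^ 'n \<Rightarrow> real) \<Rightarrow> (real ^ 'n) set \<Rightarrow> real" where
  "average f Q = (1 / measure lebesgue Q) * (LINT x:Q|lebesgue. f x)"

text \<open>
  With the convention \<open>1/0 = \<infinity>\<close>, finiteness of the supremum forces a weight that does not vanish
  almost everywhere to be positive almost everywhere, and makes \<open>w powr (-1/(p-1))\<close> locally
  integrable. As \<open>0 powr a = 0\<close> in HOL, both facts are stated explicitly; this also excludes the
  zero weight, whose product of averages is \<open>0 \<cdot> \<infinity>\<close>.
\<close>

definition A_class :: "real \<Rightarrow> (real ^ 'n \<Rightarrow> real) \<Rightarrow> bool" where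
  "A_class p w \<longleftrightarrow>
     weight w \<and> (AE x in lebesgue. 0 < w x) \<and>
     locally_integrable (\<lambda>x. w x powr (- 1 / (p - 1))) \<and>
     bdd_above ((\<lambda>Q. average w Q * average (\<lambda>x. w x powr (- 1 / (p - 1))) Q powr (p - 1)) ` cubes)"

text \<open>
  Division in \<open>ennreal\<close> has \<open>0/0 = 0\<close> and \<open>a/0 = \<infinity>\<close> for \<open>a > 0\<close>, so on a cube where \<open>\<eta>\<close> has no
  mass the function \<open>b\<close> must be constant almost everywhere for the norm to be finite.
\<close>

definition bmo_norm :: "(real ^ 'n \<Rightarrow> real) \<Rightarrow> (real ^ 'n \<Rightarrow> real) \<Rightarrow> ennreal" where
  "bmo_norm \<eta> b =
     (SUP Q\<in>cubes. (\<integral>\<^sup>+x\<in>Q. ennreal \<bar>b x - average b Q\<bar> \<partial>lebesgue)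
                     / (\<integral>\<^sup>+x\<in>Q. ennreal (\<eta> x) \<partial>lebesgue))"

definition BMO :: "(real ^ 'n \<Rightarrow> real) \<Rightarrow> (real ^ 'n \<Rightarrow> real) set" where
  "BMO \<eta> = {b. locally_integrable b \<and> bmo_norm \<eta> b < \<infinity>}"

definition ennreal_powr :: "ennreal \<Rightarrow> real \<Rightarrow> ennreal" where
  "ennreal_powr t a = (if t = \<infinity> then \<infinity> else ennreal (enn2real t powr a))"

definition weighted_Lp_norm :: "real \<Rightarrow> (real ^ 'n \<Rightarrow> real) \<Rightarrow> (real ^ 'n \<Rightarrow> complex) \<Rightarrow> ennreal" where
  "weighted_Lp_norm p w f =
     ennreal_powr (\<integral>\<^sup>+x. ennreal (norm (f x) powr p * w x) \<partial>lebesgue) (1 / p)"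


section \<open>Calderon-Zygmund operators\<close>

definition modulus_of_continuity :: "(real \<Rightarrow> real) \<Rightarrow> bool" where
  "modulus_of_continuity \<omega> \<longleftrightarrow>
     (\<forall>t\<in>{0..1}. 0 \<le> \<omega> t) \<and> \<omega> 0 = 0 \<and> mono_on {0..1} \<omega> \<and>
     (\<forall>s t. 0 \<le> s \<and> 0 \<le> t \<and> s + t \<le> 1 \<longrightarrow> \<omega> (s + t) \<le> \<omega> s + \<omega> t)"

definition dini :: "(real \<Rightarrow> real) \<Rightarrow> bool" where
  "dini \<omega> \<longleftrightarrow> (\<lambda>t. \<omega> t / t) absolutely_integrable_on {0<..1}"

definition cz_kernel :: "(real \<Rightarrow> real) \<Rightarrow> (real ^ 'n \<Rightarrow> real ^ 'n \<Rightarrow> complex) \<Rightarrow> bool" where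
  "cz_kernel \<omega> K \<longleftrightarrow>
     modulus_of_continuity \<omega> \<and>
     (\<exists>C. \<forall>x y. x \<noteq> y \<longrightarrow> norm (K x y) \<le> C / norm (x - y) ^ CARD('n)) \<and>
     (\<forall>x x' y. norm (x - y) > 2 * norm (x - x') \<longrightarrow>
        norm (K x y - K x' y) + norm (K y x - K y x')
          \<le> \<omega> (norm (x - x') / norm (x - y)) * (1 / norm (x - y) ^ CARD('n)))"

definition L2 :: "(real ^ 'n \<Rightarrow> complex) set" where
  "L2 = {f. f \<in> borel_measurable lebesgue \<and> integrable lebesgue (\<lambda>x. (norm (f x))\<^sup>2)}"

definition L2_norm :: "(real ^ 'n \<Rightarrow> complex) \<Rightarrow> real" where
  "L2_norm f = sqrt (LINT x|lebesgue. (norm (f x))\<^sup>2)"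

text \<open>
  Operators act on representatives, so linearity and the kernel representation are required up to
  null sets. Only the values of \<open>T\<close> on square integrable functions are constrained.
\<close>

definition L2_bounded_linear ::
    "((real ^ 'n \<Rightarrow> complex) \<Rightarrow> real ^ 'n \<Rightarrow> complex) \<Rightarrow> bool" where
  "L2_bounded_linear T \<longleftrightarrow>
     (\<forall>f\<in>L2. T f \<in> L2) \<and>
     (\<forall>f\<in>L2. \<forall>g\<in>L2. AE x in lebesgue. T (\<lambda>y. f y + g y) x = T f x + T g x) \<and>
     (\<forall>c. \<forall>f\<in>L2. AE x in lebesgue. T (\<lambda>y. c * f y) x = c * T f x) \<and>
     (\<exists>C. \<forall>f\<in>L2. L2_norm (T f) \<le> C * L2_norm f)"

definition cz_operator ::
    "(real \<Rightarrow> real) \<Rightarrow> (real ^ 'n \<Rightarrow> real ^ 'n \<Rightarrow> complex) \<Rightarrow>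
     ((real ^ 'n \<Rightarrow> complex) \<Rightarrow> real ^ 'n \<Rightarrow> complex) \<Rightarrow> bool" where
  "cz_operator \<omega> K T \<longleftrightarrow>
     cz_kernel \<omega> K \<and> L2_bounded_linear T \<and>
     (\<forall>f\<in>L2. AE x in lebesgue. x \<notin> closure {y. f y \<noteq> 0} \<longrightarrow>
        T f x = (LINT y|lebesgue. K x y * f y))"

definition nondegenerate_kernel ::
    "(real \<Rightarrow> real) \<Rightarrow> (real ^ 'n \<Rightarrow> real ^ 'n \<Rightarrow> complex) \<Rightarrow> bool" where
  "nondegenerate_kernel \<omega> K \<longleftrightarrow>
     (\<omega> \<longlongrightarrow> 0) (at_right 0) \<and>
     (\<exists>c>0. \<forall>y. \<forall>r>0. \<exists>x. x \<notin> ball y r \<and> norm (K x y) \<ge> c / r ^ CARD('n))"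

definition nondegenerate_cz_operator ::
    "(real \<Rightarrow> real) \<Rightarrow> (real ^ 'n \<Rightarrow> real ^ 'n \<Rightarrow> complex) \<Rightarrow>
     ((real ^ 'n \<Rightarrow> complex) \<Rightarrow> real ^ 'n \<Rightarrow> complex) \<Rightarrow> bool" where
  "nondegenerate_cz_operator \<omega> K T \<longleftrightarrow>
     cz_operator \<omega> K T \<and>
     nondegenerate_kernel \<omega> K \<and> nondegenerate_kernel \<omega> (\<lambda>x y. K y x)"


section \<open>Iterated commutators\<close>

text \<open>
  For a merely locally integrable \<open>b\<close> and a bounded compactly supported \<open>f\<close>, the product \<open>b f\<close> is
  integrable but not necessarily square integrable. There \<open>T\<close> stands for its usual extension: if
  the kernel is Dini-continuous, \<open>T\<close> is of weak type (1,1), so for integrable \<open>g\<close> the functions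
  \<open>T (u k)\<close> converge in measure, for all \<open>u k\<close> in \<open>L1 \<inter> L2\<close> with \<open>u k \<rightarrow> g\<close> in \<open>L1\<close>, to a
  limit that is unique up to null sets and does not depend on the sequence.
\<close>

definition L1_extension ::
    "((real ^ 'n \<Rightarrow> complex) \<Rightarrow> real ^ 'n \<Rightarrow> complex) \<Rightarrow>
     (real ^ 'n \<Rightarrow> complex) \<Rightarrow> real ^ 'n \<Rightarrow> complex" where
  "L1_extension T g =
     (if g \<in> L2 then T g
      else SOME h. h \<in> borel_measurable lebesgue \<and>
        (\<forall>u. (\<forall>k::nat. u k \<in> L2 \<and> integrable lebesgue (u k)) \<and>
              (\<lambda>k. LINT x|lebesgue. norm (u k x - g x)) \<longlonglongrightarrow> 0 \<longrightarrow>
           (\<forall>\<epsilon>>0. (\<lambda>k. emeasure lebesgue {x. norm (T (u k) x - h x) \<ge> \<epsilon>}) \<longlonglongrightarrow> 0)))"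

definition commutator ::
    "(real ^ 'n \<Rightarrow> real) \<Rightarrow> ((real ^ 'n \<Rightarrow> complex) \<Rightarrow> real ^ 'n \<Rightarrow> complex) \<Rightarrow>
     (real ^ 'n \<Rightarrow> complex) \<Rightarrow> real ^ 'n \<Rightarrow> complex" where
  "commutator b S f =
     (\<lambda>x. complex_of_real (b x) * S f x - S (\<lambda>y. complex_of_real (b y) * f y) x)"

definition iterated_commutator ::
    "((real ^ 'n \<Rightarrow> complex) \<Rightarrow> real ^ 'n \<Rightarrow> complex) \<Rightarrow> (real ^ 'n \<Rightarrow> real) \<Rightarrow> nat \<Rightarrow>
     (real ^ 'n \<Rightarrow> complex) \<Rightarrow> real ^ 'n \<Rightarrow> complex" where
  "iterated_commutator T b m = (commutator b ^^ m) (L1_extension T)"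

text \<open>
  The bounded compactly supported \<open>f\<close> for which the \<open>m\<close>-th commutator is defined: it involves \<open>T\<close>
  applied to \<open>b ^ k f\<close> for \<open>k \<le> m\<close>. For \<open>m = 1\<close> the integrability condition holds for all
  bounded compactly supported \<open>f\<close>.
\<close>

definition commutator_domain :: "(real ^ 'n \<Rightarrow> real) \<Rightarrow> nat \<Rightarrow> (real ^ 'n \<Rightarrow> complex) set" where
  "commutator_domain b m =
     {f. f \<in> borel_measurable lebesgue \<and> bounded (range f) \<and> compact (closure {x. f x \<noteq> 0}) \<and>
         (\<forall>k\<le>m. integrable lebesgue (\<lambda>x. complex_of_real (b x ^ k) * f x))}"

end

theory Submission
  imports Defs
begin

text \<open>
  Write \<open>\<nu> = (\<mu>/\<lambda>)^(1/(pm))\<close>. If \<open>0 \<le> b \<le> \<eta>\<close>, then \<open>b\<close> has norm at most 2 in \<open>BMO \<eta>\<close>. Take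
  \<open>b = \<eta> 1_F\<close> (with \<open>\<eta>\<close> truncated) for a small ball \<open>F\<close>, and \<open>f = 1_B\<close> for a ball \<open>B\<close> of the same
  radius at a comparable distance, where by non-degeneracy \<open>\<bar>T f\<bar>\<close> is bounded below on \<open>F\<close>. As \<open>b f = 0\<close>,
  the commutator equals \<open>b^m T f\<close> on \<open>F\<close>, so the first hypothesis bounds the mean of \<open>\<eta>^(pm) \<lambda>\<close> over
  \<open>F\<close> by that of \<open>\<mu>\<close> over \<open>B\<close>, and Lebesgue differentiation gives \<open>\<eta> \<lesssim> \<nu>\<close>.

  Conversely, if \<open>0 \<le> b \<le> \<nu>\<close>, then every term \<open>b^(m-k) T (b^k f)\<close> of the commutator is bounded from
  \<open>L^p(\<mu>)\<close> to \<open>L^p(\<lambda>)\<close>: interpolate the \<open>A_p\<close> conditions of \<open>\<lambda>\<close> and \<open>\<mu>\<close> and use the weighted bound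
  for \<open>T\<close>, which follows from sparse domination. The second hypothesis therefore puts every such
  \<open>b\<close> (in a suitable \<open>L^q\<close>) into \<open>BMO \<eta>\<close>. If \<open>\<nu> \<lesssim> \<eta>\<close> failed, there would be tiny cubes on which
  \<open>\<eta>\<close> averages to at most \<open>2^(-j) \<tau>_j\<close> although \<open>\<nu> \<ge> \<tau>_j\<close> on half of the cube; letting \<open>b = \<tau>_j\<close> on part
  of the \<open>j\<close>-th cube and \<open>0\<close> on another part produces such a \<open>b\<close> with infinite \<open>BMO \<eta>\<close> norm.
\<close>

subsection \<open>Maximal functions on doubling spaces\<close>

text \<open>The second hypothesis is only qualitative and \<eta> has no regularity, not even
  doubling. So the lower bound cannot treat one cube at a time: a single \<open>b\<close> must
  defeat all cubes at once. The levels \<tau>_j come out of the argument and may be huge; the cubes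
  are therefore shrunk afterwards, fast enough that \<open>b\<close> stays in L^(2m) and that later
  cubes leave most of each earlier cube intact. The exponent 2m makes every b^k f with k <= m square
  integrable, so only the values of \<open>T\<close> on \<open>L2\<close> enter.

  The interpolated weights are w_k = lam^(k/m) \<mu>^(1-k/m): b <= \<nu> gives b^((m-k)p) lam <= w_k
  and b^(kp) w_k <= \<mu>, so \<open>T\<close> is needed only from L^p(w_k) to itself. This weighted
  bound avoids the duality of L^p: the sparse sum is tested against a truncated power of |Tf|
  itself, and the finite term that reappears is absorbed. What remains are maximal functions with
  respect to w dx and \<sigma> dx, for which doubling alone gives strong bounds. Sparse domination
  itself is obtained without maximal truncations of \<open>T\<close>.\<close>

lemma emeasure_UN_le_nn_integral:
  assumes "countable I" "\<And>i. i \<in> I \<Longrightarrow> X i \<in> sets M"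
  shows "emeasure M (\<Union>i\<in>I. X i) \<le> (\<integral>\<^sup>+i. emeasure M (X i) \<partial>count_space I)"
proof -
  have U: "(\<Union>i\<in>I. X i) \<in> sets M" using assms by (intro sets.countable_UN') auto
  have "emeasure M (\<Union>i\<in>I. X i) = (\<integral>\<^sup>+x. indicator (\<Union>i\<in>I. X i) x \<partial>M)"
    using U by simp
  also have "\<dots> \<le> (\<integral>\<^sup>+x. \<integral>\<^sup>+i. indicator (X i) x \<partial>count_space I \<partial>M)"
  proof (rule nn_integral_mono)
    fix x
    show "indicator (\<Union>i\<in>I. X i) x \<le> (\<integral>\<^sup>+i. indicator (X i) x \<partial>count_space I :: ennreal)"
    proof (cases "\<exists>i\<in>I. x \<in> X i")
      case True
      then obtain i where i: "i \<in> I" "x \<in> X i" by auto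
      have "(1::ennreal) = (\<integral>\<^sup>+j. indicator {i} j \<partial>count_space I)" using i by simp
      also have "\<dots> \<le> (\<integral>\<^sup>+i. indicator (X i) x \<partial>count_space I)"
        using i by (intro nn_integral_mono) (auto simp: indicator_def)
      finally show ?thesis by (auto simp: indicator_def)
    qed (auto simp: indicator_def)
  qed
  also have "\<dots> = (\<integral>\<^sup>+i. \<integral>\<^sup>+x. indicator (X i) x \<partial>M \<partial>count_space I)"
    using assms by (intro nn_integral_count_space_nn_integral) auto
  also have "\<dots> = (\<integral>\<^sup>+i. emeasure M (X i) \<partial>count_space I)"
    using assms by (intro nn_integral_cong) auto
  finally show ?thesis .
qed

text \<open>Sums over families of cubes are written as integrals over counting measure: the family
  needs no enumeration, and sum and integral are exchanged like two integrals.\<close>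

lemma nn_integral_UN_disjoint_count_space:
  assumes "countable I" "\<And>i. i \<in> I \<Longrightarrow> X i \<in> sets M" "disjoint_family_on X I"
    "F \<in> borel_measurable M"
  shows "(\<integral>\<^sup>+i. (\<integral>\<^sup>+x\<in>X i. F x \<partial>M) \<partial>count_space I) = (\<integral>\<^sup>+x\<in>(\<Union>i\<in>I. X i). F x \<partial>M)"
proof -
  have U: "(\<Union>i\<in>I. X i) \<in> sets M" using assms by (intro sets.countable_UN') auto
  have "(\<integral>\<^sup>+x\<in>(\<Union>i\<in>I. X i). F x \<partial>M) = emeasure (density M F) (\<Union>i\<in>I. X i)"
    using assms U by (simp add: emeasure_density)
  also have "\<dots> = (\<integral>\<^sup>+i. emeasure (density M F) (X i) \<partial>count_space I)"
    using assms by (intro emeasure_UN_countable) auto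
  also have "\<dots> = (\<integral>\<^sup>+i. (\<integral>\<^sup>+x\<in>X i. F x \<partial>M) \<partial>count_space I)"
    using assms by (intro nn_integral_cong) (simp add: emeasure_density)
  finally show ?thesis by simp
qed

text \<open>The factor 5 is the enlargement in the Vitali covering lemma. The measure is kept
  general because the maximal function is used for w dx and \<sigma> dx as well as for Lebesgue
  measure.\<close>

definition doubling :: "(real ^ 'n) measure \<Rightarrow> real \<Rightarrow> bool" where
  "doubling M D \<longleftrightarrow> sets M = sets lebesgue \<and> 0 \<le> D \<and>
     (\<forall>z r. emeasure M (ball z r) < \<infinity>) \<and>
     (\<forall>z r. 0 < r \<longrightarrow> emeasure M (ball z (5 * r)) \<le> ennreal D * emeasure M (ball z r))"

text \<open>A superlevel set of the uncentred maximal function, written as a union of open balls so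
  that it is visibly open. Radii are bounded by \<open>R\<close> because the covering lemma asks for
  bounded radii.\<close>

definition maximal_set ::
    "(real ^ 'n) measure \<Rightarrow> (real ^ 'n \<Rightarrow> ennreal) \<Rightarrow> real \<Rightarrow> ennreal \<Rightarrow> (real ^ 'n) set" where
  "maximal_set M F R t = (\<Union>(z, r)\<in>{(z, r). 0 < r \<and> r \<le> R \<and>
     t * emeasure M (ball z r) < (\<integral>\<^sup>+x\<in>ball z r. F x \<partial>M)}. ball z r)"

lemma open_maximal_set: "open (maximal_set M F R t)"
  unfolding maximal_set_def by auto

text \<open>Among the balls that make up the set, choose disjoint ones whose fivefold enlargements
  still cover it. Doubling undoes the enlargement, and over disjoint balls the integrals of
  \<open>F\<close> add up to at most the whole integral.\<close>

lemma maximal_set_weak_type: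
  assumes D: "doubling M D" and F: "F \<in> borel_measurable M"
  shows "t * emeasure M (maximal_set M F R t) \<le> ennreal D * (\<integral>\<^sup>+x. F x \<partial>M)"
proof -
  have sM: "sets M = sets lebesgue" using D by (simp add: doubling_def)
  define K where "K = {(z, r). 0 < r \<and> r \<le> R \<and>
     t * emeasure M (ball z r) < (\<integral>\<^sup>+x\<in>ball z r. F x \<partial>M)}"
  have S: "maximal_set M F R t \<subseteq> (\<Union>i\<in>K. ball (fst i) (snd i))"
    by (auto simp: maximal_set_def K_def)
  have r: "0 < snd i \<and> snd i \<le> R" if "i \<in> K" for i using that by (auto simp: K_def)
  obtain C where C: "countable C" "C \<subseteq> K"
     "pairwise (\<lambda>i j. disjnt (ball (fst i) (snd i)) (ball (fst j) (snd j))) C"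
     "maximal_set M F R t \<subseteq> (\<Union>i\<in>C. ball (fst i) (5 * snd i))"
    using Vitali_covering_lemma_balls[OF S r] by blast
  have ds: "disjoint_family_on (\<lambda>i. ball (fst i) (snd i)) C"
    using C(3) by (auto simp: pairwise_def disjoint_family_on_def disjnt_def)
  have "t * emeasure M (maximal_set M F R t) \<le> t * emeasure M (\<Union>i\<in>C. ball (fst i) (5 * snd i))"
    using C by (intro mult_left_mono emeasure_mono) (auto simp: sM)
  also have "\<dots> \<le> t * (\<integral>\<^sup>+i. emeasure M (ball (fst i) (5 * snd i)) \<partial>count_space C)"
    using C by (intro mult_left_mono emeasure_UN_le_nn_integral) (auto simp: sM)
  also have "\<dots> \<le> t * (\<integral>\<^sup>+i. ennreal D * emeasure M (ball (fst i) (snd i)) \<partial>count_space C)"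
    using D C(2) r unfolding doubling_def
    by (intro mult_left_mono nn_integral_mono) auto
  also have "\<dots> = ennreal D * (\<integral>\<^sup>+i. t * emeasure M (ball (fst i) (snd i)) \<partial>count_space C)"
    by (simp add: nn_integral_cmult ac_simps)
  also have "\<dots> \<le> ennreal D * (\<integral>\<^sup>+i. (\<integral>\<^sup>+x\<in>ball (fst i) (snd i). F x \<partial>M) \<partial>count_space C)"
    using C(2) by (intro mult_left_mono nn_integral_mono) (auto simp: K_def less_imp_le)
  also have "\<dots> = ennreal D * (\<integral>\<^sup>+x\<in>(\<Union>i\<in>C. ball (fst i) (snd i)). F x \<partial>M)"
    using C F ds by (subst nn_integral_UN_disjoint_count_space) (auto simp: sM)
  also have "\<dots> \<le> ennreal D * (\<integral>\<^sup>+x. F x \<partial>M)"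
    by (intro mult_left_mono nn_integral_mono) (auto simp: indicator_def)
  finally show ?thesis .
qed

text \<open>Values of \<open>F\<close> up to \<open>s\<close> contribute at most \<open>s\<close> to
  an average, so an average above \<open>2 * s\<close> leaves more than \<open>s\<close> for the
  larger values. This lets the weak type bound at each height see only the large part of the
  function, as Marcinkiewicz interpolation requires.\<close>

lemma maximal_set_split:
  assumes "sets M = sets lebesgue" and [measurable]: "F \<in> borel_measurable M"
    and fin: "\<And>z r. emeasure M (ball z r) < \<infinity>" and s: "s < \<infinity>"
  shows "maximal_set M F R (2 * s) \<subseteq> maximal_set M (\<lambda>x. F x * indicator {x. s < F x} x) R s"
proof -
  have "s * emeasure M (ball z r) < (\<integral>\<^sup>+x\<in>ball z r. F x * indicator {x. s < F x} x \<partial>M)"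
    if "2 * s * emeasure M (ball z r) < (\<integral>\<^sup>+x\<in>ball z r. F x \<partial>M)" for z r
  proof (rule ccontr)
    have B[measurable]: "ball z r \<in> sets M" using assms by simp
    assume "\<not> ?thesis"
    then have le: "(\<integral>\<^sup>+x\<in>ball z r. F x * indicator {x. s < F x} x \<partial>M) \<le> s * emeasure M (ball z r)"
      by simp
    have "(\<integral>\<^sup>+x\<in>ball z r. F x \<partial>M) \<le>
        (\<integral>\<^sup>+x. (F x * indicator {x. s < F x} x) * indicator (ball z r) x + s * indicator (ball z r) x \<partial>M)"
      by (intro nn_integral_mono) (auto simp: indicator_def)
    also have "\<dots> = (\<integral>\<^sup>+x\<in>ball z r. F x * indicator {x. s < F x} x \<partial>M) + s * emeasure M (ball z r)"
    proof -
      have "{x\<in>space M. s < F x} \<in> sets M" by measurable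
      then have [measurable]: "{x. s < F x} \<in> sets M" using assms(1) sets_eq_imp_space_eq[OF assms(1)] by simp
      show ?thesis by (subst nn_integral_add) (auto simp: nn_integral_cmult_indicator)
    qed
    also have "\<dots> \<le> s * emeasure M (ball z r) + s * emeasure M (ball z r)"
      using le by (intro add_right_mono)
    also have "\<dots> = 2 * s * emeasure M (ball z r)" by (simp add: mult_2 distrib_right)
    finally show False using that by simp
  qed
  then show ?thesis unfolding maximal_set_def by (intro UN_mono) auto
qed

section \<open>Strong type bounds for the maximal function\<close>

definition maximal_fun ::
    "(real ^ 'n) measure \<Rightarrow> (real ^ 'n \<Rightarrow> ennreal) \<Rightarrow> real \<Rightarrow> real ^ 'n \<Rightarrow> ennreal" where
  "maximal_fun M F R x = (SUP (z, r)\<in>{(z, r). 0 < r \<and> r \<le> R \<and> x \<in> ball z r}.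
     (\<integral>\<^sup>+y\<in>ball z r. F y \<partial>M) / emeasure M (ball z r))"

lemma ennreal_less_divide_iff:
  fixes t a b :: ennreal
  assumes "b < \<infinity>" "b = 0 \<Longrightarrow> a = 0"
  shows "t < a / b \<longleftrightarrow> t * b < a"
proof (cases "b = 0")
  case False
  show ?thesis
  proof
    assume "t < a / b"
    then have "t * b < a / b * b" using False assms(1)
      by (metis ennreal_mult_strict_right_mono infinity_ennreal_def not_gr_zero)
    also have "a / b * b = a" using False assms(1)
      by (metis ennreal_times_divide infinity_ennreal_def mult.commute mult_divide_eq_ennreal order_less_irrefl)
    finally show "t * b < a" .
  next
    assume "t * b < a"
    then show "t < a / b" using False assms(1)
      by (metis divide_right_mono_ennreal ennreal_times_divide infinity_ennreal_def le_less mult.commute mult_divide_eq_ennreal not_le order_less_irrefl)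
  qed
qed (use assms in auto)

lemma maximal_fun_gt_iff:
  assumes "doubling M D" "F \<in> borel_measurable M"
  shows "t < maximal_fun M F R x \<longleftrightarrow> x \<in> maximal_set M F R t"
proof -
  \<comment> \<open>On a null ball the quotient is 0/0, which is 0 in \<open>ennreal\<close>; the
    integral vanishes there as well, so both conditions below fail together.\<close>
  have z: "(\<integral>\<^sup>+y\<in>ball z r. F y \<partial>M) = 0" if "emeasure M (ball z r) = 0" for z r
  proof -
    have "ball z r \<in> null_sets M" using that assms(1) by (auto simp: null_sets_def doubling_def)
    then show ?thesis by (rule nn_integral_null_set)
  qed
  have "t < (\<integral>\<^sup>+y\<in>ball z r. F y \<partial>M) / emeasure M (ball z r) \<longleftrightarrow>
     t * emeasure M (ball z r) < (\<integral>\<^sup>+y\<in>ball z r. F y \<partial>M)" for z r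
    using z assms(1) by (intro ennreal_less_divide_iff) (auto simp: doubling_def)
  then show ?thesis
    unfolding maximal_fun_def maximal_set_def by (auto simp: less_SUP_iff)
qed

lemma average_le_maximal_fun:
  assumes "0 < r" "r \<le> R" "x \<in> ball z r"
  shows "(\<integral>\<^sup>+y\<in>ball z r. F y \<partial>M) / emeasure M (ball z r) \<le> maximal_fun M F R x"
  unfolding maximal_fun_def using assms
  by (intro SUP_upper2[of "(z, r)"]) auto

lemma borel_measurable_maximal_fun:
  assumes "doubling M D" "F \<in> borel_measurable M"
  shows "maximal_fun M F R \<in> borel_measurable M"
proof (rule borel_measurableI_greater)
  fix t
  have "{x \<in> space M. t < maximal_fun M F R x} = maximal_set M F R t"
    using assms maximal_fun_gt_iff[OF assms] sets_eq_imp_space_eq[of M lebesgue] by (auto simp: doubling_def)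
  then show "{x \<in> space M. t < maximal_fun M F R x} \<in> sets M"
    using assms(1) open_maximal_set[of M F R t] by (simp add: doubling_def)
qed

text \<open>One term of the dyadic sum is enough: the largest \<open>k\<close> with 2^k < u already
  has 2^((k+1)p) >= u^p. At u = \<infinity> every \<open>k\<close> is admissible and the terms are
  unbounded.\<close>

lemma ennreal_powr_layer_cake:
  fixes u :: ennreal
  assumes p: "0 < p"
  shows "ennreal_powr u p \<le> (\<integral>\<^sup>+k. ennreal (2 powr ((real_of_int k + 1) * p)) *
     indicator {k. ennreal (2 powr real_of_int k) < u} k \<partial>count_space UNIV)" (is "_ \<le> ?R")
proof -
  have single: "ennreal (2 powr ((real_of_int k + 1) * p)) \<le> ?R" if "ennreal (2 powr real_of_int k) < u" for k
  proof -
    have "ennreal (2 powr ((real_of_int k + 1) * p)) =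
      (\<integral>\<^sup>+j. ennreal (2 powr ((real_of_int k + 1) * p)) * indicator {k} j \<partial>count_space UNIV)"
      by (subst nn_integral_cmult) auto
    also have "\<dots> \<le> ?R" using that by (intro nn_integral_mono) (auto simp: indicator_def)
    finally show ?thesis .
  qed
  consider "u = 0" | "u = \<infinity>" | v where "u = ennreal v" "v > 0"
    by (metis ennreal_cases ennreal_eq_0_iff infinity_ennreal_def not_le)
  then show ?thesis
  proof cases
    case 2
    have "ennreal (real N) \<le> ?R" for N :: nat
    proof (cases "N = 0")
      case False
      have "real N \<le> 2 powr ((real_of_int \<lceil>log 2 (real N) / p\<rceil> + 1) * p)"
      proof -
        have "log 2 (real N) \<le> (real_of_int \<lceil>log 2 (real N) / p\<rceil>) * p"
          using p by (metis le_of_int_ceiling pos_divide_le_eq)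
        also have "\<dots> \<le> (real_of_int \<lceil>log 2 (real N) / p\<rceil> + 1) * p" using p by simp
        finally show ?thesis using False by (simp add: le_powr_iff)
      qed
      then have "ennreal (real N) \<le> ennreal (2 powr ((real_of_int \<lceil>log 2 (real N) / p\<rceil> + 1) * p))"
        by (intro ennreal_leI)
      also have "\<dots> \<le> ?R" using 2 by (intro single) auto
      finally show ?thesis .
    qed auto
    then have "?R = \<infinity>"
    proof -
      have "\<not> ?R < \<infinity>"
      proof
        assume "?R < \<infinity>"
        then obtain N where "?R < of_nat N" using ennreal_Ex_less_of_nat by auto
        with \<open>\<And>N. ennreal (real N) \<le> ?R\<close>[of N] show False by (simp add: ennreal_of_nat_eq_real_of_nat)
      qed
      then show ?thesis by (simp add: less_top[symmetric])
    qed
    then show ?thesis by simp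
  next
    case 3
    \<comment> \<open>This choice gives 2^k < v <= 2^(k+1), strict on the left as the indicator
      demands.\<close>
    define k where "k = \<lceil>log 2 v\<rceil> - 1"
    have k: "real_of_int k < log 2 v" "log 2 v \<le> real_of_int k + 1" unfolding k_def by linarith+
    have "ennreal_powr u p = ennreal (v powr p)" using 3 by (simp add: ennreal_powr_def)
    also have "\<dots> \<le> ennreal ((2 powr (real_of_int k + 1)) powr p)"
      using 3 k p by (intro ennreal_leI powr_mono2) (auto simp: le_powr_iff)
    also have "\<dots> = ennreal (2 powr ((real_of_int k + 1) * p))" by (simp add: powr_powr)
    also have "\<dots> \<le> ?R" using 3 k
      by (intro single) (auto simp: ennreal_less_iff powr_less_iff)
    finally show ?thesis .
  qed (auto simp: ennreal_powr_def)
qed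

text \<open>A geometric series read downwards from the bound \<open>K\<close> on the admissible
  indices. As 2^K is at most 4v, the top term is at most (4v)^s, and the ratio is 2^(-s).\<close>

lemma geometric_sum_below:
  fixes v :: real
  assumes s: "0 < s" and v: "0 \<le> v"
  shows "(\<integral>\<^sup>+k. ennreal (2 powr (real_of_int k * s)) *
     indicator {k. 2 powr (real_of_int k - 1) < v} k \<partial>count_space UNIV)
     \<le> ennreal (4 powr s / (1 - 2 powr (- s)) * v powr s)" (is "?L \<le> _")
proof (cases "v = 0")
  case False
  then have v: "v > 0" using v by simp
  define K where "K = \<lceil>log 2 v\<rceil> + 1"
  have K: "k \<le> K" if "2 powr (real_of_int k - 1) < v" for k
  proof -
    have "real_of_int k - 1 < log 2 v" using that v by (simp add: powr_less_iff)
    then show ?thesis unfolding K_def by linarith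
  qed
  have bij: "bij_betw (\<lambda>j::nat. K - int j) UNIV {..K}"
    by (rule bij_betwI[where g="\<lambda>k. nat (K - k)"]) auto
  have "?L \<le> (\<integral>\<^sup>+k. ennreal (2 powr (real_of_int k * s)) * indicator {..K} k \<partial>count_space UNIV)"
    using K by (intro nn_integral_mono) (auto simp: indicator_def)
  also have "\<dots> = (\<integral>\<^sup>+k. ennreal (2 powr (real_of_int k * s)) \<partial>count_space {..K})"
    by (subst nn_integral_count_space_indicator) auto
  also have "\<dots> = (\<integral>\<^sup>+j. ennreal (2 powr (real_of_int (K - int j) * s)) \<partial>count_space UNIV)"
    by (rule nn_integral_bij_count_space[OF bij, symmetric])
  also have "\<dots> = (\<Sum>j. ennreal (2 powr (real_of_int (K - int j) * s)))"
    by (simp add: nn_integral_count_space_nat)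
  also have "\<dots> = (\<Sum>j. ennreal (2 powr (real_of_int K * s)) * ennreal ((2 powr (- s)) ^ j))"
  proof -
    have "2 powr (real_of_int (K - int j) * s) = 2 powr (real_of_int K * s) * (2 powr (- s)) ^ j" for j
    proof -
      have "(2 powr (- s)) ^ j = 2 powr (- s * real j)"
        using powr_realpow[of "2 powr (- s)" j] by (simp only: powr_powr) simp
      moreover have "real_of_int (K - int j) * s = real_of_int K * s + - s * real j"
        by (simp add: algebra_simps)
      ultimately show ?thesis by (simp only: powr_add)
    qed
    then show ?thesis by (simp add: ennreal_mult)
  qed
  also have "\<dots> = ennreal (2 powr (real_of_int K * s)) * (\<Sum>j. ennreal ((2 powr (- s)) ^ j))"
    by simp
  also have "(\<Sum>j. ennreal ((2 powr (- s)) ^ j)) = ennreal (1 / (1 - 2 powr (- s)))"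
  proof -
    have "2 powr (- s) < 2 powr 0" using s by (intro powr_less_mono) auto
    then have "(\<lambda>j. (2 powr (- s)) ^ j) sums (1 / (1 - 2 powr (- s)))"
      by (intro geometric_sums) auto
    then show ?thesis by (intro suminf_ennreal_eq) auto
  qed
  also have "ennreal (2 powr (real_of_int K * s)) * \<dots> \<le> ennreal ((4 * v) powr s) * ennreal (1 / (1 - 2 powr (- s)))"
  proof (intro mult_right_mono ennreal_leI)
    have "2 powr (real_of_int K * s) = (2 powr real_of_int K) powr s" by (simp add: powr_powr)
    also have "\<dots> \<le> (4 * v) powr s"
    proof (intro powr_mono2)
      have "real_of_int K \<le> log 2 v + 2" unfolding K_def by linarith
      then have "2 powr real_of_int K \<le> 2 powr (log 2 v + 2)" by simp
      also have "\<dots> = 4 * v" using v by (simp add: powr_add)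
      finally show "2 powr real_of_int K \<le> 4 * v" .
    qed (use s in auto)
    finally show "2 powr (real_of_int K * s) \<le> (4 * v) powr s" .
  qed simp
  also have "\<dots> = ennreal (4 powr s / (1 - 2 powr (- s)) * v powr s)"
  proof -
    have "2 powr (- s) < 2 powr 0" using s by (intro powr_less_mono) auto
    then show ?thesis using v by (simp add: powr_mult flip: ennreal_mult)
  qed
  finally show ?thesis .
next
  case True then show ?thesis by (simp add: not_less)
qed

text \<open>Marcinkiewicz interpolation in dyadic form. At height 2^k the weak type bound is applied
  to the part of \<open>f\<close> above 2^(k-1); after exchanging sum and integral there remains at
  each point a geometric sum in \<open>k\<close>, which converges because p > 1. The measure enters
  the constant only through \<open>D\<close>.\<close>

theorem maximal_fun_strong_type:
  assumes D: "doubling M D" and p: "1 < p"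
    and f[measurable]: "f \<in> borel_measurable M" and f0: "\<And>x. 0 \<le> f x"
  shows "(\<integral>\<^sup>+x. ennreal_powr (maximal_fun M (\<lambda>x. ennreal (f x)) R x) p \<partial>M)
     \<le> ennreal (2 * D * 2 powr p * (4 powr (p - 1) / (1 - 2 powr (- (p - 1)))))
        * (\<integral>\<^sup>+x. ennreal (f x powr p) \<partial>M)"
proof -
  have sM: "sets M = sets lebesgue" using D by (simp add: doubling_def)
  have spM: "space M = UNIV" using sets_eq_imp_space_eq[OF sM] by simp
  have D0: "0 \<le> D" using D by (simp add: doubling_def)
  define F where "F x = ennreal (f x)" for x
  have F[measurable]: "F \<in> borel_measurable M" unfolding F_def by measurable
  let ?MF = "maximal_fun M F R"
  have [measurable]: "?MF \<in> borel_measurable M" by (rule borel_measurable_maximal_fun[OF D F])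
  let ?b = "\<lambda>k. 2 powr real_of_int k"
  have sets1: "maximal_set M F R t \<in> sets M" for t F
    using open_maximal_set[of M F R t] by (simp add: sM)
  have lev: "emeasure M {x. ennreal (?b k) < ?MF x}
     \<le> ennreal (D * 2 powr (1 - real_of_int k)) * (\<integral>\<^sup>+x. F x * indicator {x. 2 powr (real_of_int k - 1) < f x} x \<partial>M)" for k
  proof -
    define s where "s = 2 powr (real_of_int k - 1)"
    have s: "s > 0" "?b k = 2 * s" unfolding s_def by (auto simp: powr_diff)
    define G where "G x = F x * indicator {x. ennreal s < F x} x" for x
    have [measurable]: "{x. ennreal s < F x} \<in> sets M"
    proof -
      have "{x\<in>space M. ennreal s < F x} \<in> sets M" by measurable
      then show ?thesis by (simp add: spM)
    qed
    have G[measurable]: "G \<in> borel_measurable M" unfolding G_def by measurable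
    have "{x. ennreal (?b k) < ?MF x} = maximal_set M F R (2 * ennreal s)"
      using maximal_fun_gt_iff[OF D F] s by (auto simp: ennreal_mult)
    also have "\<dots> \<subseteq> maximal_set M G R (ennreal s)" unfolding G_def
      using D F by (intro maximal_set_split) (auto simp: sM doubling_def)
    finally have "emeasure M {x. ennreal (?b k) < ?MF x} \<le> emeasure M (maximal_set M G R (ennreal s))"
      using sets1 by (intro emeasure_mono) auto
    also have "\<dots> = ennreal (1 / s) * (ennreal s * emeasure M (maximal_set M G R (ennreal s)))"
      using s by (simp add: ennreal_mult[symmetric] mult.assoc[symmetric])
    also have "\<dots> \<le> ennreal (1 / s) * (ennreal D * (\<integral>\<^sup>+x. G x \<partial>M))"
      by (intro mult_left_mono maximal_set_weak_type D G) auto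
    also have "\<dots> = ennreal (D * 2 powr (1 - real_of_int k)) * (\<integral>\<^sup>+x. G x \<partial>M)"
    proof -
      have "1 / s = 2 powr (1 - real_of_int k)" unfolding s_def by (simp add: powr_diff)
      then show ?thesis using D0 by (simp add: ennreal_mult ac_simps)
    qed
    also have "(\<integral>\<^sup>+x. G x \<partial>M) = (\<integral>\<^sup>+x. F x * indicator {x. 2 powr (real_of_int k - 1) < f x} x \<partial>M)"
      unfolding G_def F_def using s(1) f0 by (simp add: ennreal_less_iff s_def)
    finally show ?thesis .
  qed
  have m1[measurable]: "{x. ennreal (?b k) < ?MF x} \<in> sets M" for k
  proof -
    have "{x\<in>space M. ennreal (?b k) < ?MF x} \<in> sets M" by measurable
    then show ?thesis by (simp add: spM)
  qed
  have m2[measurable]: "{x. 2 powr (real_of_int k - 1) < f x} \<in> sets M" for k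
  proof -
    have "{x\<in>space M. 2 powr (real_of_int k - 1) < f x} \<in> sets M" by measurable
    then show ?thesis by (simp add: spM)
  qed
  have "(\<integral>\<^sup>+x. ennreal_powr (?MF x) p \<partial>M) \<le>
     (\<integral>\<^sup>+x. \<integral>\<^sup>+k. ennreal (2 powr ((real_of_int k + 1) * p)) * indicator {x. ennreal (?b k) < ?MF x} x \<partial>count_space UNIV \<partial>M)"
    using p by (intro nn_integral_mono order.trans[OF ennreal_powr_layer_cake])
      (auto simp: indicator_def intro!: nn_integral_mono)
  also have "\<dots> = (\<integral>\<^sup>+k. \<integral>\<^sup>+x. ennreal (2 powr ((real_of_int k + 1) * p)) * indicator {x. ennreal (?b k) < ?MF x} x \<partial>M \<partial>count_space UNIV)"
    by (rule nn_integral_count_space_nn_integral) auto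
  also have "\<dots> = (\<integral>\<^sup>+k. ennreal (2 powr ((real_of_int k + 1) * p)) * emeasure M {x. ennreal (?b k) < ?MF x} \<partial>count_space UNIV)"
    by (intro nn_integral_cong nn_integral_cmult_indicator) auto
  also have "\<dots> \<le> (\<integral>\<^sup>+k. ennreal (2 powr ((real_of_int k + 1) * p)) * (ennreal (D * 2 powr (1 - real_of_int k)) * (\<integral>\<^sup>+x. F x * indicator {x. 2 powr (real_of_int k - 1) < f x} x \<partial>M)) \<partial>count_space UNIV)"
    by (intro nn_integral_mono mult_left_mono lev) auto
  also have "\<dots> = (\<integral>\<^sup>+k. \<integral>\<^sup>+x. ennreal (2 * D * 2 powr p) * (F x * (ennreal (2 powr (real_of_int k * (p - 1))) *
       indicator {x. 2 powr (real_of_int k - 1) < f x} x)) \<partial>M \<partial>count_space UNIV)"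
  proof (rule nn_integral_cong)
    fix k :: int
    have "2 powr ((real_of_int k + 1) * p) * (D * 2 powr (1 - real_of_int k)) = 2 * D * 2 powr p * 2 powr (real_of_int k * (p - 1))"
    proof -
      have "2 powr ((real_of_int k + 1) * p) * 2 powr (1 - real_of_int k) = 2 powr (1 + p + real_of_int k * (p - 1))"
        by (simp add: algebra_simps flip: powr_add)
      also have "\<dots> = 2 * 2 powr p * 2 powr (real_of_int k * (p - 1))" by (simp add: powr_add)
      finally show ?thesis by (simp add: mult.left_commute mult.commute)
    qed
    then have "ennreal (2 powr ((real_of_int k + 1) * p)) * ennreal (D * 2 powr (1 - real_of_int k))
      = ennreal (2 * D * 2 powr p) * ennreal (2 powr (real_of_int k * (p - 1)))"
      using D0 by (simp flip: ennreal_mult)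
    note eq = this
    have [measurable]: "(\<lambda>x. ennreal (2 powr (real_of_int k * (p - 1))) *
       indicator {x. 2 powr (real_of_int k - 1) < f x} x) \<in> borel_measurable M" by measurable
    have "(\<integral>\<^sup>+x. ennreal (2 * D * 2 powr p) * (F x * (ennreal (2 powr (real_of_int k * (p - 1))) *
       indicator {x. 2 powr (real_of_int k - 1) < f x} x)) \<partial>M) =
       (\<integral>\<^sup>+x. (ennreal (2 * D * 2 powr p) * ennreal (2 powr (real_of_int k * (p - 1)))) *
         (F x * indicator {x. 2 powr (real_of_int k - 1) < f x} x) \<partial>M)"
      by (intro nn_integral_cong) (simp only: mult_ac)
    also have "\<dots> = (ennreal (2 * D * 2 powr p) * ennreal (2 powr (real_of_int k * (p - 1)))) *
         (\<integral>\<^sup>+x. F x * indicator {x. 2 powr (real_of_int k - 1) < f x} x \<partial>M)"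
      by (rule nn_integral_cmult) measurable
    finally show "ennreal (2 powr ((real_of_int k + 1) * p)) * (ennreal (D * 2 powr (1 - real_of_int k)) * (\<integral>\<^sup>+x. F x * indicator {x. 2 powr (real_of_int k - 1) < f x} x \<partial>M)) =
       (\<integral>\<^sup>+x. ennreal (2 * D * 2 powr p) * (F x * (ennreal (2 powr (real_of_int k * (p - 1))) *
       indicator {x. 2 powr (real_of_int k - 1) < f x} x)) \<partial>M)"
      by (simp only: mult.assoc[symmetric] eq)
  qed
  also have "\<dots> = (\<integral>\<^sup>+x. \<integral>\<^sup>+k. ennreal (2 * D * 2 powr p) * (F x * (ennreal (2 powr (real_of_int k * (p - 1))) *
       indicator {x. 2 powr (real_of_int k - 1) < f x} x)) \<partial>count_space UNIV \<partial>M)"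
    by (rule nn_integral_count_space_nn_integral[symmetric]) auto
  also have "\<dots> = (\<integral>\<^sup>+x. ennreal (2 * D * 2 powr p) * (F x * (\<integral>\<^sup>+k. (ennreal (2 powr (real_of_int k * (p - 1))) *
       indicator {k. 2 powr (real_of_int k - 1) < f x} k) \<partial>count_space UNIV)) \<partial>M)"
    by (simp add: nn_integral_cmult indicator_def)
  also have "\<dots> \<le> (\<integral>\<^sup>+x. ennreal (2 * D * 2 powr p) * (F x * ennreal (4 powr (p - 1) / (1 - 2 powr (- (p - 1))) * f x powr (p - 1))) \<partial>M)"
    using p f0 by (intro nn_integral_mono mult_left_mono geometric_sum_below) auto
  also have "\<dots> = (\<integral>\<^sup>+x. ennreal (2 * D * 2 powr p * (4 powr (p - 1) / (1 - 2 powr (- (p - 1))))) * ennreal (f x powr p) \<partial>M)"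
  proof (rule nn_integral_cong)
    fix x
    have "2 powr (- (p - 1)) < 2 powr 0" using p by (intro powr_less_mono) auto
    then have pos: "1 - 2 powr (- (p - 1)) > 0" by simp
    have "f x * f x powr (p - 1) = f x powr p"
      using f0[of x] by (cases "f x = 0") (auto simp: powr_mult_base)
    then have e: "2 * D * 2 powr p * (f x * (4 powr (p - 1) / (1 - 2 powr (- (p - 1))) * f x powr (p - 1)))
       = 2 * D * 2 powr p * (4 powr (p - 1) / (1 - 2 powr (- (p - 1)))) * f x powr p" by (simp add: mult_ac)
    show "ennreal (2 * D * 2 powr p) * (F x * ennreal (4 powr (p - 1) / (1 - 2 powr (- (p - 1))) * f x powr (p - 1)))
       = ennreal (2 * D * 2 powr p * (4 powr (p - 1) / (1 - 2 powr (- (p - 1))))) * ennreal (f x powr p)"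
      unfolding F_def using D0 f0[of x] pos e by (simp flip: ennreal_mult)
  qed
  also have "\<dots> = ennreal (2 * D * 2 powr p * (4 powr (p - 1) / (1 - 2 powr (- (p - 1)))))
        * (\<integral>\<^sup>+x. ennreal (f x powr p) \<partial>M)"
    by (rule nn_integral_cmult) measurable
  finally show ?thesis unfolding F_def .
qed

subsection \<open>Lebesgue points\<close>

lemma emeasure_lebesgue_ball:
  fixes z :: "real ^ 'n"
  assumes "0 \<le> r"
  shows "emeasure lebesgue (ball z r) = ennreal (r ^ CARD('n) * measure lborel (ball (0 :: real ^ 'n) 1))"
  using emeasure_lebesgue_ball_conv_unit_ball[OF assms, of z] assms
  by (simp add: emeasure_eq_measure2 ennreal_mult)

lemma open_in_sets_lebesgue: "open S \<Longrightarrow> S \<in> sets lebesgue"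
  by (simp add: lborelD borel_open)

lemma ball_in_sets_lebesgue [measurable]: "ball z r \<in> sets lebesgue"
  by (simp add: open_in_sets_lebesgue)

lemma doubling_lebesgue: "doubling (lebesgue :: (real ^ 'n) measure) (5 ^ CARD('n))"
proof -
  have "emeasure lebesgue (ball z r) < \<infinity>" for z :: "real ^ 'n" and r
    using emeasure_lborel_ball_finite[of z r] by simp
  moreover have "emeasure lebesgue (ball z (5 * r)) \<le> ennreal (5 ^ CARD('n)) * emeasure lebesgue (ball z r)"
    if "0 < r" for z :: "real ^ 'n" and r
    using that by (simp only: emeasure_lebesgue_ball less_imp_le power_mult_distrib mult.assoc
        zero_le_mult_iff zero_le_numeral simp_thms zero_le_power measure_nonneg mult_nonneg_nonneg
        flip: ennreal_mult)
  ultimately show ?thesis by (auto simp: doubling_def)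
qed

text \<open>The nonnegative integral is used because the Bochner integral of a measurable function
  that is not integrable near \<open>x\<close> would be 0 and satisfy the bound by default.\<close>

definition lebesgue_point :: "(real ^ 'n \<Rightarrow> real) \<Rightarrow> real ^ 'n \<Rightarrow> bool" where
  "lebesgue_point f x \<longleftrightarrow> (\<forall>e>0. \<exists>d>0. \<forall>r. 0 < r \<and> r < d \<longrightarrow>
     (\<integral>\<^sup>+y\<in>ball x r. ennreal \<bar>f y - f x\<bar> \<partial>lebesgue) \<le> ennreal e * emeasure lebesgue (ball x r))"

text \<open>Up to null sets, \<open>P\<close> can fail only on the intersection of the sets for e =
  1/(k+1), which is null. This is the form in which weak type bounds yield statements almost
  everywhere.\<close>

lemma AE_if_outside_small_sets:
  assumes "\<And>e::real. 0 < e \<Longrightarrow> \<exists>U\<in>sets M. emeasure M U \<le> ennreal e \<and> (AE x in M. x \<notin> U \<longrightarrow> P x)"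
  shows "AE x in M. P x"
proof -
  have "\<forall>k::nat. \<exists>U\<in>sets M. emeasure M U \<le> ennreal (1 / real (Suc k)) \<and> (AE x in M. x \<notin> U \<longrightarrow> P x)"
    using assms by auto
  then obtain U where U: "\<And>k::nat. U k \<in> sets M" "\<And>k. emeasure M (U k) \<le> ennreal (1 / real (Suc k))"
    "\<And>k. AE x in M. x \<notin> U k \<longrightarrow> P x" by metis
  have I: "(\<Inter>k. U k) \<in> sets M" using U(1) by auto
  have le: "emeasure M (\<Inter>k. U k) \<le> ennreal (1 / real (Suc k))" for k
    using emeasure_mono[of "\<Inter>k. U k" "U k" M] U(1,2)[of k] by (auto intro: order.trans)
  have "(\<lambda>k. ennreal (1 / real (Suc k))) \<longlonglongrightarrow> ennreal 0"
    using LIMSEQ_inverse_real_of_nat by (intro tendsto_ennrealI) (simp add: inverse_eq_divide)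
  then have "emeasure M (\<Inter>k. U k) \<le> ennreal 0"
    by (rule LIMSEQ_le_const) (use le in auto)
  then have "(\<Inter>k. U k) \<in> null_sets M" using I by auto
  then have "AE x in M. x \<notin> (\<Inter>k. U k)" by (rule AE_not_in)
  moreover have "AE x in M. \<forall>k. x \<notin> U k \<longrightarrow> P x" using U(3) by (subst AE_all_countable) auto
  ultimately show ?thesis by eventually_elim auto
qed

lemma AE_lebesgue_pointI:
  assumes "\<And>e::real. 0 < e \<Longrightarrow> AE x in lebesgue. \<exists>d>0. \<forall>r. 0 < r \<and> r < d \<longrightarrow>
     (\<integral>\<^sup>+y\<in>ball x r. ennreal \<bar>f y - f x\<bar> \<partial>lebesgue) \<le> ennreal e * emeasure lebesgue (ball x r)"
  shows "AE x in lebesgue. lebesgue_point f x"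
proof -
  have "AE x in lebesgue. \<forall>k::nat. \<exists>d>0. \<forall>r. 0 < r \<and> r < d \<longrightarrow>
     (\<integral>\<^sup>+y\<in>ball x r. ennreal \<bar>f y - f x\<bar> \<partial>lebesgue) \<le> ennreal (1 / real (Suc k)) * emeasure lebesgue (ball x r)"
    using assms by (simp add: AE_all_countable)
  then show ?thesis
  proof eventually_elim
    case (elim x)
    show ?case unfolding lebesgue_point_def
    proof (intro allI impI)
      fix e :: real assume "0 < e"
      then obtain k where k: "1 / real (Suc k) < e" using nat_approx_posE by blast
      from elim obtain d where d: "d > 0" "\<And>r. 0 < r \<and> r < d \<Longrightarrow>
        (\<integral>\<^sup>+y\<in>ball x r. ennreal \<bar>f y - f x\<bar> \<partial>lebesgue) \<le> ennreal (1 / real (Suc k)) * emeasure lebesgue (ball x r)" by blast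
      have "ennreal (1 / real (Suc k)) * emeasure lebesgue (ball x r) \<le> ennreal e * emeasure lebesgue (ball x r)" for r
        using k by (intro mult_right_mono ennreal_leI) auto
      then show "\<exists>d>0. \<forall>r. 0 < r \<and> r < d \<longrightarrow>
        (\<integral>\<^sup>+y\<in>ball x r. ennreal \<bar>f y - f x\<bar> \<partial>lebesgue) \<le> ennreal e * emeasure lebesgue (ball x r)"
        using d order.trans by blast
    qed
  qed
qed

lemma not_in_maximal_setD:
  assumes "x \<notin> maximal_set M F R t" "0 < r" "r \<le> R" "x \<in> ball z r"
  shows "(\<integral>\<^sup>+y\<in>ball z r. F y \<partial>M) \<le> t * emeasure M (ball z r)"
  using assms unfolding maximal_set_def by (force simp: not_less)

text \<open>Take an open \<open>T\<close> around \<open>A\<close> with \<open>T - A\<close> tiny.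
  Small balls about a point of \<open>A\<close> lie in \<open>T\<close>, so their part outside
  \<open>A\<close> lies in \<open>T - A\<close>; where that part is too large, the maximal function
  of the indicator of \<open>T - A\<close> is large, and this happens only on a small set.\<close>

lemma AE_density_one:
  fixes A :: "(real ^ 'n) set"
  assumes A[measurable]: "A \<in> sets lebesgue" and e: "0 < e"
  shows "AE x in lebesgue. x \<in> A \<longrightarrow> (\<exists>d>0. \<forall>r. 0 < r \<and> r < d \<longrightarrow>
     emeasure lebesgue (ball x r - A) \<le> ennreal e * emeasure lebesgue (ball x r))"
proof (rule AE_if_outside_small_sets)
  fix \<epsilon> :: real assume \<epsilon>: "0 < \<epsilon>"
  \<comment> \<open>The weak type bound at height \<open>e\<close> costs the factor 5^n / e, which
    turns \<delta> into \<epsilon>.\<close>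
  define \<delta> where "\<delta> = \<epsilon> * e / 5 ^ CARD('n)"
  have \<delta>: "\<delta> > 0" using e \<epsilon> by (simp add: \<delta>_def)
  obtain T where T: "open T" "A \<subseteq> T" "T - A \<in> lmeasurable" "emeasure lebesgue (T - A) < ennreal \<delta>"
    using sets_lebesgue_outer_open[OF A \<delta>] by blast
  have TA[measurable]: "T - A \<in> sets lebesgue" using T by auto
  define U where "U = maximal_set lebesgue (indicator (T - A)) 1 (ennreal e)"
  have U: "U \<in> sets lebesgue" unfolding U_def by (rule open_in_sets_lebesgue[OF open_maximal_set])
  have "ennreal e * emeasure lebesgue U \<le> ennreal (5 ^ CARD('n)) * emeasure lebesgue (T - A)"
    unfolding U_def using maximal_set_weak_type[OF doubling_lebesgue, of "indicator (T - A)" "ennreal e" 1] by simp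
  also have "\<dots> \<le> ennreal (5 ^ CARD('n)) * ennreal \<delta>" using T by (intro mult_left_mono) auto
  also have "\<dots> = ennreal (\<epsilon> * e)" using \<delta> by (simp add: \<delta>_def flip: ennreal_mult)
  finally have "ennreal (1 / e) * (ennreal e * emeasure lebesgue U) \<le> ennreal (1 / e) * ennreal (\<epsilon> * e)"
    by (intro mult_left_mono) auto
  then have "emeasure lebesgue U \<le> ennreal \<epsilon>"
    using e \<epsilon> by (simp add: mult.assoc[symmetric] ennreal_mult[symmetric])
  moreover have "\<exists>d>0. \<forall>r. 0 < r \<and> r < d \<longrightarrow>
     emeasure lebesgue (ball x r - A) \<le> ennreal e * emeasure lebesgue (ball x r)" if x: "x \<notin> U" "x \<in> A" for x
  proof -
    obtain d where d: "d > 0" "ball x d \<subseteq> T" using T x by (meson openE subsetD)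
    have "emeasure lebesgue (ball x r - A) \<le> ennreal e * emeasure lebesgue (ball x r)" if r: "0 < r" "r < min d 1" for r
    proof -
      have "emeasure lebesgue (ball x r - A) = (\<integral>\<^sup>+y. indicator (ball x r - A) y \<partial>lebesgue)" by simp
      also have "\<dots> = (\<integral>\<^sup>+y\<in>ball x r. indicator (T - A) y \<partial>lebesgue)"
        using d r by (intro nn_integral_cong) (auto simp: indicator_def)
      also have "\<dots> \<le> ennreal e * emeasure lebesgue (ball x r)"
        using x r unfolding U_def by (intro not_in_maximal_setD) auto
      finally show ?thesis .
    qed
    then show ?thesis using d by (intro exI[of _ "min d 1"]) auto
  qed
  ultimately show "\<exists>U\<in>sets lebesgue. emeasure lebesgue U \<le> ennreal \<epsilon> \<and>
     (AE x in lebesgue. x \<notin> U \<longrightarrow> x \<in> A \<longrightarrow> (\<exists>d>0. \<forall>r. 0 < r \<and> r < d \<longrightarrow>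
     emeasure lebesgue (ball x r - A) \<le> ennreal e * emeasure lebesgue (ball x r)))"
    using U by auto
qed

lemma AE_lebesgue_point_indicator:
  fixes A :: "(real ^ 'n) set"
  assumes A[measurable]: "A \<in> sets lebesgue"
  shows "AE x in lebesgue. lebesgue_point (indicator A) x"
proof (rule AE_lebesgue_pointI)
  fix e :: real assume e: "e > 0"
  have cA: "- A \<in> sets lebesgue" using A by (metis Compl_eq_Diff_UNIV sets.compl_sets space_lebesgue_on space_restrict_space sets.top lebesgue_on_UNIV_eq)
  have i: "(\<integral>\<^sup>+y\<in>ball x r. ennreal \<bar>indicator A y - indicator A x\<bar> \<partial>lebesgue) =
      emeasure lebesgue (ball x r - (if x \<in> A then A else - A))" for x r
  proof -
    have "ball x r - (if x \<in> A then A else - A) \<in> sets lebesgue" using A cA by auto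
    then have "emeasure lebesgue (ball x r - (if x \<in> A then A else - A)) =
      (\<integral>\<^sup>+y. indicator (ball x r - (if x \<in> A then A else - A)) y \<partial>lebesgue)" by simp
    also have "\<dots> = (\<integral>\<^sup>+y\<in>ball x r. ennreal \<bar>indicator A y - indicator A x\<bar> \<partial>lebesgue)"
      by (intro nn_integral_cong) (auto simp: indicator_def)
    finally show ?thesis by simp
  qed
  show "AE x in lebesgue. \<exists>d>0. \<forall>r. 0 < r \<and> r < d \<longrightarrow>
     (\<integral>\<^sup>+y\<in>ball x r. ennreal \<bar>indicator A y - indicator A x\<bar> \<partial>lebesgue) \<le> ennreal e * emeasure lebesgue (ball x r)"
    unfolding i using AE_density_one[OF A e] AE_density_one[OF cA e]
    by eventually_elim auto
qed

lemma lebesgue_point_add: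
  assumes [measurable]: "f \<in> borel_measurable lebesgue" "g \<in> borel_measurable lebesgue"
    and "lebesgue_point f x" "lebesgue_point g x"
  shows "lebesgue_point (\<lambda>x. f x + g x) x"
  unfolding lebesgue_point_def
proof (intro allI impI)
  fix e :: real assume e: "0 < e"
  obtain d where d: "d > 0" "\<And>r. 0 < r \<and> r < d \<Longrightarrow>
     (\<integral>\<^sup>+y\<in>ball x r. ennreal \<bar>f y - f x\<bar> \<partial>lebesgue) \<le> ennreal (e/2) * emeasure lebesgue (ball x r)"
    using assms(3) e unfolding lebesgue_point_def by (meson half_gt_zero)
  obtain d' where d': "d' > 0" "\<And>r. 0 < r \<and> r < d' \<Longrightarrow>
     (\<integral>\<^sup>+y\<in>ball x r. ennreal \<bar>g y - g x\<bar> \<partial>lebesgue) \<le> ennreal (e/2) * emeasure lebesgue (ball x r)"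
    using assms(4) e unfolding lebesgue_point_def by (meson half_gt_zero)
  have "(\<integral>\<^sup>+y\<in>ball x r. ennreal \<bar>f y + g y - (f x + g x)\<bar> \<partial>lebesgue) \<le> ennreal e * emeasure lebesgue (ball x r)"
    if r: "0 < r" "r < min d d'" for r
  proof -
    have "(\<integral>\<^sup>+y\<in>ball x r. ennreal \<bar>f y + g y - (f x + g x)\<bar> \<partial>lebesgue) \<le>
      (\<integral>\<^sup>+y. ennreal \<bar>f y - f x\<bar> * indicator (ball x r) y + ennreal \<bar>g y - g x\<bar> * indicator (ball x r) y \<partial>lebesgue)"
      by (intro nn_integral_mono) (auto simp: indicator_def simp flip: ennreal_plus intro!: ennreal_leI)
    also have "\<dots> = (\<integral>\<^sup>+y\<in>ball x r. ennreal \<bar>f y - f x\<bar> \<partial>lebesgue) + (\<integral>\<^sup>+y\<in>ball x r. ennreal \<bar>g y - g x\<bar> \<partial>lebesgue)"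
      by (rule nn_integral_add) auto
    also have "\<dots> \<le> ennreal (e/2) * emeasure lebesgue (ball x r) + ennreal (e/2) * emeasure lebesgue (ball x r)"
      using d d' r by (intro add_mono) auto
    also have "\<dots> = ennreal e * emeasure lebesgue (ball x r)"
      using e by (simp flip: distrib_right ennreal_plus)
    finally show ?thesis .
  qed
  then show "\<exists>d>0. \<forall>r. 0 < r \<and> r < d \<longrightarrow>
     (\<integral>\<^sup>+y\<in>ball x r. ennreal \<bar>f y + g y - (f x + g x)\<bar> \<partial>lebesgue) \<le> ennreal e * emeasure lebesgue (ball x r)"
    using d d' by (intro exI[of _ "min d d'"]) auto
qed

lemma lebesgue_point_cmult:
  assumes [measurable]: "f \<in> borel_measurable lebesgue" and "lebesgue_point f x"
  shows "lebesgue_point (\<lambda>x. f x * c) x"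
  unfolding lebesgue_point_def
proof (intro allI impI)
  fix e :: real assume e: "0 < e"
  obtain d where d: "d > 0" "\<And>r. 0 < r \<and> r < d \<Longrightarrow>
     (\<integral>\<^sup>+y\<in>ball x r. ennreal \<bar>f y - f x\<bar> \<partial>lebesgue) \<le> ennreal (e/(\<bar>c\<bar>+1)) * emeasure lebesgue (ball x r)"
    using assms(2)[unfolded lebesgue_point_def, rule_format, of "e/(\<bar>c\<bar>+1)"] e
    by (auto simp: add_nonneg_pos)
  have "(\<integral>\<^sup>+y\<in>ball x r. ennreal \<bar>f y * c - f x * c\<bar> \<partial>lebesgue) \<le> ennreal e * emeasure lebesgue (ball x r)"
    if r: "0 < r" "r < d" for r
  proof -
    have "\<bar>f y * c - f x * c\<bar> = \<bar>c\<bar> * \<bar>f y - f x\<bar>" for y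
      by (metis abs_mult left_diff_distrib mult.commute)
    then have "(\<integral>\<^sup>+y\<in>ball x r. ennreal \<bar>f y * c - f x * c\<bar> \<partial>lebesgue) =
      (\<integral>\<^sup>+y. ennreal \<bar>c\<bar> * (ennreal \<bar>f y - f x\<bar> * indicator (ball x r) y) \<partial>lebesgue)"
      by (intro nn_integral_cong)
        (auto simp: indicator_def ennreal_mult)
    also have "\<dots> = ennreal \<bar>c\<bar> * (\<integral>\<^sup>+y\<in>ball x r. ennreal \<bar>f y - f x\<bar> \<partial>lebesgue)"
      by (rule nn_integral_cmult) auto
    also have "\<dots> \<le> ennreal \<bar>c\<bar> * (ennreal (e/(\<bar>c\<bar>+1)) * emeasure lebesgue (ball x r))"
      using d r by (intro mult_left_mono) auto
    also have "\<dots> = ennreal (\<bar>c\<bar> * (e/(\<bar>c\<bar>+1))) * emeasure lebesgue (ball x r)"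
      using e by (simp add: mult.assoc[symmetric] ennreal_mult[symmetric])
    also have "\<dots> \<le> ennreal e * emeasure lebesgue (ball x r)"
      using e by (intro mult_right_mono ennreal_leI) (auto simp: field_simps)
    finally show ?thesis .
  qed
  then show "\<exists>d>0. \<forall>r. 0 < r \<and> r < d \<longrightarrow>
     (\<integral>\<^sup>+y\<in>ball x r. ennreal \<bar>f y * c - f x * c\<bar> \<partial>lebesgue) \<le> ennreal e * emeasure lebesgue (ball x r)"
    using d by blast
qed

text \<open>Induction over integrable functions, starting from the density theorem. In the limit
  step \<open>f\<close> is close in L1 to some \<open>s i\<close>: the mean of |f - s i| over small
  balls is controlled by the maximal function, its value at the centre by Chebyshev's
  inequality.\<close>

lemma AE_lebesgue_point_integrable:
  fixes f :: "real ^ 'n \<Rightarrow> real"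
  assumes "integrable lebesgue f"
  shows "AE x in lebesgue. lebesgue_point f x"
  using assms
proof (induction rule: integrable_induct)
  case (base A c)
  then show ?case using AE_lebesgue_point_indicator[of A]
    by (auto elim!: eventually_mono intro!: lebesgue_point_cmult)
next
  case (add f g)
  have "f \<in> borel_measurable lebesgue" "g \<in> borel_measurable lebesgue" using add by auto
  with add(3,4) show ?case
    by (auto elim: eventually_elim2 intro: lebesgue_point_add)
next
  case (lim f s)
  have [measurable]: "f \<in> borel_measurable lebesgue" "\<And>i. s i \<in> borel_measurable lebesgue" using lim by auto
  have "(\<lambda>i. \<integral>\<^sup>+x. norm (f x - s i x) \<partial>lebesgue) \<longlonglongrightarrow> 0"
  proof (rule nn_integral_dominated_convergence_norm[where w="\<lambda>x. 2 * norm (f x)"])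
    show "(\<integral>\<^sup>+x. ennreal (2 * norm (f x)) \<partial>lebesgue) < \<infinity>"
      using lim(4) by (simp add: integrable_iff_bounded ennreal_mult nn_integral_cmult ennreal_mult_less_top)
  qed (use lim in auto)
  then have L1: "(\<lambda>i. \<integral>\<^sup>+x. norm (s i x - f x) \<partial>lebesgue) \<longlonglongrightarrow> 0"
    by (simp only: norm_minus_commute)
  show ?case
  proof (rule AE_lebesgue_pointI, rule AE_if_outside_small_sets)
    fix e \<epsilon> :: real assume e: "0 < e" and \<epsilon>: "0 < \<epsilon>"
    \<comment> \<open>The summand 5^n pays for the maximal set \<open>U1\<close> and the summand 1
      for the Chebyshev set \<open>U2\<close>, both at height e/3; together they have measure at
      most \<epsilon>.\<close>
    define \<delta> where "\<delta> = \<epsilon> * (e/3) / (5 ^ CARD('n) + 1)"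
    have p5: "(5::real) ^ CARD('n) > 0" by simp
    have \<delta>: "\<delta> > 0" using e \<epsilon> p5 by (simp add: \<delta>_def add_pos_pos)
    have "\<forall>\<^sub>F i in sequentially. (\<integral>\<^sup>+x. norm (s i x - f x) \<partial>lebesgue) < ennreal \<delta>"
      using L1 \<delta> by (intro order_tendstoD) auto
    then obtain i where i: "(\<integral>\<^sup>+x. norm (s i x - f x) \<partial>lebesgue) < ennreal \<delta>"
      by (auto simp: eventually_sequentially)
    define h where "h x = ennreal \<bar>s i x - f x\<bar>" for x
    have h[measurable]: "h \<in> borel_measurable lebesgue" unfolding h_def by measurable
    define U1 where "U1 = maximal_set lebesgue h 1 (ennreal (e/3))"
    define U2 where "U2 = {x. ennreal (e/3) \<le> h x}"
    have m1: "U1 \<in> sets lebesgue" unfolding U1_def by (rule open_in_sets_lebesgue[OF open_maximal_set])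
    have "{x\<in>space lebesgue. ennreal (e/3) \<le> h x} \<in> sets lebesgue" by measurable
    then have m2: "U2 \<in> sets lebesgue" by (simp add: U2_def)
    have e1: "ennreal (e/3) * emeasure lebesgue U1 \<le> ennreal (5 ^ CARD('n)) * ennreal \<delta>"
      unfolding U1_def using i
      by (intro order.trans[OF maximal_set_weak_type[OF doubling_lebesgue h]] mult_left_mono) (auto simp: h_def)
    have e2: "ennreal (e/3) * emeasure lebesgue U2 \<le> ennreal \<delta>"
    proof -
      have "ennreal (e/3) * emeasure lebesgue U2 = (\<integral>\<^sup>+x. ennreal (e/3) * indicator U2 x \<partial>lebesgue)"
        using m2 by (simp add: nn_integral_cmult_indicator)
      also have "\<dots> \<le> (\<integral>\<^sup>+x. h x \<partial>lebesgue)"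
        by (intro nn_integral_mono) (auto simp: U2_def indicator_def)
      finally show ?thesis using i by (simp add: h_def)
    qed
    have "ennreal (e/3) * emeasure lebesgue (U1 \<union> U2) \<le> ennreal (e/3) * (emeasure lebesgue U1 + emeasure lebesgue U2)"
      using m1 m2 by (intro mult_left_mono emeasure_subadditive) auto
    also have "\<dots> \<le> ennreal (5 ^ CARD('n)) * ennreal \<delta> + ennreal \<delta>"
      unfolding distrib_left by (intro add_mono e1 e2)
    also have "\<dots> = ennreal ((5 ^ CARD('n) + 1) * \<delta>)"
      using \<delta> by (simp add: distrib_right flip: ennreal_mult ennreal_plus)
    also have "(5 ^ CARD('n) + 1) * \<delta> = (e/3) * \<epsilon>"
    proof -
      have "(5 ^ CARD('n) + 1 :: real) \<noteq> 0" using p5 by linarith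
      from nonzero_mult_div_cancel_left[OF this, of "\<epsilon> * (e/3)"] show ?thesis
        unfolding \<delta>_def by (simp only: times_divide_eq_right mult.commute[of "e/3"])
    qed
    finally have "ennreal (3/e) * (ennreal (e/3) * emeasure lebesgue (U1 \<union> U2)) \<le> ennreal (3/e) * ennreal ((e/3) * \<epsilon>)"
      by (intro mult_left_mono) auto
    then have U: "emeasure lebesgue (U1 \<union> U2) \<le> ennreal \<epsilon>"
      using e \<epsilon> by (simp add: mult.assoc[symmetric] ennreal_mult[symmetric])
    have "AE x in lebesgue. x \<notin> U1 \<union> U2 \<longrightarrow> (\<exists>d>0. \<forall>r. 0 < r \<and> r < d \<longrightarrow>
     (\<integral>\<^sup>+y\<in>ball x r. ennreal \<bar>f y - f x\<bar> \<partial>lebesgue) \<le> ennreal e * emeasure lebesgue (ball x r))"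
      using lim(5)[of i]
    proof eventually_elim
      case (elim x)
      show ?case
      proof
        assume x: "x \<notin> U1 \<union> U2"
        obtain d where d: "d > 0" "\<And>r. 0 < r \<and> r < d \<Longrightarrow>
          (\<integral>\<^sup>+y\<in>ball x r. ennreal \<bar>s i y - s i x\<bar> \<partial>lebesgue) \<le> ennreal (e/3) * emeasure lebesgue (ball x r)"
          using elim[unfolded lebesgue_point_def, rule_format, of "e/3"] e by auto
        have "(\<integral>\<^sup>+y\<in>ball x r. ennreal \<bar>f y - f x\<bar> \<partial>lebesgue) \<le> ennreal e * emeasure lebesgue (ball x r)"
          if r: "0 < r" "r < min d 1" for r
        proof -
          let ?m = "emeasure lebesgue (ball x r)"
          have "(\<integral>\<^sup>+y\<in>ball x r. ennreal \<bar>f y - f x\<bar> \<partial>lebesgue) \<le>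
            (\<integral>\<^sup>+y. (ennreal \<bar>s i y - s i x\<bar> * indicator (ball x r) y + h y * indicator (ball x r) y)
               + h x * indicator (ball x r) y \<partial>lebesgue)"
            unfolding h_def
            by (intro nn_integral_mono) (auto simp: indicator_def simp flip: ennreal_plus intro!: ennreal_leI)
          also have "\<dots> = (\<integral>\<^sup>+y\<in>ball x r. ennreal \<bar>s i y - s i x\<bar> \<partial>lebesgue) + (\<integral>\<^sup>+y\<in>ball x r. h y \<partial>lebesgue) + h x * ?m"
            by (subst nn_integral_add, measurable)+ (simp add: nn_integral_cmult_indicator)
          also have "\<dots> \<le> ennreal (e/3) * ?m + ennreal (e/3) * ?m + ennreal (e/3) * ?m"
          proof (intro add_mono mult_right_mono)
            show "(\<integral>\<^sup>+y\<in>ball x r. ennreal \<bar>s i y - s i x\<bar> \<partial>lebesgue) \<le> ennreal (e/3) * ?m"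
              using d(2) r by auto
            show "(\<integral>\<^sup>+y\<in>ball x r. h y \<partial>lebesgue) \<le> ennreal (e/3) * ?m"
              using x r unfolding U1_def by (intro not_in_maximal_setD[where R=1]) auto
            show "h x \<le> ennreal (e/3)" using x unfolding U2_def by (auto intro: less_imp_le simp: not_le)
          qed simp
          also have "\<dots> = ennreal e * ?m"
            using e by (simp flip: distrib_right ennreal_plus)
          finally show ?thesis .
        qed
        then show "\<exists>d>0. \<forall>r. 0 < r \<and> r < d \<longrightarrow>
           (\<integral>\<^sup>+y\<in>ball x r. ennreal \<bar>f y - f x\<bar> \<partial>lebesgue) \<le> ennreal e * emeasure lebesgue (ball x r)"
          using d by (intro exI[of _ "min d 1"]) auto
      qed
    qed
    then show "\<exists>U\<in>sets lebesgue. emeasure lebesgue U \<le> ennreal \<epsilon> \<and>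
      (AE x in lebesgue. x \<notin> U \<longrightarrow> (\<exists>d>0. \<forall>r. 0 < r \<and> r < d \<longrightarrow>
        (\<integral>\<^sup>+y\<in>ball x r. ennreal \<bar>f y - f x\<bar> \<partial>lebesgue) \<le> ennreal e * emeasure lebesgue (ball x r)))"
      using U m1 m2 by (intro bexI[of _ "U1 \<union> U2"]) auto
  qed
qed

lemma locally_integrable_set_integrable:
  assumes "locally_integrable f" "bounded A" "A \<in> sets lebesgue"
  shows "set_integrable lebesgue A f"
proof -
  obtain B where "A \<subseteq> cball 0 B" using assms(2) by (auto simp: bounded_iff subset_iff)
  moreover have "set_integrable lebesgue (cball 0 B) f"
    using assms(1) by (simp add: locally_integrable_def)
  ultimately show ?thesis using assms(3) by (metis set_integrable_subset)
qed

lemma locally_integrable_measurable: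
  fixes f :: "real ^ 'n \<Rightarrow> real"
  assumes "locally_integrable f"
  shows "f \<in> borel_measurable lebesgue"
proof (rule borel_measurable_LIMSEQ_real)
  show "(\<lambda>x. indicator (ball 0 (real i)) x * f x) \<in> borel_measurable lebesgue" for i
    using locally_integrable_set_integrable[OF assms, of "ball 0 (real i)"]
    by (auto simp: set_integrable_def)
  fix x :: "real ^ 'n"
  obtain N where N: "norm x < real N" using reals_Archimedean2 by auto
  have "\<forall>\<^sub>F i in sequentially. indicator (ball 0 (real i)) x * f x = f x"
    using eventually_ge_at_top[of N] by eventually_elim (use N in \<open>auto simp: indicator_def\<close>)
  then show "(\<lambda>i. indicator (ball 0 (real i)) x * f x) \<longlonglongrightarrow> f x"
    by (simp add: tendsto_eventually)
qed

theorem AE_lebesgue_point: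
  fixes f :: "real ^ 'n \<Rightarrow> real"
  assumes "locally_integrable f"
  shows "AE x in lebesgue. lebesgue_point f x"
proof -
  have "integrable lebesgue (\<lambda>x. indicator (ball 0 (real N)) x * f x)" for N
    using locally_integrable_set_integrable[OF assms, of "ball 0 (real N)"]
    by (auto simp: set_integrable_def)
  then have "AE x in lebesgue. \<forall>N. lebesgue_point (\<lambda>x. indicator (ball 0 (real N)) x * f x) x"
    by (simp add: AE_all_countable AE_lebesgue_point_integrable)
  then show ?thesis
  proof eventually_elim
    case (elim x)
    obtain N where N: "norm x < real N" using reals_Archimedean2 by auto
    show ?case unfolding lebesgue_point_def
    proof (intro allI impI)
      fix e :: real assume "0 < e"
      then obtain d where d: "d > 0" "\<And>r. 0 < r \<and> r < d \<Longrightarrow>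
         (\<integral>\<^sup>+y\<in>ball x r. ennreal \<bar>indicator (ball 0 (real N)) y * f y - indicator (ball 0 (real N)) x * f x\<bar> \<partial>lebesgue)
          \<le> ennreal e * emeasure lebesgue (ball x r)"
        using elim unfolding lebesgue_point_def by meson
      have "(\<integral>\<^sup>+y\<in>ball x r. ennreal \<bar>f y - f x\<bar> \<partial>lebesgue) \<le> ennreal e * emeasure lebesgue (ball x r)"
        if r: "0 < r" "r < min d (real N - norm x)" for r
      proof -
        have "(\<integral>\<^sup>+y\<in>ball x r. ennreal \<bar>f y - f x\<bar> \<partial>lebesgue) =
          (\<integral>\<^sup>+y\<in>ball x r. ennreal \<bar>indicator (ball 0 (real N)) y * f y - indicator (ball 0 (real N)) x * f x\<bar> \<partial>lebesgue)"
        proof (intro nn_integral_cong)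
          fix y
          have "norm y < real N" if "dist x y < r"
            using that r norm_triangle_ineq2[of y x] by (simp add: dist_norm norm_minus_commute)
          then show "ennreal \<bar>f y - f x\<bar> * indicator (ball x r) y =
            ennreal \<bar>indicator (ball 0 (real N)) y * f y - indicator (ball 0 (real N)) x * f x\<bar> * indicator (ball x r) y"
            using N by (auto simp: indicator_def)
        qed
        also have "\<dots> \<le> ennreal e * emeasure lebesgue (ball x r)" using d r by auto
        finally show ?thesis .
      qed
      then show "\<exists>d>0. \<forall>r. 0 < r \<and> r < d \<longrightarrow>
         (\<integral>\<^sup>+y\<in>ball x r. ennreal \<bar>f y - f x\<bar> \<partial>lebesgue) \<le> ennreal e * emeasure lebesgue (ball x r)"
        using d N by (intro exI[of _ "min d (real N - norm x)"]) auto
    qed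
  qed
qed

text \<open>The error is measured against the volume of the ball, not of \<open>A\<close>, so
  \<open>A\<close> may lie off centre. Below it is a dyadic cell containing \<open>x\<close>, a cube
  with corner \<open>x\<close>, or a small ball at a comparable distance from
  \<open>x\<close>.\<close>

lemma lebesgue_point_set_integral:
  fixes f :: "real ^ 'n \<Rightarrow> real"
  assumes f: "locally_integrable f" and x: "lebesgue_point f x" and e: "0 < e"
  obtains d where "0 < d" "\<And>r A. \<lbrakk>0 < r; r < d; A \<in> sets lebesgue; A \<subseteq> ball x r\<rbrakk> \<Longrightarrow>
    \<bar>(LINT y:A|lebesgue. f y) - f x * measure lebesgue A\<bar> \<le> e * r ^ CARD('n)"
proof -
  define V where "V = measure lborel (ball (0 :: real ^ 'n) 1)"
  have V: "V > 0" unfolding V_def by (simp add: content_ball_pos)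
  obtain d where d: "d > 0" "\<And>r. 0 < r \<and> r < d \<Longrightarrow>
     (\<integral>\<^sup>+y\<in>ball x r. ennreal \<bar>f y - f x\<bar> \<partial>lebesgue) \<le> ennreal (e/V) * emeasure lebesgue (ball x r)"
    using x[unfolded lebesgue_point_def, rule_format, of "e/V"] e V by auto
  have [measurable]: "f \<in> borel_measurable lebesgue" by (rule locally_integrable_measurable[OF f])
  show ?thesis
  proof (rule that[OF d(1)])
    fix r A assume r: "0 < r" "r < d" and A[measurable]: "A \<in> sets lebesgue" and s: "A \<subseteq> ball x r"
    have bA: "bounded A" using s bounded_ball bounded_subset by blast
    have fA: "set_integrable lebesgue A f" by (rule locally_integrable_set_integrable[OF f bA A])
    have lmA: "A \<in> lmeasurable" using bA A by (simp add: bounded_set_imp_lmeasurable)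
    then have cA: "set_integrable lebesgue A (\<lambda>y. f x)"
      by (simp add: set_integrable_def fmeasurable_def less_top[symmetric])
    have "(LINT y:A|lebesgue. f y) - f x * measure lebesgue A = (LINT y:A|lebesgue. f y - f x)"
      using fA cA by (subst set_integral_diff) (simp_all add: set_lebesgue_integral_def)
    moreover have "ennreal (norm (LINT y:A|lebesgue. f y - f x)) \<le> (\<integral>\<^sup>+y. norm (indicator A y *\<^sub>R (f y - f x)) \<partial>lebesgue)"
    proof -
      have "set_integrable lebesgue A (\<lambda>y. f y - f x)" using fA cA by (rule set_integral_diff)
      then show ?thesis unfolding set_lebesgue_integral_def set_integrable_def
        by (rule integral_norm_bound_ennreal)
    qed
    moreover have "(\<integral>\<^sup>+y. norm (indicator A y *\<^sub>R (f y - f x)) \<partial>lebesgue) \<le> (\<integral>\<^sup>+y\<in>ball x r. ennreal \<bar>f y - f x\<bar> \<partial>lebesgue)"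
      using s by (intro nn_integral_mono) (auto simp: indicator_def)
    moreover have "\<dots> \<le> ennreal (e/V) * emeasure lebesgue (ball x r)" using d r by auto
    moreover have "\<dots> = ennreal (e * r ^ CARD('n))"
      using r V e by (subst emeasure_lebesgue_ball) (simp_all add: V_def[symmetric] flip: ennreal_mult)
    ultimately have "ennreal \<bar>(LINT y:A|lebesgue. f y) - f x * measure lebesgue A\<bar> \<le> ennreal (e * r ^ CARD('n))"
      by simp
    then show "\<bar>(LINT y:A|lebesgue. f y) - f x * measure lebesgue A\<bar> \<le> e * r ^ CARD('n)"
      using e r by (subst (asm) ennreal_le_iff) auto
  qed
qed

declare emeasure_completion [simp del]

section \<open>Half-open cubes: measurability, volume and diameter\<close>

lemma cube_in_sets_borel: "cube a h \<in> sets borel"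
proof -
  have "cube a h = (\<Inter>i\<in>UNIV. {x. a $ i \<le> x $ i} \<inter> {x. x $ i < a $ i + h})"
    by (auto simp: cube_def)
  also have "\<dots> \<in> sets borel"
    by (intro sets.finite_INT sets.Int borel_closed borel_open closed_halfspace_component_ge_cart
        open_halfspace_component_lt_cart) auto
  finally show ?thesis .
qed

lemma cube_in_sets_lebesgue [measurable]: "cube a h \<in> sets lebesgue"
  using cube_in_sets_borel[of a h] by (simp add: lborelD)

lemma emeasure_lebesgue_cube:
  fixes a :: "real ^ 'n"
  assumes h: "0 < h"
  shows "emeasure lebesgue (cube a h) = ennreal (h ^ CARD('n))"
proof -
  define b where "b = (\<chi> i. a $ i + h)"
  have sub: "box a b \<subseteq> cube a h" "cube a h \<subseteq> cbox a b"
    by (auto simp: cube_def b_def mem_box_cart less_imp_le)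
  have "cbox a b \<noteq> {}" using h by (auto simp: b_def interval_ne_empty_cart)
  then have "measure lborel (cbox a b) = (\<Prod>i\<in>UNIV. b $ i - a $ i)"
    by (rule content_cbox_cart)
  then have "measure lborel (cbox a b) = h ^ CARD('n)" by (simp add: b_def)
  then have c: "emeasure lebesgue (cbox a b) = ennreal (h ^ CARD('n))"
    using emeasure_eq_ennreal_measure[of lborel "cbox a b"] emeasure_lborel_cbox_finite[of a b]
    by (simp add: emeasure_completion less_top)
  have "cbox a b - cube a h \<in> null_sets lebesgue"
  proof -
    have "negligible (cbox a b - box a b)" by (rule negligible_frontier_interval)
    then have "negligible (cbox a b - cube a h)" by (rule negligible_subset) (use sub in auto)
    then show ?thesis by (simp add: negligible_iff_null_sets)
  qed
  then have "emeasure lebesgue (cbox a b) = emeasure lebesgue (cube a h)"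
    using emeasure_Un_null_set[of "cube a h" lebesgue "cbox a b - cube a h"] sub(2)
    by (simp add: Un_absorb1)
  then show ?thesis using c by (simp only:)
qed

lemma measure_lebesgue_cube:
  "0 < h \<Longrightarrow> measure lebesgue (cube a h :: (real ^ 'n) set) = h ^ CARD('n)"
  by (simp add: measure_def emeasure_lebesgue_cube)

text \<open>The crude estimate by the l1 norm; it is the source of the factor n in the radii of the
  enlarged balls.\<close>

lemma cube_dist_corner:
  fixes x :: "real ^ 'n"
  assumes "x \<in> cube a h"
  shows "norm (x - a) \<le> real CARD('n) * h"
proof -
  have "norm (x - a) \<le> (\<Sum>i\<in>UNIV. \<bar>(x - a) $ i\<bar>)" by (rule norm_le_l1_cart)
  also have "\<dots> \<le> (\<Sum>i\<in>(UNIV :: 'n set). h)"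
  proof (intro sum_mono)
    fix i
    have "a $ i \<le> x $ i" "x $ i < a $ i + h" using assms by (auto simp: cube_def)
    then show "\<bar>(x - a) $ i\<bar> \<le> h" by simp
  qed
  finally show ?thesis by simp
qed

lemma cube_dist:
  fixes x :: "real ^ 'n"
  assumes "x \<in> cube a h" "y \<in> cube a h"
  shows "norm (x - y) \<le> real CARD('n) * h"
proof -
  have "norm (x - y) \<le> (\<Sum>i\<in>UNIV. \<bar>(x - y) $ i\<bar>)" by (rule norm_le_l1_cart)
  also have "\<dots> \<le> (\<Sum>i\<in>(UNIV :: 'n set). h)"
  proof (intro sum_mono)
    fix i
    have "a $ i \<le> x $ i" "x $ i < a $ i + h" "a $ i \<le> y $ i" "y $ i < a $ i + h"
      using assms by (auto simp: cube_def)
    then show "\<bar>(x - y) $ i\<bar> \<le> h" by simp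
  qed
  finally show ?thesis by simp
qed

lemma corner_in_cube: "0 < h \<Longrightarrow> a \<in> cube a h"
  by (simp add: cube_def)

lemma bounded_cube: "bounded (cube a h)"
  unfolding bounded_def by (metis cube_dist dist_norm)

lemma integrable_imp_locally_integrable:
  assumes "integrable lebesgue (F :: real ^ 'n \<Rightarrow> real)"
  shows "locally_integrable F"
  unfolding locally_integrable_def set_integrable_def
  using integrable_mult_indicator[OF fmeasurableD[OF lmeasurable_compact] assms] by blast

subsection \<open>The Calderon-Zygmund decomposition\<close>

text \<open>The cell of generation \<open>k\<close> containing \<open>x\<close> in the dyadic grid
  of top side \<open>h\<close> through \<open>a\<close>. Equality of floors makes cells equivalence
  classes, so they partition space by definition. The free grid point \<open>a\<close> allows any
  given cube to be a top cell.\<close>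

definition cell :: "real ^ 'n \<Rightarrow> real \<Rightarrow> nat \<Rightarrow> real ^ 'n \<Rightarrow> (real ^ 'n) set" where
  "cell a h k x = {y. \<forall>i. \<lfloor>(y $ i - a $ i) * 2 ^ k / h\<rfloor> = \<lfloor>(x $ i - a $ i) * 2 ^ k / h\<rfloor>}"

definition cell_corner :: "real ^ 'n \<Rightarrow> real \<Rightarrow> nat \<Rightarrow> real ^ 'n \<Rightarrow> real ^ 'n" where
  "cell_corner a h k x = (\<chi> i. a $ i + h / 2 ^ k * real_of_int \<lfloor>(x $ i - a $ i) * 2 ^ k / h\<rfloor>)"

lemma cell_eq_cube:
  assumes h: "0 < h"
  shows "cell a h k x = cube (cell_corner a h k x) (h / 2 ^ k)"
proof -
  have "\<lfloor>(v - w) * 2 ^ k / h\<rfloor> = m \<longleftrightarrow> w + h / 2 ^ k * real_of_int m \<le> v \<and> v < w + h / 2 ^ k * real_of_int m + h / 2 ^ k"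
    for v w and m :: int
  proof -
    have "\<lfloor>(v - w) * 2 ^ k / h\<rfloor> = m \<longleftrightarrow> real_of_int m \<le> (v - w) * 2 ^ k / h \<and> (v - w) * 2 ^ k / h < real_of_int m + 1"
      by (simp add: floor_eq_iff)
    also have "\<dots> \<longleftrightarrow> w + h / 2 ^ k * real_of_int m \<le> v \<and> v < w + h / 2 ^ k * real_of_int m + h / 2 ^ k"
      using h by (auto simp: field_simps)
    finally show ?thesis .
  qed
  then show ?thesis by (auto simp: cell_def cube_def cell_corner_def)
qed

lemma cell_zero: "0 < h \<Longrightarrow> cell a h 0 a = cube a h"
  by (simp add: cell_eq_cube cell_corner_def)

lemma in_cell_self: "x \<in> cell a h k x"
  by (simp add: cell_def)

lemma cell_cong: "y \<in> cell a h k x \<Longrightarrow> cell a h k y = cell a h k x"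
  by (auto simp: cell_def)

lemma cell_Suc_subset: "cell a h (Suc k) x \<subseteq> cell a h k x"
proof -
  \<comment> \<open>The floor of \<open>2 * t\<close> determines that of \<open>t\<close>, so
    equality in one generation passes to the preceding one.\<close>
  have fl: "\<lfloor>t\<rfloor> = \<lfloor>s\<rfloor>" if "\<lfloor>2 * t\<rfloor> = \<lfloor>2 * s\<rfloor>" for s t :: real
  proof -
    have "2 * \<lfloor>s\<rfloor> \<le> \<lfloor>2 * s\<rfloor>" "2 * \<lfloor>t\<rfloor> \<le> \<lfloor>2 * t\<rfloor>" by (simp_all add: le_floor_iff)
    moreover have "\<lfloor>2 * s\<rfloor> < 2 * \<lfloor>s\<rfloor> + 2" "\<lfloor>2 * t\<rfloor> < 2 * \<lfloor>t\<rfloor> + 2" by (simp_all add: floor_less_iff) linarith+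
    ultimately show ?thesis using that by linarith
  qed
  show ?thesis
  proof
    fix y assume y: "y \<in> cell a h (Suc k) x"
    have "\<lfloor>(y $ i - a $ i) * 2 ^ k / h\<rfloor> = \<lfloor>(x $ i - a $ i) * 2 ^ k / h\<rfloor>" for i
    proof (rule fl)
      have "\<lfloor>(y $ i - a $ i) * 2 ^ Suc k / h\<rfloor> = \<lfloor>(x $ i - a $ i) * 2 ^ Suc k / h\<rfloor>"
        using y by (simp add: cell_def)
      then show "\<lfloor>2 * ((y $ i - a $ i) * 2 ^ k / h)\<rfloor> = \<lfloor>2 * ((x $ i - a $ i) * 2 ^ k / h)\<rfloor>"
        by (simp add: mult.left_commute mult.commute)
    qed
    then show "y \<in> cell a h k x" by (simp add: cell_def)
  qed
qed

lemma cell_mono: "k \<le> l \<Longrightarrow> cell a h l x \<subseteq> cell a h k x"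
  by (induction l rule: dec_induct) (use cell_Suc_subset in blast)+

abbreviation qcube :: "(real ^ 'n) \<times> real \<Rightarrow> (real ^ 'n) set" where
  "qcube q \<equiv> cube (fst q) (snd q)"

lemma set_integral_mono_set:
  fixes F :: "'a \<Rightarrow> real"
  assumes "integrable M F" "\<And>x. 0 \<le> F x" "A \<in> sets M" "B \<in> sets M" "A \<subseteq> B"
  shows "(LINT x:A|M. F x) \<le> (LINT x:B|M. F x)"
  unfolding set_lebesgue_integral_def using assms
  by (intro integral_mono integrable_mult_indicator) (auto simp: indicator_def)

text \<open>Stop at the first generation whose cell has average above \<tau>. By \<open>top\<close>
  this is never generation 0, so a stopped cell has a parent with average at most \<tau>; hence the
  bound with 2^n and the side at most h/2. Off the stopped cells all averages are at most \<tau>,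
  and Lebesgue differentiation applies. The last clause lets a caller confine the cubes to one top
  cell.\<close>

theorem calderon_zygmund_cubes:
  fixes F :: "real ^ 'n \<Rightarrow> real"
  assumes h: "0 < h" and F: "integrable lebesgue F" and F0: "\<And>x. 0 \<le> F x" and \<tau>: "0 < \<tau>"
    and top: "\<And>x. (LINT y:cell a h 0 x|lebesgue. F y) \<le> \<tau> * h ^ CARD('n)"
  obtains S :: "((real ^ 'n) \<times> real) set" where
    "countable S" "\<And>q. q \<in> S \<Longrightarrow> 0 < snd q" "\<And>q. q \<in> S \<Longrightarrow> snd q \<le> h / 2"
    "\<And>q. q \<in> S \<Longrightarrow> \<tau> * snd q ^ CARD('n) < (LINT y:qcube q|lebesgue. F y)"
    "\<And>q. q \<in> S \<Longrightarrow> (LINT y:qcube q|lebesgue. F y) \<le> 2 ^ CARD('n) * \<tau> * snd q ^ CARD('n)"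
    "disjoint_family_on qcube S"
    "AE x in lebesgue. x \<notin> (\<Union>q\<in>S. qcube q) \<longrightarrow> F x \<le> \<tau>"
    "\<And>q x. q \<in> S \<Longrightarrow> qcube q \<inter> cell a h 0 x \<noteq> {} \<Longrightarrow> qcube q \<subseteq> cell a h 0 x"
proof -
  let ?n = "CARD('n)"
  define bad where "bad k x \<longleftrightarrow> \<tau> * (h / 2 ^ k) ^ ?n < (LINT y:cell a h k x|lebesgue. F y)" for k x
  define N where "N x = (LEAST k. bad k x)" for x
  define Q where "Q x = (cell_corner a h (N x) x, h / 2 ^ N x)" for x
  define B where "B = {x. \<exists>k. bad k x}"
  have bad_cong: "bad k y \<longleftrightarrow> bad k x" if "y \<in> cell a h k x" for k x y
    using cell_cong[OF that] by (simp add: bad_def)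
  have qQ: "qcube (Q x) = cell a h (N x) x" for x
    using cell_eq_cube[OF h, of a "N x" x, symmetric] by (simp add: Q_def)
  have not0: "\<not> bad 0 x" for x using top[of x] by (simp add: bad_def)
  have badN: "bad (N x) x" if "x \<in> B" for x using that unfolding B_def N_def by (auto intro: LeastI)
  have Npos: "N x \<noteq> 0" if "x \<in> B" for x using badN[OF that] not0 by (cases "N x") auto
  \<comment> \<open>Up to generation \<open>N x\<close>, badness depends only on the cell of that
    generation. So the stopping rule is constant on a stopped cell, and two stopped cells that meet
    are equal.\<close>
  have same: "y \<in> B \<and> N y = N x \<and> Q y = Q x" if x: "x \<in> B" and y: "y \<in> cell a h (N x) x" for x y
  proof -
    have b: "bad k y \<longleftrightarrow> bad k x" if "k \<le> N x" for k
      using bad_cong cell_mono[OF that, of a h x] y by blast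
    have "bad (N x) y" using b badN[OF x] by simp
    then have "y \<in> B" by (auto simp: B_def)
    moreover have "N y = N x"
      unfolding N_def[of y]
    proof (rule Least_equality)
      fix k assume "bad k y"
      show "N x \<le> k"
      proof (rule ccontr)
        assume "\<not> N x \<le> k"
        then have "bad k x" using b[of k] \<open>bad k y\<close> by simp
        then have "N x \<le> k" unfolding N_def by (rule Least_le)
        with \<open>\<not> N x \<le> k\<close> show False by simp
      qed
    qed (rule \<open>bad (N x) y\<close>)
    moreover have "cell_corner a h (N x) y = cell_corner a h (N x) x"
      using y by (simp add: cell_def cell_corner_def)
    ultimately show ?thesis by (simp add: Q_def)
  qed
  have inB: "x \<in> (\<Union>q\<in>Q ` B. qcube q)" if "x \<in> B" for x
    using that qQ[of x] in_cell_self[of x a h "N x"] by (intro UN_I[of "Q x"]) auto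
  show ?thesis
  proof (rule that)
    have "Q ` B \<subseteq> range (\<lambda>(k :: nat, v :: int ^ 'n). ((\<chi> i. a $ i + h / 2 ^ k * real_of_int (v $ i)), h / 2 ^ k))"
    proof
      fix q assume "q \<in> Q ` B"
      then obtain x where "q = Q x" by auto
      then have "q = (\<lambda>(k :: nat, v :: int ^ 'n). ((\<chi> i. a $ i + h / 2 ^ k * real_of_int (v $ i)), h / 2 ^ k))
          (N x, (\<chi> i. \<lfloor>(x $ i - a $ i) * 2 ^ N x / h\<rfloor>))"
        by (simp add: Q_def cell_corner_def)
      then show "q \<in> range (\<lambda>(k :: nat, v :: int ^ 'n). ((\<chi> i. a $ i + h / 2 ^ k * real_of_int (v $ i)), h / 2 ^ k))"
        by blast
    qed
    then show "countable (Q ` B)" by (rule countable_subset) auto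
    fix q assume "q \<in> Q ` B"
    then obtain x where x: "x \<in> B" "q = Q x" by auto
    show "0 < snd q" using h x by (simp add: Q_def)
    obtain k where k: "N x = Suc k" using Npos[OF x(1)] by (cases "N x") auto
    have "(1::real) \<le> 2 ^ k" by simp
    then have "h * 1 \<le> h * 2 ^ k" using h by (intro mult_left_mono) auto
    then show "snd q \<le> h / 2" using h x k by (simp add: Q_def field_simps)
    have qx: "qcube q = cell a h (N x) x" using x(2) qQ by simp
    show "\<tau> * snd q ^ ?n < (LINT y:qcube q|lebesgue. F y)"
      using badN[OF x(1)] unfolding qx by (simp add: bad_def x(2) Q_def)
    have "\<not> bad k x" using k not_less_Least[of k "\<lambda>k. bad k x"] by (simp add: N_def)
    then have "(LINT y:cell a h k x|lebesgue. F y) \<le> \<tau> * (h / 2 ^ k) ^ ?n" by (simp add: bad_def)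
    moreover have "(LINT y:qcube q|lebesgue. F y) \<le> (LINT y:cell a h k x|lebesgue. F y)"
    proof -
      have "cell a h (N x) x \<subseteq> cell a h k x" unfolding k by (rule cell_Suc_subset)
      then show ?thesis unfolding qx
        by (intro set_integral_mono_set F F0) (auto simp: cell_eq_cube[OF h])
    qed
    moreover have "\<tau> * (h / 2 ^ k) ^ ?n = 2 ^ ?n * \<tau> * snd q ^ ?n"
    proof -
      have "h / 2 ^ k = 2 * snd q" by (simp add: x(2) Q_def k)
      then show ?thesis by (simp add: power_mult_distrib)
    qed
    ultimately show "(LINT y:qcube q|lebesgue. F y) \<le> 2 ^ ?n * \<tau> * snd q ^ ?n" by simp
    show "qcube q \<subseteq> cell a h 0 z" if ne: "qcube q \<inter> cell a h 0 z \<noteq> {}" for z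
    proof -
      obtain y where y: "y \<in> cell a h (N x) x" "y \<in> cell a h 0 z" using ne qx by auto
      have "cell a h (N x) x \<subseteq> cell a h 0 x" by (rule cell_mono) simp
      moreover have "cell a h 0 x = cell a h 0 z"
        using y \<open>cell a h (N x) x \<subseteq> cell a h 0 x\<close> cell_cong[of y a h 0 x] cell_cong[of y a h 0 z] by auto
      ultimately show ?thesis using qx by simp
    qed
  next
    show "disjoint_family_on qcube (Q ` B)"
      unfolding disjoint_family_on_def
    proof (intro ballI impI)
      fix q q' assume "q \<in> Q ` B" "q' \<in> Q ` B" "q \<noteq> q'"
      then obtain x x' where x: "x \<in> B" "q = Q x" "x' \<in> B" "q' = Q x'" by auto
      show "qcube q \<inter> qcube q' = {}"
      proof (rule ccontr)
        assume "qcube q \<inter> qcube q' \<noteq> {}"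
        then obtain y where y: "y \<in> qcube q" "y \<in> qcube q'" by auto
        have "Q y = Q x" using same[OF x(1), of y] y x qQ by simp
        moreover have "Q y = Q x'" using same[OF x(3), of y] y x qQ by simp
        ultimately show False using \<open>q \<noteq> q'\<close> x by simp
      qed
    qed
    show "AE x in lebesgue. x \<notin> (\<Union>q\<in>Q ` B. qcube q) \<longrightarrow> F x \<le> \<tau>"
      using AE_lebesgue_point[OF integrable_imp_locally_integrable[OF F]]
    proof eventually_elim
      case (elim x)
      show ?case
      proof
        assume "x \<notin> (\<Union>q\<in>Q ` B. qcube q)"
        then have nb: "\<not> bad k x" for k using inB by (auto simp: B_def)
        show "F x \<le> \<tau>"
        proof (rule field_le_epsilon)
          fix e :: real assume e: "0 < e"
          \<comment> \<open>A cell of side \<open>s\<close> lies in the ball of radius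
            \<open>2 * real ?n * s\<close> about each of its points; \<open>c\<close> is the
            resulting ratio of r^n to s^n.\<close>
          define c where "c = (2 * real ?n) ^ ?n"
          have c: "c > 0" by (simp add: c_def)
          obtain d where d: "0 < d" "\<And>r A. \<lbrakk>0 < r; r < d; A \<in> sets lebesgue; A \<subseteq> ball x r\<rbrakk> \<Longrightarrow>
            \<bar>(LINT y:A|lebesgue. F y) - F x * measure lebesgue A\<bar> \<le> (e / c) * r ^ ?n"
            using lebesgue_point_set_integral[OF integrable_imp_locally_integrable[OF F] elim, of "e / c"] e c by auto
          obtain k where k: "2 * real ?n * h / d < 2 ^ k" using real_arch_pow[of 2] by auto
          define s where "s = h / 2 ^ k"
          have s: "s > 0" using h by (simp add: s_def)
          define r where "r = 2 * real ?n * s"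
          have r: "0 < r" "r < d" using s k d(1) h by (auto simp: r_def s_def field_simps)
          have cb: "cell a h k x = cube (cell_corner a h k x) s" using cell_eq_cube[OF h] by (simp add: s_def)
          have "cell a h k x \<subseteq> ball x r"
          proof
            fix y assume "y \<in> cell a h k x"
            then have "norm (x - y) \<le> real ?n * s" using cube_dist[of x "cell_corner a h k x" s y] in_cell_self[of x a h k] unfolding cb by simp
            also have "\<dots> < r" using s by (simp add: r_def)
            finally show "y \<in> ball x r" by (simp add: dist_norm)
          qed
          then have "\<bar>(LINT y:cell a h k x|lebesgue. F y) - F x * s ^ ?n\<bar> \<le> (e / c) * r ^ ?n"
            using d(2)[OF r, of "cell a h k x"] by (simp add: cb measure_lebesgue_cube[OF s])
          moreover have "(e / c) * r ^ ?n = e * s ^ ?n" using c by (simp add: r_def power_mult_distrib c_def)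
          moreover have "(LINT y:cell a h k x|lebesgue. F y) \<le> \<tau> * s ^ ?n" using nb[of k] by (simp add: bad_def s_def)
          ultimately have "F x * s ^ ?n \<le> (\<tau> + e) * s ^ ?n" by (simp add: distrib_right)
          then show "F x \<le> \<tau> + e" using s by (simp add: mult_le_cancel_right)
        qed
      qed
    qed
  qed
qed

subsection \<open>Calderon-Zygmund operators\<close>

text \<open>For t between 2^(-k-1) and 2^(-k), monotonicity gives \<omega>(t)/t >=
  \<omega>(2^(-k-1)) / 2^(-k), and the interval has half the length 2^(-k). So the Dini integral
  dominates half of the dyadic sum.\<close>

lemma modulus_dyadic_summable:
  assumes \<omega>: "modulus_of_continuity \<omega>" and dini: "dini \<omega>"
  shows "summable (\<lambda>k. \<omega> ((1/2) ^ k))"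
proof -
  have nn: "0 \<le> \<omega> t" if "t \<in> {0..1}" for t using \<omega> that by (auto simp: modulus_of_continuity_def)
  have mono: "\<omega> s \<le> \<omega> t" if "0 \<le> s" "s \<le> t" "t \<le> 1" for s t
    using \<omega> that mono_onD[of "{0..1}" \<omega> s t] unfolding modulus_of_continuity_def by auto
  define F where "F t = ennreal (indicator {0<..1} t * (\<omega> t / t))" for t :: real
  have int: "integrable lebesgue (\<lambda>t. indicator {0<..1} t * (\<omega> t / t))"
    using dini by (simp add: dini_def set_integrable_def)
  have [measurable]: "F \<in> borel_measurable lebesgue"
    unfolding F_def using borel_measurable_integrable[OF int] by measurable
  define J where "J k = {(1/2) ^ Suc k <.. (1/2) ^ k :: real}" for k :: nat
  have disj: "disjoint_family_on J UNIV"
    unfolding disjoint_family_on_def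
  proof (intro ballI impI)
    have "J m \<inter> J n = {}" if "m < n" for m n
    proof -
      have "(1/2 :: real) ^ n \<le> (1/2) ^ Suc m" using that by (intro power_decreasing) auto
      then show ?thesis by (auto simp: J_def)
    qed
    then show "J m \<inter> J n = {}" if "m \<noteq> n" for m n using that by (metis Int_commute linorder_neqE_nat)
  qed
  have step: "ennreal (\<omega> ((1/2) ^ Suc k) / 2) \<le> (\<integral>\<^sup>+t\<in>J k. F t \<partial>lebesgue)" for k
  proof -
    let ?c = "\<omega> ((1/2) ^ Suc k) / (1/2) ^ k"
    have c0: "0 \<le> \<omega> ((1/2) ^ Suc k)" by (intro nn) (use power_le_one[of "1/2 :: real" "Suc k"] in simp)
    have "ennreal (\<omega> ((1/2) ^ Suc k) / 2) = ennreal ?c * emeasure lebesgue (J k)"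
    proof -
      have "emeasure lebesgue (J k) = ennreal ((1/2) ^ k - (1/2) ^ Suc k)"
        unfolding J_def by (simp add: emeasure_completion)
      also have "(1/2) ^ k - (1/2) ^ Suc k = (1/2 :: real) ^ k / 2" by simp
      finally show ?thesis using c0 by (simp add: ennreal_mult[symmetric])
    qed
    also have "\<dots> = (\<integral>\<^sup>+t\<in>J k. ennreal ?c \<partial>lebesgue)"
      by (subst nn_integral_cmult_indicator) (auto simp: J_def)
    also have "\<dots> \<le> (\<integral>\<^sup>+t\<in>J k. F t \<partial>lebesgue)"
    proof (intro nn_integral_mono)
      fix t :: real
      show "ennreal ?c * indicator (J k) t \<le> F t * indicator (J k) t"
      proof (cases "t \<in> J k")
        case True
        then have t: "(1/2) ^ Suc k < t" "t \<le> (1/2) ^ k" by (auto simp: J_def)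
        have "(0::real) < (1/2) ^ Suc k" by simp
        then have t0: "0 < t" using t by linarith
        have t1: "t \<le> 1" using t power_le_one[of "1/2 :: real" k] by linarith
        have "\<omega> ((1/2) ^ Suc k) \<le> \<omega> t" using t t1 by (intro mono) auto
        then have "?c \<le> \<omega> t / t" using t t0 c0 by (intro frac_le) auto
        then show ?thesis using True t0 t1 by (auto simp: F_def intro!: ennreal_leI)
      qed auto
    qed
    finally show ?thesis .
  qed
  have "(\<Sum>k. ennreal (\<omega> ((1/2) ^ Suc k) / 2)) \<le> (\<Sum>k. (\<integral>\<^sup>+t\<in>J k. F t \<partial>lebesgue))"
    by (intro suminf_le step) auto
  also have "\<dots> = (\<integral>\<^sup>+k. (\<integral>\<^sup>+t\<in>J k. F t \<partial>lebesgue) \<partial>count_space UNIV)"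
    by (simp add: nn_integral_count_space_nat)
  also have "\<dots> = (\<integral>\<^sup>+t\<in>(\<Union>k\<in>UNIV. J k). F t \<partial>lebesgue)"
    by (intro nn_integral_UN_disjoint_count_space disj) (auto simp: J_def)
  also have "\<dots> \<le> (\<integral>\<^sup>+t. F t \<partial>lebesgue)"
    by (intro nn_integral_mono) (auto simp: indicator_def)
  also have "\<dots> < \<infinity>"
  proof -
    have "(\<integral>\<^sup>+t. F t \<partial>lebesgue) \<le> (\<integral>\<^sup>+t. ennreal (norm (indicator {0<..1} t * (\<omega> t / t))) \<partial>lebesgue)"
      unfolding F_def by (intro nn_integral_mono ennreal_leI) (simp only: real_norm_def abs_ge_self)
    also have "\<dots> < \<infinity>" using int unfolding integrable_iff_bounded by blast
    finally show ?thesis .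
  qed
  finally have fin: "(\<Sum>k. ennreal (\<omega> ((1/2) ^ Suc k) / 2)) < \<infinity>" .
  have "summable (\<lambda>k. \<omega> ((1/2) ^ Suc k) / 2)"
  proof (rule summable_suminf_not_top)
    show "0 \<le> \<omega> ((1/2) ^ Suc k) / 2" for k
      using nn[of "(1/2) ^ Suc k"] power_le_one[of "1/2 :: real" "Suc k"] by simp
    show "(\<Sum>k. ennreal (\<omega> ((1/2) ^ Suc k) / 2)) \<noteq> top" using fin by simp
  qed
  then have "summable (\<lambda>k. \<omega> ((1/2) ^ Suc k))"
    using summable_mult[of "\<lambda>k. \<omega> ((1/2) ^ Suc k) / 2" 2] by simp
  then show ?thesis by (subst (asm) summable_Suc_iff)
qed

section \<open>Restrictions, and functions that are both integrable and square integrable\<close>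

definition rst :: "'a set \<Rightarrow> ('a \<Rightarrow> complex) \<Rightarrow> 'a \<Rightarrow> complex" where
  "rst S f = (\<lambda>y. indicat_real S y *\<^sub>R f y)"

lemma norm_rst: "ennreal (norm (rst S f y)) = ennreal (norm (f y)) * indicator S y"
  by (simp add: rst_def indicator_def)

text \<open>\<open>T\<close> is constrained on \<open>L2\<close> only, whereas the weak type bound
  and sparse domination are about L1 norms; both are stated on the intersection.\<close>

definition L12 :: "(real ^ 'n \<Rightarrow> complex) set" where
  "L12 = {f \<in> L2. integrable lebesgue f}"

lemma L2_iff: "f \<in> L2 \<longleftrightarrow> f \<in> borel_measurable lebesgue \<and> (\<integral>\<^sup>+x. ennreal ((norm (f x))\<^sup>2) \<partial>lebesgue) < \<infinity>"
  unfolding L2_def by (auto simp: integrable_iff_bounded)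

lemma L2_measurable [measurable_dest]: "f \<in> L2 \<Longrightarrow> f \<in> borel_measurable lebesgue"
  by (simp add: L2_def)

lemma L2_add:
  assumes "f \<in> L2" "g \<in> L2"
  shows "(\<lambda>x. f x + g x) \<in> L2"
proof -
  have [measurable]: "f \<in> borel_measurable lebesgue" "g \<in> borel_measurable lebesgue" using assms by (auto dest: L2_measurable)
  have "(\<integral>\<^sup>+x. ennreal ((norm (f x + g x))\<^sup>2) \<partial>lebesgue) \<le>
    (\<integral>\<^sup>+x. 2 * ennreal ((norm (f x))\<^sup>2) + 2 * ennreal ((norm (g x))\<^sup>2) \<partial>lebesgue)"
  proof (intro nn_integral_mono)
    fix x
    have "(norm (f x + g x))\<^sup>2 \<le> (norm (f x) + norm (g x))\<^sup>2" by (intro power_mono norm_triangle_ineq) auto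
    also have "\<dots> \<le> 2 * (norm (f x))\<^sup>2 + 2 * (norm (g x))\<^sup>2"
      using sum_squares_bound[of "norm (f x)" "norm (g x)"] by (simp add: power2_sum)
    finally show "ennreal ((norm (f x + g x))\<^sup>2) \<le> 2 * ennreal ((norm (f x))\<^sup>2) + 2 * ennreal ((norm (g x))\<^sup>2)"
      using ennreal_leI[of "(norm (f x + g x))\<^sup>2" "2 * (norm (f x))\<^sup>2 + 2 * (norm (g x))\<^sup>2"]
      by (simp add: ennreal_mult)
  qed
  also have "\<dots> = 2 * (\<integral>\<^sup>+x. ennreal ((norm (f x))\<^sup>2) \<partial>lebesgue) + 2 * (\<integral>\<^sup>+x. ennreal ((norm (g x))\<^sup>2) \<partial>lebesgue)"
    by (simp add: nn_integral_add nn_integral_cmult)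
  also have "\<dots> < \<infinity>" using assms by (simp add: L2_iff ennreal_mult_less_top)
  finally show ?thesis using assms by (auto simp: L2_iff)
qed

lemma L2_cmult:
  assumes "f \<in> L2"
  shows "(\<lambda>x. c * f x) \<in> L2"
proof -
  have [measurable]: "f \<in> borel_measurable lebesgue" using assms by (auto dest: L2_measurable)
  have "(\<integral>\<^sup>+x. ennreal ((norm (c * f x))\<^sup>2) \<partial>lebesgue) = (\<integral>\<^sup>+x. ennreal ((norm c)\<^sup>2) * ennreal ((norm (f x))\<^sup>2) \<partial>lebesgue)"
    by (simp add: norm_mult power_mult_distrib ennreal_mult)
  also have "\<dots> = ennreal ((norm c)\<^sup>2) * (\<integral>\<^sup>+x. ennreal ((norm (f x))\<^sup>2) \<partial>lebesgue)"
    by (rule nn_integral_cmult) measurable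
  also have "\<dots> < \<infinity>" using assms by (simp add: L2_iff ennreal_mult_less_top)
  finally show ?thesis using assms by (auto simp: L2_iff)
qed

lemma L2_dominated:
  assumes "f \<in> L2" "g \<in> borel_measurable lebesgue" "\<And>x. norm (g x) \<le> norm (f x)"
  shows "g \<in> L2"
proof -
  have "(\<integral>\<^sup>+x. ennreal ((norm (g x))\<^sup>2) \<partial>lebesgue) \<le> (\<integral>\<^sup>+x. ennreal ((norm (f x))\<^sup>2) \<partial>lebesgue)"
    using assms by (intro nn_integral_mono ennreal_leI power_mono) auto
  then show ?thesis using assms by (auto simp: L2_iff)
qed

lemma rst_measurable: "f \<in> borel_measurable lebesgue \<Longrightarrow> S \<in> sets lebesgue \<Longrightarrow> rst S f \<in> borel_measurable lebesgue"
  unfolding rst_def by (intro borel_measurable_scaleR borel_measurable_indicator)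

lemma L2_rst: "f \<in> L2 \<Longrightarrow> S \<in> sets lebesgue \<Longrightarrow> rst S f \<in> L2"
  by (rule L2_dominated[where f=f]) (auto simp: rst_measurable L2_measurable, auto simp: rst_def indicator_def)

lemma L12_rst: "f \<in> L12 \<Longrightarrow> S \<in> sets lebesgue \<Longrightarrow> rst S f \<in> L12"
  by (auto simp: L12_def L2_rst) (auto simp: rst_def intro: integrable_mult_indicator)

lemma L12_add: "f \<in> L12 \<Longrightarrow> g \<in> L12 \<Longrightarrow> (\<lambda>x. f x + g x) \<in> L12"
  by (auto simp: L12_def L2_add)

lemma L12_cmult: "f \<in> L12 \<Longrightarrow> (\<lambda>x. c * f x) \<in> L12"
  by (auto simp: L12_def L2_cmult)

lemma L12_diff: "f \<in> L12 \<Longrightarrow> g \<in> L12 \<Longrightarrow> (\<lambda>x. f x - g x) \<in> L12"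
  using L12_add[of f "\<lambda>x. - 1 * g x"] L12_cmult[of g "- 1"] by simp

lemma L12_measurable [measurable_dest]: "f \<in> L12 \<Longrightarrow> f \<in> borel_measurable lebesgue"
  by (simp add: L12_def L2_def)

lemma nn_integral_rst:
  "(\<integral>\<^sup>+x. ennreal (norm (rst S f x)) \<partial>lebesgue) = (\<integral>\<^sup>+x\<in>S. ennreal (norm (f x)) \<partial>lebesgue)"
  by (simp add: norm_rst)

locale dini_cz_operator =
  fixes \<omega> :: "real \<Rightarrow> real"
    and K :: "real ^ 'n \<Rightarrow> real ^ 'n \<Rightarrow> complex"
    and T :: "(real ^ 'n \<Rightarrow> complex) \<Rightarrow> real ^ 'n \<Rightarrow> complex"
  assumes cz: "cz_operator \<omega> K T" and dini: "dini \<omega>"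
begin

lemma modulus: "modulus_of_continuity \<omega>"
  using cz by (simp add: cz_operator_def cz_kernel_def)

lemma \<omega>_nonneg: "0 \<le> t \<Longrightarrow> t \<le> 1 \<Longrightarrow> 0 \<le> \<omega> t"
  using modulus by (auto simp: modulus_of_continuity_def)

lemma \<omega>_mono: "0 \<le> s \<Longrightarrow> s \<le> t \<Longrightarrow> t \<le> 1 \<Longrightarrow> \<omega> s \<le> \<omega> t"
  using modulus mono_onD[of "{0..1}" \<omega> s t] unfolding modulus_of_continuity_def by auto

text \<open>Summability makes the dyadic values of \<omega> tend to 0, and monotonicity extends this
  to all small arguments.\<close>

lemma \<omega>_small:
  assumes "0 < e"
  obtains \<delta> where "0 < \<delta>" "\<delta> \<le> 1" "\<And>t. 0 \<le> t \<Longrightarrow> t \<le> \<delta> \<Longrightarrow> \<omega> t < e"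
proof -
  have "(\<lambda>k. \<omega> ((1/2) ^ k)) \<longlonglongrightarrow> 0"
    by (rule summable_LIMSEQ_zero[OF modulus_dyadic_summable[OF modulus dini]])
  then have "\<forall>\<^sub>F k in sequentially. \<omega> ((1/2) ^ k) < e" using assms by (rule order_tendstoD)
  then obtain k where k: "\<omega> ((1/2) ^ k) < e" by (auto simp: eventually_sequentially)
  show ?thesis
  proof (rule that[of "(1/2) ^ k"])
    fix t :: real assume "0 \<le> t" "t \<le> (1/2) ^ k"
    then have "\<omega> t \<le> \<omega> ((1/2) ^ k)" by (intro \<omega>_mono) (auto intro: power_le_one)
    with k show "\<omega> t < e" by simp
  qed (auto intro: power_le_one)
qed

definition dini_const :: real where
  "dini_const = 2 ^ CARD('n) * (\<Sum>k. \<omega> ((1/2) ^ k))"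

lemma dini_const_nonneg: "0 \<le> dini_const"
  unfolding dini_const_def
  by (intro mult_nonneg_nonneg suminf_nonneg modulus_dyadic_summable modulus dini \<omega>_nonneg)
    (auto intro: power_le_one)

text \<open>The k-th annulus is 2^(k+2) s <= |y - a| < 2^(k+3) s. On it \<omega> is at most
  \<omega>(2^(-k-2)), and the growth of \<open>F\<close> over the ball of the outer radius exceeds
  the denominator by the factor 2^n. Growth is asked for only at radii from 4s on, which is what a
  stopping cube can supply.\<close>

lemma annuli_sum:
  fixes F :: "real ^ 'n \<Rightarrow> ennreal"
  assumes [measurable]: "F \<in> borel_measurable lebesgue" and s: "0 < s"
    and A: "\<And>r. 4 * s \<le> r \<Longrightarrow> (\<integral>\<^sup>+y\<in>ball a r. F y \<partial>lebesgue) \<le> A * ennreal (r ^ CARD('n))"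
  shows "(\<integral>\<^sup>+y\<in>- ball a (4 * s). F y * ennreal (\<omega> (s / norm (y - a)) / norm (y - a) ^ CARD('n)) \<partial>lebesgue)
     \<le> ennreal dini_const * A"
proof -
  let ?n = "CARD('n)"
  define c where "c k = \<omega> ((1/2) ^ (k + 2)) / (2 ^ (k + 2) * s) ^ ?n" for k
  have \<omega>k: "0 \<le> \<omega> ((1/2) ^ k)" for k by (rule \<omega>_nonneg) (auto intro: power_le_one)
  have c0: "0 \<le> c k" for k unfolding c_def using \<omega>k[of "k+2"] s by simp
  have "(\<integral>\<^sup>+y\<in>- ball a (4 * s). F y * ennreal (\<omega> (s / norm (y - a)) / norm (y - a) ^ ?n) \<partial>lebesgue)
    \<le> (\<integral>\<^sup>+y. (\<Sum>k. ennreal (c k) * (F y * indicator (ball a (2 ^ (k + 3) * s)) y)) \<partial>lebesgue)"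
  proof (intro nn_integral_mono)
    fix y
    show "F y * ennreal (\<omega> (s / norm (y - a)) / norm (y - a) ^ ?n) * indicator (- ball a (4 * s)) y
      \<le> (\<Sum>k. ennreal (c k) * (F y * indicator (ball a (2 ^ (k + 3) * s)) y))"
    proof (cases "y \<in> ball a (4 * s)")
      case False
      define d where "d = norm (y - a)"
      have d: "4 * s \<le> d" using False by (simp add: d_def dist_norm norm_minus_commute)
      define P where "P k \<longleftrightarrow> d < 2 ^ (k + 3) * s" for k :: nat
      have "\<exists>k. P k"
      proof -
        obtain k where "d / s < 2 ^ k" using real_arch_pow[of 2 "d/s"] by auto
        then have "d < 2 ^ k * s" using s by (simp add: field_simps)
        also have "\<dots> \<le> 2 ^ (k + 3) * s" using s by (intro mult_right_mono power_increasing) auto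
        finally show ?thesis by (auto simp: P_def)
      qed
      define k where "k = (LEAST k. P k)"
      have Pk: "P k" unfolding k_def using \<open>\<exists>k. P k\<close> by (auto intro: LeastI)
      have low: "2 ^ (k + 2) * s \<le> d"
      proof (cases k)
        case (Suc j)
        then have "\<not> P j" using not_less_Least[of j P] by (simp add: k_def)
        then show ?thesis using Suc by (simp add: P_def not_less eval_nat_numeral)
      qed (use d in simp)
      have d0: "d > 0" using d s by linarith
      have p2: "(0::real) < 2 ^ (k + 2) * s" using s by simp
      have "s / d \<le> s / (2 ^ (k + 2) * s)" using low s p2 d0 by (intro divide_left_mono mult_pos_pos) auto
      also have "\<dots> = (1/2) ^ (k + 2)" using s by (simp add: power_divide)
      finally have "\<omega> (s / d) \<le> \<omega> ((1/2) ^ (k + 2))" using s d0 power_le_one[of "1/2 :: real" "k + 2"] by (intro \<omega>_mono) auto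
      then have "\<omega> (s / d) / d ^ ?n \<le> c k"
        unfolding c_def using low p2 d0 \<omega>k[of "k+2"] by (intro frac_le power_mono) auto
      then have "F y * ennreal (\<omega> (s / d) / d ^ ?n) \<le> ennreal (c k) * F y"
        by (subst mult.commute) (intro mult_right_mono ennreal_leI, auto)
      also have "\<dots> = ennreal (c k) * (F y * indicator (ball a (2 ^ (k + 3) * s)) y)"
        using Pk by (simp add: P_def d_def dist_norm norm_minus_commute)
      also have "\<dots> \<le> (\<Sum>k. ennreal (c k) * (F y * indicator (ball a (2 ^ (k + 3) * s)) y))"
        using sum_le_suminf[of "\<lambda>k. ennreal (c k) * (F y * indicator (ball a (2 ^ (k + 3) * s)) y)" "{k}"] by simp
      finally show ?thesis using False by (simp add: d_def)
    qed auto
  qed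
  also have "\<dots> = (\<Sum>k. ennreal (c k) * (\<integral>\<^sup>+y\<in>ball a (2 ^ (k + 3) * s). F y \<partial>lebesgue))"
    by (subst nn_integral_suminf) (auto simp: nn_integral_cmult)
  also have "\<dots> \<le> (\<Sum>k. ennreal (c k) * (A * ennreal ((2 ^ (k + 3) * s) ^ ?n)))"
  proof (intro suminf_le mult_left_mono A)
    fix k :: nat
    have "(1::real) \<le> 2 ^ k" by simp
    then have "(4::real) \<le> 8 * 2 ^ k" by linarith
    then have "(4::real) \<le> 2 ^ (k + 3)" by (simp add: power_add)
    then show "4 * s \<le> 2 ^ (k + 3) * s" using s by (intro mult_right_mono) auto
  qed auto
  also have "\<dots> = (\<Sum>k. ennreal (2 ^ ?n * \<omega> ((1/2) ^ (k + 2))) * A)"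
  proof -
    have "c k * (2 ^ (k + 3) * s) ^ ?n = 2 ^ ?n * \<omega> ((1/2) ^ (k + 2))" for k
    proof -
      have e: "(2 ^ (k + 3) * s) ^ ?n = 2 ^ ?n * (2 ^ (k + 2) * s) ^ ?n"
      proof -
        have "2 ^ (k + 3) * s = 2 * (2 ^ (k + 2) * s)" by (simp add: eval_nat_numeral)
        then show ?thesis by (simp only: power_mult_distrib)
      qed
      have "(2 ^ (k + 2) * s) ^ ?n \<noteq> 0" using s by simp
      then show ?thesis unfolding e c_def by (simp add: field_simps)
    qed
    note eq = this
    have "ennreal (c k) * (A * ennreal ((2 ^ (k + 3) * s) ^ ?n)) = ennreal (2 ^ ?n * \<omega> ((1/2) ^ (k + 2))) * A" for k
    proof -
      have "ennreal (c k) * (A * ennreal ((2 ^ (k + 3) * s) ^ ?n)) = (ennreal (c k) * ennreal ((2 ^ (k + 3) * s) ^ ?n)) * A"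
        by (simp only: mult_ac)
      also have "ennreal (c k) * ennreal ((2 ^ (k + 3) * s) ^ ?n) = ennreal (c k * (2 ^ (k + 3) * s) ^ ?n)"
        using c0[of k] s by (intro ennreal_mult[symmetric]) auto
      finally show ?thesis by (simp only: eq)
    qed
    then show ?thesis by simp
  qed
  also have "\<dots> = (\<Sum>k. ennreal (2 ^ ?n * \<omega> ((1/2) ^ (k + 2)))) * A"
    by simp
  also have "\<dots> \<le> ennreal dini_const * A"
  proof (intro mult_right_mono)
    define f where "f k = 2 ^ ?n * \<omega> ((1/2) ^ k)" for k
    have f0: "0 \<le> f k" for k unfolding f_def by (intro mult_nonneg_nonneg \<omega>k) simp
    have sm: "summable f"
      unfolding f_def by (intro summable_mult modulus_dyadic_summable modulus dini)
    have "(\<Sum>k. ennreal (f (k + 2))) = ennreal (\<Sum>k. f (k + 2))"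
      by (intro suminf_ennreal2 f0 summable_ignore_initial_segment[OF sm])
    also have "(\<Sum>k. f (k + 2)) \<le> suminf f"
    proof -
      have "0 \<le> sum f {..<2}" by (intro sum_nonneg f0)
      then show ?thesis using suminf_split_initial_segment[OF sm, of 2] by linarith
    qed
    also have "suminf f = dini_const"
      unfolding dini_const_def f_def by (subst suminf_mult) (auto intro: modulus_dyadic_summable modulus dini)
    finally have "(\<Sum>k. ennreal (f (k + 2))) \<le> ennreal dini_const" using ennreal_leI by simp
    then have "(\<Sum>k. ennreal (2 ^ ?n * \<omega> ((1/2) ^ (k + 2)))) \<le> ennreal dini_const" by (simp only: f_def)
    then     show "(\<Sum>k. ennreal (2 ^ ?n * \<omega> ((1/2) ^ (k + 2)))) \<le> ennreal dini_const" .
  qed simp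
  finally show ?thesis .
qed

end

section \<open>Bounds for \<open>T\<close> in L2 and through its kernel\<close>

context dini_cz_operator
begin

lemma T_lin: "L2_bounded_linear T"
  using cz by (simp add: cz_operator_def)

lemma T_L2: "f \<in> L2 \<Longrightarrow> T f \<in> L2"
  using T_lin by (simp add: L2_bounded_linear_def)

lemma T_measurable: "f \<in> L2 \<Longrightarrow> T f \<in> borel_measurable lebesgue"
  using T_L2 L2_measurable by blast

lemma T_add: "f \<in> L2 \<Longrightarrow> g \<in> L2 \<Longrightarrow> AE x in lebesgue. T (\<lambda>y. f y + g y) x = T f x + T g x"
  using T_lin by (simp add: L2_bounded_linear_def)

lemma T_bounded:
  obtains C where "0 < C" "\<And>f. f \<in> L2 \<Longrightarrow>
    (\<integral>\<^sup>+x. ennreal ((norm (T f x))\<^sup>2) \<partial>lebesgue) \<le> ennreal C * (\<integral>\<^sup>+x. ennreal ((norm (f x))\<^sup>2) \<partial>lebesgue)"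
proof -
  have "\<exists>C. \<forall>f\<in>L2. L2_norm (T f) \<le> C * L2_norm f"
    using T_lin unfolding L2_bounded_linear_def by blast
  then obtain C where C: "\<And>f. f \<in> L2 \<Longrightarrow> L2_norm (T f) \<le> C * L2_norm f" by blast
  have sq: "(\<integral>\<^sup>+x. ennreal ((norm (f x))\<^sup>2) \<partial>lebesgue) = ennreal ((L2_norm f)\<^sup>2)" if "f \<in> L2" for f :: "real ^ 'n \<Rightarrow> complex"
  proof -
    have "(\<integral>\<^sup>+x. ennreal ((norm (f x))\<^sup>2) \<partial>lebesgue) = ennreal (LINT x|lebesgue. (norm (f x))\<^sup>2)"
      using that by (intro nn_integral_eq_integral) (auto simp: L2_def)
    also have "(LINT x|lebesgue. (norm (f x))\<^sup>2) = (L2_norm f)\<^sup>2"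
      unfolding L2_norm_def by (subst real_sqrt_pow2) (auto intro: integral_nonneg_AE)
    finally show ?thesis .
  qed
  have n0: "0 \<le> L2_norm f" for f :: "real ^ 'n \<Rightarrow> complex"
    unfolding L2_norm_def by (intro real_sqrt_ge_zero integral_nonneg_AE) auto
  show ?thesis
  proof (rule that[of "C\<^sup>2 + 1"])
    show "0 < C\<^sup>2 + 1" by (simp add: add_nonneg_pos)
    fix f :: "real ^ 'n \<Rightarrow> complex" assume f: "f \<in> L2"
    have "(L2_norm (T f))\<^sup>2 \<le> (C * L2_norm f)\<^sup>2" using C[OF f] n0 by (intro power_mono) auto
    also have "\<dots> \<le> (C\<^sup>2 + 1) * (L2_norm f)\<^sup>2" by (simp add: power_mult_distrib distrib_right)
    finally have "ennreal ((L2_norm (T f))\<^sup>2) \<le> ennreal ((C\<^sup>2 + 1) * (L2_norm f)\<^sup>2)" by (rule ennreal_leI)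
    then show "(\<integral>\<^sup>+x. ennreal ((norm (T f x))\<^sup>2) \<partial>lebesgue) \<le> ennreal (C\<^sup>2 + 1) * (\<integral>\<^sup>+x. ennreal ((norm (f x))\<^sup>2) \<partial>lebesgue)"
      using sq[OF f] sq[OF T_L2[OF f]] by (simp add: ennreal_mult)
  qed
qed

lemma T_zero_AE:
  assumes f: "f \<in> L2" and z: "AE x in lebesgue. f x = 0"
  shows "AE x in lebesgue. T f x = 0"
proof -
  obtain C where C: "0 < C" "\<And>f. f \<in> L2 \<Longrightarrow>
    (\<integral>\<^sup>+x. ennreal ((norm (T f x))\<^sup>2) \<partial>lebesgue) \<le> ennreal C * (\<integral>\<^sup>+x. ennreal ((norm (f x))\<^sup>2) \<partial>lebesgue)"
    by (rule T_bounded) blast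
  have [measurable]: "T f \<in> borel_measurable lebesgue" by (rule T_measurable[OF f])
  have "(\<integral>\<^sup>+x. ennreal ((norm (f x))\<^sup>2) \<partial>lebesgue) = (\<integral>\<^sup>+x. 0 \<partial>(lebesgue :: (real ^ 'n) measure))"
    using z by (intro nn_integral_cong_AE) auto
  then have "(\<integral>\<^sup>+x. ennreal ((norm (T f x))\<^sup>2) \<partial>lebesgue) = 0" using C(2)[OF f] by simp
  then have "AE x in lebesgue. ennreal ((norm (T f x))\<^sup>2) = 0" by (subst (asm) nn_integral_0_iff_AE) auto
  then show ?thesis by eventually_elim simp
qed

lemma T_kernel:
  assumes "f \<in> L2"
  shows "AE x in lebesgue. x \<notin> closure {y. f y \<noteq> 0} \<longrightarrow> T f x = (LINT y|lebesgue. K x y * f y)"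
  using cz assms by (simp add: cz_operator_def)

lemma kernel_smooth:
  assumes "norm (x - y) > 2 * norm (x - x')"
  shows "norm (K x y - K x' y) \<le> \<omega> (norm (x - x') / norm (x - y)) / norm (x - y) ^ CARD('n)"
    and "norm (K y x - K y x') \<le> \<omega> (norm (x - x') / norm (x - y)) / norm (x - y) ^ CARD('n)"
proof -
  have "norm (K x y - K x' y) + norm (K y x - K y x')
          \<le> \<omega> (norm (x - x') / norm (x - y)) * (1 / norm (x - y) ^ CARD('n))"
    using cz assms unfolding cz_operator_def cz_kernel_def by blast
  then show "norm (K x y - K x' y) \<le> \<omega> (norm (x - x') / norm (x - y)) / norm (x - y) ^ CARD('n)"
    and "norm (K y x - K y x') \<le> \<omega> (norm (x - x') / norm (x - y)) / norm (x - y) ^ CARD('n)"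
    using norm_ge_zero[of "K x y - K x' y"] norm_ge_zero[of "K y x - K y x'"]
    unfolding times_divide_eq_right mult_1_right by linarith+
qed

lemma kernel_size:
  obtains C where "0 < C" "\<And>x y. x \<noteq> y \<Longrightarrow> norm (K x y) \<le> C / norm (x - y) ^ CARD('n)"
proof -
  obtain C where C: "\<And>x y. x \<noteq> y \<Longrightarrow> norm (K x y) \<le> C / norm (x - y) ^ CARD('n)"
    using cz unfolding cz_operator_def cz_kernel_def by blast
  have "norm (K x y) \<le> (\<bar>C\<bar> + 1) / norm (x - y) ^ CARD('n)" if "x \<noteq> y" for x y
  proof -
    have "C / norm (x - y) ^ CARD('n) \<le> (\<bar>C\<bar> + 1) / norm (x - y) ^ CARD('n)"
      by (intro divide_right_mono) auto
    then show ?thesis using C[OF that] by linarith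
  qed
  then show ?thesis by (intro that[of "\<bar>C\<bar> + 1"]) (auto simp: add_nonneg_pos)
qed

text \<open>Serves the measurability of the kernel integrands. It combines smoothness in the second
  variable with \<omega> tending to 0.\<close>

lemma kernel_continuous: "continuous_on (- {x}) (K x)"
proof (rule continuous_at_imp_continuous_on, rule ballI)
  fix y assume "y \<in> - {x}"
  define d where "d = norm (y - x)"
  have d: "d > 0" using \<open>y \<in> - {x}\<close> by (simp add: d_def)
  show "isCont (K x) y"
    unfolding continuous_at_eps_delta
  proof (intro allI impI)
    fix e :: real assume e: "0 < e"
    obtain \<delta> where \<delta>: "0 < \<delta>" "\<delta> \<le> 1" "\<And>t. 0 \<le> t \<Longrightarrow> t \<le> \<delta> \<Longrightarrow> \<omega> t < e * d ^ CARD('n)"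
      using \<omega>_small[of "e * d ^ CARD('n)"] e d by auto
    have "dist (K x y') (K x y) < e" if y': "dist y' y < min (d/3) (\<delta> * d)" for y'
    proof -
      have n: "norm (y - y') < d/3" "norm (y - y') < \<delta> * d"
        using y' by (auto simp: dist_norm norm_minus_commute)
      have "norm (K x y - K x y') \<le> \<omega> (norm (y - y') / norm (y - x)) / norm (y - x) ^ CARD('n)"
        using n norm_ge_zero[of "y - y'"] by (intro kernel_smooth(2)) (auto simp only: d_def)
      also have "\<dots> < (e * d ^ CARD('n)) / d ^ CARD('n)"
        using n d unfolding d_def[symmetric]
        by (intro divide_strict_right_mono \<delta>) (auto simp: field_simps)
      also have "\<dots> = e" using d by simp
      finally show ?thesis by (simp add: dist_norm norm_minus_commute)
    qed
    then show "\<exists>d>0. \<forall>x'. dist x' y < d \<longrightarrow> dist (K x x') (K x y) < e"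
      using d \<delta> by (intro exI[of _ "min (d/3) (\<delta> * d)"]) auto
  qed
qed

lemma kernel_integrable:
  assumes f: "integrable lebesgue f" and x: "0 < \<delta>" "\<And>y. f y \<noteq> 0 \<Longrightarrow> \<delta> \<le> norm (x - y)"
  shows "integrable lebesgue (\<lambda>y. K x y * f y)"
proof -
  obtain C where C: "0 < C" "\<And>x y. x \<noteq> y \<Longrightarrow> norm (K x y) \<le> C / norm (x - y) ^ CARD('n)"
    by (rule kernel_size) blast
  have "(\<lambda>y. indicator (- {x}) y *\<^sub>R K x y) \<in> borel_measurable borel"
    by (rule borel_measurable_continuous_on_indicator) (auto intro: kernel_continuous)
  then have "(\<lambda>y. indicator (- {x}) y *\<^sub>R K x y) \<in> borel_measurable lebesgue"
    by (intro measurable_completion) simp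
  then have "(\<lambda>y. (indicator (- {x}) y *\<^sub>R K x y) * f y) \<in> borel_measurable lebesgue"
    using f by (intro borel_measurable_times) auto
  moreover have "(\<lambda>y. (indicator (- {x}) y *\<^sub>R K x y) * f y) = (\<lambda>y. K x y * f y)"
    using x(1) x(2)[of x] by (auto simp: indicator_def fun_eq_iff)
  ultimately have m: "(\<lambda>y. K x y * f y) \<in> borel_measurable lebesgue" by simp
  show ?thesis
  proof (rule Bochner_Integration.integrable_bound[OF _ m])
    show "integrable lebesgue (\<lambda>y. (C / \<delta> ^ CARD('n)) * norm (f y))" using f by simp
    show "AE y in lebesgue. norm (K x y * f y) \<le> norm ((C / \<delta> ^ CARD('n)) * norm (f y))"
    proof (rule AE_I2)
      fix y
      show "norm (K x y * f y) \<le> norm ((C / \<delta> ^ CARD('n)) * norm (f y))"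
      proof (cases "f y = 0")
        case False
        have le: "\<delta> \<le> norm (x - y)" using x False by auto
        then have "x \<noteq> y" using x(1) by auto
        then have "norm (K x y) \<le> C / norm (x - y) ^ CARD('n)" by (rule C)
        also have "\<dots> \<le> C / \<delta> ^ CARD('n)" using C x le \<open>x \<noteq> y\<close> by (intro divide_left_mono power_mono mult_pos_pos) auto
        finally have "norm (K x y) * norm (f y) \<le> (C / \<delta> ^ CARD('n)) * norm (f y)" by (intro mult_right_mono) auto
        then show ?thesis using C x by (simp add: norm_mult)
      qed auto
    qed
  qed
qed

text \<open>The vanishing mean allows \<open>K x a\<close> to be subtracted from the kernel, and
  smoothness in the second variable bounds the difference on the support of \<beta>.\<close>

lemma T_mean_zero_pointwise:
  fixes \<beta> :: "real ^ 'n \<Rightarrow> complex"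
  assumes \<beta>: "\<beta> \<in> L12" and s: "0 < s" and supp: "\<And>y. \<beta> y \<noteq> 0 \<Longrightarrow> norm (y - a) \<le> s"
    and mean: "(LINT y|lebesgue. \<beta> y) = 0"
  shows "AE x in lebesgue. x \<notin> ball a (4 * s) \<longrightarrow> ennreal (norm (T \<beta> x)) \<le>
    (\<integral>\<^sup>+y. ennreal (norm (\<beta> y)) \<partial>lebesgue) * ennreal (\<omega> (s / norm (x - a)) / norm (x - a) ^ CARD('n))"
proof -
  have bL2: "\<beta> \<in> L2" and int: "integrable lebesgue \<beta>" using \<beta> by (auto simp: L12_def)
  have [measurable]: "\<beta> \<in> borel_measurable lebesgue" using bL2 by (rule L2_measurable)
  have "{y. \<beta> y \<noteq> 0} \<subseteq> cball a s" using supp by (auto simp: dist_norm norm_minus_commute)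
  then have cl: "closure {y. \<beta> y \<noteq> 0} \<subseteq> cball a s" by (simp add: closure_minimal)
  show ?thesis using T_kernel[OF bL2]
  proof eventually_elim
    case (elim x)
    show ?case
    proof
      assume "x \<notin> ball a (4 * s)"
      then have xa: "4 * s \<le> norm (x - a)" by (simp add: dist_norm norm_minus_commute)
      then have "x \<notin> cball a s" using s by (auto simp: dist_norm norm_minus_commute)
      then have Tx: "T \<beta> x = (LINT y|lebesgue. K x y * \<beta> y)" using elim cl by blast
      have far: "3 * s \<le> norm (x - y)" if "\<beta> y \<noteq> 0" for y
        using supp[OF that] xa norm_triangle_ineq[of "x - y" "y - a"] by simp
      have i1: "integrable lebesgue (\<lambda>y. K x y * \<beta> y)"
        using s far by (intro kernel_integrable[OF int, of "3 * s"]) auto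
      have i2: "integrable lebesgue (\<lambda>y. K x a * \<beta> y)" using int by simp
      have "T \<beta> x = (LINT y|lebesgue. K x y * \<beta> y) - (LINT y|lebesgue. K x a * \<beta> y)"
        using Tx mean by simp
      also have "\<dots> = (LINT y|lebesgue. K x y * \<beta> y - K x a * \<beta> y)" using i1 i2 by simp
      finally have "ennreal (norm (T \<beta> x)) \<le> (\<integral>\<^sup>+y. ennreal (norm (K x y * \<beta> y - K x a * \<beta> y)) \<partial>lebesgue)"
        using integral_norm_bound_ennreal[OF Bochner_Integration.integrable_diff[OF i1 i2]] by simp
      also have "\<dots> \<le> (\<integral>\<^sup>+y. ennreal (norm (\<beta> y)) * ennreal (\<omega> (s / norm (x - a)) / norm (x - a) ^ CARD('n)) \<partial>lebesgue)"
      proof (intro nn_integral_mono)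
        fix y
        show "ennreal (norm (K x y * \<beta> y - K x a * \<beta> y)) \<le>
          ennreal (norm (\<beta> y)) * ennreal (\<omega> (s / norm (x - a)) / norm (x - a) ^ CARD('n))"
        proof (cases "\<beta> y = 0")
          case False
          have ya: "norm (a - y) \<le> s" using supp[OF False] by (simp add: norm_minus_commute)
          have ax: "norm (a - x) = norm (x - a)" by (rule norm_minus_commute)
          have pos: "norm (x - a) > 0" using xa s by linarith
          have "norm (K x a - K x y) \<le> \<omega> (norm (a - y) / norm (a - x)) / norm (a - x) ^ CARD('n)"
            using ya xa s by (intro kernel_smooth(2)) (auto simp: ax)
          also have "\<dots> \<le> \<omega> (s / norm (x - a)) / norm (x - a) ^ CARD('n)"
            unfolding ax using ya xa s pos
            by (intro divide_right_mono \<omega>_mono) (auto simp: field_simps)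
          finally have b: "norm (K x y - K x a) \<le> \<omega> (s / norm (x - a)) / norm (x - a) ^ CARD('n)"
            by (simp add: norm_minus_commute)
          have "norm (K x y * \<beta> y - K x a * \<beta> y) = norm (\<beta> y) * norm (K x y - K x a)"
            by (simp add: left_diff_distrib[symmetric] norm_mult)
          also have "\<dots> \<le> norm (\<beta> y) * (\<omega> (s / norm (x - a)) / norm (x - a) ^ CARD('n))"
            using b by (intro mult_left_mono) auto
          finally have "norm (K x y * \<beta> y - K x a * \<beta> y) \<le> norm (\<beta> y) * (\<omega> (s / norm (x - a)) / norm (x - a) ^ CARD('n))" .
          then show ?thesis using b order.trans[OF norm_ge_zero b]
            by (simp add: ennreal_leI flip: ennreal_mult)
        qed simp
      qed
      also have "\<dots> = (\<integral>\<^sup>+y. ennreal (norm (\<beta> y)) \<partial>lebesgue) * ennreal (\<omega> (s / norm (x - a)) / norm (x - a) ^ CARD('n))"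
        by (rule nn_integral_multc) measurable
      finally show "ennreal (norm (T \<beta> x)) \<le>
        (\<integral>\<^sup>+y. ennreal (norm (\<beta> y)) \<partial>lebesgue) * ennreal (\<omega> (s / norm (x - a)) / norm (x - a) ^ CARD('n))" .
    qed
  qed
qed

definition off_const :: real where
  "off_const = dini_const * measure lborel (ball (0 :: real ^ 'n) 1)"

text \<open>In the pointwise bound the L1 norm of \<beta> is a constant factor, so
  \<open>annuli_sum\<close> applies to a constant function; its growth is where the volume of the
  unit ball enters \<open>off_const\<close>.\<close>

lemma T_mean_zero:
  fixes \<beta> :: "real ^ 'n \<Rightarrow> complex"
  assumes \<beta>: "\<beta> \<in> L12" and s: "0 < s" and supp: "\<And>y. \<beta> y \<noteq> 0 \<Longrightarrow> norm (y - a) \<le> s"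
    and mean: "(LINT y|lebesgue. \<beta> y) = 0"
  shows "(\<integral>\<^sup>+x\<in>- ball a (4 * s). ennreal (norm (T \<beta> x)) \<partial>lebesgue) \<le> ennreal off_const * (\<integral>\<^sup>+y. ennreal (norm (\<beta> y)) \<partial>lebesgue)"
proof -
  let ?V = "measure lborel (ball (0 :: real ^ 'n) 1)"
  let ?I = "\<integral>\<^sup>+y. ennreal (norm (\<beta> y)) \<partial>lebesgue"
  have "(\<integral>\<^sup>+x\<in>- ball a (4 * s). ennreal (norm (T \<beta> x)) \<partial>lebesgue) \<le>
    (\<integral>\<^sup>+x\<in>- ball a (4 * s). ?I * ennreal (\<omega> (s / norm (x - a)) / norm (x - a) ^ CARD('n)) \<partial>lebesgue)"
    using T_mean_zero_pointwise[OF assms] by (intro nn_integral_mono_AE) (auto elim!: eventually_mono simp: indicator_def)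
  also have "\<dots> \<le> ennreal dini_const * (?I * ennreal ?V)"
  proof (rule annuli_sum[OF _ s])
    fix r assume "4 * s \<le> r"
    then have r: "0 \<le> r" using s by linarith
    have "(\<integral>\<^sup>+y\<in>ball a r. ?I \<partial>lebesgue) = ?I * emeasure lebesgue (ball a r)"
      by (subst nn_integral_cmult_indicator) auto
    also have "\<dots> = ?I * ennreal ?V * ennreal (r ^ CARD('n))"
      using r by (simp add: emeasure_lebesgue_ball ennreal_mult mult_ac)
    finally show "(\<integral>\<^sup>+y\<in>ball a r. ?I \<partial>lebesgue) \<le> ?I * ennreal ?V * ennreal (r ^ CARD('n))" by simp
  qed auto
  also have "\<dots> = ennreal off_const * ?I"
    using dini_const_nonneg by (simp add: off_const_def ennreal_mult mult_ac)
  finally show ?thesis .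
qed

end

subsection \<open>The weak type (1,1) estimate\<close>

text \<open>Centred at the corner: the cube lies in the ball of radius n times its side, and the
  kernel estimates start at four times that radius.\<close>

abbreviation qball :: "(real ^ 'n) \<times> real \<Rightarrow> (real ^ 'n) set" where
  "qball q \<equiv> ball (fst q) (4 * real CARD('n) * snd q)"

lemma qcube_subset_qball:
  fixes q :: "(real ^ 'n) \<times> real"
  assumes "0 < snd q"
  shows "qcube q \<subseteq> qball q"
proof
  fix x assume "x \<in> qcube q"
  then have "norm (x - fst q) \<le> real CARD('n) * snd q" by (rule cube_dist_corner)
  also have "\<dots> < 4 * real CARD('n) * snd q" using assms by simp
  finally show "x \<in> qball q" by (simp add: dist_norm norm_minus_commute)
qed

text \<open>A linear substitute for the Cauchy-Schwarz inequality; \<theta> is tuned later so that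
  both terms are small.\<close>

lemma nn_integral_power2_le:
  fixes u :: "'a \<Rightarrow> complex"
  assumes [measurable]: "u \<in> borel_measurable M" "A \<in> sets M" and \<theta>: "0 < \<theta>"
  shows "(\<integral>\<^sup>+x\<in>A. ennreal (norm (u x)) \<partial>M) \<le>
    ennreal \<theta> * emeasure M A + ennreal (1 / \<theta>) * (\<integral>\<^sup>+x. ennreal ((norm (u x))\<^sup>2) \<partial>M)"
proof -
  have "(\<integral>\<^sup>+x\<in>A. ennreal (norm (u x)) \<partial>M) \<le>
    (\<integral>\<^sup>+x. ennreal \<theta> * indicator A x + ennreal (1 / \<theta>) * ennreal ((norm (u x))\<^sup>2) \<partial>M)"
  proof (intro nn_integral_mono)
    fix x
    have "norm (u x) * \<theta> \<le> \<theta>\<^sup>2 + (norm (u x))\<^sup>2"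
      using sum_squares_bound[of "norm (u x)" \<theta>] zero_le_power2[of "norm (u x)"] zero_le_power2[of \<theta>]
        mult_nonneg_nonneg[of "norm (u x)" \<theta>] \<theta> norm_ge_zero[of "u x"] by linarith
    then have "norm (u x) \<le> \<theta> + 1 / \<theta> * (norm (u x))\<^sup>2"
      using \<theta> by (simp add: field_simps power2_eq_square)
    then have "ennreal (norm (u x)) \<le> ennreal (\<theta> + 1 / \<theta> * (norm (u x))\<^sup>2)" by (rule ennreal_leI)
    then show "ennreal (norm (u x)) * indicator A x \<le> ennreal \<theta> * indicator A x + ennreal (1 / \<theta>) * ennreal ((norm (u x))\<^sup>2)"
      using \<theta> by (auto simp: indicator_def ennreal_mult[symmetric])
  qed
  also have "\<dots> = ennreal \<theta> * emeasure M A + ennreal (1 / \<theta>) * (\<integral>\<^sup>+x. ennreal ((norm (u x))\<^sup>2) \<partial>M)"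
    by (simp add: nn_integral_add nn_integral_cmult)
  finally show ?thesis .
qed

lemma chebyshev_L2:
  fixes u :: "'a \<Rightarrow> complex"
  assumes [measurable]: "u \<in> borel_measurable M" and t: "0 < t"
  shows "emeasure M {x\<in>space M. t < norm (u x)} \<le> ennreal (1 / t\<^sup>2) * (\<integral>\<^sup>+x. ennreal ((norm (u x))\<^sup>2) \<partial>M)"
proof -
  have "emeasure M {x\<in>space M. t < norm (u x)} = (\<integral>\<^sup>+x. indicator {x\<in>space M. t < norm (u x)} x \<partial>M)"
    by simp
  also have "\<dots> \<le> (\<integral>\<^sup>+x. ennreal (1 / t\<^sup>2) * ennreal ((norm (u x))\<^sup>2) \<partial>M)"
  proof (intro nn_integral_mono)
    fix x
    have "1 \<le> 1 / t\<^sup>2 * (norm (u x))\<^sup>2" if "t < norm (u x)"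
    proof -
      have "t\<^sup>2 \<le> (norm (u x))\<^sup>2" using that t by (intro power_mono) auto
      then show ?thesis using t by (simp add: field_simps)
    qed
    then show "indicator {x\<in>space M. t < norm (u x)} x \<le> ennreal (1 / t\<^sup>2) * ennreal ((norm (u x))\<^sup>2)"
      by (auto simp: indicator_def ennreal_mult[symmetric] simp flip: ennreal_1 intro!: ennreal_leI)
  qed
  also have "\<dots> = ennreal (1 / t\<^sup>2) * (\<integral>\<^sup>+x. ennreal ((norm (u x))\<^sup>2) \<partial>M)"
    by (rule nn_integral_cmult) measurable
  finally show ?thesis .
qed

lemma set_lint_eq_rst: "(LINT y:S|lebesgue. f y) = (LINT y|lebesgue. rst S f y)"
  by (simp add: set_lebesgue_integral_def rst_def)

context dini_cz_operator
begin

lemma off_const_nonneg: "0 \<le> off_const"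
  unfolding off_const_def using dini_const_nonneg by simp

text \<open>Additivity of \<open>T\<close> reaches only finite sums, so the cubes are added one at a
  time with a bound that does not depend on their number. \<open>T_weak_type\<close> passes to
  infinite families by an L2 limit.\<close>

lemma T_finite_bad_part:
  fixes \<beta> :: "real ^ 'n \<Rightarrow> complex"
  assumes "finite X" and \<beta>: "\<beta> \<in> L12" and pos: "\<And>q. q \<in> X \<Longrightarrow> 0 < snd q"
    and disj: "disjoint_family_on qcube X"
    and mean: "\<And>q. q \<in> X \<Longrightarrow> (LINT y:qcube q|lebesgue. \<beta> y) = 0"
  shows "(\<integral>\<^sup>+x\<in>- (\<Union>q\<in>X. qball q). ennreal (norm (T (rst (\<Union>q\<in>X. qcube q) \<beta>) x)) \<partial>lebesgue)
     \<le> ennreal off_const * (\<integral>\<^sup>+x\<in>(\<Union>q\<in>X. qcube q). ennreal (norm (\<beta> x)) \<partial>lebesgue)"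
  using assms(1) pos disj mean
proof (induction X rule: finite_induct)
  case empty
  have z: "rst {} \<beta> = (\<lambda>y. 0)" by (simp add: rst_def)
  have "AE x in lebesgue. T (rst {} \<beta>) x = 0"
    by (rule T_zero_AE) (auto simp: z L2_iff)
  then have "(\<integral>\<^sup>+x. ennreal (norm (T (rst {} \<beta>) x)) \<partial>lebesgue) = (\<integral>\<^sup>+x. 0 \<partial>(lebesgue :: (real ^ 'n) measure))"
    by (intro nn_integral_cong_AE) (auto elim!: eventually_mono)
  then show ?case by simp
next
  case (insert q X)
  let ?U = "\<Union>q\<in>X. qcube q"
  have [measurable]: "\<beta> \<in> borel_measurable lebesgue" using \<beta> by (rule L12_measurable)
  have mU: "?U \<in> sets lebesgue" using insert.hyps by (intro sets.finite_UN) auto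
  have mB: "- (\<Union>q\<in>X. qball q) \<in> sets lebesgue" "- qball q \<in> sets lebesgue"
    by (auto intro!: lborelD borel_closed closed_Compl open_UN)
  have dj: "qcube q \<inter> ?U = {}" using insert.prems(2) insert.hyps(2)
    by (fastforce simp: disjoint_family_on_def)
  have l1: "rst (qcube q) \<beta> \<in> L12" "rst ?U \<beta> \<in> L12" using \<beta> mU by (auto intro: L12_rst)
  then have l2: "rst (qcube q) \<beta> \<in> L2" "rst ?U \<beta> \<in> L2" by (auto simp: L12_def)
  have [measurable]: "T (rst (qcube q) \<beta>) \<in> borel_measurable lebesgue" "T (rst ?U \<beta>) \<in> borel_measurable lebesgue"
    using l2 by (auto intro: T_measurable)
  have eq: "rst (\<Union>q\<in>insert q X. qcube q) \<beta> = (\<lambda>y. rst (qcube q) \<beta> y + rst ?U \<beta> y)"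
    using dj by (auto simp: rst_def indicator_def fun_eq_iff)
  have n: "real CARD('n) * snd q > 0" using insert.prems(1)[of q] by simp
  have one: "(\<integral>\<^sup>+x\<in>- qball q. ennreal (norm (T (rst (qcube q) \<beta>) x)) \<partial>lebesgue)
     \<le> ennreal off_const * (\<integral>\<^sup>+x\<in>qcube q. ennreal (norm (\<beta> x)) \<partial>lebesgue)"
  proof -
    have "(\<integral>\<^sup>+x\<in>- ball (fst q) (4 * (real CARD('n) * snd q)). ennreal (norm (T (rst (qcube q) \<beta>) x)) \<partial>lebesgue)
      \<le> ennreal off_const * (\<integral>\<^sup>+x. ennreal (norm (rst (qcube q) \<beta> x)) \<partial>lebesgue)"
    proof (rule T_mean_zero[OF l1(1) n])
      show "norm (y - fst q) \<le> real CARD('n) * snd q" if "rst (qcube q) \<beta> y \<noteq> 0" for y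
        using that by (intro cube_dist_corner) (auto simp: rst_def indicator_def split: if_splits)
      show "(LINT y|lebesgue. rst (qcube q) \<beta> y) = 0"
        using insert.prems(3)[of q] by (simp add: set_lint_eq_rst)
    qed
    then show ?thesis by (simp add: nn_integral_rst mult.assoc)
  qed
  have IH: "(\<integral>\<^sup>+x\<in>- (\<Union>q\<in>X. qball q). ennreal (norm (T (rst ?U \<beta>) x)) \<partial>lebesgue)
     \<le> ennreal off_const * (\<integral>\<^sup>+x\<in>?U. ennreal (norm (\<beta> x)) \<partial>lebesgue)"
    using insert.prems by (intro insert.IH) (auto simp: disjoint_family_on_def)
  have "(\<integral>\<^sup>+x\<in>- (\<Union>q\<in>insert q X. qball q). ennreal (norm (T (rst (\<Union>q\<in>insert q X. qcube q) \<beta>) x)) \<partial>lebesgue)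
    \<le> (\<integral>\<^sup>+x. ennreal (norm (T (rst (qcube q) \<beta>) x)) * indicator (- qball q) x +
         ennreal (norm (T (rst ?U \<beta>) x)) * indicator (- (\<Union>q\<in>X. qball q)) x \<partial>lebesgue)"
  proof (intro nn_integral_mono_AE)
    show "AE x in lebesgue. ennreal (norm (T (rst (\<Union>q\<in>insert q X. qcube q) \<beta>) x)) * indicator (- (\<Union>q\<in>insert q X. qball q)) x
      \<le> ennreal (norm (T (rst (qcube q) \<beta>) x)) * indicator (- qball q) x +
         ennreal (norm (T (rst ?U \<beta>) x)) * indicator (- (\<Union>q\<in>X. qball q)) x"
      using T_add[OF l2] unfolding eq
    proof eventually_elim
      case (elim x)
      show ?case
        using norm_triangle_ineq[of "T (rst (qcube q) \<beta>) x" "T (rst ?U \<beta>) x"]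
        by (auto simp: indicator_def elim ennreal_leI simp flip: ennreal_plus)
    qed
  qed
  also have "\<dots> = (\<integral>\<^sup>+x\<in>- qball q. ennreal (norm (T (rst (qcube q) \<beta>) x)) \<partial>lebesgue) +
     (\<integral>\<^sup>+x\<in>- (\<Union>q\<in>X. qball q). ennreal (norm (T (rst ?U \<beta>) x)) \<partial>lebesgue)"
    using mB by (intro nn_integral_add) auto
  also have "\<dots> \<le> ennreal off_const * (\<integral>\<^sup>+x\<in>qcube q. ennreal (norm (\<beta> x)) \<partial>lebesgue) +
     ennreal off_const * (\<integral>\<^sup>+x\<in>?U. ennreal (norm (\<beta> x)) \<partial>lebesgue)"
    by (intro add_mono one IH)
  also have "\<dots> = ennreal off_const * (\<integral>\<^sup>+x. ennreal (norm (\<beta> x)) * indicator (qcube q) x + ennreal (norm (\<beta> x)) * indicator ?U x \<partial>lebesgue)"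
    using mU by (subst nn_integral_add) (auto simp: distrib_left)
  also have "\<dots> = ennreal off_const * (\<integral>\<^sup>+x\<in>(\<Union>q\<in>insert q X. qcube q). ennreal (norm (\<beta> x)) \<partial>lebesgue)"
    using dj by (intro arg_cong2[where f="(*)"] refl nn_integral_cong) (auto simp: indicator_def)
  finally show ?case .
qed


text \<open>Decompose f = g + \<beta> at height \<open>t\<close>. The three terms of
  \<open>C\<close> come from Chebyshev's inequality for \<open>T g\<close> in L2, from the volume of
  the enlarged balls, and from \<open>T \<beta>\<close> off these balls.\<close>

theorem T_weak_type:
  obtains C where "0 < C" "\<And>f t. f \<in> L12 \<Longrightarrow> 0 < t \<Longrightarrow>
    emeasure lebesgue {x. t < norm (T f x)} \<le> ennreal (C / t) * (\<integral>\<^sup>+x. ennreal (norm (f x)) \<partial>lebesgue)"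
proof -
  let ?n = "CARD('n)"
  let ?V = "measure lborel (ball (0 :: real ^ 'n) 1)"
  obtain C2 where C2: "0 < C2" "\<And>f. f \<in> L2 \<Longrightarrow>
    (\<integral>\<^sup>+x. ennreal ((norm (T f x))\<^sup>2) \<partial>lebesgue) \<le> ennreal C2 * (\<integral>\<^sup>+x. ennreal ((norm (f x))\<^sup>2) \<partial>lebesgue)"
    by (rule T_bounded) blast
  define C where "C = 4 * C2 * 2 ^ ?n + ?V * (4 * real ?n) ^ ?n + 4 * off_const"
  have Cpos: "0 < C" unfolding C_def using C2(1) off_const_nonneg
    by (intro add_pos_nonneg) auto
  have main: "emeasure lebesgue {x. t < norm (T f x)} \<le> ennreal (C / t) * (\<integral>\<^sup>+x. ennreal (norm (f x)) \<partial>lebesgue)"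
    if f: "f \<in> L12" and t: "0 < t" for f :: "real ^ 'n \<Rightarrow> complex" and t
  proof -
    have fL2: "f \<in> L2" and fint: "integrable lebesgue f" using f by (auto simp: L12_def)
    have [measurable]: "f \<in> borel_measurable lebesgue" by (rule L12_measurable[OF f])
    define I where "I = (LINT x|lebesgue. norm (f x))"
    have I: "(\<integral>\<^sup>+x. ennreal (norm (f x)) \<partial>lebesgue) = ennreal I"
      unfolding I_def using fint by (intro nn_integral_eq_integral) auto
    have I0: "0 \<le> I" unfolding I_def by (intro integral_nonneg_AE) auto
    define F where "F x = norm (f x)" for x
    have Fint: "integrable lebesgue F" unfolding F_def using fint by simp
    \<comment> \<open>The top cells must be so large that none has average above \<open>t\<close>;
      as h >= 1, indeed h^n >= h >= I/t.\<close>
    define h where "h = max 1 (I / t)"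
    have h: "0 < h" "1 \<le> h" "I / t \<le> h" by (auto simp: h_def)
    have "I \<le> t * h ^ ?n"
    proof -
      have "h \<le> h ^ ?n" using h by (simp add: self_le_power)
      then have "I / t \<le> h ^ ?n" using h by linarith
      then show ?thesis using t by (simp add: field_simps)
    qed
    then have top: "(LINT y:cell 0 h 0 x|lebesgue. F y) \<le> t * h ^ ?n" for x
      using set_integral_mono_set[OF Fint, of "cell 0 h 0 x" UNIV] h
      by (simp add: F_def I_def cell_eq_cube set_lebesgue_integral_def)
    obtain S where S: "countable S" "\<And>q. q \<in> S \<Longrightarrow> 0 < snd q"
      "\<And>q. q \<in> S \<Longrightarrow> t * snd q ^ ?n < (LINT y:qcube q|lebesgue. F y)"
      "\<And>q. q \<in> S \<Longrightarrow> (LINT y:qcube q|lebesgue. F y) \<le> 2 ^ ?n * t * snd q ^ ?n"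
      "disjoint_family_on qcube S"
      "AE x in lebesgue. x \<notin> (\<Union>q\<in>S. qcube q) \<longrightarrow> F x \<le> t"
      by (rule calderon_zygmund_cubes[OF h(1) Fint _ t top]) (auto simp: F_def)
    have nnF: "(\<integral>\<^sup>+y\<in>qcube q. ennreal (norm (f y)) \<partial>lebesgue) = ennreal (LINT y:qcube q|lebesgue. F y)" for q :: "(real ^ 'n) \<times> real"
    proof -
      have "integrable lebesgue (\<lambda>y. indicator (qcube q) y *\<^sub>R F y)"
        by (intro integrable_mult_indicator Fint) auto
      then have "(\<integral>\<^sup>+y. ennreal (indicator (qcube q) y *\<^sub>R F y) \<partial>lebesgue) = ennreal (LINT y:qcube q|lebesgue. F y)"
        unfolding set_lebesgue_integral_def by (intro nn_integral_eq_integral) (auto simp: F_def)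
      moreover have "ennreal (indicator (qcube q) y *\<^sub>R F y) = ennreal (norm (f y)) * indicator (qcube q) y" for y
        by (auto simp: F_def indicator_def)
      ultimately show ?thesis by simp
    qed
    define U where "U = (\<Union>q\<in>S. qcube q)"
    have mU[measurable]: "U \<in> sets lebesgue" unfolding U_def using S(1) by (intro sets.countable_UN') auto
    have sumS: "(\<integral>\<^sup>+q. (\<integral>\<^sup>+y\<in>qcube q. ennreal (norm (f y)) \<partial>lebesgue) \<partial>count_space S) = (\<integral>\<^sup>+y\<in>U. ennreal (norm (f y)) \<partial>lebesgue)"
      unfolding U_def using S(1,5) by (intro nn_integral_UN_disjoint_count_space) auto
    have sumI: "(\<integral>\<^sup>+q. (\<integral>\<^sup>+y\<in>qcube q. ennreal (norm (f y)) \<partial>lebesgue) \<partial>count_space S) \<le> ennreal I"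
      unfolding sumS I[symmetric] by (intro nn_integral_mono) (auto simp: indicator_def)
    have vol: "ennreal (snd q ^ ?n) \<le> ennreal (1 / t) * (\<integral>\<^sup>+y\<in>qcube q. ennreal (norm (f y)) \<partial>lebesgue)" if "q \<in> S" for q
    proof -
      have "snd q ^ ?n \<le> (1 / t) * (LINT y:qcube q|lebesgue. F y)"
        using S(3)[OF that] t by (simp add: field_simps)
      then have "ennreal (snd q ^ ?n) \<le> ennreal ((1 / t) * (LINT y:qcube q|lebesgue. F y))" by (rule ennreal_leI)
      then show ?thesis unfolding nnF using t by (simp only: ennreal_mult' zero_le_divide_1_iff less_imp_le)
    qed
    \<comment> \<open>\<open>m q\<close> is the mean of \<open>f\<close> over the cube, so \<beta>
      has mean zero on every cube. The choice operator in \<beta> picks the only cube that contains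
      \<open>y\<close>.\<close>
    define m where "m q = (LINT y:qcube q|lebesgue. f y) / of_real (snd q ^ ?n)" for q :: "(real ^ 'n) \<times> real"
    define \<beta> where "\<beta> y = (if y \<in> U then f y - m (SOME q. q \<in> S \<and> y \<in> qcube q) else 0)" for y
    have b_on: "\<beta> y = f y - m q" if "q \<in> S" "y \<in> qcube q" for q y
    proof -
      have "(SOME q. q \<in> S \<and> y \<in> qcube q) = q"
      proof (rule some_equality)
        fix q' assume "q' \<in> S \<and> y \<in> qcube q'"
        then show "q' = q" using S(5) that unfolding disjoint_family_on_def by blast
      qed (use that in auto)
      then show ?thesis using that by (auto simp: \<beta>_def U_def)
    qed
    have b_off: "\<beta> y = 0" if "y \<notin> U" for y using that by (simp add: \<beta>_def)
    \<comment> \<open>As \<beta> is defined through a choice, measurability is checked piece by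
      piece on the countable partition into the cubes and the complement of
      \<open>U\<close>.\<close>
    have mb[measurable]: "\<beta> \<in> borel_measurable lebesgue"
    proof (rule measurable_piecewise_restrict[where C="insert (- U) (qcube ` S)"])
      show "countable (insert (- U) (qcube ` S))" using S(1) by auto
      show "space lebesgue \<subseteq> \<Union> (insert (- U) (qcube ` S))" by (auto simp: U_def)
      fix X assume "X \<in> insert (- U) (qcube ` S)"
      then consider "X = - U" | q where "q \<in> S" "X = qcube q" by auto
      note cases = this
      have mnU: "- U \<in> sets lebesgue" using sets.compl_sets[OF mU] by (simp add: Compl_eq_Diff_UNIV)
      show "X \<inter> space lebesgue \<in> sets lebesgue" using cases mnU by cases auto
      show "\<beta> \<in> borel_measurable (restrict_space lebesgue X)" using cases
      proof cases
        case 1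
        have "(\<lambda>y. 0) \<in> borel_measurable (restrict_space lebesgue X)" by simp
        then show ?thesis
          by (rule measurable_cong[THEN iffD1, rotated]) (auto simp: space_restrict_space 1 b_off)
      next
        case 2
        have "(\<lambda>y. f y - m q) \<in> borel_measurable (restrict_space lebesgue X)"
          by (intro measurable_restrict_space1) measurable
        then show ?thesis
          by (rule measurable_cong[THEN iffD1, rotated]) (auto simp: space_restrict_space 2(2) b_on[OF 2(1)])
      qed
    qed
    define g where "g y = f y - \<beta> y" for y
    have [measurable]: "g \<in> borel_measurable lebesgue" unfolding g_def by measurable
    have mq: "norm (m q) * snd q ^ ?n \<le> (LINT y:qcube q|lebesgue. F y)" if "q \<in> S" for q
    proof -
      have "norm (LINT y:qcube q|lebesgue. f y) \<le> (LINT y:qcube q|lebesgue. F y)"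
        unfolding set_lebesgue_integral_def F_def
        by (rule order.trans[OF integral_norm_bound]) (simp add: abs_mult)
      then show ?thesis using S(2)[OF that] by (simp add: m_def norm_divide norm_power)
    qed
    have mq2: "norm (m q) \<le> 2 ^ ?n * t" if "q \<in> S" for q
    proof -
      have "norm (m q) * snd q ^ ?n \<le> (2 ^ ?n * t) * snd q ^ ?n"
        using mq[OF that] S(4)[OF that] by linarith
      then show ?thesis using S(2)[OF that] by (simp add: mult_le_cancel_right)
    qed
    have g_on: "g y = m q" if "q \<in> S" "y \<in> qcube q" for q y using b_on[OF that] by (simp add: g_def)
    have g_off: "g y = f y" if "y \<notin> U" for y using b_off[OF that] by (simp add: g_def)
    have g_bd: "AE y in lebesgue. norm (g y) \<le> 2 ^ ?n * t"
      using S(6)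
    proof eventually_elim
      case (elim y)
      show ?case
      proof (cases "y \<in> U")
        case True
        then obtain q where q: "q \<in> S" "y \<in> qcube q" by (auto simp: U_def)
        show ?thesis using g_on[OF q] mq2[OF q(1)] by simp
      next
        case False
        then have "norm (g y) \<le> 1 * t" using elim g_off by (auto simp: U_def F_def)
        also have "\<dots> \<le> 2 ^ ?n * t" using t by (intro mult_right_mono) auto
        finally show ?thesis .
      qed
    qed
    have gU: "(\<integral>\<^sup>+y\<in>U. ennreal (norm (g y)) \<partial>lebesgue) \<le> (\<integral>\<^sup>+y\<in>U. ennreal (norm (f y)) \<partial>lebesgue)"
    proof -
      have "(\<integral>\<^sup>+y\<in>U. ennreal (norm (g y)) \<partial>lebesgue) = (\<integral>\<^sup>+q. (\<integral>\<^sup>+y\<in>qcube q. ennreal (norm (g y)) \<partial>lebesgue) \<partial>count_space S)"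
        unfolding U_def using S(1,5) by (intro nn_integral_UN_disjoint_count_space[symmetric]) auto
      also have "\<dots> \<le> (\<integral>\<^sup>+q. (\<integral>\<^sup>+y\<in>qcube q. ennreal (norm (f y)) \<partial>lebesgue) \<partial>count_space S)"
      proof (rule nn_integral_mono)
        fix q assume "q \<in> space (count_space S)"
        then have q: "q \<in> S" by simp
        have "(\<integral>\<^sup>+y\<in>qcube q. ennreal (norm (g y)) \<partial>lebesgue) = (\<integral>\<^sup>+y\<in>qcube q. ennreal (norm (m q)) \<partial>lebesgue)"
          using g_on[OF q] by (intro nn_integral_cong) (auto simp: indicator_def)
        also have "\<dots> = ennreal (norm (m q)) * emeasure lebesgue (qcube q)"
          by (rule nn_integral_cmult_indicator) auto
        also have "\<dots> = ennreal (norm (m q) * snd q ^ ?n)"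
          using S(2)[OF q] by (simp add: emeasure_lebesgue_cube ennreal_mult)
        also have "\<dots> \<le> (\<integral>\<^sup>+y\<in>qcube q. ennreal (norm (f y)) \<partial>lebesgue)"
          unfolding nnF by (intro ennreal_leI mq q)
        finally show "(\<integral>\<^sup>+y\<in>qcube q. ennreal (norm (g y)) \<partial>lebesgue) \<le> (\<integral>\<^sup>+y\<in>qcube q. ennreal (norm (f y)) \<partial>lebesgue)" .
      qed
      finally show ?thesis unfolding sumS .
    qed
    have split: "(\<integral>\<^sup>+y. ennreal (norm (u y)) \<partial>lebesgue) = (\<integral>\<^sup>+y\<in>U. ennreal (norm (u y)) \<partial>lebesgue) + (\<integral>\<^sup>+y\<in>- U. ennreal (norm (u y)) \<partial>lebesgue)"
      if [measurable]: "u \<in> borel_measurable lebesgue" for u :: "real ^ 'n \<Rightarrow> complex"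
    proof -
      have mnU[measurable]: "- U \<in> sets lebesgue" using sets.compl_sets[OF mU] by (simp add: Compl_eq_Diff_UNIV)
      have "(\<integral>\<^sup>+y. ennreal (norm (u y)) \<partial>lebesgue) = (\<integral>\<^sup>+y. ennreal (norm (u y)) * indicator U y + ennreal (norm (u y)) * indicator (- U) y \<partial>lebesgue)"
        by (intro nn_integral_cong) (auto simp: indicator_def)
      then show ?thesis by (subst (asm) nn_integral_add) auto
    qed
    have gI: "(\<integral>\<^sup>+y. ennreal (norm (g y)) \<partial>lebesgue) \<le> ennreal I"
    proof -
      have "(\<integral>\<^sup>+y\<in>- U. ennreal (norm (g y)) \<partial>lebesgue) = (\<integral>\<^sup>+y\<in>- U. ennreal (norm (f y)) \<partial>lebesgue)"
        using g_off by (intro nn_integral_cong) (auto simp: indicator_def)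
      moreover note split[of g] split[of f]
      ultimately show ?thesis using gU unfolding I[symmetric] by (simp add: add_mono)
    qed
    have g2: "(\<integral>\<^sup>+y. ennreal ((norm (g y))\<^sup>2) \<partial>lebesgue) \<le> ennreal (2 ^ ?n * t * I)"
    proof -
      have "(\<integral>\<^sup>+y. ennreal ((norm (g y))\<^sup>2) \<partial>lebesgue) \<le> (\<integral>\<^sup>+y. ennreal (2 ^ ?n * t) * ennreal (norm (g y)) \<partial>lebesgue)"
        using g_bd
      proof (intro nn_integral_mono_AE, eventually_elim)
        case (elim y)
        have "(norm (g y))\<^sup>2 \<le> (2 ^ ?n * t) * norm (g y)"
          unfolding power2_eq_square using elim by (intro mult_right_mono) auto
        then show ?case using t by (simp add: ennreal_leI flip: ennreal_mult)
      qed
      also have "\<dots> = ennreal (2 ^ ?n * t) * (\<integral>\<^sup>+y. ennreal (norm (g y)) \<partial>lebesgue)"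
        by (rule nn_integral_cmult) measurable
      also have "\<dots> \<le> ennreal (2 ^ ?n * t) * ennreal I" by (intro mult_left_mono gI) auto
      also have "\<dots> = ennreal (2 ^ ?n * t * I)" using t I0 by (simp add: ennreal_mult)
      finally show ?thesis .
    qed
    have gL2: "g \<in> L2" using g2 by (auto simp: L2_iff intro: order.strict_trans1)
    have gL12: "g \<in> L12"
      using gL2 gI by (auto simp: L12_def integrable_iff_bounded intro: order.strict_trans1)
    have bL12: "\<beta> \<in> L12" using L12_diff[OF f gL12] by (simp add: g_def)
    then have bL2: "\<beta> \<in> L2" by (simp add: L12_def)
    have bI: "(\<integral>\<^sup>+y\<in>U. ennreal (norm (\<beta> y)) \<partial>lebesgue) \<le> ennreal (2 * I)"
    proof -
      have "(\<integral>\<^sup>+y\<in>U. ennreal (norm (\<beta> y)) \<partial>lebesgue) \<le> (\<integral>\<^sup>+y. ennreal (norm (f y)) + ennreal (norm (g y)) \<partial>lebesgue)"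
      proof (intro nn_integral_mono)
        fix y
        have "norm (\<beta> y) \<le> norm (f y) + norm (g y)" using norm_triangle_ineq4[of "f y" "g y"] by (simp add: g_def)
        then show "ennreal (norm (\<beta> y)) * indicator U y \<le> ennreal (norm (f y)) + ennreal (norm (g y))"
          by (auto simp: indicator_def ennreal_leI simp flip: ennreal_plus)
      qed
      also have "\<dots> = (\<integral>\<^sup>+y. ennreal (norm (f y)) \<partial>lebesgue) + (\<integral>\<^sup>+y. ennreal (norm (g y)) \<partial>lebesgue)"
        by (rule nn_integral_add) measurable
      also have "\<dots> \<le> ennreal I + ennreal I" using gI I by (intro add_mono) auto
      also have "\<dots> = ennreal (2 * I)" using I0 by (simp flip: ennreal_plus)
      finally show ?thesis .
    qed
    have mean: "(LINT y:qcube q|lebesgue. \<beta> y) = 0" if q: "q \<in> S" for q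
    proof -
      have "(LINT y:qcube q|lebesgue. \<beta> y) = (LINT y:qcube q|lebesgue. f y - m q)"
        unfolding set_lebesgue_integral_def
        by (intro Bochner_Integration.integral_cong refl) (auto simp: indicator_def b_on[OF q])
      also have "\<dots> = (LINT y:qcube q|lebesgue. f y) - (LINT y:qcube q|lebesgue. m q)"
      proof (rule set_integral_diff)
        show "set_integrable lebesgue (qcube q) f" unfolding set_integrable_def
          by (intro integrable_mult_indicator fint) auto
        show "set_integrable lebesgue (qcube q) (\<lambda>y. m q)"
          unfolding set_integrable_def using S(2)[OF q]
          by (intro integrable_scaleR_left integrable_real_indicator) (auto simp: emeasure_lebesgue_cube)
      qed
      also have "(LINT y:qcube q|lebesgue. m q) = of_real (snd q ^ ?n) * m q"
        unfolding set_lebesgue_integral_def using S(2)[OF q]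
        by (simp add: measure_lebesgue_cube emeasure_lebesgue_cube scaleR_conv_of_real)
      also have "\<dots> = (LINT y:qcube q|lebesgue. f y)" using S(2)[OF q] by (simp add: m_def)
      finally show ?thesis by simp
    qed
    have [measurable]: "T f \<in> borel_measurable lebesgue" "T g \<in> borel_measurable lebesgue" "T \<beta> \<in> borel_measurable lebesgue"
      using fL2 gL2 bL2 by (auto intro: T_measurable)
    have "{x\<in>space lebesgue. t/2 < norm (T g x)} \<in> sets lebesgue" by measurable
    then have m1: "{x. t/2 < norm (T g x)} \<in> sets lebesgue"
      by (simp only: space_lebesgue_on space_completion space_lborel space_borel UNIV_I simp_thms)
    have e1: "emeasure lebesgue {x. t/2 < norm (T g x)} \<le> ennreal (4 * C2 * 2 ^ ?n / t * I)"
    proof -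
      have "emeasure lebesgue {x. t/2 < norm (T g x)} \<le> ennreal (1 / (t/2)\<^sup>2) * (\<integral>\<^sup>+x. ennreal ((norm (T g x))\<^sup>2) \<partial>lebesgue)"
        using chebyshev_L2[of "T g" lebesgue "t/2"] t by simp
      also have "\<dots> \<le> ennreal (1 / (t/2)\<^sup>2) * (ennreal C2 * ennreal (2 ^ ?n * t * I))"
        by (intro mult_left_mono order.trans[OF C2(2)[OF gL2]] g2) auto
      also have "\<dots> = ennreal (1 / (t/2)\<^sup>2 * (C2 * (2 ^ ?n * t * I)))"
        using C2(1) t I0 by (simp add: ennreal_mult[symmetric])
      also have "1 / (t/2)\<^sup>2 * (C2 * (2 ^ ?n * t * I)) = 4 * C2 * 2 ^ ?n / t * I"
        using t by (simp add: field_simps power2_eq_square)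
      finally show ?thesis .
    qed
    define B where "B = (\<Union>q\<in>S. qball q)"
    have oB: "open B" unfolding B_def by auto
    have mB[measurable]: "B \<in> sets lebesgue" "- B \<in> sets lebesgue"
      using oB by (auto intro: open_in_sets_lebesgue lborelD borel_closed closed_Compl)
    have e2: "emeasure lebesgue B \<le> ennreal (?V * (4 * real ?n) ^ ?n / t * I)"
    proof -
      have "emeasure lebesgue B \<le> (\<integral>\<^sup>+q. emeasure lebesgue (qball q) \<partial>count_space S)"
        unfolding B_def using S(1) by (intro emeasure_UN_le_nn_integral) auto
      also have "\<dots> \<le> (\<integral>\<^sup>+q. ennreal (?V * (4 * real ?n) ^ ?n / t) * (\<integral>\<^sup>+y\<in>qcube q. ennreal (norm (f y)) \<partial>lebesgue) \<partial>count_space S)"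
      proof (intro nn_integral_mono)
        fix q assume "q \<in> space (count_space S)"
        then have q: "q \<in> S" by simp
        have "emeasure lebesgue (qball q) = ennreal ((4 * real ?n * snd q) ^ ?n * ?V)"
          using S(2)[OF q] by (intro emeasure_lebesgue_ball) auto
        also have "\<dots> = ennreal (?V * (4 * real ?n) ^ ?n) * ennreal (snd q ^ ?n)"
          using S(2)[OF q] by (simp add: power_mult_distrib mult_ac flip: ennreal_mult)
        also have "\<dots> \<le> ennreal (?V * (4 * real ?n) ^ ?n) * (ennreal (1 / t) * (\<integral>\<^sup>+y\<in>qcube q. ennreal (norm (f y)) \<partial>lebesgue))"
          by (intro mult_left_mono vol q) auto
        also have "\<dots> = ennreal (?V * (4 * real ?n) ^ ?n / t) * (\<integral>\<^sup>+y\<in>qcube q. ennreal (norm (f y)) \<partial>lebesgue)"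
          using t by (simp add: mult.assoc[symmetric] ennreal_mult[symmetric])
        finally show "emeasure lebesgue (qball q) \<le> ennreal (?V * (4 * real ?n) ^ ?n / t) * (\<integral>\<^sup>+y\<in>qcube q. ennreal (norm (f y)) \<partial>lebesgue)" .
      qed
      also have "\<dots> \<le> ennreal (?V * (4 * real ?n) ^ ?n / t) * ennreal I"
        by (subst nn_integral_cmult) (auto intro!: mult_left_mono sumI)
      also have "\<dots> = ennreal (?V * (4 * real ?n) ^ ?n / t * I)" using t I0 by (simp add: ennreal_mult[symmetric])
      finally show ?thesis .
    qed
    \<comment> \<open>Chebyshev's inequality in L2 makes \<open>A\<close> of finite measure,
      although not yet with the right bound; this lets a remainder that is small in L2 be small in
      L1 on \<open>A\<close>.\<close>
    define A where "A = {x\<in>space lebesgue. t/2 < norm (T \<beta> x)} - B"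
    have ms: "{x\<in>space lebesgue. t/2 < norm (T \<beta> x)} \<in> sets lebesgue" by measurable
    have mA[measurable]: "A \<in> sets lebesgue" unfolding A_def by (rule sets.Diff[OF ms mB(1)])
    have Afin: "emeasure lebesgue A < \<infinity>"
    proof -
      have "emeasure lebesgue A \<le> emeasure lebesgue {x\<in>space lebesgue. t/2 < norm (T \<beta> x)}"
        by (rule emeasure_mono[OF _ ms]) (auto simp: A_def)
      also have "\<dots> \<le> ennreal (1 / (t/2)\<^sup>2) * (\<integral>\<^sup>+x. ennreal ((norm (T \<beta> x))\<^sup>2) \<partial>lebesgue)"
        using t by (intro chebyshev_L2) auto
      also have "\<dots> < \<infinity>" using T_L2[OF bL2] by (auto simp: L2_iff ennreal_mult_less_top)
      finally show ?thesis .
    qed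
    define a where "a = measure lebesgue A"
    have a: "emeasure lebesgue A = ennreal a" unfolding a_def using Afin by (intro emeasure_eq_ennreal_measure) auto
    have a0: "0 \<le> a" by (simp add: a_def)
    \<comment> \<open>Finite subfamilies exhausting \<open>S\<close>. The part of \<beta> on
      \<open>W N\<close> falls under \<open>T_finite_bad_part\<close>; the part on the complement
      tends to 0 in L2 by dominated convergence.\<close>
    define SN where "SN N = {q\<in>S. to_nat_on S q < N}" for N
    have finSN: "finite (SN N)" for N
    proof (rule inj_on_finite)
      show "inj_on (to_nat_on S) (SN N)" using inj_on_to_nat_on[OF S(1)] by (rule inj_on_subset) (auto simp: SN_def)
      show "to_nat_on S ` SN N \<subseteq> {..<N}" by (auto simp: SN_def)
    qed auto
    define W where "W N = (\<Union>q\<in>SN N. qcube q)" for N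
    have mUN[measurable]: "W N \<in> sets lebesgue" for N unfolding W_def using finSN by (intro sets.finite_UN) auto
    have UNU: "W N \<subseteq> U" for N by (auto simp: W_def U_def SN_def)
    have rbL12: "rst (W N) \<beta> \<in> L12" "rst (- W N) \<beta> \<in> L12" for N
      using bL12 mUN[of N] sets.compl_sets[OF mUN[of N]] by (auto intro!: L12_rst simp: Compl_eq_Diff_UNIV)
    then have rbL2: "rst (W N) \<beta> \<in> L2" "rst (- W N) \<beta> \<in> L2" for N by (auto simp: L12_def)
    have [measurable]: "T (rst (W N) \<beta>) \<in> borel_measurable lebesgue" "T (rst (- W N) \<beta>) \<in> borel_measurable lebesgue" for N
      using rbL2 by (auto intro: T_measurable)
    have lim: "(\<lambda>N. \<integral>\<^sup>+x. ennreal ((norm (rst (- W N) \<beta> x))\<^sup>2) \<partial>lebesgue) \<longlonglongrightarrow> 0"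
    proof -
      have [measurable]: "rst (- W N) \<beta> \<in> borel_measurable lebesgue" for N using rbL2(2) by (rule L2_measurable)
      have "(\<lambda>N. \<integral>\<^sup>+x. ennreal ((norm (rst (- W N) \<beta> x))\<^sup>2) \<partial>lebesgue) \<longlonglongrightarrow> (\<integral>\<^sup>+x. 0 \<partial>(lebesgue :: (real ^ 'n) measure))"
      proof (rule nn_integral_dominated_convergence[where w="\<lambda>x. ennreal ((norm (\<beta> x))\<^sup>2)"])
        show "(\<integral>\<^sup>+x. ennreal ((norm (\<beta> x))\<^sup>2) \<partial>lebesgue) < \<infinity>" using bL2 by (simp add: L2_iff)
        show "AE x in lebesgue. (\<lambda>N. ennreal ((norm (rst (- W N) \<beta> x))\<^sup>2)) \<longlonglongrightarrow> 0"
        proof (rule AE_I2)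
          fix x
          have "\<forall>\<^sub>F N in sequentially. rst (- W N) \<beta> x = 0"
          proof (cases "x \<in> U")
            case True
            then obtain q where q: "q \<in> S" "x \<in> qcube q" by (auto simp: U_def)
            show ?thesis using eventually_gt_at_top[of "to_nat_on S q"]
            proof eventually_elim
              case (elim N)
              then have "x \<in> W N" unfolding W_def using q by (intro UN_I[of q]) (auto simp: SN_def)
              then show ?case by (simp add: rst_def)
            qed
          qed (simp add: rst_def b_off)
          then have "\<forall>\<^sub>F N in sequentially. ennreal ((norm (rst (- W N) \<beta> x))\<^sup>2) = 0"
            by eventually_elim simp
          then show "(\<lambda>N. ennreal ((norm (rst (- W N) \<beta> x))\<^sup>2)) \<longlonglongrightarrow> 0" by (rule tendsto_eventually)
        qed
      qed (auto simp: rst_def indicator_def)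
      then show ?thesis by simp
    qed
    have int_A: "(\<integral>\<^sup>+x\<in>A. ennreal (norm (T \<beta> x)) \<partial>lebesgue) \<le> ennreal (2 * off_const * I)"
    proof (rule ennreal_le_epsilon)
      fix e :: real assume e: "0 < e"
      \<comment> \<open>With this \<theta> the term with the measure of \<open>A\<close> is at most
        e/2; \<epsilon> is then chosen to make the L2 term equal to e/2.\<close>
      define \<theta> where "\<theta> = e / (2 * (a + 1))"
      have \<theta>: "0 < \<theta>" using e a0 by (simp add: \<theta>_def)
      define \<epsilon> where "\<epsilon> = \<theta> * e / (2 * C2)"
      have \<epsilon>: "0 < \<epsilon>" using e \<theta> C2 by (simp add: \<epsilon>_def)
      have "\<forall>\<^sub>F N in sequentially. (\<integral>\<^sup>+x. ennreal ((norm (rst (- W N) \<beta> x))\<^sup>2) \<partial>lebesgue) < ennreal \<epsilon>"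
        using lim \<epsilon> by (intro order_tendstoD) auto
      then obtain N where N: "(\<integral>\<^sup>+x. ennreal ((norm (rst (- W N) \<beta> x))\<^sup>2) \<partial>lebesgue) < ennreal \<epsilon>"
        by (auto simp: eventually_sequentially)
      have eq: "\<beta> = (\<lambda>y. rst (W N) \<beta> y + rst (- W N) \<beta> y)" by (auto simp: rst_def indicator_def fun_eq_iff)
      have "(\<integral>\<^sup>+x\<in>A. ennreal (norm (T \<beta> x)) \<partial>lebesgue) \<le>
        (\<integral>\<^sup>+x. ennreal (norm (T (rst (W N) \<beta>) x)) * indicator A x + ennreal (norm (T (rst (- W N) \<beta>) x)) * indicator A x \<partial>lebesgue)"
      proof (intro nn_integral_mono_AE)
        show "AE x in lebesgue. ennreal (norm (T \<beta> x)) * indicator A x \<le>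
          ennreal (norm (T (rst (W N) \<beta>) x)) * indicator A x + ennreal (norm (T (rst (- W N) \<beta>) x)) * indicator A x"
          using T_add[OF rbL2(1)[of N] rbL2(2)[of N]] unfolding eq[symmetric]
        proof eventually_elim
          case (elim x)
          show ?case
            using norm_triangle_ineq[of "T (rst (W N) \<beta>) x" "T (rst (- W N) \<beta>) x"]
            by (auto simp: indicator_def elim ennreal_leI simp flip: ennreal_plus)
        qed
      qed
      also have "\<dots> = (\<integral>\<^sup>+x\<in>A. ennreal (norm (T (rst (W N) \<beta>) x)) \<partial>lebesgue) + (\<integral>\<^sup>+x\<in>A. ennreal (norm (T (rst (- W N) \<beta>) x)) \<partial>lebesgue)"
        by (rule nn_integral_add) auto
      also have "\<dots> \<le> ennreal (2 * off_const * I) + ennreal e"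
      proof (rule add_mono)
        have "(\<integral>\<^sup>+x\<in>A. ennreal (norm (T (rst (W N) \<beta>) x)) \<partial>lebesgue) \<le>
          (\<integral>\<^sup>+x\<in>- (\<Union>q\<in>SN N. qball q). ennreal (norm (T (rst (W N) \<beta>) x)) \<partial>lebesgue)"
          by (intro nn_integral_mono) (auto simp: indicator_def A_def B_def SN_def)
        also have "\<dots> \<le> ennreal off_const * (\<integral>\<^sup>+x\<in>W N. ennreal (norm (\<beta> x)) \<partial>lebesgue)"
          unfolding W_def
        proof (rule T_finite_bad_part[OF finSN bL12])
          show "disjoint_family_on qcube (SN N)" using S(5) by (auto simp: disjoint_family_on_def SN_def)
        qed (use S(2) mean in \<open>auto simp: SN_def\<close>)
        also have "\<dots> \<le> ennreal off_const * (\<integral>\<^sup>+x\<in>U. ennreal (norm (\<beta> x)) \<partial>lebesgue)"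
          using UNU[of N] by (intro mult_left_mono nn_integral_mono) (auto simp: indicator_def)
        also have "\<dots> \<le> ennreal off_const * ennreal (2 * I)" by (intro mult_left_mono bI) auto
        also have "\<dots> = ennreal (2 * off_const * I)"
          using off_const_nonneg I0 by (simp add: mult_ac flip: ennreal_mult)
        finally show "(\<integral>\<^sup>+x\<in>A. ennreal (norm (T (rst (W N) \<beta>) x)) \<partial>lebesgue) \<le> ennreal (2 * off_const * I)" .
        have "(\<integral>\<^sup>+x\<in>A. ennreal (norm (T (rst (- W N) \<beta>) x)) \<partial>lebesgue) \<le>
          ennreal \<theta> * emeasure lebesgue A + ennreal (1 / \<theta>) * (\<integral>\<^sup>+x. ennreal ((norm (T (rst (- W N) \<beta>) x))\<^sup>2) \<partial>lebesgue)"
          using \<theta> by (intro nn_integral_power2_le) auto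
        also have "\<dots> \<le> ennreal \<theta> * ennreal a + ennreal (1 / \<theta>) * (ennreal C2 * ennreal \<epsilon>)"
          unfolding a using N
          by (intro add_mono order_refl mult_left_mono order.trans[OF C2(2)[OF rbL2(2)]]) (auto intro: less_imp_le)
        also have "\<dots> = ennreal (\<theta> * a + 1 / \<theta> * (C2 * \<epsilon>))"
          using \<theta> a0 C2(1) \<epsilon> by (simp add: ennreal_mult[symmetric] ennreal_plus[symmetric] del: ennreal_plus)
        also have "\<dots> \<le> ennreal e"
        proof (rule ennreal_leI)
          have "1 / \<theta> * (C2 * \<epsilon>) = e / 2" using \<theta> C2 by (simp add: \<epsilon>_def)
          moreover have "\<theta> * a \<le> e / 2"
          proof -
            have "e * a \<le> e * (a + 1)" using e by simp
            then show ?thesis using a0 by (simp add: \<theta>_def field_simps)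
          qed
          ultimately show "\<theta> * a + 1 / \<theta> * (C2 * \<epsilon>) \<le> e" by linarith
        qed
        finally show "(\<integral>\<^sup>+x\<in>A. ennreal (norm (T (rst (- W N) \<beta>) x)) \<partial>lebesgue) \<le> ennreal e" .
      qed
      finally show "(\<integral>\<^sup>+x\<in>A. ennreal (norm (T \<beta> x)) \<partial>lebesgue) \<le> ennreal (2 * off_const * I) + ennreal e" .
    qed
    have e3: "emeasure lebesgue A \<le> ennreal (4 * off_const / t * I)"
    proof -
      have "ennreal (t/2) * emeasure lebesgue A = (\<integral>\<^sup>+x\<in>A. ennreal (t/2) \<partial>lebesgue)"
        by (rule nn_integral_cmult_indicator[symmetric]) auto
      also have "\<dots> \<le> (\<integral>\<^sup>+x\<in>A. ennreal (norm (T \<beta> x)) \<partial>lebesgue)"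
        by (intro nn_integral_mono) (auto simp: A_def indicator_def intro!: ennreal_leI)
      also note int_A
      finally have "ennreal (2/t) * (ennreal (t/2) * emeasure lebesgue A) \<le> ennreal (2/t) * ennreal (2 * off_const * I)"
        by (intro mult_left_mono) auto
      also have "\<dots> = ennreal (4 * off_const / t * I)"
        using t off_const_nonneg I0 by (simp flip: ennreal_mult)
      finally show ?thesis using t by (simp add: mult.assoc[symmetric] ennreal_mult[symmetric])
    qed
    have "AE x in lebesgue. x \<in> {x. t < norm (T f x)} \<longrightarrow> x \<in> {x. t/2 < norm (T g x)} \<union> (B \<union> A)"
    proof -
      have "f = (\<lambda>y. g y + \<beta> y)" by (simp add: g_def)
      then have "AE x in lebesgue. T f x = T g x + T \<beta> x" using T_add[OF gL2 bL2] by simp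
      then show ?thesis
      proof eventually_elim
        case (elim x)
        show ?case using norm_triangle_ineq[of "T g x" "T \<beta> x"] elim by (auto simp: A_def)
      qed
    qed
    then have "emeasure lebesgue {x. t < norm (T f x)} \<le> emeasure lebesgue ({x. t/2 < norm (T g x)} \<union> (B \<union> A))"
      using m1 by (intro emeasure_mono_AE) auto
    also have "\<dots> \<le> emeasure lebesgue {x. t/2 < norm (T g x)} + (emeasure lebesgue B + emeasure lebesgue A)"
      using m1 by (intro order.trans[OF emeasure_subadditive] add_mono emeasure_subadditive order_refl) auto
    also have "\<dots> \<le> ennreal (4 * C2 * 2 ^ ?n / t * I) + (ennreal (?V * (4 * real ?n) ^ ?n / t * I) + ennreal (4 * off_const / t * I))"
      by (intro add_mono e1 e2 e3)
    also have "\<dots> = ennreal (C / t * I)"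
    proof -
      have "C / t * I = 4 * C2 * 2 ^ ?n / t * I + (?V * (4 * real ?n) ^ ?n / t * I + 4 * off_const / t * I)"
        unfolding C_def by (simp add: add_divide_distrib distrib_right)
      then show ?thesis using C2(1) t I0 off_const_nonneg by (simp add: ennreal_plus[symmetric] del: ennreal_plus)
    qed
    also have "\<dots> = ennreal (C / t) * (\<integral>\<^sup>+x. ennreal (norm (f x)) \<partial>lebesgue)"
      unfolding I using Cpos t I0 by (simp add: ennreal_mult[symmetric])
    finally show ?thesis .
  qed
  show ?thesis by (rule that[OF Cpos main])
qed

end

subsection \<open>Sparse domination\<close>

lemma ennreal_le_divideI:
  assumes t: "0 < t" and "ennreal t * X \<le> ennreal B"
  shows "X \<le> ennreal (B / t)"
proof -
  have "X = ennreal (1 / t) * (ennreal t * X)"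
    using t by (simp add: mult.assoc[symmetric] ennreal_mult[symmetric])
  also have "\<dots> \<le> ennreal (1 / t) * ennreal B" using assms(2) by (intro mult_left_mono) auto
  also have "\<dots> = ennreal (1 / t * B)" using t by (intro ennreal_mult'[symmetric]) auto
  finally show ?thesis by simp
qed

text \<open>An average only up to a dimensional factor: the integral is over the enlarged ball, the
  divisor is the volume of the cube.\<close>

definition qavg :: "(real ^ 'n \<Rightarrow> complex) \<Rightarrow> (real ^ 'n) \<times> real \<Rightarrow> real" where
  "qavg f q = (LINT y:qball q|lebesgue. norm (f y)) / snd q ^ CARD('n)"

lemma nn_integral_qball:
  assumes "f \<in> L12"
  shows "(\<integral>\<^sup>+y\<in>qball q. ennreal (norm (f y)) \<partial>lebesgue) = ennreal (LINT y:qball q|lebesgue. norm (f y))"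
proof -
  have "integrable lebesgue (\<lambda>y. indicator (qball q) y *\<^sub>R norm (f y))"
    using assms by (intro integrable_mult_indicator) (auto simp: L12_def)
  then have "(\<integral>\<^sup>+y. ennreal (indicator (qball q) y *\<^sub>R norm (f y)) \<partial>lebesgue) = ennreal (LINT y:qball q|lebesgue. norm (f y))"
    unfolding set_lebesgue_integral_def by (intro nn_integral_eq_integral) auto
  moreover have "ennreal (indicator (qball q) y *\<^sub>R norm (f y)) = ennreal (norm (f y)) * indicator (qball q) y" for y
    by (auto simp: indicator_def)
  ultimately show ?thesis by simp
qed

lemma set_lint_norm_nonneg: "0 \<le> (LINT y:S|M. norm (f y))"
  unfolding set_lebesgue_integral_def by (intro integral_nonneg_AE) (auto simp: indicator_def)

text \<open>In units of n times the side of \<open>q\<close>, the corner of \<open>p\<close> is at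
  distance at most 1 from that of \<open>q\<close>, the smaller radius is at most 2 and the larger
  radius is 4.\<close>

lemma qball_mono:
  fixes p q :: "(real ^ 'n) \<times> real"
  assumes "qcube p \<subseteq> qcube q" "0 < snd p" "snd p \<le> snd q / 2"
  shows "qball p \<subseteq> qball q"
proof -
  let ?n = "real CARD('n)"
  have "fst p \<in> qcube q" using corner_in_cube[OF assms(2)] assms(1) by blast
  then have d: "norm (fst p - fst q) \<le> ?n * snd q" by (rule cube_dist_corner)
  show ?thesis
  proof
    fix x assume "x \<in> qball p"
    then have "norm (x - fst p) < 4 * ?n * snd p" by (simp add: dist_norm norm_minus_commute)
    moreover have "4 * ?n * snd p \<le> 2 * (?n * snd q)"
      using mult_left_mono[OF assms(3), of "4 * ?n"] by simp
    moreover have "0 \<le> ?n * snd q" using assms(2,3) by simp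
    moreover have "norm (x - fst q) \<le> norm (x - fst p) + norm (fst p - fst q)"
      using norm_triangle_ineq[of "x - fst p" "fst p - fst q"] by simp
    ultimately have "norm (x - fst q) < 4 * ?n * snd q" using d by linarith
    then show "x \<in> qball q" by (simp add: dist_norm norm_minus_commute)
  qed
qed

context dini_cz_operator
begin

text \<open>As \<zeta> vanishes near the cube, \<open>T \<zeta>\<close> is given on it by the
  kernel, and smoothness in the first variable keeps it nearly constant. The witness
  \<open>c\<close> is the kernel integral at the corner and not \<open>T \<zeta>\<close> at the
  corner, since the latter is determined only almost everywhere.\<close>

lemma T_oscillation:
  fixes \<zeta> :: "real ^ 'n \<Rightarrow> complex"
  assumes \<zeta>: "\<zeta> \<in> L12" and p: "0 < snd p" and off: "\<And>y. y \<in> qball p \<Longrightarrow> \<zeta> y = 0"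
    and A: "\<And>r. 4 * real CARD('n) * snd p \<le> r \<Longrightarrow>
      (\<integral>\<^sup>+y\<in>ball (fst p) r. ennreal (norm (\<zeta> y)) \<partial>lebesgue) \<le> ennreal A * ennreal (r ^ CARD('n))"
    and A0: "0 \<le> A"
  shows "\<exists>c. AE x in lebesgue. x \<in> qcube p \<longrightarrow> norm (T \<zeta> x - c) \<le> dini_const * A"
proof -
  let ?n = "CARD('n)"
  define s where "s = real ?n * snd p"
  have s: "0 < s" using p by (simp add: s_def)
  define a where "a = fst p"
  have qb: "qball p = ball a (4 * s)" by (simp add: s_def a_def mult.assoc)
  have cL2: "\<zeta> \<in> L2" and int: "integrable lebesgue \<zeta>" using \<zeta> by (auto simp: L12_def)
  have [measurable]: "\<zeta> \<in> borel_measurable lebesgue" using cL2 by (rule L2_measurable)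
  have "{y. \<zeta> y \<noteq> 0} \<subseteq> - ball a (4 * s)" using off by (auto simp: qb)
  then have cl: "closure {y. \<zeta> y \<noteq> 0} \<subseteq> - ball a (4 * s)" by (intro closure_minimal) auto
  have far: "4 * s \<le> norm (a - y)" if "\<zeta> y \<noteq> 0" for y
    using off[of y] that by (auto simp: qb dist_norm intro: leI)
  have i2: "integrable lebesgue (\<lambda>y. K a y * \<zeta> y)"
    using s far by (intro kernel_integrable[OF int, of "4 * s"]) auto
  define c where "c = (LINT y|lebesgue. K a y * \<zeta> y)"
  have "AE x in lebesgue. x \<in> qcube p \<longrightarrow> norm (T \<zeta> x - c) \<le> dini_const * A"
    using T_kernel[OF cL2]
  proof eventually_elim
    case (elim x)
    show ?case
    proof
      assume x: "x \<in> qcube p"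
      have xa: "norm (a - x) \<le> s" using cube_dist_corner[OF x] by (simp add: s_def a_def norm_minus_commute)
      have "x \<in> ball a (4 * s)" using xa s by (simp add: dist_norm)
      then have Tx: "T \<zeta> x = (LINT y|lebesgue. K x y * \<zeta> y)" using elim cl by blast
      have far3: "3 * s \<le> norm (x - y)" if "\<zeta> y \<noteq> 0" for y
        using far[OF that] xa norm_triangle_ineq[of "a - x" "x - y"] by simp
      have i1: "integrable lebesgue (\<lambda>y. K x y * \<zeta> y)"
        using s far3 by (intro kernel_integrable[OF int, of "3 * s"]) auto
      have "T \<zeta> x - c = (LINT y|lebesgue. K x y * \<zeta> y - K a y * \<zeta> y)"
        unfolding Tx c_def using i1 i2 by simp
      then have "ennreal (norm (T \<zeta> x - c)) \<le> (\<integral>\<^sup>+y. ennreal (norm (K x y * \<zeta> y - K a y * \<zeta> y)) \<partial>lebesgue)"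
        using integral_norm_bound_ennreal[OF Bochner_Integration.integrable_diff[OF i1 i2]] by simp
      also have "\<dots> \<le> (\<integral>\<^sup>+y\<in>- ball a (4 * s). ennreal (norm (\<zeta> y)) * ennreal (\<omega> (s / norm (y - a)) / norm (y - a) ^ ?n) \<partial>lebesgue)"
      proof (intro nn_integral_mono)
        fix y
        show "ennreal (norm (K x y * \<zeta> y - K a y * \<zeta> y)) \<le>
          ennreal (norm (\<zeta> y)) * ennreal (\<omega> (s / norm (y - a)) / norm (y - a) ^ ?n) * indicator (- ball a (4 * s)) y"
        proof (cases "\<zeta> y = 0")
          case False
          have ay: "norm (a - y) = norm (y - a)" by (rule norm_minus_commute)
          have yf: "4 * s \<le> norm (y - a)" using far[OF False] ay by simp
          then have pos: "norm (y - a) > 0" using s by linarith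
          have "norm (K a y - K x y) \<le> \<omega> (norm (a - x) / norm (a - y)) / norm (a - y) ^ ?n"
            using xa yf s by (intro kernel_smooth(1)) (auto simp: ay)
          also have "\<dots> \<le> \<omega> (s / norm (y - a)) / norm (y - a) ^ ?n"
            unfolding ay using xa yf s pos
            by (intro divide_right_mono \<omega>_mono) (auto simp: field_simps)
          finally have b: "norm (K x y - K a y) \<le> \<omega> (s / norm (y - a)) / norm (y - a) ^ ?n"
            by (simp add: norm_minus_commute)
          have "norm (K x y * \<zeta> y - K a y * \<zeta> y) = norm (\<zeta> y) * norm (K x y - K a y)"
            by (simp add: left_diff_distrib[symmetric] norm_mult)
          also have "\<dots> \<le> norm (\<zeta> y) * (\<omega> (s / norm (y - a)) / norm (y - a) ^ ?n)"
            using b by (intro mult_left_mono) auto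
          finally have le: "norm (K x y * \<zeta> y - K a y * \<zeta> y) \<le> norm (\<zeta> y) * (\<omega> (s / norm (y - a)) / norm (y - a) ^ ?n)" .
          have "y \<notin> ball a (4 * s)" using yf ay by (simp add: dist_norm)
          then show ?thesis using le order.trans[OF norm_ge_zero b]
            by (simp add: ennreal_leI flip: ennreal_mult)
        qed simp
      qed
      also have "\<dots> \<le> ennreal dini_const * ennreal A"
        using A by (intro annuli_sum s) (auto simp: s_def a_def mult.assoc)
      also have "\<dots> = ennreal (dini_const * A)" using dini_const_nonneg A0 by (simp add: ennreal_mult)
      finally show "norm (T \<zeta> x - c) \<le> dini_const * A"
        using dini_const_nonneg A0 by (subst (asm) ennreal_le_iff) auto
    qed
  qed
  then show ?thesis by blast
qed

text \<open>Let \<open>E\<close> be the part of the cube where \<open>T \<phi>\<close> or the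
  maximal function of \<phi> exceeds \<open>t\<close>. The children come from decomposing its
  indicator; \<open>E\<close> fills at most half of each child. One good point of a child bounds the
  growth of \<phi> around it, hence the oscillation of \<open>T \<zeta>\<close>; another bounds
  \<open>T \<zeta>\<close> itself as the difference of \<open>T \<phi>\<close> and
  \<open>T \<psi>\<close>. This takes the place of a weak type bound for a maximal truncated
  operator.\<close>

lemma sparse_step:
  obtains C where "0 < C" "\<And>f q. f \<in> L12 \<Longrightarrow> 0 < snd q \<Longrightarrow> \<exists>S. countable S \<and>
     (\<forall>p\<in>S. 0 < snd p \<and> qcube p \<subseteq> qcube q) \<and> disjoint_family_on qcube S \<and>
     emeasure lebesgue (\<Union>p\<in>S. qcube p) \<le> ennreal (snd q ^ CARD('n) / 2) \<and>
     (AE x in lebesgue. x \<in> qcube q - (\<Union>p\<in>S. qcube p) \<longrightarrow> norm (T (rst (qball q) f) x) \<le> C * qavg f q) \<and>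
     (\<forall>p\<in>S. AE x in lebesgue. x \<in> qcube p \<longrightarrow> norm (T (rst (qball q) f) x - T (rst (qball p) f) x) \<le> C * qavg f q)"
proof -
  let ?n = "CARD('n)"
  define V where "V = measure lborel (ball (0 :: real ^ 'n) 1)"
  have V: "V > 0" unfolding V_def by (simp add: content_ball_pos)
  obtain C1 where C1: "0 < C1" "\<And>f t. f \<in> L12 \<Longrightarrow> 0 < t \<Longrightarrow>
    emeasure lebesgue {x. t < norm (T f x)} \<le> ennreal (C1 / t) * (\<integral>\<^sup>+x. ennreal (norm (f x)) \<partial>lebesgue)"
    by (rule T_weak_type) blast
  \<comment> \<open>At height \<kappa> times \<open>qavg f q\<close> the two weak type bounds, with
    constants \<open>C1\<close> and 5^n, leave \<open>E\<close> at most the share 2^(-n-2) of the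
    cube.\<close>
  define \<kappa> where "\<kappa> = 2 ^ (?n + 2) * (C1 + 5 ^ ?n)"
  have p5: "(0::real) < C1 + 5 ^ ?n" using C1(1) by (intro add_pos_pos) auto
  have \<kappa>: "0 < \<kappa>" unfolding \<kappa>_def using p5 by simp
  \<comment> \<open>Chosen so that \<open>T \<psi>\<close> exceeds \<kappa>2 t on at most a quarter
    of a child.\<close>
  define \<kappa>2 where "\<kappa>2 = 4 * C1 * V * (4 * real ?n) ^ ?n"
  have \<kappa>2: "0 < \<kappa>2" unfolding \<kappa>2_def using C1(1) V by simp
  \<comment> \<open>In units of \<open>t\<close>: 1 for \<open>T \<phi>\<close> and \<kappa>2 for
    \<open>T \<psi>\<close> at the comparison point, and twice the oscillation bound for
    \<open>T \<zeta>\<close>.\<close>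
  define C where "C = \<kappa> * (1 + \<kappa>2 + 2 * (dini_const * V))"
  have "1 \<le> 1 + \<kappa>2 + 2 * (dini_const * V)" using \<kappa>2 V dini_const_nonneg by simp
  then have C\<kappa>: "\<kappa> \<le> C" unfolding C_def using mult_left_mono[of 1 "1 + \<kappa>2 + 2 * (dini_const * V)" \<kappa>] \<kappa> by simp
  have main: "\<exists>S. countable S \<and>
     (\<forall>p\<in>S. 0 < snd p \<and> qcube p \<subseteq> qcube q) \<and> disjoint_family_on qcube S \<and>
     emeasure lebesgue (\<Union>p\<in>S. qcube p) \<le> ennreal (snd q ^ CARD('n) / 2) \<and>
     (AE x in lebesgue. x \<in> qcube q - (\<Union>p\<in>S. qcube p) \<longrightarrow> norm (T (rst (qball q) f) x) \<le> C * qavg f q) \<and>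
     (\<forall>p\<in>S. AE x in lebesgue. x \<in> qcube p \<longrightarrow> norm (T (rst (qball q) f) x - T (rst (qball p) f) x) \<le> C * qavg f q)"
    if f: "f \<in> L12" and q: "0 < snd q" for f :: "real ^ 'n \<Rightarrow> complex" and q :: "(real ^ 'n) \<times> real"
  proof -
    define h where "h = snd q"
    have h: "0 < h" using q by (simp add: h_def)
    define M where "M = (LINT y:qball q|lebesgue. norm (f y))"
    have M0: "0 \<le> M" unfolding M_def by (rule set_lint_norm_nonneg)
    define \<phi> where "\<phi> = rst (qball q) f"
    have \<phi>: "\<phi> \<in> L12" unfolding \<phi>_def using f by (intro L12_rst) auto
    then have \<phi>2: "\<phi> \<in> L2" by (simp add: L12_def)
    have [measurable]: "f \<in> borel_measurable lebesgue" "\<phi> \<in> borel_measurable lebesgue"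
      using f \<phi> by (auto intro: L12_measurable)
    have \<phi>M: "(\<integral>\<^sup>+y. ennreal (norm (\<phi> y)) \<partial>lebesgue) = ennreal M"
      unfolding \<phi>_def M_def nn_integral_rst by (rule nn_integral_qball[OF f])
    have [measurable]: "T \<phi> \<in> borel_measurable lebesgue" by (rule T_measurable[OF \<phi>2])
    have av: "qavg f q = M / h ^ ?n" by (simp add: qavg_def M_def h_def)
    show ?thesis
    proof (cases "M = 0")
      \<comment> \<open>Without mass there is no positive height to stop at. Then \<phi> and
        \<open>T \<phi>\<close> vanish almost everywhere, and the empty family of children
        serves.\<close>
      case True
      have "(\<integral>\<^sup>+y. ennreal (norm (\<phi> y)) \<partial>lebesgue) = 0" using \<phi>M True by simp
      then have "AE x in lebesgue. ennreal (norm (\<phi> x)) = 0"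
        by (subst (asm) nn_integral_0_iff_AE) auto
      then have "AE x in lebesgue. \<phi> x = 0" by eventually_elim simp
      then have "AE x in lebesgue. T \<phi> x = 0" by (rule T_zero_AE[OF \<phi>2])
      then have "AE x in lebesgue. norm (T (rst (qball q) f) x) \<le> C * qavg f q"
        unfolding \<phi>_def[symmetric] av True by eventually_elim simp
      then show ?thesis by (intro exI[of _ "{}"]) (auto simp: disjoint_family_on_def elim!: eventually_mono)
    next
      case False
      then have M: "0 < M" using M0 by simp
      define t where "t = \<kappa> * M / h ^ ?n"
      have t: "0 < t" using \<kappa> M h by (simp add: t_def)
      define \<rho> where "\<rho> = 4 * real ?n * h"
      define E1 where "E1 = {x\<in>space lebesgue. t < norm (T \<phi> x)}"
      define E2 where "E2 = maximal_set lebesgue (\<lambda>y. ennreal (norm (\<phi> y))) \<rho> (ennreal t)"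
      define E where "E = (E1 \<union> E2) \<inter> qcube q"
      have mE1: "E1 \<in> sets lebesgue" unfolding E1_def by measurable
      have mE2: "E2 \<in> sets lebesgue" unfolding E2_def by (rule open_in_sets_lebesgue[OF open_maximal_set])
      have mE[measurable]: "E \<in> sets lebesgue" unfolding E_def using mE1 mE2 by auto
      have E1: "emeasure lebesgue E1 \<le> ennreal (C1 / t * M)"
        using C1(2)[OF \<phi> t] C1(1) t M unfolding \<phi>M E1_def by (simp add: ennreal_mult[symmetric])
      have E2: "emeasure lebesgue E2 \<le> ennreal (5 ^ ?n / t * M)"
      proof -
        have "ennreal t * emeasure lebesgue E2 \<le> ennreal (5 ^ ?n) * ennreal M"
          unfolding E2_def \<phi>M[symmetric] by (intro maximal_set_weak_type doubling_lebesgue) measurable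
        also have "\<dots> = ennreal (5 ^ ?n * M)" using M by (intro ennreal_mult[symmetric]) auto
        finally have "emeasure lebesgue E2 \<le> ennreal (5 ^ ?n * M / t)" by (rule ennreal_le_divideI[OF t])
        then show ?thesis by simp
      qed
      have Eh: "emeasure lebesgue E \<le> ennreal (h ^ ?n / 2 ^ (?n + 2))"
      proof -
        have "emeasure lebesgue E \<le> emeasure lebesgue (E1 \<union> E2)"
          unfolding E_def using mE1 mE2 by (intro emeasure_mono) auto
        also have "\<dots> \<le> emeasure lebesgue E1 + emeasure lebesgue E2"
          using mE1 mE2 by (rule emeasure_subadditive)
        also have "\<dots> \<le> ennreal (C1 / t * M) + ennreal (5 ^ ?n / t * M)" by (rule add_mono[OF E1 E2])
        also have "\<dots> = ennreal ((C1 + 5 ^ ?n) / t * M)"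
          using C1(1) t M by (simp add: ennreal_plus[symmetric] add_divide_distrib distrib_right del: ennreal_plus)
        also have "(C1 + 5 ^ ?n) / t * M = h ^ ?n / 2 ^ (?n + 2)"
        proof -
          have "C1 + 5 ^ ?n = \<kappa> / 2 ^ (?n + 2)" by (simp add: \<kappa>_def)
          then show ?thesis unfolding t_def using M \<kappa> h by simp
        qed
        finally show ?thesis .
      qed
      have Efin: "emeasure lebesgue E < \<infinity>" using Eh by (rule order.strict_trans1) simp
      have Einter: "emeasure lebesgue (E \<inter> X) < \<infinity>" for X
        by (rule order.strict_trans1[OF emeasure_mono[OF Int_lower1 mE] Efin])
      define F where "F = indicat_real E"
      have Fint: "integrable lebesgue F" unfolding F_def using Efin by (intro integrable_real_indicator) auto
      have F_set: "(LINT y:X|lebesgue. F y) = measure lebesgue (E \<inter> X)" if "X \<in> sets lebesgue" for X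
      proof -
        have "(LINT y:X|lebesgue. F y) = (LINT y|lebesgue. indicator (E \<inter> X) y)"
          unfolding set_lebesgue_integral_def F_def by (intro Bochner_Integration.integral_cong) (auto simp: indicator_def)
        then show ?thesis using that by simp
      qed
      \<comment> \<open>This height turns the upper density bound 2^n \<tau> of the stopped cubes
        into 1/2, and the lower one makes their total volume at most 2^(n+1) times that of
        \<open>E\<close>, hence at most half the cube.\<close>
      define \<tau> where "\<tau> = 1 / (2::real) ^ (?n + 1)"
      have \<tau>: "0 < \<tau>" by (simp add: \<tau>_def)
      have mEle: "measure lebesgue (E \<inter> X) \<le> h ^ ?n / 2 ^ (?n + 2)" if "X \<in> sets lebesgue" for X
      proof -
        have "emeasure lebesgue (E \<inter> X) \<le> ennreal (h ^ ?n / 2 ^ (?n + 2))"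
          using that by (intro order.trans[OF emeasure_mono Eh]) auto
        then show ?thesis unfolding measure_def using h by (intro enn2real_leI) auto
      qed
      have top: "(LINT y:cell (fst q) h 0 x|lebesgue. F y) \<le> \<tau> * h ^ ?n" for x
      proof -
        have "cell (fst q) h 0 x \<in> sets lebesgue" using h by (simp add: cell_eq_cube)
        then have "(LINT y:cell (fst q) h 0 x|lebesgue. F y) \<le> h ^ ?n / 2 ^ (?n + 2)" by (simp only: F_set mEle)
        also have "\<dots> \<le> \<tau> * h ^ ?n" unfolding \<tau>_def using h by (simp add: field_simps)
        finally show ?thesis .
      qed
      obtain S where S: "countable S" "\<And>p. p \<in> S \<Longrightarrow> 0 < snd p" "\<And>p. p \<in> S \<Longrightarrow> snd p \<le> h / 2"
        "\<And>p. p \<in> S \<Longrightarrow> \<tau> * snd p ^ ?n < (LINT y:qcube p|lebesgue. F y)"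
        "\<And>p. p \<in> S \<Longrightarrow> (LINT y:qcube p|lebesgue. F y) \<le> 2 ^ ?n * \<tau> * snd p ^ ?n"
        "disjoint_family_on qcube S"
        "AE x in lebesgue. x \<notin> (\<Union>p\<in>S. qcube p) \<longrightarrow> F x \<le> \<tau>"
        "\<And>p x. p \<in> S \<Longrightarrow> qcube p \<inter> cell (fst q) h 0 x \<noteq> {} \<Longrightarrow> qcube p \<subseteq> cell (fst q) h 0 x"
        by (rule calderon_zygmund_cubes[OF h Fint _ \<tau> top]) (auto simp: F_def)
      \<comment> \<open>A cube of positive density meets \<open>E\<close> and hence the top cell
        that equals \<open>qcube q\<close>; the decomposition then places it inside.\<close>
      have Sq: "qcube p \<subseteq> qcube q" if p: "p \<in> S" for p
      proof -
        have "0 < (LINT y:qcube p|lebesgue. F y)"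
          using S(4)[OF p] \<tau> S(2)[OF p] by (meson less_trans mult_pos_pos zero_less_power)
        then have "E \<inter> qcube p \<noteq> {}" by (auto simp: F_set)
        then have "qcube p \<inter> cell (fst q) h 0 (fst q) \<noteq> {}" using cell_zero[OF h, of "fst q"] by (auto simp: E_def h_def)
        then have "qcube p \<subseteq> cell (fst q) h 0 (fst q)" by (rule S(8)[OF p])
        then show ?thesis using cell_zero[OF h, of "fst q"] by (simp add: h_def)
      qed
      have vol: "emeasure lebesgue (\<Union>p\<in>S. qcube p) \<le> ennreal (snd q ^ ?n / 2)"
      proof -
        have eE: "(\<integral>\<^sup>+y\<in>qcube p. indicator E y \<partial>lebesgue) = ennreal (measure lebesgue (E \<inter> qcube p))" for p :: "(real ^ 'n) \<times> real"
        proof -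
          have "(\<integral>\<^sup>+y\<in>qcube p. indicator E y \<partial>lebesgue) = (\<integral>\<^sup>+y. indicator (E \<inter> qcube p) y \<partial>lebesgue)"
            by (simp only: indicator_inter_arith)
          also have "\<dots> = emeasure lebesgue (E \<inter> qcube p)" by (rule nn_integral_indicator) auto
          finally have "(\<integral>\<^sup>+y\<in>qcube p. indicator E y \<partial>lebesgue) = emeasure lebesgue (E \<inter> qcube p)" .
          moreover have "emeasure lebesgue (E \<inter> qcube p) < \<infinity>" by (rule Einter)
          ultimately show ?thesis by (simp add: emeasure_eq_ennreal_measure)
        qed
        have "emeasure lebesgue (\<Union>p\<in>S. qcube p) \<le> (\<integral>\<^sup>+p. emeasure lebesgue (qcube p) \<partial>count_space S)"
          using S(1) by (intro emeasure_UN_le_nn_integral) auto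
        also have "\<dots> \<le> (\<integral>\<^sup>+p. ennreal (1 / \<tau>) * (\<integral>\<^sup>+y\<in>qcube p. indicator E y \<partial>lebesgue) \<partial>count_space S)"
        proof (intro nn_integral_mono)
          fix p assume "p \<in> space (count_space S)"
          then have p: "p \<in> S" by simp
          have "snd p ^ ?n \<le> 1 / \<tau> * measure lebesgue (E \<inter> qcube p)"
            using S(4)[OF p] \<tau> by (simp add: F_set field_simps)
          then have "ennreal (snd p ^ ?n) \<le> ennreal (1 / \<tau> * measure lebesgue (E \<inter> qcube p))" by (rule ennreal_leI)
          then show "emeasure lebesgue (qcube p) \<le> ennreal (1 / \<tau>) * (\<integral>\<^sup>+y\<in>qcube p. indicator E y \<partial>lebesgue)"
            unfolding eE using S(2)[OF p] \<tau> by (simp add: emeasure_lebesgue_cube ennreal_mult[symmetric])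
        qed
        also have "\<dots> = ennreal (1 / \<tau>) * (\<integral>\<^sup>+p. (\<integral>\<^sup>+y\<in>qcube p. indicator E y \<partial>lebesgue) \<partial>count_space S)"
          by (rule nn_integral_cmult) simp
        also have "\<dots> = ennreal (1 / \<tau>) * (\<integral>\<^sup>+y\<in>(\<Union>p\<in>S. qcube p). indicator E y \<partial>lebesgue)"
          using S(1,6) by (subst nn_integral_UN_disjoint_count_space) auto
        also have "\<dots> \<le> ennreal (1 / \<tau>) * (\<integral>\<^sup>+y. indicator E y \<partial>lebesgue)"
          by (intro mult_left_mono nn_integral_mono) (auto simp: indicator_def)
        also have "\<dots> \<le> ennreal (1 / \<tau>) * ennreal (h ^ ?n / 2 ^ (?n + 2))"
          using Eh by (intro mult_left_mono) auto
        also have "\<dots> = ennreal (snd q ^ ?n / 2)"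
          using h by (simp add: \<tau>_def h_def[symmetric] flip: ennreal_mult)
        finally show ?thesis .
      qed
      have outside: "AE x in lebesgue. x \<in> qcube q - (\<Union>p\<in>S. qcube p) \<longrightarrow> norm (T (rst (qball q) f) x) \<le> C * qavg f q"
        using S(7)
      proof eventually_elim
        case (elim x)
        show ?case
        proof
          assume x: "x \<in> qcube q - (\<Union>p\<in>S. qcube p)"
          have "\<tau> < 1" unfolding \<tau>_def by (simp add: less_1_mult)
          then have "x \<notin> E" using elim x by (auto simp: F_def indicator_def split: if_splits)
          then have "norm (T \<phi> x) \<le> t" using x by (auto simp: E_def E1_def)
          also have "t = \<kappa> * qavg f q" by (simp add: t_def av)
          also have "\<dots> \<le> C * qavg f q" using C\<kappa> M h av by (intro mult_right_mono) auto
          finally show "norm (T (rst (qball q) f) x) \<le> C * qavg f q" by (simp add: \<phi>_def)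
        qed
      qed
      have inside: "AE x in lebesgue. x \<in> qcube p \<longrightarrow> norm (T (rst (qball q) f) x - T (rst (qball p) f) x) \<le> C * qavg f q"
        if p: "p \<in> S" for p
      proof -
        define s where "s = snd p"
        have s: "0 < s" "s \<le> h / 2" using S(2,3)[OF p] by (auto simp: s_def)
        have pq: "qcube p \<subseteq> qcube q" by (rule Sq[OF p])
        have bpq: "qball p \<subseteq> qball q" using pq s by (intro qball_mono) (auto simp: s_def h_def)
        have volp: "emeasure lebesgue (qcube p) = ennreal (s ^ ?n)" using s by (simp add: emeasure_lebesgue_cube s_def)
        have Ep: "emeasure lebesgue (E \<inter> qcube p) \<le> ennreal (s ^ ?n / 2)"
        proof -
          have "measure lebesgue (E \<inter> qcube p) \<le> s ^ ?n / 2"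
            using S(5)[OF p] by (simp add: F_set \<tau>_def s_def)
          moreover have "emeasure lebesgue (E \<inter> qcube p) < \<infinity>" by (rule Einter)
          ultimately show ?thesis by (simp add: emeasure_eq_ennreal_measure ennreal_leI)
        qed
        obtain z where z: "z \<in> qcube p" "z \<notin> E"
        proof -
          have "\<not> qcube p \<subseteq> E"
          proof
            assume "qcube p \<subseteq> E"
            then have "E \<inter> qcube p = qcube p" by auto
            then have "ennreal (s ^ ?n) \<le> ennreal (s ^ ?n / 2)" using Ep volp by simp
            then show False using s by (subst (asm) ennreal_le_iff) auto
          qed
          then show ?thesis using that by auto
        qed
        then have zE2: "z \<notin> E2" using pq by (auto simp: E_def)
        have zball: "z \<in> ball (fst p) r" if "4 * real ?n * s \<le> r" for r
        proof -
          have "norm (z - fst p) \<le> real ?n * s" using cube_dist_corner[OF z(1)] by (simp add: s_def)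
          also have "\<dots> < 4 * real ?n * s" using s by simp
          finally show ?thesis using that by (simp add: dist_norm norm_minus_commute)
        qed
        have small: "(\<integral>\<^sup>+y\<in>ball c r. ennreal (norm (\<phi> y)) \<partial>lebesgue) \<le> ennreal (t * V) * ennreal (r ^ ?n)"
          if "0 < r" "r \<le> \<rho>" "z \<in> ball c r" for c r
        proof -
          have "(\<integral>\<^sup>+y\<in>ball c r. ennreal (norm (\<phi> y)) \<partial>lebesgue) \<le> ennreal t * emeasure lebesgue (ball c r)"
            using zE2 that unfolding E2_def by (intro not_in_maximal_setD) auto
          also have "\<dots> = ennreal (t * V) * ennreal (r ^ ?n)"
            using that t V by (simp add: emeasure_lebesgue_ball V_def[symmetric] mult_ac flip: ennreal_mult)
          finally show ?thesis .
        qed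
        \<comment> \<open>Radii above \<rho> are beyond the maximal function in \<open>E2\<close>.
          But \<phi> lives in \<open>qball q\<close>, a ball of radius exactly \<rho> that contains
          \<open>z\<close>.\<close>
        have growth: "(\<integral>\<^sup>+y\<in>ball (fst p) r. ennreal (norm (\<phi> y)) \<partial>lebesgue) \<le> ennreal (t * V) * ennreal (r ^ ?n)"
          if r: "4 * real ?n * s \<le> r" for r
        proof (cases "r \<le> \<rho>")
          case True
          have "0 < 4 * real ?n * s" using s by simp
          then have "0 < r" using r by linarith
          then show ?thesis using True zball[OF r] by (intro small)
        next
          case False
          have "z \<in> qball q" using z(1) pq qcube_subset_qball[OF q] by blast
          then have zq: "z \<in> ball (fst q) \<rho>" by (simp add: \<rho>_def h_def)
          have \<rho>0: "0 < \<rho>" using h by (simp add: \<rho>_def)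
          have "(\<integral>\<^sup>+y\<in>ball (fst p) r. ennreal (norm (\<phi> y)) \<partial>lebesgue) \<le> (\<integral>\<^sup>+y\<in>ball (fst q) \<rho>. ennreal (norm (\<phi> y)) \<partial>lebesgue)"
            by (intro nn_integral_mono) (auto simp: indicator_def \<phi>_def rst_def \<rho>_def h_def)
          also have "\<dots> \<le> ennreal (t * V) * ennreal (\<rho> ^ ?n)" by (rule small[OF \<rho>0 order_refl zq])
          also have "\<dots> \<le> ennreal (t * V) * ennreal (r ^ ?n)"
            using False \<rho>0 by (intro mult_left_mono ennreal_leI power_mono) auto
          finally show ?thesis .
        qed
        define \<psi> where "\<psi> = rst (qball p) f"
        define \<zeta> where "\<zeta> = rst (qball q - qball p) f"
        have l12: "\<psi> \<in> L12" "\<zeta> \<in> L12" unfolding \<psi>_def \<zeta>_def using f by (auto intro!: L12_rst)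
        then have l2: "\<psi> \<in> L2" "\<zeta> \<in> L2" by (auto simp: L12_def)
        have [measurable]: "T \<psi> \<in> borel_measurable lebesgue" by (rule T_measurable[OF l2(1)])
        have \<phi>eq: "\<phi> = (\<lambda>y. \<psi> y + \<zeta> y)"
          using bpq by (auto simp: \<phi>_def \<psi>_def \<zeta>_def rst_def indicator_def fun_eq_iff)
        have "\<exists>c. AE x in lebesgue. x \<in> qcube p \<longrightarrow> norm (T \<zeta> x - c) \<le> dini_const * (t * V)"
        proof (rule T_oscillation[OF l12(2)])
          show "0 < snd p" using s by (simp add: s_def)
          show "\<zeta> y = 0" if "y \<in> qball p" for y using that by (simp add: \<zeta>_def rst_def)
          show "0 \<le> t * V" using t V by simp
          fix r assume r: "4 * real ?n * snd p \<le> r"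
          have "(\<integral>\<^sup>+y\<in>ball (fst p) r. ennreal (norm (\<zeta> y)) \<partial>lebesgue) \<le> (\<integral>\<^sup>+y\<in>ball (fst p) r. ennreal (norm (\<phi> y)) \<partial>lebesgue)"
            by (intro nn_integral_mono) (auto simp: indicator_def \<phi>_def \<zeta>_def rst_def)
          then show "(\<integral>\<^sup>+y\<in>ball (fst p) r. ennreal (norm (\<zeta> y)) \<partial>lebesgue) \<le> ennreal (t * V) * ennreal (r ^ ?n)"
            using growth[of r] r by (auto simp: s_def intro: order.trans)
        qed
        then obtain c where c: "AE x in lebesgue. x \<in> qcube p \<longrightarrow> norm (T \<zeta> x - c) \<le> dini_const * (t * V)" by blast
        have add: "AE x in lebesgue. T \<phi> x = T \<psi> x + T \<zeta> x" unfolding \<phi>eq by (rule T_add[OF l2])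
        define E3 where "E3 = {x\<in>space lebesgue. \<kappa>2 * t < norm (T \<psi> x)}"
        have mE3: "E3 \<in> sets lebesgue" unfolding E3_def by measurable
        have E3: "emeasure lebesgue E3 \<le> ennreal (s ^ ?n / 4)"
        proof -
          have "emeasure lebesgue E3 \<le> ennreal (C1 / (\<kappa>2 * t)) * (\<integral>\<^sup>+x. ennreal (norm (\<psi> x)) \<partial>lebesgue)"
            unfolding E3_def using C1(2)[OF l12(1), of "\<kappa>2 * t"] \<kappa>2 t by simp
          also have "(\<integral>\<^sup>+x. ennreal (norm (\<psi> x)) \<partial>lebesgue) \<le> (\<integral>\<^sup>+y\<in>ball (fst p) (4 * real ?n * s). ennreal (norm (\<phi> y)) \<partial>lebesgue)"
            using bpq by (intro nn_integral_mono) (auto simp: indicator_def \<phi>_def \<psi>_def rst_def s_def)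
          also have "\<dots> \<le> ennreal (t * V) * ennreal ((4 * real ?n * s) ^ ?n)" by (rule growth) simp
          also have "ennreal (C1 / (\<kappa>2 * t)) * (ennreal (t * V) * ennreal ((4 * real ?n * s) ^ ?n))
            = ennreal (C1 / (\<kappa>2 * t) * ((t * V) * (4 * real ?n * s) ^ ?n))"
            using C1(1) \<kappa>2 t V s by (simp add: ennreal_mult[symmetric])
          also have "C1 / (\<kappa>2 * t) * ((t * V) * (4 * real ?n * s) ^ ?n) = s ^ ?n / 4"
          proof -
            have "(4 * real ?n * s) ^ ?n = (4 * real ?n) ^ ?n * s ^ ?n" by (simp only: power_mult_distrib)
            then have "C1 * (V * (4 * real ?n * s) ^ ?n) = \<kappa>2 * s ^ ?n / 4" by (simp add: \<kappa>2_def)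
            moreover have "C1 / (\<kappa>2 * t) * ((t * V) * (4 * real ?n * s) ^ ?n) = C1 * (V * (4 * real ?n * s) ^ ?n) / \<kappa>2"
              using t \<kappa>2 by (simp add: field_simps)
            ultimately show ?thesis using \<kappa>2 by simp
          qed
          finally show ?thesis by (simp add: mult_left_mono)
        qed
        \<comment> \<open>\<open>E\<close> takes at most half of the child and \<open>E3\<close> at
          most a quarter, so a set of positive measure is left to avoid the null sets as
          well.\<close>
        have "\<exists>x'. x' \<in> qcube p \<and> x' \<notin> E \<and> x' \<notin> E3 \<and> T \<phi> x' = T \<psi> x' + T \<zeta> x' \<and> norm (T \<zeta> x' - c) \<le> dini_const * (t * V)"
        proof (rule ccontr)
          assume no: "\<not> ?thesis"
          have "AE x in lebesgue. x \<in> qcube p \<longrightarrow> x \<in> (E \<inter> qcube p) \<union> E3"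
            using c add by eventually_elim (use no in blast)
          then have "emeasure lebesgue (qcube p) \<le> emeasure lebesgue ((E \<inter> qcube p) \<union> E3)"
            using mE3 by (intro emeasure_mono_AE) auto
          also have "\<dots> \<le> emeasure lebesgue (E \<inter> qcube p) + emeasure lebesgue E3"
            using mE3 by (intro emeasure_subadditive) auto
          also have "\<dots> \<le> ennreal (s ^ ?n / 2) + ennreal (s ^ ?n / 4)" by (rule add_mono[OF Ep E3])
          also have "\<dots> = ennreal (3 / 4 * s ^ ?n)" using s by (simp flip: ennreal_plus)
          finally show False unfolding volp using s by (subst (asm) ennreal_le_iff) auto
        qed
        then obtain x' where x': "x' \<in> qcube p" "x' \<notin> E" "x' \<notin> E3" "T \<phi> x' = T \<psi> x' + T \<zeta> x'"
          "norm (T \<zeta> x' - c) \<le> dini_const * (t * V)" by blast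
        have b1: "norm (T \<phi> x') \<le> t" using x'(1,2) pq by (auto simp: E_def E1_def)
        have b2: "norm (T \<psi> x') \<le> \<kappa>2 * t" using x'(3) by (auto simp: E3_def)
        have b3: "norm (T \<zeta> x') \<le> t + \<kappa>2 * t"
          using b1 b2 x'(4) norm_triangle_ineq4[of "T \<phi> x'" "T \<psi> x'"] by simp
        have Ct: "C * qavg f q = t + \<kappa>2 * t + 2 * (dini_const * (t * V))"
          unfolding C_def av t_def by (simp add: algebra_simps)
        show ?thesis using c add
        proof eventually_elim
          case (elim x)
          show ?case
          proof
            assume "x \<in> qcube p"
            then have cx: "norm (T \<zeta> x - c) \<le> dini_const * (t * V)" using elim by blast
            have "T \<phi> x - T \<psi> x = (T \<zeta> x - c) - (T \<zeta> x' - c) + T \<zeta> x'" using elim by simp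
            then have "norm (T \<phi> x - T \<psi> x) \<le> norm (T \<zeta> x - c) + norm (T \<zeta> x' - c) + norm (T \<zeta> x')"
              using norm_triangle_ineq[of "(T \<zeta> x - c) - (T \<zeta> x' - c)" "T \<zeta> x'"] norm_triangle_ineq4[of "T \<zeta> x - c" "T \<zeta> x' - c"]
              by simp
            also have "\<dots> \<le> C * qavg f q" unfolding Ct using cx x'(5) b3 by linarith
            finally show "norm (T (rst (qball q) f) x - T (rst (qball p) f) x) \<le> C * qavg f q"
              by (simp add: \<phi>_def \<psi>_def)
          qed
        qed
      qed
      show ?thesis
        by (intro exI[of _ S] conjI ballI S(1,2,6) Sq vol outside inside)
    qed
  qed
  have "0 < C" using \<kappa> C\<kappa> by linarith
  then show ?thesis using main by (rule that)
qed

end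

context dini_cz_operator
begin

text \<open>Names the conclusion of \<open>sparse_step\<close>, so that children can be chosen for
  all cubes at once.\<close>

definition sparse_children ::
    "real \<Rightarrow> (real ^ 'n \<Rightarrow> complex) \<Rightarrow> (real ^ 'n) \<times> real \<Rightarrow> ((real ^ 'n) \<times> real) set \<Rightarrow> bool" where
  "sparse_children C f q S \<longleftrightarrow> countable S \<and>
     (\<forall>p\<in>S. 0 < snd p \<and> qcube p \<subseteq> qcube q) \<and> disjoint_family_on qcube S \<and>
     emeasure lebesgue (\<Union>p\<in>S. qcube p) \<le> ennreal (snd q ^ CARD('n) / 2) \<and>
     (AE x in lebesgue. x \<in> qcube q - (\<Union>p\<in>S. qcube p) \<longrightarrow> norm (T (rst (qball q) f) x) \<le> C * qavg f q) \<and>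
     (\<forall>p\<in>S. AE x in lebesgue. x \<in> qcube p \<longrightarrow> norm (T (rst (qball q) f) x - T (rst (qball p) f) x) \<le> C * qavg f q)"

lemma sparse_children_exist:
  obtains C where "0 < C" "\<And>f q. f \<in> L12 \<Longrightarrow> 0 < snd q \<Longrightarrow> \<exists>S. sparse_children C f q S"
proof (rule sparse_step[folded sparse_children_def])
qed (rule that)

text \<open>Iterate the step from \<open>q0\<close>. The generations at least halve in volume, so
  almost every point leaves them; telescoping along the cubes that contain the point bounds
  \<open>T\<close> by the sum of averages. A cube minus its children keeps half of its volume, and
  these remainders are disjoint. An index carries its generation, so a cube need not be shown to
  occur only once.\<close>

theorem sparse_domination:
  obtains C where "0 < C" "\<And>f q0. f \<in> L12 \<Longrightarrow> 0 < snd q0 \<Longrightarrow>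
    \<exists>(J :: (nat \<times> (real ^ 'n) \<times> real) set) E. countable J \<and>
      (\<forall>j\<in>J. 0 < snd (snd j) \<and> qcube (snd j) \<subseteq> qcube q0 \<and> E j \<in> sets lebesgue \<and> E j \<subseteq> qcube (snd j) \<and>
         ennreal (snd (snd j) ^ CARD('n) / 2) \<le> emeasure lebesgue (E j)) \<and>
      disjoint_family_on E J \<and>
      (AE x in lebesgue. x \<in> qcube q0 \<longrightarrow> ennreal (norm (T (rst (qball q0) f) x)) \<le>
         (\<integral>\<^sup>+j. ennreal (C * qavg f (snd j)) * indicator (qcube (snd j)) x \<partial>count_space J))"
proof -
  let ?n = "CARD('n)"
  obtain C where C: "0 < C" "\<And>f q. f \<in> L12 \<Longrightarrow> 0 < snd q \<Longrightarrow> \<exists>S. sparse_children C f q S"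
    by (rule sparse_children_exist) (rule that)
  have main: "\<exists>(J :: (nat \<times> (real ^ 'n) \<times> real) set) E. countable J \<and>
      (\<forall>j\<in>J. 0 < snd (snd j) \<and> qcube (snd j) \<subseteq> qcube q0 \<and> E j \<in> sets lebesgue \<and> E j \<subseteq> qcube (snd j) \<and>
         ennreal (snd (snd j) ^ CARD('n) / 2) \<le> emeasure lebesgue (E j)) \<and>
      disjoint_family_on E J \<and>
      (AE x in lebesgue. x \<in> qcube q0 \<longrightarrow> ennreal (norm (T (rst (qball q0) f) x)) \<le>
         (\<integral>\<^sup>+j. ennreal (C * qavg f (snd j)) * indicator (qcube (snd j)) x \<partial>count_space J))"
    if f: "f \<in> L12" and q0: "0 < snd q0" for f :: "real ^ 'n \<Rightarrow> complex" and q0 :: "(real ^ 'n) \<times> real"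
  proof -
    have "\<forall>q. \<exists>S. 0 < snd q \<longrightarrow> sparse_children C f q S"
      using C(2)[OF f] by blast
    from choice[OF this] obtain S where S0: "\<And>q. 0 < snd q \<Longrightarrow> sparse_children C f q (S q)" by blast
    have S: "countable (S q)" "\<And>p. p \<in> S q \<Longrightarrow> 0 < snd p" "\<And>p. p \<in> S q \<Longrightarrow> qcube p \<subseteq> qcube q"
      "disjoint_family_on qcube (S q)" "emeasure lebesgue (\<Union>p\<in>S q. qcube p) \<le> ennreal (snd q ^ ?n / 2)"
      "AE x in lebesgue. x \<in> qcube q - (\<Union>p\<in>S q. qcube p) \<longrightarrow> norm (T (rst (qball q) f) x) \<le> C * qavg f q"
      "\<And>p. p \<in> S q \<Longrightarrow> AE x in lebesgue. x \<in> qcube p \<longrightarrow> norm (T (rst (qball q) f) x - T (rst (qball p) f) x) \<le> C * qavg f q"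
      if "0 < snd q" for q using S0[OF that] unfolding sparse_children_def by simp_all
    define gen where "gen = rec_nat {q0} (\<lambda>_ G. \<Union>q\<in>G. S q)"
    have gen0: "gen 0 = {q0}" and genS: "gen (Suc N) = (\<Union>q\<in>gen N. S q)" for N by (simp_all add: gen_def)
    have gpos: "0 < snd q" if "q \<in> gen N" for q N
      using that
    proof (induction N arbitrary: q)
      case (Suc N)
      then obtain q' where q': "q' \<in> gen N" "q \<in> S q'" unfolding genS by blast
      show ?case by (rule S(2)[OF Suc.IH[OF q'(1)] q'(2)])
    qed (use q0 in \<open>simp add: gen0\<close>)
    have gcount: "countable (gen N)" for N
    proof (induction N)
      case (Suc N)
      show ?case unfolding genS by (rule countable_UN[OF Suc S(1)[OF gpos]])
    qed (simp add: gen0)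
    have gsub: "qcube q \<subseteq> qcube q0" if "q \<in> gen N" for q N
      using that
    proof (induction N arbitrary: q)
      case (Suc N)
      then obtain q' where q': "q' \<in> gen N" "q \<in> S q'" unfolding genS by blast
      show ?case using Suc.IH[OF q'(1)] S(3)[OF gpos[OF q'(1)] q'(2)] by blast
    qed (simp add: gen0)
    have gdisj: "disjoint_family_on qcube (gen N)" for N
    proof (induction N)
      case (Suc N)
      show ?case unfolding disjoint_family_on_def
      proof (intro ballI impI)
        fix p p' assume "p \<in> gen (Suc N)" "p' \<in> gen (Suc N)" and ne: "p \<noteq> p'"
        then obtain q q' where q: "q \<in> gen N" "p \<in> S q" "q' \<in> gen N" "p' \<in> S q'" unfolding genS by blast
        show "qcube p \<inter> qcube p' = {}"
        proof (cases "q = q'")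
          case True
          then show ?thesis using S(4)[OF gpos[OF q(1)]] q ne unfolding disjoint_family_on_def by blast
        next
          case False
          then have "qcube q \<inter> qcube q' = {}" using Suc q unfolding disjoint_family_on_def by blast
          then show ?thesis using S(3)[OF gpos[OF q(1)] q(2)] S(3)[OF gpos[OF q(3)] q(4)] by blast
        qed
      qed
    qed (auto simp: gen0 disjoint_family_on_def)
    define U where "U N = (\<Union>q\<in>gen N. qcube q)" for N
    have mU[measurable]: "U N \<in> sets lebesgue" for N unfolding U_def using gcount by (intro sets.countable_UN') auto
    have USuc: "U (Suc N) = (\<Union>q\<in>gen N. \<Union>p\<in>S q. qcube p)" for N by (auto simp: U_def genS)
    have Udec: "U (Suc N) \<subseteq> U N" for N
    proof
      fix x assume "x \<in> U (Suc N)"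
      then obtain q p where q: "q \<in> gen N" "p \<in> S q" "x \<in> qcube p" unfolding USuc by blast
      then have "x \<in> qcube q" using S(3)[OF gpos[OF q(1)] q(2)] by blast
      then show "x \<in> U N" using q(1) unfolding U_def by blast
    qed
    have Udec2: "U N \<subseteq> U M" if "M \<le> N" for M N
      using that by (induction N rule: dec_induct) (use Udec in auto)
    have mS: "(\<Union>p\<in>S q. qcube p) \<in> sets lebesgue" if "0 < snd q" for q
      using S(1)[OF that] by (intro sets.countable_UN') auto
    have half: "ennreal (1/2) * ennreal y = ennreal (y / 2)" if "0 \<le> y" for y
      by (rule trans[OF ennreal_mult[symmetric]]) (use that in auto)
    have Uvol: "emeasure lebesgue (U N) \<le> ennreal (snd q0 ^ ?n / 2 ^ N)" for N
    proof (induction N)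
      case 0
      then show ?case using q0 by (simp add: U_def gen0 emeasure_lebesgue_cube)
    next
      case (Suc N)
      have "emeasure lebesgue (U (Suc N)) \<le> (\<integral>\<^sup>+q. emeasure lebesgue (\<Union>p\<in>S q. qcube p) \<partial>count_space (gen N))"
        unfolding USuc using gcount mS[OF gpos] by (intro emeasure_UN_le_nn_integral) auto
      also have "\<dots> \<le> (\<integral>\<^sup>+q. ennreal (1/2) * emeasure lebesgue (qcube q) \<partial>count_space (gen N))"
      proof (intro nn_integral_mono)
        fix q assume "q \<in> space (count_space (gen N))"
        then have "0 < snd q" using gpos by auto
        then show "emeasure lebesgue (\<Union>p\<in>S q. qcube p) \<le> ennreal (1/2) * emeasure lebesgue (qcube q)"
          using S(5)[of q] by (simp only: emeasure_lebesgue_cube half zero_le_power less_imp_le)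
      qed
      also have "\<dots> = ennreal (1/2) * (\<integral>\<^sup>+q. emeasure lebesgue (qcube q) \<partial>count_space (gen N))"
        by (rule nn_integral_cmult) simp
      also have "(\<integral>\<^sup>+q. emeasure lebesgue (qcube q) \<partial>count_space (gen N)) = emeasure lebesgue (U N)"
        unfolding U_def using gcount gdisj by (intro emeasure_UN_countable[symmetric]) auto
      also have "ennreal (1/2) * emeasure lebesgue (U N) \<le> ennreal (1/2) * ennreal (snd q0 ^ ?n / 2 ^ N)"
        using Suc by (intro mult_left_mono) auto
      also have "\<dots> = ennreal (snd q0 ^ ?n / 2 ^ Suc N)" using q0 by (subst half) (auto simp: mult.commute)
      finally show ?case .
    qed
    have nullU: "AE x in lebesgue. \<exists>N. x \<notin> U N"
    proof -
      have "emeasure lebesgue (\<Inter>N. U N) \<le> ennreal (snd q0 ^ ?n / 2 ^ N)" for N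
        by (rule order.trans[OF emeasure_mono Uvol]) auto
      moreover have "(\<lambda>N. ennreal (snd q0 ^ ?n / 2 ^ N)) \<longlonglongrightarrow> ennreal 0"
      proof (rule tendsto_ennrealI)
        have "(\<lambda>N. snd q0 ^ ?n * (1/2) ^ N) \<longlonglongrightarrow> snd q0 ^ ?n * 0"
          by (intro tendsto_mult_left LIMSEQ_power_zero) simp
        then show "(\<lambda>N. snd q0 ^ ?n / 2 ^ N) \<longlonglongrightarrow> 0" by (simp add: power_divide)
      qed
      ultimately have "emeasure lebesgue (\<Inter>N. U N) \<le> ennreal 0"
        by (intro LIMSEQ_le_const) auto
      then have "(\<Inter>N. U N) \<in> null_sets lebesgue" by (auto simp: null_sets_def)
      then show ?thesis using AE_not_in by fastforce
    qed
    define J where "J = {(i, q). q \<in> gen i}"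
    define E where "E j = qcube (snd j) - (\<Union>p\<in>S (snd j). qcube p)" for j :: "nat \<times> (real ^ 'n) \<times> real"
    have Jc: "countable J"
    proof -
      have "J = Sigma UNIV gen" by (auto simp: J_def)
      then show ?thesis using gcount by (simp add: countable_SIGMA)
    qed
    \<comment> \<open>Places the remainder of a cube of generation \<open>i\<close> in the shell
      between consecutive unions, which separates different generations.\<close>
    have EU: "E (i, q) \<subseteq> U i - U (Suc i)" if "q \<in> gen i" for i q
    proof
      fix x assume x: "x \<in> E (i, q)"
      then have xq: "x \<in> qcube q" "x \<notin> (\<Union>p\<in>S q. qcube p)" by (auto simp: E_def)
      have "x \<notin> U (Suc i)"
      proof
        assume "x \<in> U (Suc i)"
        then obtain q' p where q': "q' \<in> gen i" "p \<in> S q'" "x \<in> qcube p" unfolding USuc by blast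
        then have "x \<in> qcube q'" using S(3)[OF gpos[OF q'(1)] q'(2)] by blast
        then have "q' = q" using gdisj[of i] q'(1) that xq(1) unfolding disjoint_family_on_def by blast
        then show False using q' xq by blast
      qed
      then show "x \<in> U i - U (Suc i)" using xq that by (auto simp: U_def)
    qed
    have Ed: "disjoint_family_on E J"
      unfolding disjoint_family_on_def
    proof (intro ballI impI)
      fix j k assume j: "j \<in> J" and k: "k \<in> J" and ne: "j \<noteq> k"
      obtain i q where jq: "j = (i, q)" "q \<in> gen i" using j by (auto simp: J_def)
      obtain l r where kr: "k = (l, r)" "r \<in> gen l" using k by (auto simp: J_def)
      consider "i = l" | "i < l" | "l < i" by linarith
      then show "E j \<inter> E k = {}"
      proof cases
        case 1
        then have "qcube q \<inter> qcube r = {}" using gdisj[of i] jq kr ne unfolding disjoint_family_on_def by blast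
        then show ?thesis by (auto simp: E_def jq kr)
      next
        case 2
        then show ?thesis using EU[OF jq(2)] EU[OF kr(2)] Udec2[of "Suc i" l] unfolding jq(1) kr(1) by fastforce
      next
        case 3
        then show ?thesis using EU[OF jq(2)] EU[OF kr(2)] Udec2[of "Suc l" i] unfolding jq(1) kr(1) by fastforce
      qed
    qed
    have props: "0 < snd (snd j) \<and> qcube (snd j) \<subseteq> qcube q0 \<and> E j \<in> sets lebesgue \<and> E j \<subseteq> qcube (snd j) \<and>
         ennreal (snd (snd j) ^ ?n / 2) \<le> emeasure lebesgue (E j)" if j: "j \<in> J" for j
    proof -
      obtain i q where jq: "j = (i, q)" "q \<in> gen i" using j by (auto simp: J_def)
      have pos: "0 < snd q" by (rule gpos[OF jq(2)])
      have mE: "E j \<in> sets lebesgue" unfolding E_def jq using mS[OF pos] by auto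
      have vol: "emeasure lebesgue (qcube q) = ennreal (snd q ^ ?n)" using pos by (rule emeasure_lebesgue_cube)
      have sub: "(\<Union>p\<in>S q. qcube p) \<subseteq> qcube q" using S(3)[OF pos] by blast
      have "ennreal (snd q ^ ?n / 2) = ennreal (snd q ^ ?n) - ennreal (snd q ^ ?n / 2)"
        using pos by (subst ennreal_minus) auto
      also have "\<dots> \<le> emeasure lebesgue (qcube q) - emeasure lebesgue (\<Union>p\<in>S q. qcube p)"
        unfolding vol using S(5)[OF pos] by (intro ennreal_minus_mono) auto
      also have "\<dots> = emeasure lebesgue (E j)"
        unfolding E_def jq snd_conv using S(5)[OF pos]
        by (intro emeasure_Diff[symmetric] mS pos sub) (auto simp: top_unique)
      finally show ?thesis using pos gsub[OF jq(2)] mE by (auto simp: jq E_def)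
    qed
    \<comment> \<open>The part of the sparse sum from generations below \<open>N\<close>; it bounds
      the difference between \<open>T\<close> for \<open>q0\<close> and for a cube of generation
      \<open>N\<close>.\<close>
    define b where "b N x = (\<integral>\<^sup>+j. ennreal (C * qavg f (snd j)) * indicator (qcube (snd j)) x * indicator {..<N} (fst j) \<partial>count_space J)" for N x
    have bstep: "b N x + ennreal (C * qavg f q) \<le> b (Suc N) x" if "q \<in> gen N" "x \<in> qcube q" for N q x
    proof -
      have "(N, q) \<in> J" using that by (simp add: J_def)
      then have "b N x + ennreal (C * qavg f q) = b N x + (\<integral>\<^sup>+j. ennreal (C * qavg f q) * indicator {(N, q)} j \<partial>count_space J)"
        by (subst nn_integral_cmult) auto
      also have "\<dots> = (\<integral>\<^sup>+j. ennreal (C * qavg f (snd j)) * indicator (qcube (snd j)) x * indicator {..<N} (fst j)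
          + ennreal (C * qavg f q) * indicator {(N, q)} j \<partial>count_space J)"
        unfolding b_def by (subst nn_integral_add) auto
      also have "\<dots> \<le> b (Suc N) x"
        unfolding b_def using that(2) by (intro nn_integral_mono) (auto simp: indicator_def)
      finally show ?thesis .
    qed
    have bfull: "b N x \<le> (\<integral>\<^sup>+j. ennreal (C * qavg f (snd j)) * indicator (qcube (snd j)) x \<partial>count_space J)" for N x
      unfolding b_def by (intro nn_integral_mono) (auto simp: indicator_def)
    let ?T0 = "T (rst (qball q0) f)"
    have chain: "\<forall>q\<in>gen N. AE x in lebesgue. x \<in> qcube q \<longrightarrow> ennreal (norm (?T0 x - T (rst (qball q) f) x)) \<le> b N x" for N
    proof (induction N)
      case 0
      then show ?case by (simp add: gen0)
    next
      case (Suc N)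
      show ?case
      proof
        fix p assume "p \<in> gen (Suc N)"
        then obtain q where q: "q \<in> gen N" "p \<in> S q" unfolding genS by blast
        have "AE x in lebesgue. x \<in> qcube q \<longrightarrow> ennreal (norm (?T0 x - T (rst (qball q) f) x)) \<le> b N x"
          using Suc q by blast
        moreover have "AE x in lebesgue. x \<in> qcube p \<longrightarrow> norm (T (rst (qball q) f) x - T (rst (qball p) f) x) \<le> C * qavg f q"
          by (rule S(7)[OF gpos[OF q(1)] q(2)])
        ultimately show "AE x in lebesgue. x \<in> qcube p \<longrightarrow> ennreal (norm (?T0 x - T (rst (qball p) f) x)) \<le> b (Suc N) x"
        proof eventually_elim
          case (elim x)
          show ?case
          proof
            assume xp: "x \<in> qcube p"
            then have xq: "x \<in> qcube q" using S(3)[OF gpos[OF q(1)] q(2)] by blast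
            have "norm (?T0 x - T (rst (qball p) f) x) \<le> norm (?T0 x - T (rst (qball q) f) x) + norm (T (rst (qball q) f) x - T (rst (qball p) f) x)"
              using norm_triangle_ineq[of "?T0 x - T (rst (qball q) f) x" "T (rst (qball q) f) x - T (rst (qball p) f) x"] by simp
            then have "ennreal (norm (?T0 x - T (rst (qball p) f) x)) \<le> ennreal (norm (?T0 x - T (rst (qball q) f) x)) + ennreal (norm (T (rst (qball q) f) x - T (rst (qball p) f) x))"
              by (simp add: ennreal_leI flip: ennreal_plus)
            also have "\<dots> \<le> b N x + ennreal (C * qavg f q)"
              using elim xp xq by (intro add_mono ennreal_leI) auto
            also have "\<dots> \<le> b (Suc N) x" by (rule bstep[OF q(1) xq])
            finally show "ennreal (norm (?T0 x - T (rst (qball p) f) x)) \<le> b (Suc N) x" .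
          qed
        qed
      qed
    qed
    have A1: "AE x in lebesgue. \<forall>N. \<forall>q\<in>gen N. x \<in> qcube q \<longrightarrow> ennreal (norm (?T0 x - T (rst (qball q) f) x)) \<le> b N x"
      unfolding AE_all_countable using chain gcount by (intro allI AE_ball_countable') auto
    have A2: "AE x in lebesgue. \<forall>N. \<forall>q\<in>gen N. x \<in> qcube q - (\<Union>p\<in>S q. qcube p) \<longrightarrow> norm (T (rst (qball q) f) x) \<le> C * qavg f q"
      unfolding AE_all_countable using S(6)[OF gpos] gcount by (intro allI AE_ball_countable') auto
    have "AE x in lebesgue. x \<in> qcube q0 \<longrightarrow> ennreal (norm (?T0 x)) \<le>
         (\<integral>\<^sup>+j. ennreal (C * qavg f (snd j)) * indicator (qcube (snd j)) x \<partial>count_space J)"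
      using A1 A2 nullU
    proof eventually_elim
      case (elim x)
      show ?case
      proof
        assume x0: "x \<in> qcube q0"
        \<comment> \<open>The last cube containing \<open>x\<close> has generation one less. There
          \<open>x\<close> lies off the children, where the step bounds \<open>T\<close> itself and
          not only a difference.\<close>
        define N where "N = (LEAST N. x \<notin> U N)"
        have xN: "x \<notin> U N" unfolding N_def using elim(3) by (rule LeastI_ex)
        have "U 0 = qcube q0" by (simp add: U_def gen0)
        then have "N \<noteq> 0" using xN x0 by (cases "N = 0") auto
        then obtain i where i: "N = Suc i" by (cases N) auto
        have "x \<in> U i" using not_less_Least[of i "\<lambda>N. x \<notin> U N"] i by (simp add: N_def[symmetric])
        then obtain q where q: "q \<in> gen i" "x \<in> qcube q" by (auto simp: U_def)
        have "x \<notin> (\<Union>p\<in>S q. qcube p)" using xN q(1) by (auto simp: i USuc)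
        then have b2: "norm (T (rst (qball q) f) x) \<le> C * qavg f q" using elim(2) q by blast
        have b1: "ennreal (norm (?T0 x - T (rst (qball q) f) x)) \<le> b i x" using elim(1) q by blast
        have "norm (?T0 x) \<le> norm (?T0 x - T (rst (qball q) f) x) + norm (T (rst (qball q) f) x)"
          using norm_triangle_ineq[of "?T0 x - T (rst (qball q) f) x" "T (rst (qball q) f) x"] by simp
        then have "ennreal (norm (?T0 x)) \<le> ennreal (norm (?T0 x - T (rst (qball q) f) x)) + ennreal (norm (T (rst (qball q) f) x))"
          by (simp add: ennreal_leI flip: ennreal_plus)
        also have "\<dots> \<le> b i x + ennreal (C * qavg f q)" using b1 b2 by (intro add_mono ennreal_leI)
        also have "\<dots> \<le> b (Suc i) x" by (rule bstep[OF q])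
        also note bfull
        finally show "ennreal (norm (?T0 x)) \<le> (\<integral>\<^sup>+j. ennreal (C * qavg f (snd j)) * indicator (qcube (snd j)) x \<partial>count_space J)" .
      qed
    qed
    then show ?thesis using Jc props Ed by (intro exI[of _ J] exI[of _ E] conjI ballI) auto
  qed
  show ?thesis by (rule that[OF C(1) main])
qed

end

subsection \<open>Weighted norm inequalities\<close>

text \<open>Hoelder's inequality, from Young's inequality after both integrals are normalised; a
  vanishing integral is treated apart. The end exponents 0 and 1, which occur for the first and last
  term of the commutator, are included, with \<open>0 powr 0 = 0\<close> on both sides.\<close>

lemma integral_powr_interpolation:
  fixes u v :: "'a \<Rightarrow> real"
  assumes u: "integrable M u" "\<And>x. 0 \<le> u x" and v: "integrable M v" "\<And>x. 0 \<le> v x"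
    and \<theta>: "0 \<le> \<theta>" "\<theta> \<le> 1"
  shows "(LINT x|M. u x powr \<theta> * v x powr (1 - \<theta>)) \<le> (LINT x|M. u x) powr \<theta> * (LINT x|M. v x) powr (1 - \<theta>)"
    and "integrable M (\<lambda>x. u x powr \<theta> * v x powr (1 - \<theta>))"
proof -
  have [measurable]: "u \<in> borel_measurable M" "v \<in> borel_measurable M" using u v by auto
  have young: "a powr \<theta> * b powr (1 - \<theta>) \<le> \<theta> * a + (1 - \<theta>) * b" if "0 \<le> a" "0 \<le> b" for a b :: real
    using that \<theta> Youngs_inequality_0[of \<theta> "1 - \<theta>" a b] by (cases "a = 0 \<or> b = 0") auto
  show int: "integrable M (\<lambda>x. u x powr \<theta> * v x powr (1 - \<theta>))"
  proof (rule Bochner_Integration.integrable_bound)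
    show "integrable M (\<lambda>x. \<theta> * u x + (1 - \<theta>) * v x)" using u v by simp
    show "AE x in M. norm (u x powr \<theta> * v x powr (1 - \<theta>)) \<le> norm (\<theta> * u x + (1 - \<theta>) * v x)"
      using young u v \<theta> by (intro AE_I2) (simp add: abs_mult)
  qed measurable
  define \<alpha> where "\<alpha> = (LINT x|M. u x)"
  define \<beta> where "\<beta> = (LINT x|M. v x)"
  have nn: "0 \<le> \<alpha>" "0 \<le> \<beta>" unfolding \<alpha>_def \<beta>_def using u v by (auto intro: integral_nonneg_AE)
  show "(LINT x|M. u x powr \<theta> * v x powr (1 - \<theta>)) \<le> (LINT x|M. u x) powr \<theta> * (LINT x|M. v x) powr (1 - \<theta>)"
  proof (cases "\<alpha> = 0 \<or> \<beta> = 0")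
    case True
    have "AE x in M. u x powr \<theta> * v x powr (1 - \<theta>) = 0"
    proof (cases "\<alpha> = 0")
      case True
      then have "AE x in M. u x = 0"
        using u integral_nonneg_eq_0_iff_AE[of M u] by (simp add: \<alpha>_def)
      then show ?thesis by eventually_elim simp
    next
      case False
      then have "AE x in M. v x = 0"
        using \<open>\<alpha> = 0 \<or> \<beta> = 0\<close> v integral_nonneg_eq_0_iff_AE[of M v] by (simp add: \<beta>_def)
      then show ?thesis by eventually_elim simp
    qed
    then have "(LINT x|M. u x powr \<theta> * v x powr (1 - \<theta>)) = 0" by (rule integral_eq_zero_AE)
    then show ?thesis by simp
  next
    case False
    then have pos: "0 < \<alpha>" "0 < \<beta>" using nn by auto
    have "(LINT x|M. u x powr \<theta> * v x powr (1 - \<theta>)) \<le> (LINT x|M. \<alpha> powr \<theta> * \<beta> powr (1 - \<theta>) * (\<theta> / \<alpha> * u x + (1 - \<theta>) / \<beta> * v x))"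
    proof (rule integral_mono[OF int])
      show "integrable M (\<lambda>x. \<alpha> powr \<theta> * \<beta> powr (1 - \<theta>) * (\<theta> / \<alpha> * u x + (1 - \<theta>) / \<beta> * v x))"
        using u v by (intro integrable_mult_right Bochner_Integration.integrable_add) auto
      fix x
      have "u x powr \<theta> * v x powr (1 - \<theta>) = \<alpha> powr \<theta> * \<beta> powr (1 - \<theta>) * ((u x / \<alpha>) powr \<theta> * (v x / \<beta>) powr (1 - \<theta>))"
        using pos u v by (simp add: powr_divide)
      also have "\<dots> \<le> \<alpha> powr \<theta> * \<beta> powr (1 - \<theta>) * (\<theta> * (u x / \<alpha>) + (1 - \<theta>) * (v x / \<beta>))"
        using pos u v by (intro mult_left_mono young) auto
      finally show "u x powr \<theta> * v x powr (1 - \<theta>) \<le> \<alpha> powr \<theta> * \<beta> powr (1 - \<theta>) * (\<theta> / \<alpha> * u x + (1 - \<theta>) / \<beta> * v x)"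
        by simp
    qed
    also have "\<dots> = \<alpha> powr \<theta> * \<beta> powr (1 - \<theta>) * (\<theta> / \<alpha> * \<alpha> + (1 - \<theta>) / \<beta> * \<beta>)"
      using u v by (simp add: \<alpha>_def \<beta>_def)
    also have "\<dots> = \<alpha> powr \<theta> * \<beta> powr (1 - \<theta>)" using pos by simp
    finally show ?thesis by (simp add: \<alpha>_def \<beta>_def)
  qed
qed

text \<open>The A_p condition for \<open>w\<close> and its dual weight \<sigma> = w^(-1/(p-1)), kept
  as a pair so that duality becomes an exchange and interpolation acts on both alike. Integrals in
  place of averages produce the factor (h^n)^p.\<close>

definition Ap_pair :: "real \<Rightarrow> real \<Rightarrow> (real ^ 'n \<Rightarrow> real) \<Rightarrow> (real ^ 'n \<Rightarrow> real) \<Rightarrow> bool" where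
  "Ap_pair p B w \<sigma> \<longleftrightarrow> weight w \<and> weight \<sigma> \<and> (AE x in lebesgue. 0 < w x) \<and> (AE x in lebesgue. 0 < \<sigma> x) \<and>
     (AE x in lebesgue. w x * \<sigma> x powr (p - 1) = 1) \<and> 0 \<le> B \<and>
     (\<forall>a h. 0 < h \<longrightarrow> (LINT x:cube a h|lebesgue. w x) * (LINT x:cube a h|lebesgue. \<sigma> x) powr (p - 1)
        \<le> B * (h ^ CARD('n)) powr p)"

lemma weight_set_integral_nonneg: "weight w \<Longrightarrow> 0 \<le> (LINT x:S|lebesgue. w x)"
  unfolding set_lebesgue_integral_def weight_def by (intro integral_nonneg_AE) auto

lemma weight_measurable: "weight w \<Longrightarrow> w \<in> borel_measurable lebesgue"
  by (simp add: weight_def locally_integrable_measurable)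

lemma weight_set_integrable:
  assumes "weight w" "bounded S" "S \<in> sets lebesgue"
  shows "integrable lebesgue (\<lambda>x. indicator S x * w x)"
  using locally_integrable_set_integrable[of w S] assms by (simp add: weight_def set_integrable_def)

lemma weight_set_integral_mono:
  assumes w: "weight w" and "S \<subseteq> S'" "bounded S'" "S \<in> sets lebesgue" "S' \<in> sets lebesgue"
  shows "(LINT x:S|lebesgue. w x) \<le> (LINT x:S'|lebesgue. w x)"
proof -
  have "bounded S" using assms bounded_subset by blast
  then show ?thesis unfolding set_lebesgue_integral_def real_scaleR_def
    using assms by (intro integral_mono weight_set_integrable) (auto simp: indicator_def weight_def)
qed

lemma A_class_imp_Ap_pair:
  fixes w :: "real ^ 'n \<Rightarrow> real"
  assumes w: "A_class p w" and p: "1 < p"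
  obtains B where "Ap_pair p B w (\<lambda>x. w x powr (- 1 / (p - 1)))"
proof -
  define \<sigma> where "\<sigma> x = w x powr (- 1 / (p - 1))" for x
  have s: "\<sigma> = (\<lambda>x. w x powr (- 1 / (p - 1)))" by (simp add: \<sigma>_def fun_eq_iff)
  have ww: "weight w" and pos: "AE x in lebesgue. 0 < w x" and ws: "weight \<sigma>"
    using w unfolding A_class_def weight_def s by auto
  obtain B where B: "\<And>Q. Q \<in> cubes \<Longrightarrow> average w Q * average \<sigma> Q powr (p - 1) \<le> B"
    using w unfolding A_class_def bdd_above_def \<sigma>_def by auto
  have pos2: "AE x in lebesgue. 0 < \<sigma> x" using pos by eventually_elim (simp add: \<sigma>_def)
  have one: "AE x in lebesgue. w x * \<sigma> x powr (p - 1) = 1"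
    using pos
  proof eventually_elim
    case (elim x)
    have "\<sigma> x powr (p - 1) = w x powr (- 1)" unfolding \<sigma>_def powr_powr using p by simp
    then show ?case using elim by (simp add: powr_minus)
  qed
  have bd: "(LINT x:cube a h|lebesgue. w x) * (LINT x:cube a h|lebesgue. \<sigma> x) powr (p - 1) \<le> max 0 B * (h ^ CARD('n)) powr p"
    if h: "0 < h" for a h
  proof -
    define q where "q = h ^ CARD('n)"
    have q: "0 < q" using h by (simp add: q_def)
    define W where "W = (LINT x:cube a h|lebesgue. w x)"
    define S where "S = (LINT x:cube a h|lebesgue. \<sigma> x)"
    have nn: "0 \<le> W" "0 \<le> S" unfolding W_def S_def using ww ws by (auto intro: weight_set_integral_nonneg)
    have "cube a h \<in> cubes" using h by (auto simp: cubes_def)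
    then have "(1/q * W) * (1/q * S) powr (p - 1) \<le> B"
      using B[of "cube a h"] measure_lebesgue_cube[OF h, of a]
      by (simp only: average_def W_def S_def q_def)
    then have "(1/q * W) * (1/q * S) powr (p - 1) * q powr p \<le> max 0 B * q powr p"
      by (intro mult_right_mono) auto
    moreover have "(1/q * W) * (1/q * S) powr (p - 1) * q powr p = W * S powr (p - 1)"
    proof -
      have "(1/q * S) powr (p - 1) = S powr (p - 1) / q powr (p - 1)" using q nn by (simp add: powr_divide)
      moreover have "q powr p = q * q powr (p - 1)" using q by (simp add: powr_mult_base)
      ultimately show ?thesis using q by simp
    qed
    ultimately show ?thesis unfolding W_def S_def q_def by linarith
  qed
  show ?thesis
    by (rule that[of "max 0 B"]) (use ww ws pos pos2 one bd in \<open>auto simp: Ap_pair_def \<sigma>_def[abs_def]\<close>)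
qed

text \<open>The dual exponent minus one is 1/(p-1), and raising the conditions to this power
  exchanges the roles of the two weights.\<close>

lemma Ap_pair_dual:
  fixes w \<sigma> :: "real ^ 'n \<Rightarrow> real"
  assumes A: "Ap_pair p B w \<sigma>" and p: "1 < p"
  shows "Ap_pair (p / (p - 1)) (B powr (1 / (p - 1))) \<sigma> w"
proof -
  have e: "p / (p - 1) - 1 = 1 / (p - 1)" using p by (simp add: field_simps)
  have w: "weight w" "weight \<sigma>" and pw: "AE x in lebesgue. 0 < w x" "AE x in lebesgue. 0 < \<sigma> x"
    and one: "AE x in lebesgue. w x * \<sigma> x powr (p - 1) = 1" and B: "0 \<le> B"
    and bd: "\<And>a h. 0 < h \<Longrightarrow> (LINT x:cube a h|lebesgue. w x) * (LINT x:cube a h|lebesgue. \<sigma> x) powr (p - 1)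
        \<le> B * (h ^ CARD('n)) powr p"
    using A by (auto simp: Ap_pair_def)
  have "AE x in lebesgue. \<sigma> x * w x powr (1 / (p - 1)) = 1"
    using pw one
  proof eventually_elim
    case (elim x)
    have "(w x * \<sigma> x powr (p - 1)) powr (1 / (p - 1)) = w x powr (1 / (p - 1)) * \<sigma> x"
      using elim(1,2) p by (simp add: powr_mult powr_powr)
    moreover have "(w x * \<sigma> x powr (p - 1)) powr (1 / (p - 1)) = 1" using elim(3) by simp
    ultimately show ?case by (simp only: mult.commute)
  qed
  moreover have "(LINT x:cube a h|lebesgue. \<sigma> x) * (LINT x:cube a h|lebesgue. w x) powr (1 / (p - 1))
        \<le> B powr (1 / (p - 1)) * (h ^ CARD('n)) powr (p / (p - 1))" if h: "0 < h" for a h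
  proof -
    define W where "W = (LINT x:cube a h|lebesgue. w x)"
    define S where "S = (LINT x:cube a h|lebesgue. \<sigma> x)"
    have nn: "0 \<le> W" "0 \<le> S" unfolding W_def S_def using w by (auto intro: weight_set_integral_nonneg)
    have "(W * S powr (p - 1)) powr (1 / (p - 1)) \<le> (B * (h ^ CARD('n)) powr p) powr (1 / (p - 1))"
      using bd[OF h, of a] p nn unfolding W_def[symmetric] S_def[symmetric] by (intro powr_mono2) auto
    moreover have "(W * S powr (p - 1)) powr (1 / (p - 1)) = S * W powr (1 / (p - 1))"
      using nn p by (simp add: powr_mult powr_powr)
    moreover have "(B * (h ^ CARD('n)) powr p) powr (1 / (p - 1)) = B powr (1 / (p - 1)) * (h ^ CARD('n)) powr (p / (p - 1))"
      using B by (simp add: powr_mult powr_powr)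
    ultimately show ?thesis unfolding W_def S_def by simp
  qed
  ultimately show ?thesis using w pw unfolding Ap_pair_def e by simp
qed

lemma set_integral_powr_interpolation:
  fixes u v :: "real ^ 'n \<Rightarrow> real"
  assumes u: "weight u" and v: "weight v" and S: "bounded S" "S \<in> sets lebesgue"
    and \<theta>: "0 \<le> \<theta>" "\<theta> \<le> 1"
  shows "(LINT x:S|lebesgue. u x powr \<theta> * v x powr (1 - \<theta>))
     \<le> (LINT x:S|lebesgue. u x) powr \<theta> * (LINT x:S|lebesgue. v x) powr (1 - \<theta>)"
    and "set_integrable lebesgue S (\<lambda>x. u x powr \<theta> * v x powr (1 - \<theta>))"
proof -
  have eq: "(indicator S x * u x) powr \<theta> * (indicator S x * v x) powr (1 - \<theta>) = indicator S x *\<^sub>R (u x powr \<theta> * v x powr (1 - \<theta>))" for x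
    by (auto simp: indicator_def)
  have nn: "0 \<le> indicat_real S x * u x" "0 \<le> indicat_real S x * v x" for x
    using u v by (auto simp: weight_def)
  note i = integral_powr_interpolation[OF weight_set_integrable[OF u S] nn(1) weight_set_integrable[OF v S] nn(2) \<theta>]
  show "(LINT x:S|lebesgue. u x powr \<theta> * v x powr (1 - \<theta>))
     \<le> (LINT x:S|lebesgue. u x) powr \<theta> * (LINT x:S|lebesgue. v x) powr (1 - \<theta>)"
    using i(1) unfolding eq set_lebesgue_integral_def by simp
  show "set_integrable lebesgue S (\<lambda>x. u x powr \<theta> * v x powr (1 - \<theta>))"
    using i(2) unfolding eq set_integrable_def .
qed

lemma weight_interpolation:
  fixes u v :: "real ^ 'n \<Rightarrow> real"
  assumes "weight u" "weight v" "0 \<le> \<theta>" "\<theta> \<le> 1"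
  shows "weight (\<lambda>x. u x powr \<theta> * v x powr (1 - \<theta>))"
  using assms set_integral_powr_interpolation(2)[of u v _ \<theta>]
  by (auto simp: weight_def locally_integrable_def compact_imp_bounded fmeasurableD lmeasurable_compact)

text \<open>Hoelder's inequality is applied to each factor of the A_p product; the exponents then
  regroup into a geometric mean of the two given products, which is \<open>alg\<close>.\<close>

lemma Ap_pair_interpolation:
  fixes w v \<sigma> \<tau> :: "real ^ 'n \<Rightarrow> real"
  assumes A: "Ap_pair p B w \<sigma>" and A': "Ap_pair p B' v \<tau>" and p: "1 < p" and \<theta>: "0 \<le> \<theta>" "\<theta> \<le> 1"
  shows "Ap_pair p (B powr \<theta> * B' powr (1 - \<theta>)) (\<lambda>x. w x powr \<theta> * v x powr (1 - \<theta>)) (\<lambda>x. \<sigma> x powr \<theta> * \<tau> x powr (1 - \<theta>))"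
proof -
  have w: "weight w" "weight \<sigma>" and pw: "AE x in lebesgue. 0 < w x" "AE x in lebesgue. 0 < \<sigma> x"
    and one: "AE x in lebesgue. w x * \<sigma> x powr (p - 1) = 1" and B: "0 \<le> B"
    and bd: "\<And>a h. 0 < h \<Longrightarrow> (LINT x:cube a h|lebesgue. w x) * (LINT x:cube a h|lebesgue. \<sigma> x) powr (p - 1)
        \<le> B * (h ^ CARD('n)) powr p"
    using A by (auto simp: Ap_pair_def)
  have v: "weight v" "weight \<tau>" and pv: "AE x in lebesgue. 0 < v x" "AE x in lebesgue. 0 < \<tau> x"
    and one': "AE x in lebesgue. v x * \<tau> x powr (p - 1) = 1" and B': "0 \<le> B'"
    and bd': "\<And>a h. 0 < h \<Longrightarrow> (LINT x:cube a h|lebesgue. v x) * (LINT x:cube a h|lebesgue. \<tau> x) powr (p - 1)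
        \<le> B' * (h ^ CARD('n)) powr p"
    using A' by (auto simp: Ap_pair_def)
  have alg: "(a powr \<theta> * b powr (1 - \<theta>)) * (c powr \<theta> * d powr (1 - \<theta>)) powr (p - 1) =
     (a * c powr (p - 1)) powr \<theta> * (b * d powr (p - 1)) powr (1 - \<theta>)"
    if "0 \<le> a" "0 \<le> b" "0 \<le> c" "0 \<le> d" for a b c d :: real
    using that by (simp add: powr_mult powr_powr mult_ac)
  have one2: "AE x in lebesgue. (w x powr \<theta> * v x powr (1 - \<theta>)) * (\<sigma> x powr \<theta> * \<tau> x powr (1 - \<theta>)) powr (p - 1) = 1"
    using pw pv one one' by eventually_elim (simp add: alg)
  have p1: "AE x in lebesgue. 0 < w x powr \<theta> * v x powr (1 - \<theta>)" using pw(1) pv(1) by eventually_elim simp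
  have p2: "AE x in lebesgue. 0 < \<sigma> x powr \<theta> * \<tau> x powr (1 - \<theta>)" using pw(2) pv(2) by eventually_elim simp
  have bd2: "(LINT x:cube a h|lebesgue. w x powr \<theta> * v x powr (1 - \<theta>)) * (LINT x:cube a h|lebesgue. \<sigma> x powr \<theta> * \<tau> x powr (1 - \<theta>)) powr (p - 1)
        \<le> (B powr \<theta> * B' powr (1 - \<theta>)) * (h ^ CARD('n)) powr p" if h: "0 < h" for a h
  proof -
    let ?I = "\<lambda>f. LINT x:cube a h|lebesgue. f x"
    have nn: "0 \<le> ?I w" "0 \<le> ?I \<sigma>" "0 \<le> ?I v" "0 \<le> ?I \<tau>"
      using w v by (auto intro: weight_set_integral_nonneg)
    have i1: "?I (\<lambda>x. w x powr \<theta> * v x powr (1 - \<theta>)) \<le> ?I w powr \<theta> * ?I v powr (1 - \<theta>)"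
      by (intro set_integral_powr_interpolation w v bounded_cube cube_in_sets_lebesgue \<theta>)
    have i2: "?I (\<lambda>x. \<sigma> x powr \<theta> * \<tau> x powr (1 - \<theta>)) \<le> ?I \<sigma> powr \<theta> * ?I \<tau> powr (1 - \<theta>)"
      by (intro set_integral_powr_interpolation w v bounded_cube cube_in_sets_lebesgue \<theta>)
    have n2: "0 \<le> ?I (\<lambda>x. \<sigma> x powr \<theta> * \<tau> x powr (1 - \<theta>))"
      by (intro weight_set_integral_nonneg weight_interpolation w v \<theta>)
    define q where "q = (h ^ CARD('n)) powr p"
    have q: "0 < q" using h by (simp add: q_def)
    have "?I (\<lambda>x. w x powr \<theta> * v x powr (1 - \<theta>)) * ?I (\<lambda>x. \<sigma> x powr \<theta> * \<tau> x powr (1 - \<theta>)) powr (p - 1)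
      \<le> (?I w powr \<theta> * ?I v powr (1 - \<theta>)) * (?I \<sigma> powr \<theta> * ?I \<tau> powr (1 - \<theta>)) powr (p - 1)"
      using p by (intro mult_mono i1 powr_mono2 i2 n2) auto
    also have "\<dots> = (?I w * ?I \<sigma> powr (p - 1)) powr \<theta> * (?I v * ?I \<tau> powr (p - 1)) powr (1 - \<theta>)"
      by (rule alg) (use nn in auto)
    also have "\<dots> \<le> (B * q) powr \<theta> * (B' * q) powr (1 - \<theta>)"
      unfolding q_def using bd[OF h, of a] bd'[OF h, of a] nn \<theta>
      by (intro mult_mono[OF powr_mono2 powr_mono2]) auto
    also have "\<dots> = (B powr \<theta> * B' powr (1 - \<theta>)) * (q powr \<theta> * q powr (1 - \<theta>))"
      using B B' q by (simp add: powr_mult mult_ac)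
    also have "q powr \<theta> * q powr (1 - \<theta>) = q" using q by (simp flip: powr_add)
    finally show ?thesis by (simp add: q_def)
  qed
  show ?thesis unfolding Ap_pair_def
    by (intro conjI allI impI weight_interpolation w v \<theta> p1 p2 one2 bd2) auto
qed

text \<open>Almost everywhere 1 = w^(1/p) \<sigma>^(1-1/p), so Hoelder's inequality bounds |E|^p by
  w(E) \<sigma>(E)^(p-1). Enlarging \<open>E\<close> to the cube in the \<sigma> factor brings in
  the A_p condition.\<close>

lemma Ap_pair_subset:
  fixes w \<sigma> :: "real ^ 'n \<Rightarrow> real"
  assumes A: "Ap_pair p B w \<sigma>" and p: "1 < p" and h: "0 < h"
    and E: "E \<in> sets lebesgue" "E \<subseteq> cube a h"
  shows "(LINT x:cube a h|lebesgue. w x) * measure lebesgue E powr p \<le> B * (h ^ CARD('n)) powr p * (LINT x:E|lebesgue. w x)"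
proof -
  have w: "weight w" "weight \<sigma>" and pw: "AE x in lebesgue. 0 < w x" "AE x in lebesgue. 0 < \<sigma> x"
    and one: "AE x in lebesgue. w x * \<sigma> x powr (p - 1) = 1"
    and bd: "(LINT x:cube a h|lebesgue. w x) * (LINT x:cube a h|lebesgue. \<sigma> x) powr (p - 1)
        \<le> B * (h ^ CARD('n)) powr p"
    using A h by (auto simp: Ap_pair_def)
  have bE: "bounded E" using E bounded_cube bounded_subset by blast
  let ?q = "cube a h"
  let ?W = "\<lambda>S. LINT x:S|lebesgue. w x"
  let ?S = "\<lambda>S. LINT x:S|lebesgue. \<sigma> x"
  have nn: "0 \<le> ?W S" "0 \<le> ?S S" for S using w by (auto intro: weight_set_integral_nonneg)
  have e1: "1 - 1 / p = (p - 1) / p" using p by (simp add: field_simps)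
  have "measure lebesgue E = (LINT x:E|lebesgue. 1)"
    using E by (simp add: set_lebesgue_integral_def)
  also have "\<dots> = (LINT x:E|lebesgue. w x powr (1/p) * \<sigma> x powr (1 - 1/p))"
    unfolding set_lebesgue_integral_def
  proof (rule integral_cong_AE)
    have [measurable]: "w \<in> borel_measurable lebesgue" "\<sigma> \<in> borel_measurable lebesgue" using w weight_measurable by auto
    show "(\<lambda>x. indicat_real E x *\<^sub>R (1::real)) \<in> borel_measurable lebesgue"
      using E(1) by (intro borel_measurable_scaleR borel_measurable_indicator) auto
    show "(\<lambda>x. indicat_real E x *\<^sub>R (w x powr (1/p) * \<sigma> x powr (1 - 1/p))) \<in> borel_measurable lebesgue"
      using E by (intro borel_measurable_scaleR borel_measurable_indicator) auto
    show "AE x in lebesgue. indicat_real E x *\<^sub>R 1 = indicat_real E x *\<^sub>R (w x powr (1/p) * \<sigma> x powr (1 - 1/p))"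
      using pw one
    proof eventually_elim
      case (elim x)
      have "(w x * \<sigma> x powr (p - 1)) powr (1/p) = w x powr (1/p) * \<sigma> x powr (1 - 1/p)"
        using elim(1,2) by (simp add: powr_mult powr_powr e1)
      moreover have "(w x * \<sigma> x powr (p - 1)) powr (1/p) = 1" using elim(3) by simp
      ultimately show ?case by (simp only:)
    qed
  qed
  also have "\<dots> \<le> ?W E powr (1/p) * ?S E powr (1 - 1/p)"
    using p by (intro set_integral_powr_interpolation w bE E) auto
  finally have "measure lebesgue E powr p \<le> (?W E powr (1/p) * ?S E powr (1 - 1/p)) powr p"
    using p by (intro powr_mono2) auto
  also have "\<dots> = ?W E * ?S E powr (p - 1)"
    using nn p by (simp add: powr_mult powr_powr e1)
  also have "\<dots> \<le> ?W E * ?S ?q powr (p - 1)"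
    using p nn E bounded_cube w by (intro mult_left_mono powr_mono2 weight_set_integral_mono) auto
  finally have "?W ?q * measure lebesgue E powr p \<le> ?W ?q * (?W E * ?S ?q powr (p - 1))"
    using nn by (intro mult_left_mono) auto
  also have "\<dots> = ?W E * (?W ?q * ?S ?q powr (p - 1))" by (simp add: mult_ac)
  also have "\<dots> \<le> ?W E * (B * (h ^ CARD('n)) powr p)" using bd nn by (intro mult_left_mono) auto
  finally show ?thesis by (simp add: mult_ac)
qed

section \<open>Weighted measures: doubling, and the passage to large subsets of cubes\<close>

lemma emeasure_density_weight:
  assumes w: "weight w" and S: "bounded S" "S \<in> sets lebesgue"
  shows "emeasure (density lebesgue (\<lambda>x. ennreal (w x))) S = ennreal (LINT x:S|lebesgue. w x)"
proof -
  have [measurable]: "w \<in> borel_measurable lebesgue" using w by (rule weight_measurable)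
  have "emeasure (density lebesgue (\<lambda>x. ennreal (w x))) S = (\<integral>\<^sup>+x\<in>S. ennreal (w x) \<partial>lebesgue)"
    using S by (intro emeasure_density) auto
  also have "\<dots> = (\<integral>\<^sup>+x. ennreal (indicator S x * w x) \<partial>lebesgue)"
    using w by (intro nn_integral_cong) (auto simp: indicator_def)
  also have "\<dots> = ennreal (LINT x:S|lebesgue. w x)"
    unfolding set_lebesgue_integral_def real_scaleR_def using w
    by (intro nn_integral_eq_integral weight_set_integrable S) (auto simp: weight_def)
  finally show ?thesis .
qed

definition cube_around :: "real ^ 'n \<Rightarrow> real \<Rightarrow> (real ^ 'n) set" where
  "cube_around z r = cube (\<chi> i. z $ i - r) (2 * r)"

lemma ball_subset_cube_around: "ball z r \<subseteq> cube_around z r"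
proof
  fix x assume "x \<in> ball z r"
  then have "norm (x - z) < r" by (simp add: dist_norm norm_minus_commute)
  then have "\<bar>x $ i - z $ i\<bar> < r" for i using component_le_norm_cart[of "x - z" i] by (simp add: order.strict_trans1)
  then show "x \<in> cube_around z r" by (auto simp: cube_around_def cube_def abs_less_iff algebra_simps) (smt (verit) \<open>\<And>i. \<bar>x $ i - z $ i\<bar> < r\<close>)+
qed

text \<open>\<open>Ap_pair_subset\<close> is applied to the ball of radius \<open>r\<close> in the
  concentric cube of side 10r, which contains the fivefold ball.\<close>

lemma Ap_pair_doubling:
  fixes w \<sigma> :: "real ^ 'n \<Rightarrow> real"
  assumes A: "Ap_pair p B w \<sigma>" and p: "1 < p"
  obtains D where "doubling (density lebesgue (\<lambda>x. ennreal (w x))) D"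
proof -
  let ?n = "CARD('n)"
  define V where "V = measure lborel (ball (0 :: real ^ 'n) 1)"
  have V: "V > 0" unfolding V_def by (simp add: content_ball_pos)
  have w: "weight w" and B: "0 \<le> B" using A by (auto simp: Ap_pair_def)
  let ?W = "\<lambda>S. LINT x:S|lebesgue. w x"
  define D where "D = B * (10 ^ ?n / V) powr p"
  have bl: "?W (ball z (5 * r)) \<le> D * ?W (ball z r)" if r: "0 < r" for z r
  proof -
    have "0 < 2 * (5 * r)" using r by simp
    have sub: "ball z r \<subseteq> cube_around z (5 * r)" using ball_subset_cube_around[of z "5 * r"] r by auto
    have mb: "measure lebesgue (ball z r) = r ^ ?n * V"
    proof -
      have "emeasure lebesgue (ball z r) = ennreal (r ^ ?n * V)"
        using r emeasure_lebesgue_ball[of r z] by (simp add: V_def)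
      then show ?thesis using r V by (simp add: Sigma_Algebra.measure_def)
    qed
    have q: "(2 * (5 * r)) ^ ?n = 10 ^ ?n / V * (r ^ ?n * V)"
    proof -
      have "2 * (5 * r) = 10 * r" by simp
      then have "(2 * (5 * r)) ^ ?n = 10 ^ ?n * r ^ ?n" by (simp only: power_mult_distrib)
      then show ?thesis using V by simp
    qed
    have m0: "0 < r ^ ?n * V" using r V by simp
    have "?W (cube_around z (5 * r)) * (r ^ ?n * V) powr p \<le> B * ((2 * (5 * r)) ^ ?n) powr p * ?W (ball z r)"
      using Ap_pair_subset[OF A p \<open>0 < 2 * (5 * r)\<close>, of "ball z r"] sub unfolding mb[symmetric]
      by (simp add: cube_around_def)
    also have "\<dots> = D * ?W (ball z r) * (r ^ ?n * V) powr p"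
      unfolding q D_def using V m0 by (subst powr_mult) (auto simp: mult_ac)
    finally have "?W (cube_around z (5 * r)) \<le> D * ?W (ball z r)"
      by (rule mult_right_le_imp_le) (use r V in auto)
    moreover have "?W (ball z (5 * r)) \<le> ?W (cube_around z (5 * r))"
      by (intro weight_set_integral_mono w ball_subset_cube_around) (auto simp: cube_around_def bounded_cube)
    ultimately show ?thesis by linarith
  qed
  have em: "emeasure (density lebesgue (\<lambda>x. ennreal (w x))) (ball z r) = ennreal (?W (ball z r))" for z r
    by (rule emeasure_density_weight[OF w]) auto
  have D0: "0 \<le> D" using B by (simp add: D_def)
  have "doubling (density lebesgue (\<lambda>x. ennreal (w x))) D"
    unfolding doubling_def em using D0 bl weight_set_integral_nonneg[OF w]
    by (auto simp: ennreal_leI simp flip: ennreal_mult)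
  then show ?thesis by (rule that)
qed

text \<open>Transfers a sparse term from its ball to the set \<open>E\<close>, which is disjoint
  from those of the other terms. For a cube Q around the ball, w(Q) and \<sigma>(Q) are split into
  powers 1/p and (p-1)/p: one mixed product is the A_p condition, the other passes from Q to
  \<open>E\<close> by \<open>Ap_pair_subset\<close> for the pair and for its dual.\<close>

lemma Ap_pair_cube_bound:
  fixes w \<sigma> :: "real ^ 'n \<Rightarrow> real"
  assumes A: "Ap_pair p B w \<sigma>" and p: "1 < p"
  obtains c where "0 \<le> c" "\<And>q E. 0 < snd q \<Longrightarrow> E \<in> sets lebesgue \<Longrightarrow> E \<subseteq> qcube q \<Longrightarrow> snd q ^ CARD('n) / 2 \<le> measure lebesgue E \<Longrightarrow>
    (LINT x:qball q|lebesgue. \<sigma> x) * (LINT x:qball q|lebesgue. w x) \<le>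
      c * snd q ^ CARD('n) * ((LINT x:E|lebesgue. w x) powr ((p - 1) / p) * (LINT x:E|lebesgue. \<sigma> x) powr (1 / p))"
proof -
  let ?n = "CARD('n)"
  define p' where "p' = p / (p - 1)"
  have p': "1 < p'" using p by (simp add: p'_def field_simps)
  define B' where "B' = B powr (1 / (p - 1))"
  have A': "Ap_pair p' B' \<sigma> w" unfolding p'_def B'_def by (rule Ap_pair_dual[OF A p])
  have w: "weight w" "weight \<sigma>" and B: "0 \<le> B" "0 \<le> B'" using A A' by (auto simp: Ap_pair_def)
  have bd: "\<And>a h. 0 < h \<Longrightarrow> (LINT x:cube a h|lebesgue. w x) * (LINT x:cube a h|lebesgue. \<sigma> x) powr (p - 1)
        \<le> B * (h ^ CARD('n)) powr p" using A by (auto simp: Ap_pair_def)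
  define c where "c = (8 * real ?n) ^ ?n"
  have c: "0 < c" by (simp add: c_def)
  define c1 where "c1 = B * (2 * c) powr p"
  define c2 where "c2 = B' * (2 * c) powr p'"
  have c12: "0 \<le> c1" "0 \<le> c2" using B by (auto simp: c1_def c2_def)
  define c3 where "c3 = B powr (1/p) * c * (c1 powr ((p - 1) / p) * c2 powr (1 / p))"
  have "0 \<le> c3" using c by (simp add: c3_def)
  moreover have "(LINT x:qball q|lebesgue. \<sigma> x) * (LINT x:qball q|lebesgue. w x) \<le>
      c3 * snd q ^ CARD('n) * ((LINT x:E|lebesgue. w x) powr ((p - 1) / p) * (LINT x:E|lebesgue. \<sigma> x) powr (1 / p))"
    if q: "0 < snd q" and E: "E \<in> sets lebesgue" "E \<subseteq> qcube q" "snd q ^ ?n / 2 \<le> measure lebesgue E"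
    for q :: "(real ^ 'n) \<times> real" and E
  proof -
    let ?W = "\<lambda>S. LINT x:S|lebesgue. w x"
    let ?S = "\<lambda>S. LINT x:S|lebesgue. \<sigma> x"
    have nn: "0 \<le> ?W X" "0 \<le> ?S X" for X using w by (auto intro: weight_set_integral_nonneg)
    define h where "h = snd q"
    define H where "H = h ^ ?n"
    have h: "0 < h" "0 < H" using q by (auto simp: h_def H_def)
    define Q where "Q = cube_around (fst q) (4 * real ?n * h)"
    define a where "a = (\<chi> i. fst q $ i - 4 * real ?n * h)"
    have Qc: "Q = cube a (8 * real ?n * h)" by (simp add: Q_def cube_around_def a_def mult.assoc)
    have h8: "0 < 8 * real ?n * h" using h by simp
    have vol: "(8 * real ?n * h) ^ ?n = c * H" by (simp add: c_def H_def power_mult_distrib)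
    have BQ: "qball q \<subseteq> Q" unfolding Q_def h_def by (rule ball_subset_cube_around)
    have EQ: "E \<subseteq> Q" using E(2) qcube_subset_qball[OF q] BQ by blast
    have mQ: "Q \<in> sets lebesgue" "bounded Q" unfolding Qc by (auto simp: bounded_cube)
    \<comment> \<open>\<open>E\<close> has at least half the volume of the small cube, so the volume
      of \<open>Q\<close> exceeds that of \<open>E\<close> at most by the factor 2c.\<close>
    have half: "X Q \<le> B0 * (2 * c) powr r * X E"
      if "X Q * measure lebesgue E powr r \<le> B0 * (c * H) powr r * X E" "0 \<le> X Q" "1 < r" for X :: "(real ^ 'n) set \<Rightarrow> real" and B0 r
    proof -
      have "X Q * (H / 2) powr r \<le> X Q * measure lebesgue E powr r"
        using that E(3) h by (intro mult_left_mono powr_mono2) (auto simp: H_def h_def)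
      also have "\<dots> \<le> B0 * (c * H) powr r * X E" by (rule that(1))
      also have "(c * H) powr r = (2 * c) powr r * (H / 2) powr r"
        using powr_mult[of "2 * c" "H / 2" r] c h by simp
      also have "B0 * ((2 * c) powr r * (H / 2) powr r) * X E = (B0 * (2 * c) powr r * X E) * (H / 2) powr r"
        by (simp only: mult_ac)
      finally show ?thesis by (rule mult_right_le_imp_le) (use h in auto)
    qed
    have e1: "?W Q \<le> c1 * ?W E"
      unfolding c1_def
    proof (rule half[of ?W])
      show "?W Q * measure lebesgue E powr p \<le> B * (c * H) powr p * ?W E"
        using Ap_pair_subset[OF A p h8 E(1), of a] EQ unfolding Qc vol by simp
    qed (use nn p in auto)
    have e2: "?S Q \<le> c2 * ?S E"
      unfolding c2_def
    proof (rule half[of ?S])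
      show "?S Q * measure lebesgue E powr p' \<le> B' * (c * H) powr p' * ?S E"
        using Ap_pair_subset[OF A' p' h8 E(1), of a] EQ unfolding Qc vol by simp
    qed (use nn p' in auto)
    have e3: "?W Q powr (1/p) * ?S Q powr ((p - 1) / p) \<le> B powr (1/p) * (c * H)"
    proof -
      have "(?W Q * ?S Q powr (p - 1)) powr (1/p) \<le> (B * (c * H) powr p) powr (1/p)"
        using bd[OF h8, of a] nn p unfolding Qc[symmetric] vol by (intro powr_mono2) auto
      moreover have "(?W Q * ?S Q powr (p - 1)) powr (1/p) = ?W Q powr (1/p) * ?S Q powr ((p - 1) / p)"
        using nn by (simp add: powr_mult powr_powr)
      moreover have "(B * (c * H) powr p) powr (1/p) = B powr (1/p) * (c * H)"
        using B c h p by (simp add: powr_mult powr_powr)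
      ultimately show ?thesis by simp
    qed
    have split: "x = x powr (1/p) * x powr ((p - 1) / p)" if "0 \<le> x" for x :: real
    proof -
      have "1/p + (p - 1)/p = 1" using p by (simp add: field_simps)
      then show ?thesis using that by (cases "x = 0") (simp_all flip: powr_add)
    qed
    have "?S (qball q) * ?W (qball q) \<le> ?S Q * ?W Q"
      using nn mQ BQ w by (intro mult_mono weight_set_integral_mono) auto
    also have "\<dots> = (?S Q powr (1/p) * ?S Q powr ((p - 1) / p)) * (?W Q powr (1/p) * ?W Q powr ((p - 1) / p))"
      by (rule arg_cong2[where f="(*)", OF split[OF nn(2)] split[OF nn(1)]])
    also have "\<dots> = (?W Q powr (1/p) * ?S Q powr ((p - 1) / p)) * (?W Q powr ((p - 1) / p) * ?S Q powr (1/p))"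
      by (simp only: mult_ac)
    also have "\<dots> \<le> (B powr (1/p) * (c * H)) * ((c1 * ?W E) powr ((p - 1) / p) * (c2 * ?S E) powr (1/p))"
      by (rule mult_mono[OF e3 mult_mono[OF powr_mono2[OF _ _ e1] powr_mono2[OF _ _ e2]]])
        (use nn p c12 c h in auto)
    also have "\<dots> = c3 * H * (?W E powr ((p - 1) / p) * ?S E powr (1 / p))"
      using nn c12 by (simp add: c3_def powr_mult mult_ac)
    finally show ?thesis by (simp add: H_def h_def)
  qed
  ultimately show ?thesis by (rule that)
qed

section \<open>The weighted bound from sparse domination\<close>

lemma ennreal_powr_measurable [measurable]: "(\<lambda>t. ennreal_powr t a) \<in> borel_measurable borel"
  unfolding ennreal_powr_def by measurable

lemma ennreal_powr_le_iff:
  assumes "ennreal r \<le> t" "0 \<le> r" "0 < a"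
  shows "ennreal (r powr a) \<le> ennreal_powr t a"
proof (cases t)
  case (real s)
  then have "r \<le> s" using assms by simp
  then show ?thesis using assms real by (simp add: ennreal_powr_def ennreal_leI powr_mono2)
qed (simp add: ennreal_powr_def)

lemma const_times_le_maximal_integral:
  assumes D: "doubling M D" and F: "F \<in> borel_measurable M" and a: "0 < a"
    and B: "0 < s" "s \<le> R" and E: "E \<in> sets M" "E \<subseteq> ball z s"
    and r: "ennreal r \<le> (\<integral>\<^sup>+y\<in>ball z s. F y \<partial>M) / emeasure M (ball z s)" "0 \<le> r"
  shows "ennreal (r powr a) * emeasure M E \<le> (\<integral>\<^sup>+x\<in>E. ennreal_powr (maximal_fun M F R x) a \<partial>M)"
proof -
  have "ennreal (r powr a) * emeasure M E = (\<integral>\<^sup>+x\<in>E. ennreal (r powr a) \<partial>M)"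
    using E by (intro nn_integral_cmult_indicator[symmetric])
  also have "\<dots> \<le> (\<integral>\<^sup>+x\<in>E. ennreal_powr (maximal_fun M F R x) a \<partial>M)"
  proof (intro nn_integral_mono)
    fix x
    show "ennreal (r powr a) * indicator E x \<le> ennreal_powr (maximal_fun M F R x) a * indicator E x"
    proof (cases "x \<in> E")
      case True
      then have "ennreal r \<le> maximal_fun M F R x"
        using order.trans[OF r(1) average_le_maximal_fun[OF B, where x=x and z=z and F=F and M=M]] E by auto
      then show ?thesis using True ennreal_powr_le_iff[OF _ r(2) a] by simp
    qed simp
  qed
  finally show ?thesis .
qed

context dini_cz_operator
begin

text \<open>\<open>T f\<close> is tested against its own truncated power \<open>G\<close>. Young's
  inequality splits each sparse term into a p-th power of an average of |f|/\<sigma> against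
  \<sigma> dx and a p'-th power of an average of \<open>G\<close> against w dx; over the disjoint
  sets \<open>E j\<close> these sum to maximal function integrals. The second one returns a multiple
  of the left side, which is finite thanks to the truncation and the cube, and is absorbed.\<close>

theorem T_weighted_local:
  fixes w \<sigma> :: "real ^ 'n \<Rightarrow> real"
  assumes A: "Ap_pair p B w \<sigma>" and p: "1 < p"
  obtains N where "0 < N" "\<And>f q0 R. f \<in> L12 \<Longrightarrow> 0 < snd q0 \<Longrightarrow> 0 < R \<Longrightarrow>
    (\<integral>\<^sup>+x\<in>qcube q0. ennreal (min (norm (T (rst (qball q0) f) x)) R powr p * w x) \<partial>lebesgue)
      \<le> ennreal N * (\<integral>\<^sup>+x. ennreal (norm (f x) powr p * w x) \<partial>lebesgue)"
proof -
  let ?n = "CARD('n)"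
  define p' where "p' = p / (p - 1)"
  have p': "1 < p'" using p by (simp add: p'_def field_simps)
  have pp: "1/p + 1/p' = 1" "1/p' = (p - 1)/p" "(p - 1) * p' = p" using p by (auto simp: p'_def field_simps)
  have A': "Ap_pair p' (B powr (1 / (p - 1))) \<sigma> w" unfolding p'_def by (rule Ap_pair_dual[OF A p])
  have w: "weight w" "weight \<sigma>" and pw: "AE x in lebesgue. 0 < w x" "AE x in lebesgue. 0 < \<sigma> x"
    and one: "AE x in lebesgue. w x * \<sigma> x powr (p - 1) = 1"
    using A by (auto simp: Ap_pair_def)
  have w0: "0 \<le> w x" "0 \<le> \<sigma> x" for x using w by (auto simp: weight_def)
  have mw[measurable]: "w \<in> borel_measurable lebesgue" "\<sigma> \<in> borel_measurable lebesgue" using w weight_measurable by auto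
  obtain c3 where c3: "0 \<le> c3" "\<And>q E. 0 < snd q \<Longrightarrow> E \<in> sets lebesgue \<Longrightarrow> E \<subseteq> qcube q \<Longrightarrow> snd q ^ ?n / 2 \<le> measure lebesgue E \<Longrightarrow>
    (LINT x:qball q|lebesgue. \<sigma> x) * (LINT x:qball q|lebesgue. w x) \<le>
      c3 * snd q ^ ?n * ((LINT x:E|lebesgue. w x) powr ((p - 1) / p) * (LINT x:E|lebesgue. \<sigma> x) powr (1 / p))"
    by (rule Ap_pair_cube_bound[OF A p]) (rule that)
  define Mw where "Mw = density lebesgue (\<lambda>x. ennreal (w x))"
  define Ms where "Ms = density lebesgue (\<lambda>x. ennreal (\<sigma> x))"
  have "\<exists>D. doubling Mw D" unfolding Mw_def by (rule Ap_pair_doubling[OF A p]) (rule exI)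
  then obtain Dw where Dw: "doubling Mw Dw" by blast
  have "\<exists>D. doubling Ms D" unfolding Ms_def by (rule Ap_pair_doubling[OF A' p']) (rule exI)
  then obtain Ds where Ds: "doubling Ms Ds" by blast
  have sets_M: "sets Mw = sets lebesgue" "sets Ms = sets lebesgue" by (auto simp: Mw_def Ms_def)
  have meas_M: "g \<in> borel_measurable Mw \<longleftrightarrow> g \<in> borel_measurable lebesgue" "g \<in> borel_measurable Ms \<longleftrightarrow> g \<in> borel_measurable lebesgue"
    for g :: "real ^ 'n \<Rightarrow> ennreal" by (auto simp: Mw_def Ms_def)
  have meas_M': "g \<in> borel_measurable Mw \<longleftrightarrow> g \<in> borel_measurable lebesgue" "g \<in> borel_measurable Ms \<longleftrightarrow> g \<in> borel_measurable lebesgue"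
    for g :: "real ^ 'n \<Rightarrow> real" by (auto simp: Mw_def Ms_def)
  define D1 where "D1 = 2 * Ds * 2 powr p * (4 powr (p - 1) / (1 - 2 powr (- (p - 1))))"
  define D2 where "D2 = 2 * Dw * 2 powr p' * (4 powr (p' - 1) / (1 - 2 powr (- (p' - 1))))"
  have st1: "(\<integral>\<^sup>+x. ennreal_powr (maximal_fun Ms (\<lambda>x. ennreal (g x)) R x) p \<partial>Ms) \<le> ennreal D1 * (\<integral>\<^sup>+x. ennreal (g x powr p) \<partial>Ms)"
    if "g \<in> borel_measurable lebesgue" "\<And>x. 0 \<le> g x" for g R
    unfolding D1_def by (rule maximal_fun_strong_type[OF Ds p]) (use that in \<open>auto simp: meas_M'\<close>)
  have st2: "(\<integral>\<^sup>+x. ennreal_powr (maximal_fun Mw (\<lambda>x. ennreal (g x)) R x) p' \<partial>Mw) \<le> ennreal D2 * (\<integral>\<^sup>+x. ennreal (g x powr p') \<partial>Mw)"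
    if "g \<in> borel_measurable lebesgue" "\<And>x. 0 \<le> g x" for g R
    unfolding D2_def by (rule maximal_fun_strong_type[OF Dw p']) (use that in \<open>auto simp: meas_M'\<close>)
  have Dnn: "0 \<le> D1" "0 \<le> D2"
  proof -
    have "2 powr (- (r - 1)) < 1" if "1 < r" for r :: real
      using powr_less_mono[of "- (r - 1)" 0 2] that by simp
    from this[OF p] this[OF p'] show "0 \<le> D1" "0 \<le> D2" unfolding D1_def D2_def using Ds Dw by (auto simp: doubling_def)
  qed
  obtain C where C: "0 < C" "\<And>f q0. f \<in> L12 \<Longrightarrow> 0 < snd q0 \<Longrightarrow>
    \<exists>(J :: (nat \<times> (real ^ 'n) \<times> real) set) E. countable J \<and>
      (\<forall>j\<in>J. 0 < snd (snd j) \<and> qcube (snd j) \<subseteq> qcube q0 \<and> E j \<in> sets lebesgue \<and> E j \<subseteq> qcube (snd j) \<and>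
         ennreal (snd (snd j) ^ ?n / 2) \<le> emeasure lebesgue (E j)) \<and>
      disjoint_family_on E J \<and>
      (AE x in lebesgue. x \<in> qcube q0 \<longrightarrow> ennreal (norm (T (rst (qball q0) f) x)) \<le>
         (\<integral>\<^sup>+j. ennreal (C * qavg f (snd j)) * indicator (qcube (snd j)) x \<partial>count_space J))"
    by (rule sparse_domination) (rule that)
  define \<kappa> where "\<kappa> = C * c3"
  have \<kappa>: "0 \<le> \<kappa>" using C(1) c3(1) by (simp add: \<kappa>_def)
  \<comment> \<open>The parameter of Young's inequality: with \<theta>^p' = 2 \<kappa> D2 + 1 the
    term that returns has coefficient at most 1/2.\<close>
  define \<theta> where "\<theta> = (2 * \<kappa> * D2 + 1) powr (1 / p')"
  have kD: "0 < 2 * \<kappa> * D2 + 1" using \<kappa> Dnn by (intro add_nonneg_pos) auto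
  have \<theta>: "0 < \<theta>" using kD by (simp add: \<theta>_def)
  have \<theta>p: "\<theta> powr p' = 2 * \<kappa> * D2 + 1" using kD p' by (simp add: \<theta>_def powr_powr)
  define N where "N = 2 * (\<kappa> * \<theta> powr p * D1) + 1"
  have N: "0 < N" using \<kappa> Dnn by (simp add: N_def add_nonneg_pos)
  have main: "(\<integral>\<^sup>+x\<in>qcube q0. ennreal (min (norm (T (rst (qball q0) f) x)) R powr p * w x) \<partial>lebesgue)
      \<le> ennreal N * (\<integral>\<^sup>+x. ennreal (norm (f x) powr p * w x) \<partial>lebesgue)"
    if f: "f \<in> L12" and q0: "0 < snd q0" and R: "0 < R" for f :: "real ^ 'n \<Rightarrow> complex" and q0 R
  proof -
    have [measurable]: "f \<in> borel_measurable lebesgue" by (rule L12_measurable[OF f])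
    obtain J :: "(nat \<times> (real ^ 'n) \<times> real) set" and E where J: "countable J"
      and Jp: "\<And>j. j \<in> J \<Longrightarrow> 0 < snd (snd j)" "\<And>j. j \<in> J \<Longrightarrow> qcube (snd j) \<subseteq> qcube q0"
        "\<And>j. j \<in> J \<Longrightarrow> E j \<in> sets lebesgue" "\<And>j. j \<in> J \<Longrightarrow> E j \<subseteq> qcube (snd j)"
        "\<And>j. j \<in> J \<Longrightarrow> ennreal (snd (snd j) ^ ?n / 2) \<le> emeasure lebesgue (E j)"
      and Ed: "disjoint_family_on E J"
      and dom: "AE x in lebesgue. x \<in> qcube q0 \<longrightarrow> ennreal (norm (T (rst (qball q0) f) x)) \<le>
         (\<integral>\<^sup>+j. ennreal (C * qavg f (snd j)) * indicator (qcube (snd j)) x \<partial>count_space J)"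
      using C(2)[OF f q0] by (elim exE conjE) (rule that, auto)
    define F where "F x = norm (T (rst (qball q0) f) x)" for x
    have "T (rst (qball q0) f) \<in> borel_measurable lebesgue"
      using f by (intro T_measurable L2_rst) (auto simp: L12_def)
    then have [measurable]: "F \<in> borel_measurable lebesgue" unfolding F_def by measurable
    have F0: "0 \<le> F x" for x by (simp add: F_def)
    define G where "G x = indicator (qcube q0) x * min (F x) R powr (p - 1)" for x
    have [measurable]: "(\<lambda>x. indicator (qcube q0) x :: real) \<in> borel_measurable lebesgue" by (rule borel_measurable_indicator) simp
    have G[measurable]: "G \<in> borel_measurable lebesgue" unfolding G_def by measurable
    have G0: "0 \<le> G x" for x using F0 R by (simp add: G_def)
    have GR: "G x \<le> R powr (p - 1)" for x
      using F0[of x] R p by (auto simp: G_def indicator_def intro!: powr_mono2)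
    define I where "I = (\<integral>\<^sup>+x\<in>qcube q0. ennreal (min (F x) R powr p * w x) \<partial>lebesgue)"
    define X where "X = (\<integral>\<^sup>+x. ennreal (norm (f x) powr p * w x) \<partial>lebesgue)"
    \<comment> \<open>Against \<sigma> dx it integrates to the integral of |f|, and its p-th power
      to the weighted norm, because \<sigma>^(1-p) = w almost everywhere.\<close>
    define f' where "f' x = norm (f x) / \<sigma> x" for x
    have f'[measurable]: "f' \<in> borel_measurable lebesgue" unfolding f'_def by measurable
    have f'0: "0 \<le> f' x" for x using w0 by (simp add: f'_def)
    define R0 where "R0 = 4 * real ?n * snd q0"
    define H1 where "H1 x = ennreal_powr (maximal_fun Ms (\<lambda>x. ennreal (f' x)) R0 x) p" for x
    define H2 where "H2 x = ennreal_powr (maximal_fun Mw (\<lambda>x. ennreal (G x)) R0 x) p'" for x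
    have mf: "(\<lambda>x. ennreal (f' x)) \<in> borel_measurable Ms" "(\<lambda>x. ennreal (G x)) \<in> borel_measurable Mw"
      unfolding meas_M by measurable
    have mH: "H1 \<in> borel_measurable Ms" "H2 \<in> borel_measurable Mw"
      unfolding H1_def H2_def
      using borel_measurable_maximal_fun[OF Ds mf(1), of R0] borel_measurable_maximal_fun[OF Dw mf(2), of R0]
      by measurable
    have S1: "(\<integral>\<^sup>+x. H1 x \<partial>Ms) \<le> ennreal D1 * X"
    proof -
      have "(\<integral>\<^sup>+x. ennreal (f' x powr p) \<partial>Ms) = (\<integral>\<^sup>+x. ennreal (\<sigma> x) * ennreal (f' x powr p) \<partial>lebesgue)"
        unfolding Ms_def by (rule nn_integral_density) measurable
      also have "\<dots> = X"
        unfolding X_def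
      proof (rule nn_integral_cong_AE)
        show "AE x in lebesgue. ennreal (\<sigma> x) * ennreal (f' x powr p) = ennreal (norm (f x) powr p * w x)"
          using pw one
        proof eventually_elim
          case (elim x)
          have "w x = 1 / \<sigma> x powr (p - 1)" using elim(2,3) by (simp add: field_simps)
          moreover have "\<sigma> x powr p = \<sigma> x * \<sigma> x powr (p - 1)" using elim(2) by (simp add: powr_mult_base)
          ultimately have "\<sigma> x * f' x powr p = norm (f x) powr p * w x"
            using elim(2) by (simp add: f'_def powr_divide)
          then show ?case using w0 by (simp flip: ennreal_mult)
        qed
      qed
      finally show ?thesis using st1[OF f' f'0, of R0] by (simp add: H1_def)
    qed
    have S2: "(\<integral>\<^sup>+x. H2 x \<partial>Mw) \<le> ennreal D2 * I"
    proof -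
      have "(\<integral>\<^sup>+x. ennreal (G x powr p') \<partial>Mw) = (\<integral>\<^sup>+x. ennreal (w x) * ennreal (G x powr p') \<partial>lebesgue)"
        unfolding Mw_def by (rule nn_integral_density) measurable
      also have "\<dots> = I"
        unfolding I_def
      proof (rule nn_integral_cong)
        fix x
        have "(min (F x) R powr (p - 1)) powr p' = min (F x) R powr p" by (simp add: powr_powr pp)
        then show "ennreal (w x) * ennreal (G x powr p') = ennreal (min (F x) R powr p * w x) * indicator (qcube q0) x"
          using w0 by (auto simp: G_def indicator_def mult.commute simp flip: ennreal_mult)
      qed
      finally show ?thesis using st2[OF G G0, of R0] by (simp add: H2_def)
    qed
    have Ifin: "I < \<infinity>"
    proof -
      have "I \<le> (\<integral>\<^sup>+x. ennreal (R powr p) * ennreal (indicator (qcube q0) x * w x) \<partial>lebesgue)"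
        unfolding I_def
      proof (intro nn_integral_mono)
        fix x
        have "min (F x) R powr p * w x \<le> R powr p * w x"
          using F0[of x] R p w0 by (intro mult_right_mono powr_mono2) auto
        then show "ennreal (min (F x) R powr p * w x) * indicator (qcube q0) x \<le> ennreal (R powr p) * ennreal (indicator (qcube q0) x * w x)"
          by (auto simp: indicator_def ennreal_leI simp flip: ennreal_mult')
      qed
      also have "\<dots> = ennreal (R powr p) * (\<integral>\<^sup>+x. ennreal (indicator (qcube q0) x * w x) \<partial>lebesgue)"
        by (rule nn_integral_cmult) measurable
      also have "\<dots> < \<infinity>"
      proof -
        have "integrable lebesgue (\<lambda>x. indicator (qcube q0) x * w x)"
          by (intro weight_set_integrable w bounded_cube) auto
        then have "(\<integral>\<^sup>+x. ennreal (indicator (qcube q0) x * w x) \<partial>lebesgue) < \<infinity>"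
          using w0 by (subst nn_integral_eq_integral) auto
        then show ?thesis by (simp add: ennreal_mult_less_top)
      qed
      finally show ?thesis .
    qed
    have term_bd: "ennreal (C * qavg f (snd j)) * (\<integral>\<^sup>+x\<in>qcube (snd j). ennreal (G x) \<partial>Mw) \<le>
      ennreal (\<kappa> * \<theta> powr p) * (\<integral>\<^sup>+x\<in>E j. H1 x \<partial>Ms) + ennreal (\<kappa> * \<theta> powr (- p')) * (\<integral>\<^sup>+x\<in>E j. H2 x \<partial>Mw)"
      if j: "j \<in> J" for j
    proof -
      define q where "q = snd j"
      define h where "h = snd q"
      have h: "0 < h" using Jp(1)[OF j] by (simp add: h_def q_def)
      then have hn: "0 < h ^ ?n" by simp
      have hq0: "h \<le> snd q0"
      proof -
        have "emeasure lebesgue (qcube q) \<le> emeasure lebesgue (qcube q0)"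
          using Jp(2)[OF j] by (intro emeasure_mono) (auto simp: q_def)
        then have "h ^ ?n \<le> snd q0 ^ ?n" using h q0 by (simp add: emeasure_lebesgue_cube h_def)
        then show ?thesis using q0 by (meson less_imp_le linorder_not_le power_strict_mono zero_less_card_finite h)
      qed
      have rad: "0 < 4 * real ?n * h" "4 * real ?n * h \<le> R0" using h hq0 by (auto simp: R0_def)
      have Ej: "E j \<in> sets lebesgue" "E j \<subseteq> qcube q" using Jp(3,4)[OF j] by (auto simp: q_def)
      have Eb: "E j \<subseteq> qball q" using Ej(2) qcube_subset_qball[of q] h by (auto simp: h_def)
      have bE: "bounded (E j)" using Ej(2) bounded_cube bounded_subset by blast
      have mE: "h ^ ?n / 2 \<le> measure lebesgue (E j)"
      proof -
        have "emeasure lebesgue (E j) \<le> emeasure lebesgue (qcube q)" using Ej by (intro emeasure_mono) auto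
        also have "\<dots> < \<infinity>" using h by (simp add: emeasure_lebesgue_cube h_def)
        finally have "emeasure lebesgue (E j) = ennreal (measure lebesgue (E j))" by (intro emeasure_eq_ennreal_measure) auto
        then show ?thesis using Jp(5)[OF j] by (simp add: h_def q_def)
      qed
      define sB where "sB = (LINT x:qball q|lebesgue. \<sigma> x)"
      define wB where "wB = (LINT x:qball q|lebesgue. w x)"
      define sE where "sE = (LINT x:E j|lebesgue. \<sigma> x)"
      define wE where "wE = (LINT x:E j|lebesgue. w x)"
      have nn: "0 \<le> sB" "0 \<le> wB" "0 \<le> sE" "0 \<le> wE"
        unfolding sB_def wB_def sE_def wE_def using w by (auto intro: weight_set_integral_nonneg)
      have em: "emeasure Ms (qball q) = ennreal sB" "emeasure Mw (qball q) = ennreal wB"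
        "emeasure Ms (E j) = ennreal sE" "emeasure Mw (E j) = ennreal wE"
        unfolding Ms_def Mw_def sB_def wB_def sE_def wE_def using w Ej bE by (auto intro!: emeasure_density_weight)
      define a1 where "a1 = (LINT y:qball q|lebesgue. norm (f y))"
      have a10: "0 \<le> a1" unfolding a1_def by (rule set_lint_norm_nonneg)
      have av: "qavg f q = a1 / h ^ ?n" by (simp add: qavg_def a1_def h_def)
      have i1: "(\<integral>\<^sup>+y\<in>qball q. ennreal (f' y) \<partial>Ms) = ennreal a1"
      proof -
        have "(\<integral>\<^sup>+y\<in>qball q. ennreal (f' y) \<partial>Ms) = (\<integral>\<^sup>+y. ennreal (\<sigma> y) * (ennreal (f' y) * indicator (qball q) y) \<partial>lebesgue)"
          unfolding Ms_def by (rule nn_integral_density) measurable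
        also have "\<dots> = (\<integral>\<^sup>+y\<in>qball q. ennreal (norm (f y)) \<partial>lebesgue)"
        proof (rule nn_integral_cong_AE)
          show "AE y in lebesgue. ennreal (\<sigma> y) * (ennreal (f' y) * indicator (qball q) y) = ennreal (norm (f y)) * indicator (qball q) y"
            using pw(2) by eventually_elim (auto simp: f'_def indicator_def simp flip: ennreal_mult)
        qed
        finally show ?thesis unfolding a1_def nn_integral_qball[OF f] .
      qed
      define i2 where "i2 = (\<integral>\<^sup>+y\<in>qball q. ennreal (G y) \<partial>Mw)"
      have i2le: "i2 \<le> ennreal (R powr (p - 1)) * ennreal wB"
      proof -
        have "i2 \<le> (\<integral>\<^sup>+y\<in>qball q. ennreal (R powr (p - 1)) \<partial>Mw)"
          unfolding i2_def using GR by (intro nn_integral_mono) (auto simp: indicator_def intro!: ennreal_leI)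
        also have "\<dots> = ennreal (R powr (p - 1)) * emeasure Mw (qball q)"
          by (rule nn_integral_cmult_indicator) (simp add: sets_M)
        finally show ?thesis by (simp add: em)
      qed
      then have "i2 < \<infinity>" by (rule order.strict_trans1) (simp add: ennreal_mult_less_top)
      then obtain a2 where a2: "i2 = ennreal a2" "0 \<le> a2" by (cases i2) auto
      have LHS: "ennreal (C * qavg f q) * (\<integral>\<^sup>+x\<in>qcube q. ennreal (G x) \<partial>Mw) \<le> ennreal (C * (a1 / h ^ ?n) * a2)"
      proof -
        have "(\<integral>\<^sup>+x\<in>qcube q. ennreal (G x) \<partial>Mw) \<le> i2"
          unfolding i2_def using qcube_subset_qball[of q] h by (intro nn_integral_mono) (auto simp: indicator_def h_def)
        then have "ennreal (C * qavg f q) * (\<integral>\<^sup>+x\<in>qcube q. ennreal (G x) \<partial>Mw) \<le> ennreal (C * qavg f q) * ennreal a2"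
          unfolding a2(1) by (intro mult_left_mono) auto
        then show ?thesis using C(1) a10 hn a2(2) by (simp add: av ennreal_mult[symmetric])
      qed
      show ?thesis
      proof (cases "sB = 0 \<or> wB = 0")
        \<comment> \<open>An average over a ball of zero weighted measure carries no information;
          the integral over that ball is zero, and with it the whole term.\<close>
        case True
        have "a1 = 0 \<or> a2 = 0"
        proof (cases "sB = 0")
          case True
          then have "qball q \<in> null_sets Ms" using em(1) by (auto simp: null_sets_def sets_M)
          then have "(\<integral>\<^sup>+y\<in>qball q. ennreal (f' y) \<partial>Ms) = 0" by (rule nn_integral_null_set)
          then show ?thesis using i1 a10 by simp
        next
          case False
          then have "wB = 0" using True by simp
          then show ?thesis using i2le a2 by simp
        qed
        then have "ennreal (C * (a1 / h ^ ?n) * a2) = 0" by auto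
        then have "ennreal (C * qavg f q) * (\<integral>\<^sup>+x\<in>qcube q. ennreal (G x) \<partial>Mw) = 0" using LHS by (metis le_zero_eq)
        then have "ennreal (C * qavg f (snd j)) * (\<integral>\<^sup>+x\<in>qcube (snd j). ennreal (G x) \<partial>Mw) = 0" by (simp only: q_def)
        then show ?thesis by (simp only: zero_le)
      next
        case False
        then have pos: "0 < sB" "0 < wB" using nn by auto
        define r1 where "r1 = a1 / sB"
        define r2 where "r2 = a2 / wB"
        have r0: "0 \<le> r1" "0 \<le> r2" using a10 a2 pos by (auto simp: r1_def r2_def)
        have b1: "ennreal (r1 powr p) * ennreal sE \<le> (\<integral>\<^sup>+x\<in>E j. H1 x \<partial>Ms)"
          unfolding em(3)[symmetric] H1_def
        proof (rule const_times_le_maximal_integral[OF Ds mf(1) _ rad, where z="fst q"])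
          show "E j \<subseteq> ball (fst q) (4 * real ?n * h)" using Eb by (simp add: h_def)
          have "(\<integral>\<^sup>+y\<in>ball (fst q) (4 * real ?n * h). ennreal (f' y) \<partial>Ms) / emeasure Ms (ball (fst q) (4 * real ?n * h)) = ennreal a1 / ennreal sB"
            using i1 em(1) by (simp add: h_def)
          then show "ennreal r1 \<le> (\<integral>\<^sup>+y\<in>ball (fst q) (4 * real ?n * h). ennreal (f' y) \<partial>Ms) / emeasure Ms (ball (fst q) (4 * real ?n * h))"
            using a10 pos by (simp add: r1_def divide_ennreal)
        qed (use p Ej r0 in \<open>auto simp: sets_M\<close>)
        have b2: "ennreal (r2 powr p') * ennreal wE \<le> (\<integral>\<^sup>+x\<in>E j. H2 x \<partial>Mw)"
          unfolding em(4)[symmetric] H2_def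
        proof (rule const_times_le_maximal_integral[OF Dw mf(2) _ rad, where z="fst q"])
          show "E j \<subseteq> ball (fst q) (4 * real ?n * h)" using Eb by (simp add: h_def)
          have "(\<integral>\<^sup>+y\<in>ball (fst q) (4 * real ?n * h). ennreal (G y) \<partial>Mw) / emeasure Mw (ball (fst q) (4 * real ?n * h)) = ennreal a2 / ennreal wB"
            using a2(1) em(2) by (simp add: h_def i2_def)
          then show "ennreal r2 \<le> (\<integral>\<^sup>+y\<in>ball (fst q) (4 * real ?n * h). ennreal (G y) \<partial>Mw) / emeasure Mw (ball (fst q) (4 * real ?n * h))"
            using a2 pos by (simp add: r2_def divide_ennreal)
        qed (use p' Ej r0 in \<open>auto simp: sets_M\<close>)
        have "C * (a1 / h ^ ?n) * a2 = C * (r1 * r2) * (sB * wB) / h ^ ?n"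
          using pos by (simp add: r1_def r2_def)
        also have "\<dots> \<le> C * (r1 * r2) * (c3 * h ^ ?n * (wE powr ((p - 1) / p) * sE powr (1 / p))) / h ^ ?n"
          using c3(2)[of q "E j"] h Ej mE C(1) r0 hn
          by (intro divide_right_mono mult_left_mono) (auto simp: sB_def wB_def sE_def wE_def h_def)
        also have "\<dots> = \<kappa> * ((r1 * sE powr (1/p)) * (r2 * wE powr (1/p')))"
          using h hn by (simp add: \<kappa>_def pp mult_ac)
        also have "\<dots> = \<kappa> * ((\<theta> * (r1 * sE powr (1/p))) * (r2 * wE powr (1/p') / \<theta>))"
          using \<theta> by simp
        also have "\<dots> \<le> \<kappa> * ((\<theta> * (r1 * sE powr (1/p))) powr p / p + (r2 * wE powr (1/p') / \<theta>) powr p' / p')"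
          using \<theta> r0 nn \<kappa> p p' pp by (intro mult_left_mono Youngs_inequality) auto
        also have "\<dots> \<le> \<kappa> * ((\<theta> * (r1 * sE powr (1/p))) powr p + (r2 * wE powr (1/p') / \<theta>) powr p')"
        proof -
          have "u / r \<le> u" if "0 \<le> u" "1 < r" for u r :: real using that by (simp add: divide_le_eq mult_le_cancel_left1)
          then show ?thesis using \<kappa> p p' by (intro mult_left_mono add_mono) auto
        qed
        also have "(\<theta> * (r1 * sE powr (1/p))) powr p = \<theta> powr p * (r1 powr p * sE)"
          using \<theta> r0 nn p by (simp add: powr_mult powr_powr)
        also have "(r2 * wE powr (1/p') / \<theta>) powr p' = \<theta> powr (- p') * (r2 powr p' * wE)"
          using \<theta> r0 nn p' by (simp add: powr_mult powr_powr powr_divide powr_minus field_simps)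
        finally have fin: "C * (a1 / h ^ ?n) * a2 \<le> \<kappa> * \<theta> powr p * (r1 powr p * sE) + \<kappa> * \<theta> powr (- p') * (r2 powr p' * wE)"
          by (simp add: distrib_left mult.assoc)
        have "ennreal (C * (a1 / h ^ ?n) * a2) \<le> ennreal (\<kappa> * \<theta> powr p) * (ennreal (r1 powr p) * ennreal sE) + ennreal (\<kappa> * \<theta> powr (- p')) * (ennreal (r2 powr p') * ennreal wE)"
          using ennreal_leI[OF fin] \<kappa> nn by (simp add: ennreal_mult[symmetric] ennreal_plus[symmetric] del: ennreal_plus)
        also have "\<dots> \<le> ennreal (\<kappa> * \<theta> powr p) * (\<integral>\<^sup>+x\<in>E j. H1 x \<partial>Ms) + ennreal (\<kappa> * \<theta> powr (- p')) * (\<integral>\<^sup>+x\<in>E j. H2 x \<partial>Mw)"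
          by (intro add_mono mult_left_mono b1 b2) auto
        finally show ?thesis using LHS by (auto simp: q_def intro: order.trans)
      qed
    qed
    have sum_E: "(\<integral>\<^sup>+j. (\<integral>\<^sup>+x\<in>E j. H x \<partial>M) \<partial>count_space J) \<le> (\<integral>\<^sup>+x. H x \<partial>M)"
      if "H \<in> borel_measurable M" "sets M = sets lebesgue" for H and M :: "(real ^ 'n) measure"
    proof -
      have "(\<integral>\<^sup>+j. (\<integral>\<^sup>+x\<in>E j. H x \<partial>M) \<partial>count_space J) = (\<integral>\<^sup>+x\<in>(\<Union>j\<in>J. E j). H x \<partial>M)"
        using that J Ed Jp(3) by (intro nn_integral_UN_disjoint_count_space) auto
      also have "\<dots> \<le> (\<integral>\<^sup>+x. H x \<partial>M)" by (intro nn_integral_mono) (auto simp: indicator_def)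
      finally show ?thesis .
    qed
    \<comment> \<open>One of the p factors of min(F, R) is bounded by \<open>F\<close> and then by
      the sparse sum; the remaining power p - 1 is \<open>G\<close>.\<close>
    have step1: "I \<le> (\<integral>\<^sup>+j. ennreal (C * qavg f (snd j)) * (\<integral>\<^sup>+x\<in>qcube (snd j). ennreal (G x) \<partial>Mw) \<partial>count_space J)"
    proof -
      have "I \<le> (\<integral>\<^sup>+x. (\<integral>\<^sup>+j. ennreal (C * qavg f (snd j)) * indicator (qcube (snd j)) x \<partial>count_space J) * (ennreal (w x) * ennreal (G x)) \<partial>lebesgue)"
        unfolding I_def
      proof (intro nn_integral_mono_AE)
        show "AE x in lebesgue. ennreal (min (F x) R powr p * w x) * indicator (qcube q0) x \<le>
           (\<integral>\<^sup>+j. ennreal (C * qavg f (snd j)) * indicator (qcube (snd j)) x \<partial>count_space J) * (ennreal (w x) * ennreal (G x))"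
          using dom
        proof eventually_elim
          case (elim x)
          show ?case
          proof (cases "x \<in> qcube q0")
            case True
            have "min (F x) R powr p = min (F x) R * min (F x) R powr (p - 1)"
              using F0[of x] R by (cases "F x = 0") (auto simp: powr_mult_base)
            also have "\<dots> \<le> F x * min (F x) R powr (p - 1)" by (intro mult_right_mono) auto
            finally have "min (F x) R powr p * w x \<le> (F x * min (F x) R powr (p - 1)) * w x"
              by (rule mult_right_mono) (rule w0)
            also have "\<dots> = F x * (w x * G x)" using True by (simp add: G_def)
            finally have "min (F x) R powr p * w x \<le> F x * (w x * G x)" .
            then have "ennreal (min (F x) R powr p * w x) \<le> ennreal (F x) * (ennreal (w x) * ennreal (G x))"
              using F0 w0 G0 by (simp add: ennreal_mult[symmetric] ennreal_leI)
            also have "\<dots> \<le> (\<integral>\<^sup>+j. ennreal (C * qavg f (snd j)) * indicator (qcube (snd j)) x \<partial>count_space J) * (ennreal (w x) * ennreal (G x))"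
              using elim True unfolding F_def by (intro mult_right_mono) auto
            finally show ?thesis using True by simp
          qed simp
        qed
      qed
      also have "\<dots> = (\<integral>\<^sup>+x. \<integral>\<^sup>+j. ennreal (C * qavg f (snd j)) * indicator (qcube (snd j)) x * (ennreal (w x) * ennreal (G x)) \<partial>count_space J \<partial>lebesgue)"
        by (intro nn_integral_cong nn_integral_multc[symmetric]) simp
      also have "\<dots> = (\<integral>\<^sup>+j. \<integral>\<^sup>+x. ennreal (C * qavg f (snd j)) * indicator (qcube (snd j)) x * (ennreal (w x) * ennreal (G x)) \<partial>lebesgue \<partial>count_space J)"
        using J by (intro nn_integral_count_space_nn_integral) measurable
      also have "\<dots> = (\<integral>\<^sup>+j. ennreal (C * qavg f (snd j)) * (\<integral>\<^sup>+x\<in>qcube (snd j). ennreal (G x) \<partial>Mw) \<partial>count_space J)"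
      proof (intro nn_integral_cong)
        fix j
        have "(\<integral>\<^sup>+x. ennreal (C * qavg f (snd j)) * indicator (qcube (snd j)) x * (ennreal (w x) * ennreal (G x)) \<partial>lebesgue)
          = (\<integral>\<^sup>+x. ennreal (C * qavg f (snd j)) * (ennreal (w x) * (ennreal (G x) * indicator (qcube (snd j)) x)) \<partial>lebesgue)"
          by (intro nn_integral_cong) (simp only: mult_ac)
        also have "\<dots> = ennreal (C * qavg f (snd j)) * (\<integral>\<^sup>+x. ennreal (w x) * (ennreal (G x) * indicator (qcube (snd j)) x) \<partial>lebesgue)"
          by (rule nn_integral_cmult) measurable
        also have "(\<integral>\<^sup>+x. ennreal (w x) * (ennreal (G x) * indicator (qcube (snd j)) x) \<partial>lebesgue) = (\<integral>\<^sup>+x\<in>qcube (snd j). ennreal (G x) \<partial>Mw)"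
          unfolding Mw_def by (rule nn_integral_density[symmetric]) measurable
        finally show "(\<integral>\<^sup>+x. ennreal (C * qavg f (snd j)) * indicator (qcube (snd j)) x * (ennreal (w x) * ennreal (G x)) \<partial>lebesgue)
          = ennreal (C * qavg f (snd j)) * (\<integral>\<^sup>+x\<in>qcube (snd j). ennreal (G x) \<partial>Mw)" .
      qed
      finally show ?thesis .
    qed
    also have "\<dots> \<le> (\<integral>\<^sup>+j. ennreal (\<kappa> * \<theta> powr p) * (\<integral>\<^sup>+x\<in>E j. H1 x \<partial>Ms) + ennreal (\<kappa> * \<theta> powr (- p')) * (\<integral>\<^sup>+x\<in>E j. H2 x \<partial>Mw) \<partial>count_space J)"
      by (intro nn_integral_mono term_bd) auto
    also have "\<dots> = ennreal (\<kappa> * \<theta> powr p) * (\<integral>\<^sup>+j. (\<integral>\<^sup>+x\<in>E j. H1 x \<partial>Ms) \<partial>count_space J) +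
        ennreal (\<kappa> * \<theta> powr (- p')) * (\<integral>\<^sup>+j. (\<integral>\<^sup>+x\<in>E j. H2 x \<partial>Mw) \<partial>count_space J)"
      by (simp add: nn_integral_add nn_integral_cmult)
    also have "\<dots> \<le> ennreal (\<kappa> * \<theta> powr p) * (ennreal D1 * X) + ennreal (\<kappa> * \<theta> powr (- p')) * (ennreal D2 * I)"
      by (intro add_mono mult_left_mono order.trans[OF sum_E S1] order.trans[OF sum_E S2] mH sets_M) auto
    finally have fin: "I \<le> ennreal (\<kappa> * \<theta> powr p) * (ennreal D1 * X) + ennreal (\<kappa> * \<theta> powr (- p')) * (ennreal D2 * I)" .
    have "I \<le> ennreal N * X"
    proof (cases X)
      case top
      then show ?thesis using N by (simp add: ennreal_mult_top)
    next
      case (real x)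
      obtain t where t: "I = ennreal t" "0 \<le> t" using Ifin by (cases I) auto
      define k where "k = \<kappa> * \<theta> powr (- p') * D2"
      have k: "k \<le> 1/2"
      proof -
        have "k = \<kappa> * D2 / (2 * \<kappa> * D2 + 1)" using \<theta>p by (simp add: k_def powr_minus field_simps)
        also have "\<dots> \<le> 1/2" using kD by (simp add: divide_le_eq)
        finally show ?thesis .
      qed
      have "ennreal t \<le> ennreal (\<kappa> * \<theta> powr p * D1 * x + k * t)"
        using fin \<kappa> Dnn real t unfolding k_def
        by (simp add: ennreal_mult[symmetric] ennreal_plus[symmetric] mult.assoc del: ennreal_plus)
      then have "t \<le> \<kappa> * \<theta> powr p * D1 * x + k * t"
        using \<kappa> Dnn real t by (subst (asm) ennreal_le_iff) (auto simp: k_def)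
      moreover have "k * t \<le> 1/2 * t" using k t by (intro mult_right_mono) auto
      ultimately have "t \<le> 2 * (\<kappa> * \<theta> powr p * D1) * x" by (simp add: mult.assoc)
      also have "\<dots> \<le> N * x" using real by (simp add: N_def distrib_right)
      finally show ?thesis using t real N by (simp add: ennreal_leI flip: ennreal_mult)
    qed
    then show ?thesis unfolding I_def X_def F_def .
  qed
  show ?thesis by (rule that[OF N main])
qed

end

subsection \<open>Iterated commutators\<close>

text \<open>The expansion is formal, hence available for any map \<open>S\<close>; the recursion for
  \<open>d\<close> is Pascal's rule with signs. The value c 0 = 1 is recorded because the term k = 0
  is the one that survives in the upper bound.\<close>

lemma commutator_expansion:
  "\<exists>c :: nat \<Rightarrow> real. c 0 = 1 \<and> (\<forall>(b :: real ^ 'n \<Rightarrow> real) S f x. (commutator b ^^ m) S f x =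
     (\<Sum>k\<le>m. of_real (c k * b x ^ (m - k)) * S (\<lambda>y. of_real (b y ^ k) * f y) x))"
proof (induction m)
  case 0
  show ?case by (intro exI[of _ "\<lambda>_. 1"]) simp
next
  case (Suc m)
  then obtain c :: "nat \<Rightarrow> real" where c0: "c 0 = 1" and c: "\<And>(b :: real ^ 'n \<Rightarrow> real) S f x. (commutator b ^^ m) S f x =
     (\<Sum>k\<le>m. of_real (c k * b x ^ (m - k)) * S (\<lambda>y. of_real (b y ^ k) * f y) x)" by blast
  define d where "d k = (if k \<le> m then c k else 0) - (if k = 0 then 0 else c (k - 1))" for k
  have "(commutator b ^^ Suc m) S f x =
     (\<Sum>k\<le>Suc m. of_real (d k * b x ^ (Suc m - k)) * S (\<lambda>y. of_real (b y ^ k) * f y) x)" for b :: "real ^ 'n \<Rightarrow> real" and S f x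
  proof -
    let ?s = "\<lambda>k. S (\<lambda>y. of_real (b y ^ k) * f y) x"
    have "(commutator b ^^ Suc m) S f x = of_real (b x) * (commutator b ^^ m) S f x - (commutator b ^^ m) S (\<lambda>y. of_real (b y) * f y) x"
      by (simp add: commutator_def)
    also have "\<dots> = of_real (b x) * (\<Sum>k\<le>m. of_real (c k * b x ^ (m - k)) * ?s k) -
       (\<Sum>k\<le>m. of_real (c k * b x ^ (m - k)) * ?s (Suc k))"
      unfolding c by (simp add: mult_ac)
    also have "of_real (b x) * (\<Sum>k\<le>m. of_real (c k * b x ^ (m - k)) * ?s k) =
       (\<Sum>k\<le>Suc m. of_real ((if k \<le> m then c k else 0) * b x ^ (Suc m - k)) * ?s k)"
      by (simp add: sum_distrib_left Suc_diff_le mult_ac)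
    also have "(\<Sum>k\<le>m. of_real (c k * b x ^ (m - k)) * ?s (Suc k)) =
       (\<Sum>k\<le>Suc m. of_real ((if k = 0 then 0 else c (k - 1)) * b x ^ (Suc m - k)) * ?s k)"
      by (subst sum.atMost_Suc_shift) simp
    also have "(\<Sum>k\<le>Suc m. of_real ((if k \<le> m then c k else 0) * b x ^ (Suc m - k)) * ?s k) -
       (\<Sum>k\<le>Suc m. of_real ((if k = 0 then 0 else c (k - 1)) * b x ^ (Suc m - k)) * ?s k) =
       (\<Sum>k\<le>Suc m. of_real (d k * b x ^ (Suc m - k)) * ?s k)"
      unfolding sum_subtractf[symmetric] d_def by (intro sum.cong refl) (simp add: left_diff_distrib)
    finally show ?thesis .
  qed
  moreover have "d 0 = 1" using c0 by (simp add: d_def)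
  ultimately show ?case by blast
qed

lemma norm_sum_powr_le:
  fixes a :: "nat \<Rightarrow> complex"
  assumes p: "0 < p"
  shows "norm (\<Sum>k\<le>m. a k) powr p \<le> real (Suc m) powr p * (\<Sum>k\<le>m. norm (a k) powr p)"
proof -
  define M where "M = Max ((\<lambda>k. norm (a k)) ` {..m})"
  have "M \<in> (\<lambda>k. norm (a k)) ` {..m}" unfolding M_def by (intro Max_in) auto
  then obtain j where j: "j \<le> m" "M = norm (a j)" by auto
  have le: "norm (a k) \<le> M" if "k \<le> m" for k unfolding M_def using that by (intro Max_ge) auto
  have "norm (\<Sum>k\<le>m. a k) \<le> (\<Sum>k\<le>m. norm (a k))" by (rule norm_sum)
  also have "\<dots> \<le> (\<Sum>k\<le>m. M)" using le by (intro sum_mono) auto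
  also have "\<dots> = real (Suc m) * M" by simp
  finally have "norm (\<Sum>k\<le>m. a k) powr p \<le> (real (Suc m) * M) powr p" using p by (intro powr_mono2) auto
  also have "\<dots> = real (Suc m) powr p * norm (a j) powr p" using j by (simp add: powr_mult)
  also have "\<dots> \<le> real (Suc m) powr p * (\<Sum>k\<le>m. norm (a k) powr p)"
    using j(1) by (intro mult_left_mono member_le_sum) auto
  finally show ?thesis .
qed

lemma ennreal_powr_le_mult:
  assumes "Y \<le> ennreal N * X" "0 < N" "0 < a"
  shows "ennreal_powr Y a \<le> ennreal (N powr a) * ennreal_powr X a"
proof (cases X)
  case top
  then show ?thesis using assms(2) by (simp add: ennreal_powr_def ennreal_mult_top)
next
  case (real x)
  then have "Y \<le> ennreal (N * x)" using assms by (simp add: ennreal_mult)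
  then obtain y where y: "Y = ennreal y" "0 \<le> y" "y \<le> N * x"
    using real assms(2) by (cases Y) (auto simp: top_unique)
  have "y powr a \<le> (N * x) powr a" using y assms by (intro powr_mono2) auto
  also have "\<dots> = N powr a * x powr a" using assms real by (simp add: powr_mult)
  finally show ?thesis using y real by (simp add: ennreal_powr_def ennreal_leI flip: ennreal_mult)
qed

context dini_cz_operator
begin

text \<open>Cubes growing around the origin contain the support of \<open>f\<close>, so the
  restriction to their balls changes nothing; Fatou's lemma removes the cube and the truncation
  together.\<close>

theorem T_weighted:
  fixes w \<sigma> :: "real ^ 'n \<Rightarrow> real"
  assumes A: "Ap_pair p B w \<sigma>" and p: "1 < p"
  obtains N where "0 < N" "\<And>f. f \<in> L12 \<Longrightarrow> bounded {x. f x \<noteq> 0} \<Longrightarrow>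
    (\<integral>\<^sup>+x. ennreal (norm (T f x) powr p * w x) \<partial>lebesgue)
      \<le> ennreal N * (\<integral>\<^sup>+x. ennreal (norm (f x) powr p * w x) \<partial>lebesgue)"
proof -
  obtain N where N: "0 < N" "\<And>f q0 R. f \<in> L12 \<Longrightarrow> 0 < snd q0 \<Longrightarrow> 0 < R \<Longrightarrow>
    (\<integral>\<^sup>+x\<in>qcube q0. ennreal (min (norm (T (rst (qball q0) f) x)) R powr p * w x) \<partial>lebesgue)
      \<le> ennreal N * (\<integral>\<^sup>+x. ennreal (norm (f x) powr p * w x) \<partial>lebesgue)"
    by (rule T_weighted_local[OF A p]) (rule that)
  have [measurable]: "w \<in> borel_measurable lebesgue" using A weight_measurable by (auto simp: Ap_pair_def)
  have "(\<integral>\<^sup>+x. ennreal (norm (T f x) powr p * w x) \<partial>lebesgue)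
      \<le> ennreal N * (\<integral>\<^sup>+x. ennreal (norm (f x) powr p * w x) \<partial>lebesgue)"
    if f: "f \<in> L12" and supp: "bounded {x. f x \<noteq> 0}" for f
  proof -
    have [measurable]: "T f \<in> borel_measurable lebesgue" using f by (intro T_measurable) (auto simp: L12_def)
    obtain r where r: "\<And>x. f x \<noteq> 0 \<Longrightarrow> norm x \<le> r" using supp by (auto simp: bounded_iff)
    obtain k0 :: nat where k0: "r < real k0" "0 < real k0" by (metis reals_Archimedean2 max_less_iff_conj)
    define q where "q k = ((\<chi> i. - real (k + k0)) :: real ^ 'n, 2 * real (k + k0))" for k
    have qc: "qcube (q k) = cube_around 0 (real (k + k0))" for k by (simp add: q_def cube_around_def)
    have qpos: "0 < snd (q k)" for k using k0 by (simp add: q_def)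
    have ballq: "ball 0 (real (k + k0)) \<subseteq> qcube (q k)" for k unfolding qc by (rule ball_subset_cube_around)
    have rf: "rst (qball (q k)) f = f" for k
    proof
      fix x
      have "x \<in> qball (q k)" if "f x \<noteq> 0"
      proof -
        have "x \<in> ball 0 (real (k + k0))" using r[OF that] k0 by simp
        then show ?thesis using ballq qcube_subset_qball[OF qpos] by blast
      qed
      then show "rst (qball (q k)) f x = f x" by (auto simp: rst_def indicator_def)
    qed
    define u where "u k x = ennreal (min (norm (T f x)) (real (k + k0)) powr p * w x) * indicator (qcube (q k)) x" for k x
    have mu[measurable]: "u k \<in> borel_measurable lebesgue" for k unfolding u_def by measurable
    have le: "(\<integral>\<^sup>+x. u k x \<partial>lebesgue) \<le> ennreal N * (\<integral>\<^sup>+x. ennreal (norm (f x) powr p * w x) \<partial>lebesgue)" for k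
      using N(2)[OF f qpos[of k], of "real (k + k0)"] k0 by (simp add: u_def rf)
    have lim: "liminf (\<lambda>k. u k x) = ennreal (norm (T f x) powr p * w x)" for x
    proof -
      obtain M :: nat where M: "max (norm (T f x)) (norm x) < real M" using reals_Archimedean2 by blast
      have "\<forall>\<^sub>F k in sequentially. u k x = ennreal (norm (T f x) powr p * w x)"
        using eventually_ge_at_top[of M]
      proof eventually_elim
        case (elim k)
        then have b: "norm (T f x) < real (k + k0)" "norm x < real (k + k0)" using M by auto
        then have "x \<in> qcube (q k)" using ballq[of k] by auto
        then show ?case using b by (simp add: u_def min_def)
      qed
      then have "(\<lambda>k. u k x) \<longlonglongrightarrow> ennreal (norm (T f x) powr p * w x)" by (rule tendsto_eventually)
      then show ?thesis by (intro lim_imp_Liminf) auto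
    qed
    have "(\<integral>\<^sup>+x. ennreal (norm (T f x) powr p * w x) \<partial>lebesgue) = (\<integral>\<^sup>+x. liminf (\<lambda>k. u k x) \<partial>lebesgue)"
      by (simp add: lim)
    also have "\<dots> \<le> liminf (\<lambda>k. \<integral>\<^sup>+x. u k x \<partial>lebesgue)" by (rule nn_integral_liminf) measurable
    also have "\<dots> \<le> ennreal N * (\<integral>\<^sup>+x. ennreal (norm (f x) powr p * w x) \<partial>lebesgue)"
      using le by (intro Liminf_le) auto
    finally show ?thesis .
  qed
  then show ?thesis by (rule that[OF N(1)])
qed

text \<open>When every b^k f is square integrable, \<open>L1_extension T\<close> is \<open>T\<close>
  itself in each term.\<close>

lemma iterated_commutator_expansion:
  "\<exists>c :: nat \<Rightarrow> real. c 0 = 1 \<and> (\<forall>b f. (\<forall>k\<le>m. (\<lambda>y. of_real (b y ^ k) * f y) \<in> L2) \<longrightarrow>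
    (\<forall>x. iterated_commutator T b m f x = (\<Sum>k\<le>m. of_real (c k * b x ^ (m - k)) * T (\<lambda>y. of_real (b y ^ k) * f y) x)))"
proof -
  obtain c :: "nat \<Rightarrow> real" where c: "c 0 = 1" "\<And>(b :: real ^ 'n \<Rightarrow> real) S f x. (commutator b ^^ m) S f x =
     (\<Sum>k\<le>m. of_real (c k * b x ^ (m - k)) * S (\<lambda>y. of_real (b y ^ k) * f y) x)"
    using commutator_expansion[of m] by blast
  have "iterated_commutator T b m f x = (\<Sum>k\<le>m. of_real (c k * b x ^ (m - k)) * T (\<lambda>y. of_real (b y ^ k) * f y) x)"
    if "\<forall>k\<le>m. (\<lambda>y. of_real (b y ^ k) * f y) \<in> L2" for b f x
    using that unfolding iterated_commutator_def c(2) by (intro sum.cong refl) (simp add: L1_extension_def)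
  then show ?thesis using c(1) by blast
qed

text \<open>Hypothesis \<open>b2\<close> puts all b^k f with k <= m into \<open>L2\<close>, since
  b^(2k) <= 1 + b^(2m) and \<open>f\<close> is bounded with bounded support. Each term of the
  expansion is then estimated in its own interpolated weight \<open>w k\<close>.\<close>

theorem iterated_commutator_bounded:
  fixes b lam \<mu> :: "real ^ 'n \<Rightarrow> real"
  assumes A1: "Ap_pair p B1 lam \<sigma>1" and A2: "Ap_pair p B2 \<mu> \<sigma>2" and p: "1 < p" and m: "1 \<le> m"
    and mb[measurable]: "b \<in> borel_measurable lebesgue" and b0: "\<And>x. 0 \<le> b x"
    and b\<nu>: "AE x in lebesgue. b x \<le> (\<mu> x / lam x) powr (1 / (p * real m))"
    and b2: "(\<integral>\<^sup>+x. ennreal (b x ^ (2 * m)) \<partial>lebesgue) < \<infinity>"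
  shows "\<exists>C::real. \<forall>f\<in>commutator_domain b m.
    weighted_Lp_norm p lam (iterated_commutator T b m f) \<le> ennreal C * weighted_Lp_norm p \<mu> f"
proof -
  define w where "w k x = lam x powr (real k / real m) * \<mu> x powr (1 - real k / real m)" for k x
  have th: "0 \<le> real k / real m" "real k / real m \<le> 1" if "k \<le> m" for k using that m by (auto simp: divide_le_eq)
  have "\<forall>k\<in>{..m}. \<exists>N. 0 < N \<and> (\<forall>g\<in>L12. bounded {x. g x \<noteq> 0} \<longrightarrow>
    (\<integral>\<^sup>+x. ennreal (norm (T g x) powr p * w k x) \<partial>lebesgue)
      \<le> ennreal N * (\<integral>\<^sup>+x. ennreal (norm (g x) powr p * w k x) \<partial>lebesgue))"
  proof
    fix k assume "k \<in> {..m}"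
    then have k: "k \<le> m" by simp
    show "\<exists>N. 0 < N \<and> (\<forall>g\<in>L12. bounded {x. g x \<noteq> 0} \<longrightarrow>
      (\<integral>\<^sup>+x. ennreal (norm (T g x) powr p * w k x) \<partial>lebesgue)
        \<le> ennreal N * (\<integral>\<^sup>+x. ennreal (norm (g x) powr p * w k x) \<partial>lebesgue))"
      unfolding w_def by (rule T_weighted[OF Ap_pair_interpolation[OF A1 A2 p th[OF k]] p]) blast
  qed
  from bchoice[OF this] obtain N where N: "\<And>k. k \<le> m \<Longrightarrow> 0 < N k"
    "\<And>k g. k \<le> m \<Longrightarrow> g \<in> L12 \<Longrightarrow> bounded {x. g x \<noteq> 0} \<Longrightarrow>
    (\<integral>\<^sup>+x. ennreal (norm (T g x) powr p * w k x) \<partial>lebesgue)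
      \<le> ennreal (N k) * (\<integral>\<^sup>+x. ennreal (norm (g x) powr p * w k x) \<partial>lebesgue)" by auto
  obtain c :: "nat \<Rightarrow> real" where c: "\<And>b f x. (\<forall>k\<le>m. (\<lambda>y. of_real (b y ^ k) * f y) \<in> L2) \<Longrightarrow>
    iterated_commutator T b m f x = (\<Sum>k\<le>m. of_real (c k * b x ^ (m - k)) * T (\<lambda>y. of_real (b y ^ k) * f y) x)"
    using iterated_commutator_expansion[of m] by blast
  have wl: "weight lam" "weight \<mu>" and pl: "AE x in lebesgue. 0 < lam x" "AE x in lebesgue. 0 < \<mu> x"
    using A1 A2 by (auto simp: Ap_pair_def)
  have [measurable]: "lam \<in> borel_measurable lebesgue" "\<mu> \<in> borel_measurable lebesgue" using wl weight_measurable by auto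
  have [measurable]: "w k \<in> borel_measurable lebesgue" for k unfolding w_def by measurable
  have w0: "0 \<le> w k x" for k x by (simp add: w_def)
  define \<nu> where "\<nu> x = (\<mu> x / lam x) powr (1 / (p * real m))" for x
  \<comment> \<open>Since b^(jp) is at most (\<mu>/lam)^(j/m), the factor of \<open>b\<close>
    outside \<open>T\<close> carries lam to \<open>w k\<close>, and the factor inside carries
    \<open>w k\<close> to \<mu>.\<close>
  have bound1: "AE x in lebesgue. \<forall>k\<in>{..m}. (b x ^ (m - k)) powr p * lam x \<le> w k x \<and> (b x ^ k) powr p * w k x \<le> \<mu> x"
    using b\<nu> pl
  proof eventually_elim
    case (elim x)
    have pw: "(b x ^ j) powr p \<le> (\<mu> x / lam x) powr (real j / real m)" for j
    proof -
      have "b x ^ j \<le> \<nu> x ^ j" using elim(1) b0 by (intro power_mono) (auto simp: \<nu>_def)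
      then have "(b x ^ j) powr p \<le> (\<nu> x ^ j) powr p" using p b0 by (intro powr_mono2) auto
      also have "\<nu> x ^ j = \<nu> x powr real j" using elim by (simp add: \<nu>_def powr_realpow)
      also have "(\<nu> x powr real j) powr p = (\<mu> x / lam x) powr (real j / real m)"
        unfolding \<nu>_def powr_powr using p m by (simp add: field_simps)
      finally show ?thesis .
    qed
    show ?case
    proof (intro ballI conjI)
      fix k assume "k \<in> {..m}"
      then have k: "k \<le> m" by simp
      have e: "real (m - k) / real m = 1 - real k / real m" using k m by (simp add: of_nat_diff diff_divide_distrib)
      have "(b x ^ (m - k)) powr p * lam x \<le> (\<mu> x / lam x) powr (1 - real k / real m) * lam x"
        using pw[of "m - k"] elim by (intro mult_right_mono) (auto simp: e)
      also have "\<dots> = w k x"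
      proof -
        have "lam x = lam x powr (real k / real m) * lam x powr (1 - real k / real m)"
          using elim by (simp flip: powr_add)
        then have "(\<mu> x / lam x) powr (1 - real k / real m) * lam x =
          (\<mu> x powr (1 - real k / real m) / lam x powr (1 - real k / real m)) * (lam x powr (real k / real m) * lam x powr (1 - real k / real m))"
          using elim by (simp add: powr_divide)
        also have "\<dots> = w k x" using elim by (simp add: w_def)
        finally show ?thesis .
      qed
      finally show "(b x ^ (m - k)) powr p * lam x \<le> w k x" .
      have "(b x ^ k) powr p * w k x \<le> (\<mu> x / lam x) powr (real k / real m) * w k x"
        using pw[of k] w0 by (intro mult_right_mono) auto
      also have "\<dots> = \<mu> x powr (real k / real m) * \<mu> x powr (1 - real k / real m)"
        using elim by (simp add: w_def powr_divide)
      also have "\<dots> = \<mu> x" using elim by (simp flip: powr_add)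
      finally show "(b x ^ k) powr p * w k x \<le> \<mu> x" .
    qed
  qed
  define D where "D = real (Suc m) powr p * (\<Sum>k\<le>m. \<bar>c k\<bar> powr p * N k) + 1"
  have Dpos: "0 < D" unfolding D_def using N(1) by (intro add_nonneg_pos mult_nonneg_nonneg sum_nonneg) (auto intro: less_imp_le)
  have "weighted_Lp_norm p lam (iterated_commutator T b m f) \<le> ennreal (D powr (1/p)) * weighted_Lp_norm p \<mu> f"
    if f: "f \<in> commutator_domain b m" for f
  proof -
    have [measurable]: "f \<in> borel_measurable lebesgue" using f by (simp add: commutator_domain_def)
    obtain Bf where Bf: "\<And>x. norm (f x) \<le> Bf" using f by (auto simp: commutator_domain_def bounded_iff)
    have "bounded (closure {x. f x \<noteq> 0})" using f by (auto simp: commutator_domain_def compact_imp_bounded)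
    then have fs: "bounded {x. f x \<noteq> 0}" using bounded_subset closure_subset by blast
    then obtain r where r: "\<And>x. f x \<noteq> 0 \<Longrightarrow> norm x \<le> r" by (auto simp: bounded_iff)
    define g where "g k y = of_real (b y ^ k) * f y" for k y
    have gm[measurable]: "g k \<in> borel_measurable lebesgue" for k unfolding g_def by measurable
    have gL2: "g k \<in> L2" if k: "k \<le> m" for k
    proof -
      have "(\<integral>\<^sup>+x. ennreal ((norm (g k x))\<^sup>2) \<partial>lebesgue) \<le>
        (\<integral>\<^sup>+x. ennreal (Bf\<^sup>2) * (indicator (ball 0 (r + 1)) x + ennreal (b x ^ (2 * m))) \<partial>lebesgue)"
      proof (intro nn_integral_mono)
        fix x
        show "ennreal ((norm (g k x))\<^sup>2) \<le> ennreal (Bf\<^sup>2) * (indicator (ball 0 (r + 1)) x + ennreal (b x ^ (2 * m)))"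
        proof (cases "f x = 0")
          case False
          then have xr: "x \<in> ball 0 (r + 1)" using r[OF False] by simp
          have "(norm (g k x))\<^sup>2 = (norm (f x))\<^sup>2 * b x ^ (2 * k)"
            using b0 by (simp add: g_def norm_mult power_mult_distrib norm_power power_mult mult.commute power_even_eq)
          also have "\<dots> \<le> Bf\<^sup>2 * (1 + b x ^ (2 * m))"
          proof (intro mult_mono power_mono Bf)
            show "b x ^ (2 * k) \<le> 1 + b x ^ (2 * m)"
            proof (cases "b x \<le> 1")
              case True
              then show ?thesis using b0[of x] by (simp add: power_le_one add_increasing2)
            next
              case False
              then have "b x ^ (2 * k) \<le> b x ^ (2 * m)" using k by (intro power_increasing) auto
              then show ?thesis by simp
            qed
          qed (use b0 in auto)
          finally have "ennreal ((norm (g k x))\<^sup>2) \<le> ennreal (Bf\<^sup>2 * (1 + b x ^ (2 * m)))" by (rule ennreal_leI)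
          also have "\<dots> = ennreal (Bf\<^sup>2) * (indicator (ball 0 (r + 1)) x + ennreal (b x ^ (2 * m)))"
            using xr b0 by (simp add: ennreal_mult ennreal_plus)
          finally show ?thesis .
        qed (simp add: g_def)
      qed
      also have "\<dots> = ennreal (Bf\<^sup>2) * (emeasure lebesgue (ball (0 :: real ^ 'n) (r + 1)) + (\<integral>\<^sup>+x. ennreal (b x ^ (2 * m)) \<partial>lebesgue))"
        by (subst nn_integral_cmult) (auto simp: nn_integral_add)
      also have "\<dots> < \<infinity>"
      proof -
        have "emeasure lebesgue (ball (0 :: real ^ 'n) (r + 1)) < \<infinity>"
          using emeasure_lborel_ball_finite[of "0 :: real ^ 'n" "r + 1"] by (simp add: emeasure_completion)
        then show ?thesis using b2 by (simp add: ennreal_mult_less_top)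
      qed
      finally show ?thesis by (simp add: L2_iff)
    qed
    have gL12: "g k \<in> L12" if k: "k \<le> m" for k
      using gL2[OF k] f k by (auto simp: L12_def commutator_domain_def g_def[abs_def])
    have gs: "bounded {x. g k x \<noteq> 0}" for k
      by (rule bounded_subset[OF fs]) (auto simp: g_def)
    have [measurable]: "T (g k) \<in> borel_measurable lebesgue" if "k \<le> m" for k using gL2[OF that] by (rule T_measurable)
    have ic: "iterated_commutator T b m f x = (\<Sum>k\<le>m. of_real (c k * b x ^ (m - k)) * T (g k) x)" for x
      unfolding g_def[abs_def] using gL2 by (intro c) (simp add: g_def[abs_def])
    have "(\<integral>\<^sup>+x. ennreal (norm (iterated_commutator T b m f x) powr p * lam x) \<partial>lebesgue) \<le>
      (\<integral>\<^sup>+x. (\<Sum>k\<le>m. ennreal (real (Suc m) powr p * \<bar>c k\<bar> powr p) * ennreal (norm (T (g k) x) powr p * w k x)) \<partial>lebesgue)"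
    proof (intro nn_integral_mono_AE)
      show "AE x in lebesgue. ennreal (norm (iterated_commutator T b m f x) powr p * lam x) \<le>
        (\<Sum>k\<le>m. ennreal (real (Suc m) powr p * \<bar>c k\<bar> powr p) * ennreal (norm (T (g k) x) powr p * w k x))"
        using bound1 pl(1)
      proof eventually_elim
        case (elim x)
        have "norm (iterated_commutator T b m f x) powr p * lam x \<le>
          (real (Suc m) powr p * (\<Sum>k\<le>m. norm (of_real (c k * b x ^ (m - k)) * T (g k) x) powr p)) * lam x"
          unfolding ic using p elim by (intro mult_right_mono norm_sum_powr_le) auto
        also have "\<dots> = (\<Sum>k\<le>m. real (Suc m) powr p * \<bar>c k\<bar> powr p * (norm (T (g k) x) powr p * ((b x ^ (m - k)) powr p * lam x)))"
        proof -
          have "norm (of_real (c k * b x ^ (m - k)) * T (g k) x) powr p = \<bar>c k\<bar> powr p * ((b x ^ (m - k)) powr p * norm (T (g k) x) powr p)" for k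
          proof -
            have "norm (of_real (c k * b x ^ (m - k)) * T (g k) x) = \<bar>c k\<bar> * (b x ^ (m - k) * norm (T (g k) x))"
              using b0[of x] by (simp only: norm_mult norm_of_real abs_mult power_abs abs_of_nonneg mult.assoc)
            then show ?thesis using b0[of x] by (simp add: powr_mult)
          qed
          then show ?thesis unfolding sum_distrib_left sum_distrib_right by (intro sum.cong refl) (simp only: mult_ac)
        qed
        also have "\<dots> \<le> (\<Sum>k\<le>m. real (Suc m) powr p * \<bar>c k\<bar> powr p * (norm (T (g k) x) powr p * w k x))"
          using elim(1) by (intro sum_mono mult_left_mono) auto
        finally have "ennreal (norm (iterated_commutator T b m f x) powr p * lam x) \<le>
          ennreal (\<Sum>k\<le>m. real (Suc m) powr p * \<bar>c k\<bar> powr p * (norm (T (g k) x) powr p * w k x))" by (rule ennreal_leI)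
        also have "\<dots> = (\<Sum>k\<le>m. ennreal (real (Suc m) powr p * \<bar>c k\<bar> powr p * (norm (T (g k) x) powr p * w k x)))"
          using w0 by (intro sum_ennreal[symmetric]) auto
        also have "\<dots> = (\<Sum>k\<le>m. ennreal (real (Suc m) powr p * \<bar>c k\<bar> powr p) * ennreal (norm (T (g k) x) powr p * w k x))"
          using w0 by (intro sum.cong refl ennreal_mult) auto
        finally show ?case .
      qed
    qed
    also have "\<dots> = (\<Sum>k\<le>m. ennreal (real (Suc m) powr p * \<bar>c k\<bar> powr p) * (\<integral>\<^sup>+x. ennreal (norm (T (g k) x) powr p * w k x) \<partial>lebesgue))"
      by (subst nn_integral_sum) (auto intro!: sum.cong nn_integral_cmult)
    also have "\<dots> \<le> (\<Sum>k\<le>m. ennreal (real (Suc m) powr p * \<bar>c k\<bar> powr p) * (ennreal (N k) * (\<integral>\<^sup>+x. ennreal (norm (f x) powr p * \<mu> x) \<partial>lebesgue)))"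
    proof (intro sum_mono mult_left_mono)
      fix k assume "k \<in> {..m}"
      then have k: "k \<le> m" by simp
      have "(\<integral>\<^sup>+x. ennreal (norm (T (g k) x) powr p * w k x) \<partial>lebesgue) \<le> ennreal (N k) * (\<integral>\<^sup>+x. ennreal (norm (g k x) powr p * w k x) \<partial>lebesgue)"
        by (rule N(2)[OF k gL12[OF k] gs])
      also have "\<dots> \<le> ennreal (N k) * (\<integral>\<^sup>+x. ennreal (norm (f x) powr p * \<mu> x) \<partial>lebesgue)"
      proof (intro mult_left_mono nn_integral_mono_AE)
        show "AE x in lebesgue. ennreal (norm (g k x) powr p * w k x) \<le> ennreal (norm (f x) powr p * \<mu> x)"
          using bound1
        proof eventually_elim
          case (elim x)
          have "norm (g k x) powr p = norm (f x) powr p * (b x ^ k) powr p"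
            using b0[of x] by (simp add: g_def norm_mult norm_power powr_mult mult.commute)
          then have "norm (g k x) powr p * w k x = norm (f x) powr p * ((b x ^ k) powr p * w k x)" by simp
          also have "\<dots> \<le> norm (f x) powr p * \<mu> x" using elim k by (intro mult_left_mono) auto
          finally show ?case by (rule ennreal_leI)
        qed
      qed simp
      finally show "(\<integral>\<^sup>+x. ennreal (norm (T (g k) x) powr p * w k x) \<partial>lebesgue) \<le> ennreal (N k) * (\<integral>\<^sup>+x. ennreal (norm (f x) powr p * \<mu> x) \<partial>lebesgue)" .
    qed simp
    also have "\<dots> = ennreal (\<Sum>k\<le>m. real (Suc m) powr p * \<bar>c k\<bar> powr p * N k) * (\<integral>\<^sup>+x. ennreal (norm (f x) powr p * \<mu> x) \<partial>lebesgue)"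
    proof -
      have "ennreal (\<Sum>k\<le>m. real (Suc m) powr p * \<bar>c k\<bar> powr p * N k) = (\<Sum>k\<le>m. ennreal (real (Suc m) powr p * \<bar>c k\<bar> powr p) * ennreal (N k))"
        using N(1) by (subst sum_ennreal[symmetric]) (auto simp: less_imp_le intro!: sum.cong ennreal_mult)
      then show ?thesis by (simp add: sum_distrib_right mult.assoc)
    qed
    also have "\<dots> \<le> ennreal D * (\<integral>\<^sup>+x. ennreal (norm (f x) powr p * \<mu> x) \<partial>lebesgue)"
      by (intro mult_right_mono ennreal_leI) (auto simp: D_def sum_distrib_left mult.assoc)
    finally show ?thesis unfolding weighted_Lp_norm_def
      using Dpos p by (intro ennreal_powr_le_mult) auto
  qed
  then show ?thesis by blast
qed

end

subsection \<open>The upper bound\<close>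

lemma rst_ball_one_L12: "rst (ball z r) (\<lambda>_. 1) \<in> L12"
proof -
  have fin: "emeasure lebesgue (ball z r) < \<infinity>" using doubling_lebesgue by (auto simp: doubling_def)
  have m: "rst (ball z r) (\<lambda>_. 1) \<in> borel_measurable lebesgue" by (rule rst_measurable) auto
  have "(\<integral>\<^sup>+x. ennreal ((norm (rst (ball z r) (\<lambda>_. 1) x))\<^sup>2) \<partial>lebesgue) = (\<integral>\<^sup>+x. indicator (ball z r) x \<partial>lebesgue)"
    by (intro nn_integral_cong) (auto simp: rst_def indicator_def)
  also have "\<dots> < \<infinity>" using fin by simp
  finally have "rst (ball z r) (\<lambda>_. 1) \<in> L2" using m by (simp add: L2_iff)
  moreover have "integrable lebesgue (rst (ball z r) (\<lambda>_. 1))"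
    unfolding integrable_iff_bounded using m fin by (simp add: nn_integral_rst)
  ultimately show ?thesis by (simp add: L12_def)
qed

lemma measure_lebesgue_ball:
  fixes z :: "real ^ 'n"
  assumes "0 \<le> r"
  shows "measure lebesgue (ball z r) = r ^ CARD('n) * measure lborel (ball (0 :: real ^ 'n) 1)"
  using emeasure_lebesgue_ball[OF assms, of z] assms by (simp add: Sigma_Algebra.measure_def)

lemma ennreal_powr_le_multD:
  assumes le: "ennreal_powr Y (1/p) \<le> ennreal c * ennreal_powr X (1/p)" and X: "X < \<infinity>" and c: "0 \<le> c" and p: "0 < p"
  shows "Y \<le> ennreal (c powr p) * X"
proof -
  obtain x where x: "X = ennreal x" "0 \<le> x" using X by (cases X) auto
  have le': "ennreal_powr Y (1/p) \<le> ennreal (c * x powr (1/p))"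
    using le x c by (simp add: ennreal_powr_def ennreal_mult)
  then have "Y \<noteq> \<infinity>" by (auto simp: ennreal_powr_def top_unique)
  then obtain y where y: "Y = ennreal y" "0 \<le> y" by (cases Y) auto
  then have "y powr (1/p) \<le> c * x powr (1/p)" using le' c by (simp add: ennreal_powr_def)
  then have "(y powr (1/p)) powr p \<le> (c * x powr (1/p)) powr p" using p by (intro powr_mono2) auto
  then have "y \<le> c powr p * x" using p y x c by (simp add: powr_powr powr_mult)
  then show ?thesis using x y by (simp add: ennreal_leI flip: ennreal_mult)
qed

lemma ennreal_divide_le:
  fixes a d c :: ennreal
  assumes "a \<le> c * d" "d < \<infinity>"
  shows "a / d \<le> c"
proof (cases "d = 0")
  case False
  then have "a / d \<le> c * d / d" using assms by (intro divide_right_mono_ennreal)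
  also have "\<dots> = c" using False assms by (simp add: mult_divide_eq_ennreal)
  finally show ?thesis .
qed (use assms in simp)

text \<open>On a cube |b - average| <= b + average, and each term on the right integrates to the
  integral of \<open>b\<close>, at most that of \<eta>. So restrictions and truncations of an
  arbitrary \<eta> are test functions for the first hypothesis.\<close>

lemma bmo_norm_le_2:
  fixes b \<eta> :: "real ^ 'n \<Rightarrow> real"
  assumes \<eta>: "weight \<eta>" and mb: "b \<in> borel_measurable lebesgue" and b: "\<And>x. 0 \<le> b x" "\<And>x. b x \<le> \<eta> x"
  shows "locally_integrable b" and "bmo_norm \<eta> b \<le> 2"
proof -
  have [measurable]: "\<eta> \<in> borel_measurable lebesgue" using \<eta> by (rule weight_measurable)
  have int: "set_integrable lebesgue S b" if "bounded S" "S \<in> sets lebesgue" for S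
    unfolding set_integrable_def real_scaleR_def
  proof (rule Bochner_Integration.integrable_bound[OF weight_set_integrable[OF \<eta> that]])
    show "(\<lambda>x. indicator S x * b x) \<in> borel_measurable lebesgue"
      using mb that by (intro borel_measurable_times borel_measurable_indicator)
    show "AE x in lebesgue. norm (indicat_real S x * b x) \<le> norm (indicat_real S x * \<eta> x)"
      using b by (auto simp: indicator_def intro!: AE_I2 order.trans[OF b(2)])
  qed
  show "locally_integrable b"
    unfolding locally_integrable_def by (auto intro!: int compact_imp_bounded fmeasurableD lmeasurable_compact)
  show "bmo_norm \<eta> b \<le> 2"
    unfolding bmo_norm_def
  proof (rule SUP_least)
    fix Q :: "(real ^ 'n) set" assume "Q \<in> cubes"
    then obtain a h where Q: "Q = cube a h" "0 < h" by (auto simp: cubes_def)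
    have bQ: "bounded Q" "Q \<in> sets lebesgue" using Q by (auto simp: bounded_cube)
    have [measurable]: "Q \<in> sets lebesgue" by (rule bQ)
    have em: "emeasure lebesgue Q = ennreal (measure lebesgue Q)" "0 < measure lebesgue Q"
      using Q by (simp_all add: emeasure_lebesgue_cube measure_lebesgue_cube)
    define B where "B = (LINT x:Q|lebesgue. b x)"
    have B0: "0 \<le> B" unfolding B_def set_lebesgue_integral_def using b by (intro integral_nonneg_AE) auto
    have Bnn: "(\<integral>\<^sup>+x\<in>Q. ennreal (b x) \<partial>lebesgue) = ennreal B"
    proof -
      have "(\<integral>\<^sup>+x\<in>Q. ennreal (b x) \<partial>lebesgue) = (\<integral>\<^sup>+x. ennreal (indicator Q x * b x) \<partial>lebesgue)"
        by (intro nn_integral_cong) (auto simp: indicator_def)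
      also have "\<dots> = ennreal B" unfolding B_def set_lebesgue_integral_def real_scaleR_def
        using int[OF bQ] b by (intro nn_integral_eq_integral) (auto simp: set_integrable_def)
      finally show ?thesis .
    qed
    define A where "A = average b Q"
    have A: "A = B / measure lebesgue Q" by (simp add: A_def average_def B_def)
    have A0: "0 \<le> A" unfolding A using B0 by simp
    have "(\<integral>\<^sup>+x\<in>Q. ennreal \<bar>b x - A\<bar> \<partial>lebesgue) \<le> (\<integral>\<^sup>+x. ennreal (b x) * indicator Q x + ennreal A * indicator Q x \<partial>lebesgue)"
    proof (intro nn_integral_mono)
      fix x
      have "\<bar>b x - A\<bar> \<le> b x + A" using b(1)[of x] A0 by simp
      then have "ennreal \<bar>b x - A\<bar> \<le> ennreal (b x + A)" by (rule ennreal_leI)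
      then show "ennreal \<bar>b x - A\<bar> * indicator Q x \<le> ennreal (b x) * indicator Q x + ennreal A * indicator Q x"
        using b(1)[of x] A0 by (auto simp: indicator_def)
    qed
    also have "\<dots> = ennreal B + ennreal A * emeasure lebesgue Q"
      using mb by (subst nn_integral_add) (auto simp: Bnn nn_integral_cmult_indicator)
    also have "ennreal A * emeasure lebesgue Q = ennreal B"
      unfolding em(1) using em(2) B0 by (simp add: A flip: ennreal_mult)
    also have "ennreal B + ennreal B = 2 * ennreal B" by (simp add: mult_2)
    also have "\<dots> \<le> 2 * (\<integral>\<^sup>+x\<in>Q. ennreal (\<eta> x) \<partial>lebesgue)"
      unfolding Bnn[symmetric] using b by (intro mult_left_mono nn_integral_mono) (auto simp: indicator_def intro!: ennreal_leI)
    finally have "(\<integral>\<^sup>+x\<in>Q. ennreal \<bar>b x - A\<bar> \<partial>lebesgue) \<le> 2 * (\<integral>\<^sup>+x\<in>Q. ennreal (\<eta> x) \<partial>lebesgue)" .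
    moreover have "(\<integral>\<^sup>+x\<in>Q. ennreal (\<eta> x) \<partial>lebesgue) < \<infinity>"
    proof -
      have "(\<integral>\<^sup>+x\<in>Q. ennreal (\<eta> x) \<partial>lebesgue) = emeasure (density lebesgue (\<lambda>x. ennreal (\<eta> x))) Q"
        by (subst emeasure_density) auto
      then show ?thesis by (simp add: emeasure_density_weight[OF \<eta> bQ])
    qed
    ultimately show "(\<integral>\<^sup>+x\<in>Q. ennreal \<bar>b x - average b Q\<bar> \<partial>lebesgue) / (\<integral>\<^sup>+x\<in>Q. ennreal (\<eta> x) \<partial>lebesgue) \<le> 2"
      unfolding A_def by (rule ennreal_divide_le)
  qed
qed

context dini_cz_operator
begin

text \<open>Non-degeneracy in the second variable gives, for a prescribed x0, some y0 with large
  \<open>K x0 y0\<close>. Over the two small balls smoothness keeps the kernel within c/(2r^n) of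
  that value, whose norm is at least c/r^n, so the integral cannot cancel.\<close>

lemma T_indicator_lower_bound:
  assumes c: "0 < c" and nd: "\<And>y r. 0 < r \<Longrightarrow> \<exists>x. x \<notin> ball y r \<and> norm (K y x) \<ge> c / r ^ CARD('n)"
  obtains \<epsilon> M \<kappa> where "0 < \<epsilon>" "\<epsilon> < 1/4" "1 \<le> M" "0 < \<kappa>"
    "\<And>x0 r. 0 < r \<Longrightarrow> \<exists>y0. r \<le> norm (x0 - y0) \<and> norm (x0 - y0) \<le> M * r \<and>
      (AE x in lebesgue. x \<in> ball x0 (\<epsilon> * r) \<longrightarrow> \<kappa> \<le> norm (T (rst (ball y0 (\<epsilon> * r)) (\<lambda>_. 1)) x))"
proof -
  let ?n = "CARD('n)"
  define V where "V = measure lborel (ball (0 :: real ^ 'n) 1)"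
  have V: "V > 0" unfolding V_def by (simp add: content_ball_pos)
  obtain CK where CK: "0 < CK" "\<And>x y. x \<noteq> y \<Longrightarrow> norm (K x y) \<le> CK / norm (x - y) ^ ?n"
    by (rule kernel_size) blast
  \<comment> \<open>In units of r^(-n): moving x0 to \<open>x\<close> happens at distance at least
    r/2 from \<open>y\<close> and costs 2^n e = c/4; moving y0 to \<open>y\<close> costs at most
    another c/4.\<close>
  define e where "e = c / (4 * 2 ^ ?n)"
  have e: "0 < e" using c by (simp add: e_def)
  have e4: "2 ^ ?n * e = c / 4" by (simp add: e_def)
  have e4': "e \<le> c / 4" using c by (simp add: e_def field_simps)
  obtain \<delta> where \<delta>: "0 < \<delta>" "\<delta> \<le> 1" "\<And>t. 0 \<le> t \<Longrightarrow> t \<le> \<delta> \<Longrightarrow> \<omega> t < e" by (rule \<omega>_small[OF e]) blast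
  \<comment> \<open>Keeps the ratio of displacement to distance, at most 2 \<epsilon> in both moves,
    within \<delta>.\<close>
  define \<epsilon> where "\<epsilon> = \<delta> / 8"
  have \<epsilon>: "0 < \<epsilon>" "\<epsilon> \<le> 1/8" "2 * \<epsilon> \<le> \<delta>" using \<delta> by (auto simp: \<epsilon>_def)
  \<comment> \<open>If y0 were farther than M r from x0, the size bound of the kernel would
    contradict the lower bound c/r^n.\<close>
  define M where "M = max 1 (CK / c)"
  have M: "1 \<le> M" "CK / c \<le> M" by (auto simp: M_def)
  define \<kappa> where "\<kappa> = c * V * \<epsilon> ^ ?n / 2"
  have \<kappa>: "0 < \<kappa>" using c V \<epsilon> by (simp add: \<kappa>_def)
  have main: "\<exists>y0. r \<le> norm (x0 - y0) \<and> norm (x0 - y0) \<le> M * r \<and>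
      (AE x in lebesgue. x \<in> ball x0 (\<epsilon> * r) \<longrightarrow> \<kappa> \<le> norm (T (rst (ball y0 (\<epsilon> * r)) (\<lambda>_. 1)) x))"
    if r: "0 < r" for x0 r
  proof -
    obtain y0 where y0: "y0 \<notin> ball x0 r" "norm (K x0 y0) \<ge> c / r ^ ?n" using nd[OF r, of x0] by blast
    have d1: "r \<le> norm (x0 - y0)" using y0 by (simp add: dist_norm)
    then have ne: "x0 \<noteq> y0" using r by auto
    have d2: "norm (x0 - y0) \<le> M * r"
    proof (rule ccontr)
      assume "\<not> ?thesis"
      then have gt: "M * r < norm (x0 - y0)" by simp
      have Mr: "0 < M * r" using M r by simp
      have "c / r ^ ?n \<le> CK / norm (x0 - y0) ^ ?n" using y0(2) CK(2)[OF ne] by linarith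
      also have "\<dots> < CK / (M * r) ^ ?n"
        using gt Mr CK(1) ne by (intro divide_strict_left_mono power_strict_mono mult_pos_pos) auto
      also have "\<dots> \<le> c / r ^ ?n"
      proof -
        have "M \<le> M ^ ?n" using M(1) by (simp add: self_le_power)
        then have "CK \<le> c * M ^ ?n" using M(2) c by (simp add: field_simps) (smt (verit) mult_left_mono mult.commute)
        then have "CK / (M ^ ?n * r ^ ?n) \<le> c * M ^ ?n / (M ^ ?n * r ^ ?n)" using M r by (intro divide_right_mono) auto
        also have "\<dots> = c / r ^ ?n" using M by simp
        finally show ?thesis by (simp add: power_mult_distrib)
      qed
      finally show False by simp
    qed
    define f where "f = rst (ball y0 (\<epsilon> * r)) (\<lambda>_. 1)"
    have fL12: "f \<in> L12" unfolding f_def by (rule rst_ball_one_L12)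
    then have fL2: "f \<in> L2" and fint: "integrable lebesgue f" by (auto simp: L12_def)
    have er: "0 < \<epsilon> * r" "\<epsilon> * r \<le> r / 8" using \<epsilon> r by auto
    have "{y. f y \<noteq> 0} \<subseteq> cball y0 (\<epsilon> * r)" by (auto simp: f_def rst_def indicator_def)
    then have cl: "closure {y. f y \<noteq> 0} \<subseteq> cball y0 (\<epsilon> * r)" by (simp add: closure_minimal)
    have "AE x in lebesgue. x \<in> ball x0 (\<epsilon> * r) \<longrightarrow> \<kappa> \<le> norm (T f x)"
      using T_kernel[OF fL2]
    proof eventually_elim
      case (elim x)
      show ?case
      proof
        assume "x \<in> ball x0 (\<epsilon> * r)"
        then have x: "norm (x0 - x) < \<epsilon> * r" by (simp add: dist_norm)
        have xy: "r / 2 \<le> norm (x - y)" if "norm (y0 - y) < \<epsilon> * r" for y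
        proof -
          have "norm (x0 - y0) \<le> norm (x0 - x) + norm (x - y) + norm (y - y0)"
            using norm_triangle_ineq[of "x0 - x" "x - y"] norm_triangle_ineq[of "x0 - y" "y - y0"] by simp
          then show ?thesis using x that d1 er by (simp add: norm_minus_commute)
        qed
        have "x \<notin> cball y0 (\<epsilon> * r)"
        proof
          assume "x \<in> cball y0 (\<epsilon> * r)"
          then have "norm (y0 - x) \<le> \<epsilon> * r" by (simp add: dist_norm)
          then have "norm (x0 - y0) \<le> \<epsilon> * r + \<epsilon> * r"
            using x norm_triangle_ineq[of "x0 - x" "x - y0"] by (simp add: norm_minus_commute)
          then show False using d1 er r by linarith
        qed
        then have Tx: "T f x = (LINT y|lebesgue. K x y * f y)" using elim cl by blast
        have i1: "integrable lebesgue (\<lambda>y. K x y * f y)"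
        proof (rule kernel_integrable[OF fint, of "r / 2"])
          show "r / 2 \<le> norm (x - y)" if "f y \<noteq> 0" for y
            using that by (intro xy) (auto simp: f_def rst_def indicator_def dist_norm split: if_splits)
        qed (use r in auto)
        have i2: "integrable lebesgue (\<lambda>y. K x0 y0 * f y)" using fint by simp
        have mb: "measure lebesgue (ball y0 (\<epsilon> * r)) = V * (\<epsilon> * r) ^ ?n"
          using measure_lebesgue_ball[of "\<epsilon> * r" y0] er by (simp add: V_def mult.commute)
        have fI: "(LINT y|lebesgue. f y) = of_real (V * (\<epsilon> * r) ^ ?n)"
        proof -
          have "(LINT y|lebesgue. f y) = of_real (measure lebesgue (ball y0 (\<epsilon> * r)))"
            using doubling_lebesgue unfolding f_def rst_def by (auto simp: doubling_def scaleR_conv_of_real)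
          then show ?thesis by (simp only: mb)
        qed
        have K_close: "norm (K x y - K x0 y0) \<le> c / (2 * r ^ ?n)" if y: "norm (y0 - y) < \<epsilon> * r" for y
        proof -
          have x0y: "r / 2 \<le> norm (x0 - y)"
            using norm_triangle_ineq[of "x0 - y" "y - y0"] d1 y er by (simp add: norm_minus_commute)
          have p1: "0 < norm (x0 - y)" using x0y r by linarith
          have "norm (K x0 y - K x y) \<le> \<omega> (norm (x0 - x) / norm (x0 - y)) / norm (x0 - y) ^ ?n"
            using x x0y er r by (intro kernel_smooth(1)) linarith
          also have "\<dots> \<le> e / (r / 2) ^ ?n"
          proof (intro frac_le)
            have "norm (x0 - x) / norm (x0 - y) \<le> (\<epsilon> * r) / (r / 2)" using x x0y r er by (intro frac_le) auto
            also have "\<dots> = 2 * \<epsilon>" using r by simp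
            finally show "\<omega> (norm (x0 - x) / norm (x0 - y)) \<le> e" using \<delta>(3)[of "norm (x0 - x) / norm (x0 - y)"] \<epsilon>(3) by simp
            show "(r / 2) ^ ?n \<le> norm (x0 - y) ^ ?n" using x0y r by (intro power_mono) auto
          qed (use e r in auto)
          also have "\<dots> = 2 ^ ?n * e / r ^ ?n" by (simp add: power_divide mult.commute)
          also have "\<dots> = c / 4 / r ^ ?n" by (simp only: e4)
          finally have k1: "norm (K x0 y - K x y) \<le> c / 4 / r ^ ?n" .
          have y0x0: "norm (y0 - x0) = norm (x0 - y0)" by (rule norm_minus_commute)
          have "norm (K x0 y0 - K x0 y) \<le> \<omega> (norm (y0 - y) / norm (y0 - x0)) / norm (y0 - x0) ^ ?n"
            using y d1 er r by (intro kernel_smooth(2)) (unfold y0x0, linarith)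
          also have "\<dots> \<le> (c / 4) / r ^ ?n"
            unfolding y0x0
          proof (intro frac_le)
            have "norm (y0 - y) / norm (x0 - y0) \<le> (\<epsilon> * r) / r" using y d1 r er by (intro frac_le) auto
            also have "\<dots> \<le> 2 * \<epsilon>" using r \<epsilon> by simp
            finally show "\<omega> (norm (y0 - y) / norm (x0 - y0)) \<le> c / 4"
              using \<delta>(3)[of "norm (y0 - y) / norm (x0 - y0)"] \<epsilon>(3) e4' by simp
            show "r ^ ?n \<le> norm (x0 - y0) ^ ?n" using d1 r by (intro power_mono) auto
          qed (use c r in auto)
          finally have k2: "norm (K x0 y0 - K x0 y) \<le> c / 4 / r ^ ?n" .
          have "norm (K x y - K x0 y0) \<le> norm (K x0 y - K x y) + norm (K x0 y0 - K x0 y)"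
            using norm_triangle_ineq[of "K x y - K x0 y" "K x0 y - K x0 y0"] by (simp add: norm_minus_commute)
          also have "\<dots> \<le> c / (2 * r ^ ?n)" using k1 k2 by simp
          finally show ?thesis .
        qed
        have bnd: "norm ((LINT y|lebesgue. K x y * f y) - (LINT y|lebesgue. K x0 y0 * f y)) \<le> c / (2 * r ^ ?n) * (V * (\<epsilon> * r) ^ ?n)"
        proof -
          have "norm ((LINT y|lebesgue. K x y * f y) - (LINT y|lebesgue. K x0 y0 * f y)) = norm (LINT y|lebesgue. K x y * f y - K x0 y0 * f y)"
            using i1 i2 by simp
          also have "\<dots> \<le> (LINT y|lebesgue. norm (K x y * f y - K x0 y0 * f y))" by (rule integral_norm_bound)
          also have "\<dots> \<le> (LINT y|lebesgue. c / (2 * r ^ ?n) * norm (f y))"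
          proof (rule integral_mono)
            show "integrable lebesgue (\<lambda>y. norm (K x y * f y - K x0 y0 * f y))" using i1 i2 by (intro integrable_norm Bochner_Integration.integrable_diff)
            show "integrable lebesgue (\<lambda>y. c / (2 * r ^ ?n) * norm (f y))" using fint by simp
            fix y
            show "norm (K x y * f y - K x0 y0 * f y) \<le> c / (2 * r ^ ?n) * norm (f y)"
            proof (cases "f y = 0")
              case False
              then have "norm (y0 - y) < \<epsilon> * r" by (auto simp: f_def rst_def indicator_def dist_norm split: if_splits)
              then have "norm (K x y - K x0 y0) * norm (f y) \<le> c / (2 * r ^ ?n) * norm (f y)" by (intro mult_right_mono K_close) auto
              then show ?thesis by (simp add: left_diff_distrib[symmetric] norm_mult)
            qed simp
          qed
          also have "\<dots> = c / (2 * r ^ ?n) * (LINT y|lebesgue. norm (f y))" by simp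
          also have "(LINT y|lebesgue. norm (f y)) = V * (\<epsilon> * r) ^ ?n"
          proof -
            have "(LINT y|lebesgue. norm (f y)) = (LINT y|lebesgue. indicat_real (ball y0 (\<epsilon> * r)) y)"
              by (intro Bochner_Integration.integral_cong) (auto simp: f_def rst_def indicator_def)
            also have "\<dots> = measure lebesgue (ball y0 (\<epsilon> * r))" by simp
            finally show ?thesis by (simp only: mb)
          qed
          finally show ?thesis .
        qed
        have "(LINT y|lebesgue. K x0 y0 * f y) = K x0 y0 * of_real (V * (\<epsilon> * r) ^ ?n)"
          unfolding fI[symmetric] by simp
        then have "norm (LINT y|lebesgue. K x0 y0 * f y) = norm (K x0 y0) * (V * (\<epsilon> * r) ^ ?n)"
          using V er by (simp only: norm_mult norm_of_real abs_of_nonneg mult_nonneg_nonneg zero_le_power less_imp_le)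
        moreover have "c / r ^ ?n * (V * (\<epsilon> * r) ^ ?n) \<le> norm (K x0 y0) * (V * (\<epsilon> * r) ^ ?n)"
          using y0(2) V er by (intro mult_right_mono) auto
        ultimately have low: "c / r ^ ?n * (V * (\<epsilon> * r) ^ ?n) \<le> norm (LINT y|lebesgue. K x0 y0 * f y)" by simp
        have "c / r ^ ?n * (V * (\<epsilon> * r) ^ ?n) = 2 * \<kappa>" "c / (2 * r ^ ?n) * (V * (\<epsilon> * r) ^ ?n) = \<kappa>"
          using r by (simp_all add: \<kappa>_def power_mult_distrib)
        then have "2 * \<kappa> \<le> norm (LINT y|lebesgue. K x0 y0 * f y)"
          "norm ((LINT y|lebesgue. K x y * f y) - (LINT y|lebesgue. K x0 y0 * f y)) \<le> \<kappa>" using low bnd by simp_all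
        then show "\<kappa> \<le> norm (T f x)"
          unfolding Tx using norm_triangle_ineq2[of "LINT y|lebesgue. K x0 y0 * f y" "(LINT y|lebesgue. K x0 y0 * f y) - (LINT y|lebesgue. K x y * f y)"]
          by (simp add: norm_minus_commute)
      qed
    qed
    then show ?thesis using d1 d2 unfolding f_def by blast
  qed
  have "\<epsilon> < 1/4" using \<epsilon>(2) by simp
  then show ?thesis using that[OF \<epsilon>(1) _ M(1) \<kappa>] main by blast
qed

end

context dini_cz_operator
begin

text \<open>\<eta> is truncated at \<open>R\<close> to make \<eta>^(pm) lam locally integrable, as
  Lebesgue differentiation requires. The constant \<open>D\<close> does not depend on
  \<open>R\<close>, so the truncation is removed at each point by a large integer.\<close>

theorem weight_upper_bound:
  fixes lam \<mu> \<eta> :: "real ^ 'n \<Rightarrow> real"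
  assumes c: "0 < c" and nd: "\<And>y r. 0 < r \<Longrightarrow> \<exists>x. x \<notin> ball y r \<and> norm (K y x) \<ge> c / r ^ CARD('n)"
    and m: "1 \<le> m" and p: "1 < p"
    and w: "weight lam" "weight \<mu>" "weight \<eta>" and C: "0 \<le> C"
    and bd: "\<And>b f. locally_integrable b \<Longrightarrow> b \<in> BMO \<eta> \<Longrightarrow> f \<in> commutator_domain b m \<Longrightarrow>
       weighted_Lp_norm p lam (iterated_commutator T b m f) \<le> ennreal C * bmo_norm \<eta> b ^ m * weighted_Lp_norm p \<mu> f"
  shows "\<exists>D\<ge>0. AE x in lebesgue. \<eta> x powr (p * real m) * lam x \<le> D * \<mu> x"
proof -
  let ?n = "CARD('n)"
  define V where "V = measure lborel (ball (0 :: real ^ 'n) 1)"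
  have V: "V > 0" unfolding V_def by (simp add: content_ball_pos)
  obtain \<epsilon> M \<kappa> where \<epsilon>: "0 < \<epsilon>" "\<epsilon> < 1/4" and M: "1 \<le> M" and \<kappa>: "0 < \<kappa>" and low:
    "\<And>x0 r. 0 < r \<Longrightarrow> \<exists>y0. r \<le> norm (x0 - y0) \<and> norm (x0 - y0) \<le> M * r \<and>
      (AE x in lebesgue. x \<in> ball x0 (\<epsilon> * r) \<longrightarrow> \<kappa> \<le> norm (T (rst (ball y0 (\<epsilon> * r)) (\<lambda>_. 1)) x))"
    by (rule T_indicator_lower_bound[OF c nd]) (auto intro: that)
  have mw[measurable]: "lam \<in> borel_measurable lebesgue" "\<mu> \<in> borel_measurable lebesgue" "\<eta> \<in> borel_measurable lebesgue"
    using w weight_measurable by auto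
  have nn: "0 \<le> lam x" "0 \<le> \<mu> x" "0 \<le> \<eta> x" for x using w by (auto simp: weight_def)
  obtain d :: "nat \<Rightarrow> real" where d0: "d 0 = 1" and d: "\<And>b f x. (\<forall>k\<le>m. (\<lambda>y. of_real (b y ^ k) * f y) \<in> L2) \<Longrightarrow>
    iterated_commutator T b m f x = (\<Sum>k\<le>m. of_real (d k * b x ^ (m - k)) * T (\<lambda>y. of_real (b y ^ k) * f y) x)"
    using iterated_commutator_expansion[of m] by blast
  \<comment> \<open>\<open>C\<close> is the constant of the hypothesis, 2 bounds the BMO norm of the
    test function, and \<kappa> is the lower bound for \<open>T f\<close>.\<close>
  define D where "D = (C * 2 ^ m / \<kappa>) powr p"
  have D: "0 \<le> D" by (simp add: D_def)
  define g where "g R x = min (\<eta> x) R powr (p * real m) * lam x" for R x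
  have g0: "0 \<le> g R x" for R x using nn by (simp add: g_def)
  have mg[measurable]: "g R \<in> borel_measurable lebesgue" for R unfolding g_def by measurable
  have wg: "weight (g R)" if R: "0 < R" for R
  proof -
    have "set_integrable lebesgue S (g R)" if S: "bounded S" "S \<in> sets lebesgue" for S
      unfolding set_integrable_def real_scaleR_def
    proof (rule Bochner_Integration.integrable_bound)
      show "integrable lebesgue (\<lambda>x. R powr (p * real m) * (indicator S x * lam x))"
        by (intro integrable_mult_right weight_set_integrable w S)
      show "(\<lambda>x. indicator S x * g R x) \<in> borel_measurable lebesgue"
        using S by (intro borel_measurable_times borel_measurable_indicator) auto
      have "g R x \<le> R powr (p * real m) * lam x" for x
        unfolding g_def using nn R p by (intro mult_right_mono powr_mono2) auto
      then show "AE x in lebesgue. norm (indicat_real S x * g R x) \<le> norm (R powr (p * real m) * (indicat_real S x * lam x))"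
        using g0 nn by (auto simp: indicator_def intro!: AE_I2)
    qed
    then show ?thesis using g0
      by (auto simp: weight_def locally_integrable_def intro!: compact_imp_bounded fmeasurableD lmeasurable_compact)
  qed
  have local: "(LINT x:ball x0 (\<epsilon> * r)|lebesgue. g R x) \<le> D * (LINT x:ball y0 (\<epsilon> * r)|lebesgue. \<mu> x)"
    if R: "0 < R" and r: "0 < r" and d1: "r \<le> norm (x0 - y0)"
      and lb: "AE x in lebesgue. x \<in> ball x0 (\<epsilon> * r) \<longrightarrow> \<kappa> \<le> norm (T (rst (ball y0 (\<epsilon> * r)) (\<lambda>_. 1)) x)"
    for R r x0 y0
  proof -
    define F where "F = ball x0 (\<epsilon> * r)"
    define B where "B = ball y0 (\<epsilon> * r)"
    have er: "0 < \<epsilon> * r" "\<epsilon> * r < r / 4" using \<epsilon> r by auto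
    have FB: "F \<inter> B = {}"
    proof (rule ccontr)
      assume "F \<inter> B \<noteq> {}"
      then obtain z where "norm (x0 - z) < \<epsilon> * r" "norm (y0 - z) < \<epsilon> * r" by (auto simp: F_def B_def dist_norm)
      then have "norm (x0 - y0) < \<epsilon> * r + \<epsilon> * r"
        using norm_triangle_ineq[of "x0 - z" "z - y0"] by (simp add: norm_minus_commute)
      then show False using d1 er by linarith
    qed
    have [measurable]: "F \<in> sets lebesgue" "B \<in> sets lebesgue" by (auto simp: F_def B_def)
    define f where "f = rst B (\<lambda>_. 1)"
    have fL12: "f \<in> L12" unfolding f_def B_def by (rule rst_ball_one_L12)
    then have fL2: "f \<in> L2" and fint: "integrable lebesgue f" by (auto simp: L12_def)
    have f_supp: "f x = (if x \<in> B then 1 else 0)" for x by (simp add: f_def rst_def)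
    define b where "b x = (if x \<in> F then min (\<eta> x) R else 0)" for x
    have mb[measurable]: "b \<in> borel_measurable lebesgue" unfolding b_def by measurable
    have b0: "0 \<le> b x" "b x \<le> \<eta> x" for x using nn R by (auto simp: b_def)
    note bb = bmo_norm_le_2[OF w(3) mb b0]
    have bBMO: "b \<in> BMO \<eta>" using bb by (auto simp: BMO_def intro: order.strict_trans1)
    \<comment> \<open>\<open>b\<close> and \<open>f\<close> have disjoint supports, so only the term
      k = 0 of the expansion survives, with coefficient d 0 = 1.\<close>
    have bf: "(\<lambda>y. of_real (b y ^ k) * f y) = (if k = 0 then f else (\<lambda>_. 0))" for k
    proof
      fix y
      have "b y = 0 \<or> f y = 0" using FB by (auto simp: b_def f_supp)
      then show "of_real (b y ^ k) * f y = (if k = 0 then f else (\<lambda>_. 0)) y" by auto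
    qed
    have zL2: "(\<lambda>_ :: real ^ 'n. 0) \<in> L2" by (simp add: L2_iff)
    have dom: "f \<in> commutator_domain b m"
      unfolding commutator_domain_def
    proof (intro CollectI conjI allI impI)
      show "f \<in> borel_measurable lebesgue" using fL2 by (rule L2_measurable)
      show "bounded (range f)" by (rule boundedI[of _ 1]) (auto simp: f_supp)
      have "bounded {x. f x \<noteq> 0}" by (rule bounded_subset[of B]) (auto simp: f_supp B_def split: if_splits)
      then show "compact (closure {x. f x \<noteq> 0})" by (simp add: compact_closure)
      fix k
      show "integrable lebesgue (\<lambda>x. complex_of_real (b x ^ k) * f x)"
        unfolding bf using fint by auto
    qed
    have T0: "AE x in lebesgue. T (\<lambda>_. 0) x = 0" by (rule T_zero_AE[OF zL2]) auto
    define X where "X = (\<integral>\<^sup>+x. ennreal (norm (f x) powr p * \<mu> x) \<partial>lebesgue)"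
    define Y where "Y = (\<integral>\<^sup>+x. ennreal (norm (iterated_commutator T b m f x) powr p * lam x) \<partial>lebesgue)"
    have Xe: "X = ennreal (LINT x:B|lebesgue. \<mu> x)"
    proof -
      have "X = (\<integral>\<^sup>+x. ennreal (indicator B x * \<mu> x) \<partial>lebesgue)"
        unfolding X_def by (intro nn_integral_cong) (auto simp: f_supp indicator_def)
      also have "\<dots> = ennreal (LINT x:B|lebesgue. \<mu> x)"
        unfolding set_lebesgue_integral_def real_scaleR_def using nn
        by (intro nn_integral_eq_integral weight_set_integrable w) (auto simp: B_def)
      finally show ?thesis .
    qed
    have "ennreal_powr Y (1/p) \<le> ennreal C * bmo_norm \<eta> b ^ m * ennreal_powr X (1/p)"
      using bd[OF bb(1) bBMO dom] by (simp add: weighted_Lp_norm_def X_def Y_def)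
    also have "\<dots> \<le> ennreal C * 2 ^ m * ennreal_powr X (1/p)"
      using bb(2) by (intro mult_right_mono mult_left_mono power_mono) auto
    also have "ennreal C * 2 ^ m = ennreal (C * 2 ^ m)" using C by (simp add: ennreal_mult flip: ennreal_power)
    finally have YX: "Y \<le> ennreal ((C * 2 ^ m) powr p) * X"
      using p C by (intro ennreal_powr_le_multD) (auto simp: Xe)
    have lower: "ennreal (\<kappa> powr p) * (\<integral>\<^sup>+x\<in>F. ennreal (g R x) \<partial>lebesgue) \<le> Y"
    proof -
      have "ennreal (\<kappa> powr p) * (\<integral>\<^sup>+x\<in>F. ennreal (g R x) \<partial>lebesgue) = (\<integral>\<^sup>+x. ennreal (\<kappa> powr p) * (ennreal (g R x) * indicator F x) \<partial>lebesgue)"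
        by (rule nn_integral_cmult[symmetric]) measurable
      also have "\<dots> \<le> Y"
        unfolding Y_def
      proof (intro nn_integral_mono_AE)
        show "AE x in lebesgue. ennreal (\<kappa> powr p) * (ennreal (g R x) * indicator F x) \<le> ennreal (norm (iterated_commutator T b m f x) powr p * lam x)"
          using lb T0 unfolding F_def[symmetric] B_def[symmetric] f_def[symmetric]
        proof eventually_elim
          case (elim x)
          show ?case
          proof (cases "x \<in> F")
            case True
            then have k: "\<kappa> \<le> norm (T f x)" using elim(1) by simp
            have "\<forall>k\<le>m. (\<lambda>y. of_real (b y ^ k) * f y) \<in> L2" unfolding bf using zL2 fL2 by simp
            from d[OF this, of x] have "iterated_commutator T b m f x = (\<Sum>k\<le>m. of_real (d k * b x ^ (m - k)) * T (if k = 0 then f else (\<lambda>_. 0)) x)"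
              unfolding bf .
            also have "\<dots> = (\<Sum>k\<in>{0}. of_real (d k * b x ^ (m - k)) * T (if k = 0 then f else (\<lambda>_. 0)) x)"
              using elim(2) by (intro sum.mono_neutral_right) auto
            also have "\<dots> = of_real (b x ^ m) * T f x" by (simp add: d0)
            finally have "norm (iterated_commutator T b m f x) = b x ^ m * norm (T f x)"
              using b0[of x] by (simp only: norm_mult norm_of_real power_abs abs_of_nonneg)
            then have "b x ^ m * \<kappa> \<le> norm (iterated_commutator T b m f x)"
              using k b0[of x] by (simp add: mult_left_mono)
            then have "(b x ^ m * \<kappa>) powr p \<le> norm (iterated_commutator T b m f x) powr p"
              using b0[of x] \<kappa> p by (intro powr_mono2) auto
            moreover have "(b x ^ m * \<kappa>) powr p = \<kappa> powr p * b x powr (p * real m)"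
            proof (cases "b x = 0")
              case False
              then have "b x ^ m = b x powr real m" using b0[of x] by (simp add: powr_realpow)
              then show ?thesis using b0[of x] \<kappa> by (simp add: powr_mult powr_powr mult.commute)
            qed (use m in simp)
            ultimately have "\<kappa> powr p * b x powr (p * real m) * lam x \<le> norm (iterated_commutator T b m f x) powr p * lam x"
              using nn by (intro mult_right_mono) auto
            moreover have "\<kappa> powr p * b x powr (p * real m) * lam x = \<kappa> powr p * g R x"
              using True by (simp add: g_def b_def)
            ultimately show ?thesis using True g0 by (simp add: ennreal_leI flip: ennreal_mult)
          qed simp
        qed
      qed
      finally show ?thesis .
    qed
    have gF: "(\<integral>\<^sup>+x\<in>F. ennreal (g R x) \<partial>lebesgue) = ennreal (LINT x:F|lebesgue. g R x)"
    proof -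
      have "(\<integral>\<^sup>+x\<in>F. ennreal (g R x) \<partial>lebesgue) = (\<integral>\<^sup>+x. ennreal (indicator F x * g R x) \<partial>lebesgue)"
        by (intro nn_integral_cong) (auto simp: indicator_def)
      also have "\<dots> = ennreal (LINT x:F|lebesgue. g R x)"
        unfolding set_lebesgue_integral_def real_scaleR_def using g0
        by (intro nn_integral_eq_integral weight_set_integrable wg[OF R]) (auto simp: F_def)
      finally show ?thesis .
    qed
    have n1: "0 \<le> (LINT x:F|lebesgue. g R x)" "0 \<le> (LINT x:B|lebesgue. \<mu> x)"
      using wg[OF R] w by (auto intro: weight_set_integral_nonneg)
    have "ennreal (\<kappa> powr p * (LINT x:F|lebesgue. g R x)) \<le> ennreal ((C * 2 ^ m) powr p * (LINT x:B|lebesgue. \<mu> x))"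
      using order.trans[OF lower YX] n1 unfolding gF Xe by (simp add: ennreal_mult)
    then have "\<kappa> powr p * (LINT x:F|lebesgue. g R x) \<le> (C * 2 ^ m) powr p * (LINT x:B|lebesgue. \<mu> x)"
      using n1 by (subst (asm) ennreal_le_iff) auto
    then have "(LINT x:F|lebesgue. g R x) \<le> (C * 2 ^ m) powr p / \<kappa> powr p * (LINT x:B|lebesgue. \<mu> x)"
      using \<kappa> by (simp add: field_simps)
    then show ?thesis unfolding D_def F_def B_def using C \<kappa> by (simp add: powr_divide)
  qed
  have pointwise: "g R x \<le> D * \<mu> x" if R: "0 < R" and lp: "lebesgue_point (g R) x" "lebesgue_point \<mu> x" for R x
  proof (rule field_le_epsilon)
    fix e :: real assume e: "0 < e"
    \<comment> \<open>The ratio of \<rho>^n to the volume of one of the two small balls, where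
      \<rho> is large enough for the ball of radius \<rho> about \<open>x\<close> to contain both.
      It converts errors relative to \<rho>^n into errors relative to the small volume.\<close>
    define q where "q = (2 * M + 2) ^ ?n / (V * \<epsilon> ^ ?n)"
    have q: "0 < q" using M V \<epsilon> by (simp add: q_def)
    define e1 where "e1 = e / ((D + 1) * q)"
    have e1: "0 < e1" using e q D by (simp add: e1_def)
    have lg: "locally_integrable (g R)" "locally_integrable \<mu>" using wg[OF R] w by (auto simp: weight_def)
    obtain r1 where r1: "0 < r1" "\<And>r A. \<lbrakk>0 < r; r < r1; A \<in> sets lebesgue; A \<subseteq> ball x r\<rbrakk> \<Longrightarrow>
      \<bar>(LINT y:A|lebesgue. g R y) - g R x * measure lebesgue A\<bar> \<le> e1 * r ^ ?n"
      by (rule lebesgue_point_set_integral[OF lg(1) lp(1) e1]) blast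
    obtain r2 where r2: "0 < r2" "\<And>r A. \<lbrakk>0 < r; r < r2; A \<in> sets lebesgue; A \<subseteq> ball x r\<rbrakk> \<Longrightarrow>
      \<bar>(LINT y:A|lebesgue. \<mu> y) - \<mu> x * measure lebesgue A\<bar> \<le> e1 * r ^ ?n"
      by (rule lebesgue_point_set_integral[OF lg(2) lp(2) e1]) blast
    define r where "r = min r1 r2 / (2 * (2 * M + 2))"
    have r: "0 < r" using r1 r2 M by (simp add: r_def)
    define \<rho> where "\<rho> = (2 * M + 2) * r"
    have \<rho>: "0 < \<rho>" "\<rho> < r1" "\<rho> < r2"
    proof -
      have "k * (a / (2 * k)) = a / 2" if "k \<noteq> 0" for k a :: real using that by simp
      from this[of "2 * M + 2" "min r1 r2"] have "\<rho> = min r1 r2 / 2" using M unfolding \<rho>_def r_def by linarith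
      then show "0 < \<rho>" "\<rho> < r1" "\<rho> < r2" using r1 r2 by auto
    qed
    obtain y0 where y0: "r \<le> norm (x - y0)" "norm (x - y0) \<le> M * r"
      "AE z in lebesgue. z \<in> ball x (\<epsilon> * r) \<longrightarrow> \<kappa> \<le> norm (T (rst (ball y0 (\<epsilon> * r)) (\<lambda>_. 1)) z)"
      using low[OF r, of x] by blast
    define s where "s = measure lebesgue (ball x (\<epsilon> * r))"
    have er: "0 < \<epsilon> * r" "\<epsilon> * r \<le> r" using \<epsilon> r by auto
    have s: "s = (\<epsilon> * r) ^ ?n * V" unfolding s_def V_def using er by (intro measure_lebesgue_ball) auto
    have s2: "measure lebesgue (ball y0 (\<epsilon> * r)) = s" unfolding s V_def using er by (intro measure_lebesgue_ball) auto
    have spos: "0 < s" using s er V by simp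
    have Mr: "r \<le> M * r" using M r by simp
    have rho2: "\<rho> = 2 * (M * r) + 2 * r" by (simp add: \<rho>_def algebra_simps)
    have sub1: "ball x (\<epsilon> * r) \<subseteq> ball x \<rho>"
      using er(2) Mr r unfolding rho2 by (intro subset_ball) linarith
    have sub2: "ball y0 (\<epsilon> * r) \<subseteq> ball x \<rho>"
    proof
      fix z assume "z \<in> ball y0 (\<epsilon> * r)"
      then have "norm (y0 - z) < \<epsilon> * r" by (simp add: dist_norm)
      then have "norm (x - z) < M * r + r"
        using norm_triangle_ineq[of "x - y0" "y0 - z"] y0(2) er by simp
      then show "z \<in> ball x \<rho>" using r Mr unfolding rho2 mem_ball dist_norm by linarith
    qed
    have a1: "g R x * s \<le> (LINT y:ball x (\<epsilon> * r)|lebesgue. g R y) + e1 * \<rho> ^ ?n"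
      using r1(2)[OF \<rho>(1,2) ball_in_sets_lebesgue sub1] unfolding s_def[symmetric] by linarith
    have a2: "(LINT y:ball y0 (\<epsilon> * r)|lebesgue. \<mu> y) \<le> \<mu> x * s + e1 * \<rho> ^ ?n"
      using r2(2)[OF \<rho>(1,3) ball_in_sets_lebesgue sub2] unfolding s2 by linarith
    have "g R x * s \<le> D * (\<mu> x * s + e1 * \<rho> ^ ?n) + e1 * \<rho> ^ ?n"
      using a1 local[OF R r y0(1,3)] mult_left_mono[OF a2 D] by linarith
    also have "\<dots> = D * \<mu> x * s + e1 * (D + 1) * \<rho> ^ ?n" by (simp add: algebra_simps)
    also have "\<rho> ^ ?n = q * s" unfolding q_def s \<rho>_def power_mult_distrib using V \<epsilon> by simp
    also have "D * \<mu> x * s + e1 * (D + 1) * (q * s) = (D * \<mu> x + e) * s"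
    proof -
      have "e1 * (D + 1) * q = e" using q D by (simp add: e1_def)
      then have "e1 * (D + 1) * (q * s) = e * s" by (simp add: mult.assoc[symmetric])
      then show ?thesis by (simp add: distrib_right)
    qed
    finally show "g R x \<le> D * \<mu> x + e" using spos by (simp add: mult_le_cancel_right)
  qed
  have "AE x in lebesgue. \<forall>N::nat. lebesgue_point (g (real (Suc N))) x"
    unfolding AE_all_countable using wg by (auto simp: weight_def intro!: AE_lebesgue_point)
  moreover have "AE x in lebesgue. lebesgue_point \<mu> x" using w by (auto simp: weight_def intro!: AE_lebesgue_point)
  ultimately have "AE x in lebesgue. \<eta> x powr (p * real m) * lam x \<le> D * \<mu> x"
  proof eventually_elim
    case (elim x)
    obtain N :: nat where N: "\<eta> x < real N" using reals_Archimedean2 by blast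
    then have "g (real (Suc N)) x = \<eta> x powr (p * real m) * lam x" by (simp add: g_def min_def)
    then show ?case using pointwise[of "real (Suc N)" x] elim by simp
  qed
  then show ?thesis using D by blast
qed

end

subsection \<open>The lower bound\<close>

lemma lebesgue_point_cube:
  fixes f :: "real ^ 'n \<Rightarrow> real"
  assumes f: "locally_integrable f" and x: "lebesgue_point f x" and e: "0 < e"
  obtains d where "0 < d" "\<And>h. \<lbrakk>0 < h; h < d\<rbrakk> \<Longrightarrow> \<bar>(LINT y:cube x h|lebesgue. f y) - f x * h ^ CARD('n)\<bar> \<le> e * h ^ CARD('n)"
proof -
  define k where "k = real CARD('n) + 1"
  have k: "0 < k" by (simp add: k_def)
  obtain d where d: "0 < d" "\<And>r A. \<lbrakk>0 < r; r < d; A \<in> sets lebesgue; A \<subseteq> ball x r\<rbrakk> \<Longrightarrow>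
    \<bar>(LINT y:A|lebesgue. f y) - f x * measure lebesgue A\<bar> \<le> e / k ^ CARD('n) * r ^ CARD('n)"
    by (rule lebesgue_point_set_integral[OF f x, of "e / k ^ CARD('n)"]) (use e k in auto)
  show ?thesis
  proof (rule that)
    show "0 < d / k" using d k by simp
    fix h assume h: "0 < h" "h < d / k"
    have "cube x h \<subseteq> ball x (k * h)"
    proof
      fix y assume "y \<in> cube x h"
      from cube_dist_corner[OF this] show "y \<in> ball x (k * h)"
        using h by (simp add: dist_norm norm_minus_commute k_def distrib_right)
    qed
    then have "\<bar>(LINT y:cube x h|lebesgue. f y) - f x * measure lebesgue (cube x h)\<bar> \<le> e / k ^ CARD('n) * (k * h) ^ CARD('n)"
      using h k by (intro d) (auto simp: field_simps)
    then show "\<bar>(LINT y:cube x h|lebesgue. f y) - f x * h ^ CARD('n)\<bar> \<le> e * h ^ CARD('n)"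
      using h k by (simp add: measure_lebesgue_cube power_mult_distrib)
  qed
qed

text \<open>Where \<eta> < c \<nu>, a rational \<open>t\<close> lies between \<eta>/c and \<nu>. As
  there are countably many levels, some set where \<eta> < c t and t <= \<nu> is not null; a point
  of it that is a Lebesgue point of its indicator and of \<eta> serves. The constant level stands in
  for \<nu>, which is only assumed measurable.\<close>

lemma small_weight_point:
  fixes \<eta> \<nu> :: "real ^ 'n \<Rightarrow> real"
  assumes \<eta>: "weight \<eta>" and m\<nu>: "\<nu> \<in> borel_measurable lebesgue" and c: "0 < c"
    and not: "\<not> (AE x in lebesgue. c * \<nu> x \<le> \<eta> x)"
  shows "\<exists>t S x H. 0 < t \<and> S \<in> sets lebesgue \<and> (\<forall>y\<in>S. t \<le> \<nu> y) \<and> 0 < H \<and>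
    (\<forall>h. 0 < h \<and> h < H \<longrightarrow> (LINT y:cube x h|lebesgue. \<eta> y) \<le> 2 * c * t * h ^ CARD('n) \<and>
       1 / 2 * h ^ CARD('n) \<le> measure lebesgue (S \<inter> cube x h))"
proof -
  have m\<eta>: "\<eta> \<in> borel_measurable lebesgue" using \<eta> by (rule weight_measurable)
  define S where "S t = {y. \<eta> y < c * t \<and> t \<le> \<nu> y}" for t
  have S: "S t \<in> sets lebesgue" for t
  proof -
    have "{y \<in> space lebesgue. \<eta> y < c * t \<and> t \<le> \<nu> y} \<in> sets lebesgue" using m\<eta> m\<nu> by measurable
    then show ?thesis by (simp add: S_def)
  qed
  have "\<exists>t\<in>\<rat>. \<not> (AE y in lebesgue. y \<notin> S t)"
  proof (rule ccontr)
    assume "\<not> ?thesis"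
    then have "AE y in lebesgue. \<forall>t\<in>\<rat>. y \<notin> S t" by (subst AE_ball_countable) (auto simp: countable_rat)
    then have "AE y in lebesgue. c * \<nu> y \<le> \<eta> y"
    proof eventually_elim
      case (elim y)
      show ?case
      proof (rule ccontr)
        assume "\<not> ?thesis"
        then have "\<eta> y / c < \<nu> y" using c by (simp add: field_simps)
        then obtain t where "t \<in> \<rat>" "\<eta> y / c < t" "t < \<nu> y" using Rats_dense_in_real by blast
        then show False using elim c by (auto simp: S_def field_simps)
      qed
    qed
    then show False using not by simp
  qed
  then obtain t where nS: "\<not> (AE y in lebesgue. y \<notin> S t)" by blast
  have "\<exists>x. x \<in> S t \<and> lebesgue_point (indicator (S t)) x \<and> lebesgue_point \<eta> x"
  proof (rule ccontr)
    assume a: "\<not> ?thesis"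
    have "AE x in lebesgue. lebesgue_point \<eta> x" using \<eta> by (auto simp: weight_def intro!: AE_lebesgue_point)
    with AE_lebesgue_point_indicator[OF S] have "AE y in lebesgue. y \<notin> S t"
      by eventually_elim (use a in blast)
    then show False using nS by simp
  qed
  then obtain x where x: "x \<in> S t" "lebesgue_point (indicator (S t)) x" "lebesgue_point \<eta> x" by blast
  have t: "0 < t"
  proof -
    have "0 < c * t" using x(1) \<eta> by (auto simp: S_def weight_def intro: order.strict_trans1)
    then show ?thesis using c by (simp add: zero_less_mult_iff)
  qed
  have li: "locally_integrable (indicator (S t) :: real ^ 'n \<Rightarrow> real)"
    unfolding locally_integrable_def
  proof (intro allI impI)
    fix K :: "(real ^ 'n) set" assume K: "compact K"
    have "integrable lebesgue (indicator (K \<inter> S t) :: real ^ 'n \<Rightarrow> real)"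
      using lmeasurable_compact[OF K] S[of t] by (intro integrable_real_indicator) (auto simp: fmeasurable_def fmeasurable_Int_fmeasurable intro: le_less_trans[OF emeasure_mono])
    then show "set_integrable lebesgue K (indicator (S t) :: real ^ 'n \<Rightarrow> real)"
      by (simp add: set_integrable_def indicator_inter_arith[abs_def])
  qed
  have l\<eta>: "locally_integrable \<eta>" using \<eta> by (simp add: weight_def)
  obtain d1 where d1: "0 < d1" "\<And>h. \<lbrakk>0 < h; h < d1\<rbrakk> \<Longrightarrow>
    \<bar>(LINT y:cube x h|lebesgue. indicator (S t) y) - indicator (S t) x * h ^ CARD('n)\<bar> \<le> (1 / 2 :: real) * h ^ CARD('n)"
    by (rule lebesgue_point_cube[OF li x(2), of "1/2"]) auto
  have ct: "0 < c * t" using c t by simp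
  obtain d2 where d2: "0 < d2" "\<And>h. \<lbrakk>0 < h; h < d2\<rbrakk> \<Longrightarrow>
    \<bar>(LINT y:cube x h|lebesgue. \<eta> y) - \<eta> x * h ^ CARD('n)\<bar> \<le> c * t * h ^ CARD('n)"
    by (rule lebesgue_point_cube[OF l\<eta> x(3) ct]) auto
  have "(LINT y:cube x h|lebesgue. \<eta> y) \<le> 2 * c * t * h ^ CARD('n) \<and> 1 / 2 * h ^ CARD('n) \<le> measure lebesgue (S t \<inter> cube x h)"
    if h: "0 < h" "h < min d1 d2" for h
  proof
    have "\<eta> x * h ^ CARD('n) \<le> c * t * h ^ CARD('n)"
      using x(1) h by (intro mult_right_mono) (auto simp: S_def)
    then show "(LINT y:cube x h|lebesgue. \<eta> y) \<le> 2 * c * t * h ^ CARD('n)"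
    proof -
      have "h < d2" using h by simp
      from d2(2)[OF h(1) this] \<open>\<eta> x * h ^ CARD('n) \<le> c * t * h ^ CARD('n)\<close> show ?thesis unfolding abs_le_iff by linarith
    qed
    have "(LINT y:cube x h|lebesgue. indicator (S t) y) = (LINT y|lebesgue. indicator (S t \<inter> cube x h) y :: real)"
      unfolding set_lebesgue_integral_def real_scaleR_def by (intro Bochner_Integration.integral_cong) (auto simp: indicator_def)
    also have "\<dots> = measure lebesgue (S t \<inter> cube x h)" by simp
    finally have eq: "(LINT y:cube x h|lebesgue. indicator (S t) y) = measure lebesgue (S t \<inter> cube x h)" .
    have "h < d1" using h by simp
    from d1(2)[OF h(1) this] have "\<bar>measure lebesgue (S t \<inter> cube x h) - 1 * h ^ CARD('n)\<bar> \<le> (1 / 2 :: real) * h ^ CARD('n)"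
      unfolding eq using x(1) by simp
    then show "1 / 2 * h ^ CARD('n) \<le> measure lebesgue (S t \<inter> cube x h)"
      unfolding abs_le_iff by linarith
  qed
  then show ?thesis using t S d1(1) d2(1)
    by (intro exI[of _ t] exI[of _ "S t"] exI[of _ x] exI[of _ "min d1 d2"]) (auto simp: S_def)
qed

text \<open>For d = 0 the finite bound forces a = 0, because a/0 = \<infinity> for a > 0.\<close>

lemma ennreal_divide_leD:
  fixes a d c :: ennreal
  assumes "a / d \<le> c" "c < \<infinity>" "d < \<infinity>"
  shows "a \<le> c * d"
proof (cases "d = 0")
  case True
  then have "a = 0" using assms by (cases "a = 0") (auto simp: ennreal_divide_zero top_unique)
  then show ?thesis by simp
next
  case False
  have "a = a / d * d" using False assms(3)
    by (metis ennreal_times_divide infinity_ennreal_def less_irrefl mult.commute mult_divide_eq_ennreal)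
  also have "\<dots> \<le> c * d" using assms(1) by (intro mult_right_mono) auto
  finally show ?thesis .
qed

text \<open>Whatever \<open>a\<close> is, |\<tau> - a| + |a| >= \<tau>, and each summand is the
  oscillation on a set of measure at least \<open>v\<close>.\<close>

lemma nn_integral_oscillation_ge:
  fixes b :: "'a \<Rightarrow> real"
  assumes A: "A \<in> sets M" "A \<subseteq> Q" "\<And>x. x \<in> A \<Longrightarrow> b x = \<tau>" "ennreal v \<le> emeasure M A"
    and Z: "Z \<in> sets M" "Z \<subseteq> Q" "\<And>x. x \<in> Z \<Longrightarrow> b x = 0" "ennreal v \<le> emeasure M Z"
    and disj: "A \<inter> Z = {}" and v: "0 \<le> v"
  shows "ennreal (\<tau> * v) \<le> (\<integral>\<^sup>+x\<in>Q. ennreal \<bar>b x - a\<bar> \<partial>M)"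
proof -
  have "\<tau> * v \<le> \<bar>\<tau> - a\<bar> * v + \<bar>a\<bar> * v" using v by (simp flip: distrib_right add: mult_right_mono)
  then have "ennreal (\<tau> * v) \<le> ennreal (\<bar>\<tau> - a\<bar> * v + \<bar>a\<bar> * v)" by (rule ennreal_leI)
  also have "\<dots> = ennreal \<bar>\<tau> - a\<bar> * ennreal v + ennreal \<bar>a\<bar> * ennreal v"
    using v by (simp add: ennreal_plus ennreal_mult)
  also have "\<dots> \<le> ennreal \<bar>\<tau> - a\<bar> * emeasure M A + ennreal \<bar>a\<bar> * emeasure M Z"
    using A Z by (intro add_mono mult_left_mono) auto
  also have "\<dots> = (\<integral>\<^sup>+x. ennreal \<bar>\<tau> - a\<bar> * indicator A x + ennreal \<bar>a\<bar> * indicator Z x \<partial>M)"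
    using A Z by (simp add: nn_integral_add nn_integral_cmult_indicator)
  also have "\<dots> \<le> (\<integral>\<^sup>+x\<in>Q. ennreal \<bar>b x - a\<bar> \<partial>M)"
    using A(2,3) Z(2,3) disj by (intro nn_integral_mono) (auto simp: indicator_def)
  finally show ?thesis .
qed

text \<open>A gliding hump. On the j-th cube, of side h_j, \<open>b\<close> is \<tau>_j on a fixed
  share and 0 on another, so its oscillation is at least a fixed share of \<tau>_j h_j^n, while
  \<eta> has mass at most 2^(1-j) \<tau>_j h_j^n. The height cancels and the quotient grows like
  2^j. Later cubes may lie anywhere, even inside earlier ones, and are made so small that cutting
  them out of the earlier sets costs little.\<close>

theorem weight_lower_bound:
  fixes \<eta> \<nu> :: "real ^ 'n \<Rightarrow> real"
  assumes \<eta>: "weight \<eta>" and m\<nu>: "\<nu> \<in> borel_measurable lebesgue" and \<nu>: "\<And>x. 0 \<le> \<nu> x" and k: "1 \<le> k"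
    and bmo: "\<And>b. \<lbrakk>b \<in> borel_measurable lebesgue; \<And>x. 0 \<le> b x; \<And>x. b x \<le> \<nu> x;
      (\<integral>\<^sup>+x. ennreal (b x ^ k) \<partial>lebesgue) < \<infinity>\<rbrakk> \<Longrightarrow> b \<in> BMO \<eta>"
  shows "\<exists>c>0. AE x in lebesgue. c * \<nu> x \<le> \<eta> x"
proof (rule ccontr)
  let ?n = "CARD('n)"
  assume no: "\<not> ?thesis"
  have "\<forall>j::nat. \<exists>t S x H. 0 < t \<and> S \<in> sets lebesgue \<and> (\<forall>y\<in>S. t \<le> \<nu> y) \<and> 0 < H \<and>
    (\<forall>h. 0 < h \<and> h < H \<longrightarrow> (LINT y:cube x h|lebesgue. \<eta> y) \<le> 2 * (1/2) ^ j * t * h ^ ?n \<and>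
       1 / 2 * h ^ ?n \<le> measure lebesgue (S \<inter> cube x h))"
  proof
    fix j :: nat
    have "\<not> (AE x in lebesgue. (1/2) ^ j * \<nu> x \<le> \<eta> x)" using no by auto
    then show "\<exists>t S x H. 0 < t \<and> S \<in> sets lebesgue \<and> (\<forall>y\<in>S. t \<le> \<nu> y) \<and> 0 < H \<and>
      (\<forall>h. 0 < h \<and> h < H \<longrightarrow> (LINT y:cube x h|lebesgue. \<eta> y) \<le> 2 * (1/2) ^ j * t * h ^ ?n \<and>
       1 / 2 * h ^ ?n \<le> measure lebesgue (S \<inter> cube x h))"
      by (intro small_weight_point[OF \<eta> m\<nu>]) auto
  qed
  from this[THEN choice] obtain \<tau> where "\<forall>j. \<exists>S x H. 0 < \<tau> j \<and> S \<in> sets lebesgue \<and> (\<forall>y\<in>S. \<tau> j \<le> \<nu> y) \<and> 0 < H \<and>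
    (\<forall>h. 0 < h \<and> h < H \<longrightarrow> (LINT y:cube x h|lebesgue. \<eta> y) \<le> 2 * (1/2) ^ j * \<tau> j * h ^ ?n \<and>
       1 / 2 * h ^ ?n \<le> measure lebesgue (S \<inter> cube x h))" by (elim exE)
  from this[THEN choice] obtain S where "\<forall>j. \<exists>x H. 0 < \<tau> j \<and> S j \<in> sets lebesgue \<and> (\<forall>y\<in>S j. \<tau> j \<le> \<nu> y) \<and> 0 < H \<and>
    (\<forall>h. 0 < h \<and> h < H \<longrightarrow> (LINT y:cube x h|lebesgue. \<eta> y) \<le> 2 * (1/2) ^ j * \<tau> j * h ^ ?n \<and>
       1 / 2 * h ^ ?n \<le> measure lebesgue (S j \<inter> cube x h))" by (elim exE)
  from this[THEN choice] obtain z where "\<forall>j. \<exists>H. 0 < \<tau> j \<and> S j \<in> sets lebesgue \<and> (\<forall>y\<in>S j. \<tau> j \<le> \<nu> y) \<and> 0 < H \<and>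
    (\<forall>h. 0 < h \<and> h < H \<longrightarrow> (LINT y:cube (z j) h|lebesgue. \<eta> y) \<le> 2 * (1/2) ^ j * \<tau> j * h ^ ?n \<and>
       1 / 2 * h ^ ?n \<le> measure lebesgue (S j \<inter> cube (z j) h))" by (elim exE)
  from this[THEN choice] obtain H where all: "\<forall>j. 0 < \<tau> j \<and> S j \<in> sets lebesgue \<and> (\<forall>y\<in>S j. \<tau> j \<le> \<nu> y) \<and> 0 < H j \<and>
    (\<forall>h. 0 < h \<and> h < H j \<longrightarrow> (LINT y:cube (z j) h|lebesgue. \<eta> y) \<le> 2 * (1/2) ^ j * \<tau> j * h ^ ?n \<and>
       1 / 2 * h ^ ?n \<le> measure lebesgue (S j \<inter> cube (z j) h))" by (elim exE)
  have \<tau>: "0 < \<tau> j" and S[measurable]: "S j \<in> sets lebesgue" and S\<nu>: "y \<in> S j \<Longrightarrow> \<tau> j \<le> \<nu> y" and H: "0 < H j" for j y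
    using all by auto
  have small\<eta>: "(LINT y:cube (z j) h|lebesgue. \<eta> y) \<le> 2 * (1/2) ^ j * \<tau> j * h ^ ?n"
    and dense: "1 / 2 * h ^ ?n \<le> measure lebesgue (S j \<inter> cube (z j) h)" if "0 < h" "h < H j" for j h
    using all that by auto
  \<comment> \<open>Later cubes may take at most v_j = 2 \<theta> h_j^n. This \<theta> gives
    \<open>R j\<close> the volume 8 v_j, so \<open>S j\<close> fills at least 4 v_j of it; since the
    whole cube has at least 16 v_j, both \<open>A j\<close> and \<open>Z j\<close> keep v_j after
    the loss.\<close>
  define \<theta> :: real where "\<theta> = (1/2) ^ ?n / 16"
  have \<theta>: "0 < \<theta>" "\<theta> \<le> 1/2" using power_le_one[of "1/2 :: real" ?n] by (auto simp: \<theta>_def)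
  \<comment> \<open>The last condition makes the sum of \<tau>_j^k times the volumes converge, so
    that b^k is integrable.\<close>
  define P where "P j h \<longleftrightarrow> 0 < h \<and> h < H j \<and> \<tau> j ^ k * h ^ ?n \<le> (1/2) ^ j" for j h
  have ex: "\<exists>h. P j h \<and> h ^ ?n \<le> s" if s: "0 < s" for j s
  proof -
    define q where "q = min s ((1/2) ^ j / \<tau> j ^ k)"
    define h where "h = min (H j / 2) (min 1 q)"
    have "0 < q" using s \<tau>[of j] by (simp add: q_def)
    then have h: "0 < h" "h < H j" "h \<le> 1" "h \<le> q" using H[of j] by (auto simp: h_def)
    have "h ^ ?n \<le> h ^ 1" using h by (intro power_decreasing) auto
    then have hq: "h ^ ?n \<le> q" using h by simp
    then have "h ^ ?n \<le> (1/2) ^ j / \<tau> j ^ k" "h ^ ?n \<le> s" by (auto simp: q_def)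
    then show ?thesis using h(1,2) \<tau>[of j] by (intro exI[of _ h]) (simp add: P_def field_simps)
  qed
  have "\<exists>h. \<forall>j. P j (h j) \<and> h (Suc j) ^ ?n \<le> \<theta> * h j ^ ?n"
  proof (rule dependent_nat_choice)
    show "\<exists>h. P 0 h" using ex[of 1] by auto
    fix h j assume "P j h"
    then have "0 < \<theta> * h ^ ?n" using \<theta> by (simp add: P_def)
    then show "\<exists>h'. P (Suc j) h' \<and> h' ^ ?n \<le> \<theta> * h ^ ?n" by (rule ex)
  qed
  then obtain h where hP: "\<And>j. P j (h j)" and hS: "\<And>j. h (Suc j) ^ ?n \<le> \<theta> * h j ^ ?n" by blast
  have h: "0 < h j" "h j < H j" "\<tau> j ^ k * h j ^ ?n \<le> (1/2) ^ j" for j using hP[of j] by (auto simp: P_def)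
  have hdec: "h (Suc j + i) ^ ?n \<le> \<theta> * h j ^ ?n * (1/2) ^ i" for i j
  proof (induction i)
    case (Suc i)
    have "h (Suc j + Suc i) ^ ?n \<le> \<theta> * h (Suc j + i) ^ ?n" using hS[of "Suc j + i"] by simp
    also have "\<dots> \<le> 1/2 * (\<theta> * h j ^ ?n * (1/2) ^ i)" using \<theta> Suc h(1)[of "Suc j + i"] by (intro mult_mono) auto
    finally show ?case by (simp add: mult_ac)
  qed (use hS[of j] in simp)
  define Q where "Q j = cube (z j) (h j)" for j
  \<comment> \<open>The corner is kept: the density estimate for \<open>S j\<close> holds for all
    small sides at this corner, in particular for half the side. What is left of \<open>Q j\<close>
    provides room for the zero set.\<close>
  define R where "R j = cube (z j) (h j / 2)" for j
  define G where "G j = (\<Union>i. Q (Suc j + i))" for j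
  define A where "A j = S j \<inter> R j - G j" for j
  define Z where "Z j = Q j - R j - G j" for j
  have RQ: "R j \<subseteq> Q j" for j
  proof
    fix y assume "y \<in> R j"
    then have yi: "z j $ i \<le> y $ i" "y $ i < z j $ i + h j / 2" for i by (auto simp: R_def cube_def)
    have "y $ i < z j $ i + h j" for i using yi(2)[of i] h(1)[of j] by linarith
    then show "y \<in> Q j" using yi(1) by (simp add: Q_def cube_def)
  qed
  have mQ[measurable]: "Q j \<in> sets lebesgue" and mR[measurable]: "R j \<in> sets lebesgue" for j by (auto simp: Q_def R_def)
  have mG[measurable]: "G j \<in> sets lebesgue" for j unfolding G_def by measurable
  have mA[measurable]: "A j \<in> sets lebesgue" and mZ[measurable]: "Z j \<in> sets lebesgue" for j unfolding A_def Z_def by measurable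
  have eQ: "emeasure lebesgue (Q j) = ennreal (h j ^ ?n)" for j unfolding Q_def by (rule emeasure_lebesgue_cube[OF h(1)])
  have eR: "emeasure lebesgue (R j) = ennreal ((1/2) ^ ?n * h j ^ ?n)" for j
    unfolding R_def using h(1)[of j] by (subst emeasure_lebesgue_cube) (auto simp: power_divide)
  have eG: "emeasure lebesgue (G j) \<le> ennreal (2 * \<theta> * h j ^ ?n)" for j
  proof -
    have "emeasure lebesgue (G j) \<le> (\<Sum>i. emeasure lebesgue (Q (Suc j + i)))"
      unfolding G_def by (rule emeasure_subadditive_countably) auto
    also have "\<dots> \<le> (\<Sum>i. ennreal (\<theta> * h j ^ ?n * (1/2) ^ i))"
      unfolding eQ using hdec by (intro suminf_le ennreal_leI) auto
    also have "\<dots> = ennreal (\<theta> * h j ^ ?n * (1 / (1 - 1/2)))"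
      using \<theta> h(1)[of j] by (intro suminf_ennreal_eq sums_mult geometric_sums) auto
    finally show ?thesis by (simp add: mult_ac)
  qed
  define v where "v j = 2 * \<theta> * h j ^ ?n" for j
  have v: "0 < v j" for j using \<theta> h(1)[of j] by (simp add: v_def)
  have AQ: "A j \<subseteq> Q j" "Z j \<subseteq> Q j" "A j \<inter> Z j = {}" for j using RQ by (auto simp: A_def Z_def)
  have hn: "(1/2) ^ ?n * h j ^ ?n = 8 * v j" for j by (simp add: v_def \<theta>_def)
  have diff: "ennreal c \<le> emeasure lebesgue (X - Y)"
    if "X \<in> sets lebesgue" "Y \<in> sets lebesgue" "ennreal a \<le> emeasure lebesgue X" "emeasure lebesgue Y \<le> ennreal b'" "c + b' \<le> a" "0 \<le> c" "0 \<le> b'"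
    for X Y :: "(real ^ 'n) set" and a b' c
  proof -
    have "ennreal c + ennreal b' \<le> ennreal a" using that by (simp add: ennreal_leI flip: ennreal_plus)
    also have "\<dots> \<le> emeasure lebesgue X" by fact
    also have "\<dots> \<le> emeasure lebesgue ((X - Y) \<union> Y)" using that by (intro emeasure_mono) auto
    also have "\<dots> \<le> emeasure lebesgue (X - Y) + emeasure lebesgue Y" using that by (intro emeasure_subadditive) auto
    also have "\<dots> \<le> emeasure lebesgue (X - Y) + ennreal b'" using that by (intro add_mono) auto
    finally have "ennreal b' + ennreal c \<le> ennreal b' + emeasure lebesgue (X - Y)" by (simp only: add.commute)
    then show ?thesis by (simp add: ennreal_add_left_cancel_le)
  qed
  have eA: "ennreal (v j) \<le> emeasure lebesgue (A j)" for j
    unfolding A_def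
  proof (rule diff)
    have "1/2 * (h j / 2) ^ ?n \<le> measure lebesgue (S j \<inter> R j)"
      unfolding R_def using h[of j] H[of j] by (intro dense) auto
    then have "1/2 * ((1/2) ^ ?n * h j ^ ?n) \<le> measure lebesgue (S j \<inter> R j)" by (simp add: power_divide)
    then have "4 * v j \<le> measure lebesgue (S j \<inter> R j)" unfolding hn by simp
    moreover have "emeasure lebesgue (S j \<inter> R j) \<le> emeasure lebesgue (R j)" by (intro emeasure_mono) auto
    then have "emeasure lebesgue (S j \<inter> R j) \<noteq> \<infinity>" by (auto simp: eR top_unique)
    ultimately show "ennreal (4 * v j) \<le> emeasure lebesgue (S j \<inter> R j)"
      by (simp add: emeasure_eq_ennreal_measure ennreal_leI)
  qed (use eG v[of j] in \<open>auto simp: v_def\<close>)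
  have eZ: "ennreal (v j) \<le> emeasure lebesgue (Z j)" for j
    unfolding Z_def
  proof (rule diff)
    show "ennreal (2 * v j) \<le> emeasure lebesgue (Q j - R j)"
    proof (rule diff)
      show "emeasure lebesgue (R j) \<le> ennreal (8 * v j)" by (simp add: eR hn)
      have "(1/2 :: real) ^ ?n \<le> (1/2) ^ 1" by (rule power_decreasing) auto
      then have "2 * (1/2) ^ ?n * h j ^ ?n \<le> 1 * h j ^ ?n" using h(1)[of j] by (intro mult_right_mono) auto
      then show "2 * v j + 8 * v j \<le> h j ^ ?n" using hn[of j] v[of j] by simp
    qed (use v[of j] eQ in auto)
  qed (use eG v[of j] in \<open>auto simp: v_def\<close>)
  have AQ_disj: "A i \<inter> Q j = {}" if "i < j" for i j
    using that less_imp_Suc_add[of i j] unfolding A_def G_def by fastforce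
  have A_disj: "A i \<inter> A j = {}" if "i \<noteq> j" for i j
    using that AQ_disj[of i j] AQ_disj[of j i] AQ(1)[of i] AQ(1)[of j] by (cases i j rule: linorder_cases) auto
  \<comment> \<open>The sets \<open>A j\<close> are disjoint, so at each point at most one term
    differs from 0.\<close>
  define b where "b y = (\<Sum>j. \<tau> j * indicator (A j) y)" for y
  have bA: "b y = \<tau> j" if "y \<in> A j" for y j
  proof -
    have "(\<lambda>i. \<tau> i * indicator (A i) y) = (\<lambda>i. if i = j then \<tau> i else 0)"
      using that A_disj by (auto simp: indicator_def fun_eq_iff)
    then show ?thesis unfolding b_def using sums_single[of j \<tau>] by (simp add: sums_iff)
  qed
  have b0: "b y = 0" if "\<And>j. y \<notin> A j" for y unfolding b_def using that by simp
  have mb: "b \<in> borel_measurable lebesgue" unfolding b_def by measurable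
  have b_cases: "(\<exists>j. y \<in> A j \<and> b y = \<tau> j) \<or> b y = 0" for y using bA b0 by blast
  have b_nonneg: "0 \<le> b y" for y using b_cases[of y] \<tau> by (auto intro: less_imp_le)
  have b\<nu>: "b y \<le> \<nu> y" for y
    using b_cases[of y] \<nu>[of y] S\<nu> by (auto simp: A_def)
  have "(\<integral>\<^sup>+y. ennreal (b y ^ k) \<partial>lebesgue) \<le> (\<integral>\<^sup>+y. (\<Sum>j. ennreal (\<tau> j ^ k) * indicator (Q j) y) \<partial>lebesgue)"
  proof (intro nn_integral_mono)
    fix y
    show "ennreal (b y ^ k) \<le> (\<Sum>j. ennreal (\<tau> j ^ k) * indicator (Q j) y)"
    proof (cases "b y = 0")
      case True
      then show ?thesis using k by (simp add: power_0_left)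
    next
      case False
      then obtain j where j: "y \<in> A j" "b y = \<tau> j" using b_cases[of y] by auto
      have single: "f j \<le> (\<Sum>i. f i)" for f :: "nat \<Rightarrow> ennreal" using sum_le_suminf[of f "{j}"] by simp
      have "ennreal (b y ^ k) = ennreal (\<tau> j ^ k) * indicator (Q j) y" using j AQ(1)[of j] by auto
      also have "\<dots> \<le> (\<Sum>i. ennreal (\<tau> i ^ k) * indicator (Q i) y)" by (rule single)
      finally show ?thesis .
    qed
  qed
  also have "\<dots> = (\<Sum>j. \<integral>\<^sup>+y. ennreal (\<tau> j ^ k) * indicator (Q j) y \<partial>lebesgue)"
    by (rule nn_integral_suminf) measurable
  also have "\<dots> = (\<Sum>j. ennreal (\<tau> j ^ k * h j ^ ?n))"
    using \<tau> h(1) by (simp add: nn_integral_cmult_indicator eQ ennreal_mult less_imp_le)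
  also have "\<dots> \<le> (\<Sum>j. ennreal ((1/2) ^ j))" using h(3) by (intro suminf_le ennreal_leI) auto
  also have "\<dots> = ennreal (1 / (1 - 1/2))" by (intro suminf_ennreal_eq geometric_sums) auto
  also have "\<dots> < \<infinity>" by simp
  finally have "b \<in> BMO \<eta>" by (intro bmo mb b_nonneg b\<nu>)
  then have "bmo_norm \<eta> b < \<infinity>" by (simp add: BMO_def)
  then obtain B where B: "bmo_norm \<eta> b = ennreal B" "0 \<le> B" by (cases "bmo_norm \<eta> b") auto
  \<comment> \<open>The lower bound for the oscillation on \<open>Q j\<close> meets the small mass
    of \<eta>; after cancelling \<tau>_j h_j^n a fixed positive number stays below a multiple of
    2^(-j).\<close>
  have bound: "2 * \<theta> \<le> B * (2 * (1/2) ^ j)" for j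
  proof -
    have e\<eta>: "(\<integral>\<^sup>+x\<in>Q j. ennreal (\<eta> x) \<partial>lebesgue) = ennreal (LINT x:Q j|lebesgue. \<eta> x)"
    proof -
      have "(\<integral>\<^sup>+x\<in>Q j. ennreal (\<eta> x) \<partial>lebesgue) = (\<integral>\<^sup>+x. ennreal (indicator (Q j) x * \<eta> x) \<partial>lebesgue)"
        by (intro nn_integral_cong) (auto simp: indicator_def)
      also have "\<dots> = ennreal (LINT x:Q j|lebesgue. \<eta> x)"
        unfolding set_lebesgue_integral_def real_scaleR_def using \<eta>
        by (intro nn_integral_eq_integral weight_set_integrable) (auto simp: Q_def weight_def bounded_cube)
      finally show ?thesis .
    qed
    have "(\<integral>\<^sup>+x\<in>Q j. ennreal \<bar>b x - average b (Q j)\<bar> \<partial>lebesgue) / (\<integral>\<^sup>+x\<in>Q j. ennreal (\<eta> x) \<partial>lebesgue) \<le> bmo_norm \<eta> b"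
      unfolding bmo_norm_def by (rule SUP_upper) (use h(1) in \<open>auto simp: cubes_def Q_def\<close>)
    then have "(\<integral>\<^sup>+x\<in>Q j. ennreal \<bar>b x - average b (Q j)\<bar> \<partial>lebesgue) \<le> ennreal B * (\<integral>\<^sup>+x\<in>Q j. ennreal (\<eta> x) \<partial>lebesgue)"
      unfolding B e\<eta> by (rule ennreal_divide_leD) auto
    also have "\<dots> \<le> ennreal B * ennreal (2 * (1/2) ^ j * \<tau> j * h j ^ ?n)"
      unfolding e\<eta> using small\<eta>[OF h(1,2), of j] by (intro mult_left_mono ennreal_leI) (simp_all only: Q_def zero_le)
    also have "\<dots> = ennreal (B * (2 * (1/2) ^ j * \<tau> j * h j ^ ?n))"
      using B(2) \<tau>[of j] h(1)[of j] by (intro ennreal_mult[symmetric]) auto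
    finally have up: "(\<integral>\<^sup>+x\<in>Q j. ennreal \<bar>b x - average b (Q j)\<bar> \<partial>lebesgue) \<le> ennreal (B * (2 * (1/2) ^ j * \<tau> j * h j ^ ?n))" .
    \<comment> \<open>Earlier bumps avoid \<open>Q j\<close>, the j-th one lies in
      \<open>R j\<close>, and later ones lie in \<open>G j\<close>; \<open>Z j\<close> meets none of
      them.\<close>
    have bZ: "b x = 0" if "x \<in> Z j" for x
    proof (rule b0)
      fix i
      show "x \<notin> A i"
      proof (cases i j rule: linorder_cases)
        case less
        then show ?thesis using AQ_disj[OF less] AQ(2)[of j] that by auto
      next
        case equal
        then show ?thesis using AQ(3)[of j] that by auto
      next
        case greater
        then have "Q i \<subseteq> G j" using less_imp_Suc_add[of j i] by (auto simp: G_def)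
        then show ?thesis using AQ(1)[of i] that by (auto simp: Z_def)
      qed
    qed
    have "ennreal (\<tau> j * v j) \<le> (\<integral>\<^sup>+x\<in>Q j. ennreal \<bar>b x - average b (Q j)\<bar> \<partial>lebesgue)"
      by (rule nn_integral_oscillation_ge[OF mA AQ(1) bA eA mZ AQ(2) bZ eZ AQ(3)]) (use v[of j] in auto)
    from order.trans[OF this up] have "\<tau> j * v j \<le> B * (2 * (1/2) ^ j * \<tau> j * h j ^ ?n)"
      using B(2) \<tau>[of j] h(1)[of j] by (subst (asm) ennreal_le_iff) auto
    then have "(2 * \<theta>) * (\<tau> j * h j ^ ?n) \<le> (B * (2 * (1/2) ^ j)) * (\<tau> j * h j ^ ?n)"
      by (simp add: v_def mult_ac)
    then show ?thesis using \<tau>[of j] h(1)[of j] by (subst (asm) mult_le_cancel_right) auto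
  qed
  obtain j where j: "(1/2 :: real) ^ j < \<theta> / (B + 1)" using real_arch_pow_inv[of "\<theta> / (B + 1)" "1/2"] \<theta> B by auto
  have "(B + 1) * (1/2) ^ j < \<theta>" using j B(2) by (simp add: field_simps)
  moreover have "(0::real) \<le> (1/2) ^ j" by simp
  ultimately show False using bound[of j] by (simp add: distrib_right)
qed

section \<open>The two bounds combined\<close>

lemma locally_integrable_powerI:
  fixes b :: "real ^ 'n \<Rightarrow> real"
  assumes mb: "b \<in> borel_measurable lebesgue" and b: "\<And>x. 0 \<le> b x" and k: "1 \<le> k"
    and fin: "(\<integral>\<^sup>+x. ennreal (b x ^ k) \<partial>lebesgue) < \<infinity>"
  shows "locally_integrable b"
  unfolding locally_integrable_def set_integrable_def real_scaleR_def
proof (intro allI impI, rule Bochner_Integration.integrable_bound)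
  fix S :: "(real ^ 'n) set" assume S: "compact S"
  have mS: "S \<in> sets lebesgue" "emeasure lebesgue S < \<infinity>"
    using lmeasurable_compact[OF S] by (auto simp: fmeasurable_def)
  have "integrable lebesgue (\<lambda>x. b x ^ k)"
    unfolding integrable_iff_bounded using mb b fin by simp
  moreover have "integrable lebesgue (indicator S :: real ^ 'n \<Rightarrow> real)" using mS by (intro integrable_real_indicator) auto
  ultimately show "integrable lebesgue (\<lambda>x. indicator S x + b x ^ k)" by (intro Bochner_Integration.integrable_add)
  show "(\<lambda>x. indicator S x * b x) \<in> borel_measurable lebesgue"
    using mb mS by (intro borel_measurable_times borel_measurable_indicator)
  have "b x \<le> 1 + b x ^ k" for x
  proof (cases "b x \<le> 1")
    case True
    then show ?thesis using zero_le_power[OF b, of x k] by linarith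
  next
    case False
    then have "b x ^ 1 \<le> b x ^ k" using k by (intro power_increasing) auto
    then show ?thesis by simp
  qed
  then show "AE x in lebesgue. norm (indicat_real S x * b x) \<le> norm (indicat_real S x + b x ^ k)"
    using b by (auto simp: indicator_def intro!: AE_I2)
qed

theorem theorem6p1:
  fixes T :: "(real ^ 'n \<Rightarrow> complex) \<Rightarrow> real ^ 'n \<Rightarrow> complex"
    and K :: "real ^ 'n \<Rightarrow> real ^ 'n \<Rightarrow> complex"
    and \<omega> :: "real \<Rightarrow> real"
    and \<mu> lam \<eta> :: "real ^ 'n \<Rightarrow> real"
    and m :: nat and p :: real
  assumes "nondegenerate_cz_operator \<omega> K T"
    and "dini \<omega>"
    and "m \<ge> 1" and "p > 1"
    and "A_class p lam" and "A_class p \<mu>"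
    and "weight \<eta>"
    and "\<exists>C::real. \<forall>b. locally_integrable b \<longrightarrow> b \<in> BMO \<eta> \<longrightarrow>
           (\<forall>f\<in>commutator_domain b m.
              weighted_Lp_norm p lam (iterated_commutator T b m f)
                \<le> ennreal C * bmo_norm \<eta> b ^ m * weighted_Lp_norm p \<mu> f)"
    and "\<forall>b. locally_integrable b \<longrightarrow>
           (\<exists>C::real. \<forall>f\<in>commutator_domain b m.
              weighted_Lp_norm p lam (iterated_commutator T b m f)
                \<le> ennreal C * weighted_Lp_norm p \<mu> f) \<longrightarrow>
           b \<in> BMO \<eta>"
  shows "\<exists>C\<ge>1. AE x in lebesgue.
           (1 / C) * (\<mu> x / lam x) powr (1 / (p * real m)) \<le> \<eta> x \<and>
           \<eta> x \<le> C * (\<mu> x / lam x) powr (1 / (p * real m))"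
proof -
  note m = assms(3) and p = assms(4)
  have cz: "cz_operator \<omega> K T" using assms(1) by (simp add: nondegenerate_cz_operator_def)
  interpret dini_cz_operator \<omega> K T using cz assms(2) by unfold_locales
  obtain c where c: "0 < c" and nd: "\<And>y r. 0 < r \<Longrightarrow> \<exists>x. x \<notin> ball y r \<and> norm (K y x) \<ge> c / r ^ CARD('n)"
    using assms(1) by (auto simp: nondegenerate_cz_operator_def nondegenerate_kernel_def)
  have w: "weight lam" "weight \<mu>" using assms(5,6) by (auto simp: A_class_def)
  have pos: "AE x in lebesgue. 0 < lam x" "AE x in lebesgue. 0 < \<mu> x" using assms(5,6) by (auto simp: A_class_def)
  have [measurable]: "lam \<in> borel_measurable lebesgue" "\<mu> \<in> borel_measurable lebesgue" using w weight_measurable by auto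
  define \<nu> where "\<nu> x = (\<mu> x / lam x) powr (1 / (p * real m))" for x
  have pm: "0 < p * real m" using p m by simp
  obtain C where C: "\<forall>b. locally_integrable b \<longrightarrow> b \<in> BMO \<eta> \<longrightarrow> (\<forall>f\<in>commutator_domain b m.
      weighted_Lp_norm p lam (iterated_commutator T b m f)
        \<le> ennreal C * bmo_norm \<eta> b ^ m * weighted_Lp_norm p \<mu> f)"
    using assms(8) by blast
  have C': "weighted_Lp_norm p lam (iterated_commutator T b m f)
      \<le> ennreal (max 0 C) * bmo_norm \<eta> b ^ m * weighted_Lp_norm p \<mu> f"
    if "locally_integrable b" "b \<in> BMO \<eta>" "f \<in> commutator_domain b m" for b f
  proof -
    \<comment> \<open>A negative constant becomes 0 under \<open>ennreal\<close>, so the constant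
      may be taken nonnegative.\<close>
    have "ennreal C = ennreal (max 0 C)" by (simp add: max_def ennreal_neg)
    then show ?thesis using C[rule_format, OF that] by simp
  qed
  obtain D where D: "0 \<le> D" "AE x in lebesgue. \<eta> x powr (p * real m) * lam x \<le> D * \<mu> x"
    using weight_upper_bound[OF c nd m p w assms(7) max.cobounded1 C'] by blast
  obtain B1 where B1: "Ap_pair p B1 lam (\<lambda>x. lam x powr (- 1 / (p - 1)))"
    by (rule A_class_imp_Ap_pair[OF assms(5) p])
  obtain B2 where B2: "Ap_pair p B2 \<mu> (\<lambda>x. \<mu> x powr (- 1 / (p - 1)))"
    by (rule A_class_imp_Ap_pair[OF assms(6) p])
  have "\<exists>c>0. AE x in lebesgue. c * \<nu> x \<le> \<eta> x"
  proof (rule weight_lower_bound[OF assms(7)])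
    show "\<nu> \<in> borel_measurable lebesgue" unfolding \<nu>_def by measurable
    show "0 \<le> \<nu> x" for x by (simp add: \<nu>_def)
    show "1 \<le> 2 * m" using m by simp
    fix b :: "real ^ 'n \<Rightarrow> real"
    assume b: "b \<in> borel_measurable lebesgue" "\<And>x. 0 \<le> b x" "\<And>x. b x \<le> \<nu> x"
      "(\<integral>\<^sup>+x. ennreal (b x ^ (2 * m)) \<partial>lebesgue) < \<infinity>"
    have "locally_integrable b" by (rule locally_integrable_powerI[OF b(1,2) _ b(4)]) (use m in simp)
    moreover have "\<exists>C::real. \<forall>f\<in>commutator_domain b m.
        weighted_Lp_norm p lam (iterated_commutator T b m f) \<le> ennreal C * weighted_Lp_norm p \<mu> f"
      by (rule iterated_commutator_bounded[OF B1 B2 p m b(1,2) _ b(4)]) (use b(3) in \<open>simp add: \<nu>_def\<close>)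
    ultimately show "b \<in> BMO \<eta>" using assms(9) by blast
  qed
  then obtain d where d: "0 < d" "AE x in lebesgue. d * \<nu> x \<le> \<eta> x" by blast
  \<comment> \<open>The root of \<open>D\<close> undoes the power pm in the upper bound, 1/d inverts
    the constant of the lower bound, and 1 meets the requirement on the final constant.\<close>
  define A where "A = max 1 (max (D powr (1 / (p * real m))) (1 / d))"
  have A: "1 \<le> A" "D powr (1 / (p * real m)) \<le> A" "1 / d \<le> A" by (auto simp: A_def)
  have "AE x in lebesgue. (1 / A) * \<nu> x \<le> \<eta> x \<and> \<eta> x \<le> A * \<nu> x"
    using d(2) D(2) pos
  proof eventually_elim
    case (elim x)
    have \<nu>0: "0 \<le> \<nu> x" by (simp add: \<nu>_def)
    have \<eta>0: "0 \<le> \<eta> x" using assms(7) by (simp add: weight_def)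
    have "1 / A \<le> d" using A d(1) by (simp add: field_simps)
    then have "(1 / A) * \<nu> x \<le> \<eta> x" using mult_right_mono[OF _ \<nu>0, of "1 / A" d] elim(1) by linarith
    moreover have "\<eta> x \<le> A * \<nu> x"
    proof -
      have "\<eta> x powr (p * real m) \<le> D * (\<mu> x / lam x)" using elim by (simp add: field_simps)
      then have "(\<eta> x powr (p * real m)) powr (1 / (p * real m)) \<le> (D * (\<mu> x / lam x)) powr (1 / (p * real m))"
        using pm by (intro powr_mono2) auto
      also have "(\<eta> x powr (p * real m)) powr (1 / (p * real m)) = \<eta> x"
        unfolding powr_powr using p m \<eta>0 by simp
      also have "(D * (\<mu> x / lam x)) powr (1 / (p * real m)) = D powr (1 / (p * real m)) * \<nu> x"
        unfolding \<nu>_def by (rule powr_mult)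
      also have "\<dots> \<le> A * \<nu> x" using A(2) \<nu>0 by (rule mult_right_mono)
      finally show ?thesis .
    qed
    ultimately show ?case by simp
  qed
  then show ?thesis using A(1) unfolding \<nu>_def by blast
qed

end
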